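(* Consider an open set $A\subset\mathbb{R}$, a $C^3$-family $\alpha\in A\mapsto f_\alpha\in\mathcal{A}(\mathbb{T}_{\hat\rho})$ with $\hat\rho>0$, and a set $\Theta\subset\mathbb{R}$ fulfilling: (G1) for every $1\le i+j\le 3$ there exist constants $c^{i,j}_{x,\alpha}$ such that $\|\partial_{x,\alpha}^{i,j}f_\alpha\|_{A,\hat\rho}\le c^{i,j}_{x,\alpha}$ (for convenience write $c_x=c^{1,0}_{x,\alpha}$, $c_\alpha=c^{0,1}_{x,\alpha}$, $c_{xx}=c^{2,0}_{x,\alpha}$, $c_{x\alpha}=c^{1,1}_{x,\alpha}$, $c_{\alpha\alpha}=c^{0,2}_{x,\alpha}$, $c_{\alpha\alpha\alpha}=c^{0,3}_{x,\alpha}$, etc.); (G2) $\Theta\subset\mathcal{D}(\gamma,\tau)$. Assume that we have a family of pairs $\theta\in\Theta\mapsto(h_\theta,\alpha(\theta))\in\mathcal{A}(\mathbb{T}_\rho)\times A$, with $\rho>0$, such that: (H1) for every $\theta\in\Theta$ the map $h_\theta$ satisfies $\mathrm{dist}(h_\theta(\bar{\mathbb{T}}_\rho),\partial\mathbb{T}_{\hat\rho})>0$ and $\langle h_\theta-\mathrm{id}\rangle=0$; moreover, there exist constants $\sigma_1,\sigma_2,\sigma_3$ such that $\|\partial_xh\|_{\Theta,\rho}<\sigma_1$, $\|1/\partial_xh\|_{\Theta,\rho}<\sigma_2$, $\|\partial_{xx}h\|_{\Theta,\rho}<\sigma_3$; (H2) the average of the family of functions $b_\theta(x)=\dfrac{\partial_\alpha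 f_{\alpha(\theta)}(h_\theta(x))}{\partial_xh_\theta(x+\theta)}$ is different from zero for every $\theta\in\Theta$; moreover, there exists a constant $\sigma_b$ such that $\|1/\langle b\rangle\|_\Theta<\sigma_b$; (H3) there exist constants $\beta_0,\beta_1,\beta_2$ such that $\mathrm{Lip}_{\Theta,\rho}(h-\mathrm{id})<\beta_0$, $\mathrm{Lip}_{\Theta,\rho}(\partial_xh)<\beta_1$, $\mathrm{Lip}_\Theta(\alpha)<\beta_2$. Let $e_\theta(x)=f_{\alpha(\theta)}(h_\theta(x))-h_\theta(x+\theta)$ be the associated family of error functions. Then, for any $0<\delta<\rho/2$ and $0<\rho_\infty<\rho-2\delta$, there exist constants $\mathfrak{C}_1^{\mathrm{Lip}}$ and $\mathfrak{C}_2^{\mathrm{Lip}}$ such that: (T1) Existence of conjugations: if $$\frac{\mathfrak{C}_1^{\mathrm{Lip}}\max\{\|e\|_{\Theta,\rho},\ \gamma\delta^{\tau+1}\mathrm{Lip}_{\Theta,\rho}(e)\}}{\gamma^2\rho^{2\tau+2}}<1,$$ then there exists a family of pairs $\theta\in\Theta\mapsto(h_{\theta,\infty},\alpha_\infty(\theta))\in\mathcal{A}(\mathbb{T}_{\rho_\infty})\times A$ such that $$f_{\alpha_\infty(\theta)}(h_{\theta,\infty}(x))=h_{\theta,\infty}(x+\theta)\qquad\text{for all }\theta\in\Theta,$$ and also satisfying (H1), (H2) and (H3) (on the strip $\mathbb{T}_{\rho_\infty}$). (T2) Closeness: the family $\theta\in\Theta\mapsto(h_{\theta,\infty},\alpha_\infty(\theta))$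 is close to the original one: $$\|h_\infty-h\|_{\Theta,\rho_\infty}<\frac{\mathfrak{C}_2\|e\|_{\Theta,\rho}}{\gamma\rho^\tau},\qquad\|\alpha_\infty-\alpha\|_\Theta<\mathfrak{C}_3\|e\|_{\Theta,\rho},$$ where $\mathfrak{C}_2=a_3^\tau\sigma_1C_1\Sigma_{\kappa,\tau}$ and $\mathfrak{C}_3=\sigma_b\sigma_2\Sigma_{\kappa,2\tau}$, with $a_3,C_1,\kappa,\Sigma_{\kappa,\lambda}$ as defined in the context. (T4) Measure of rotations: the Lebesgue measure of conjugacies to rigid rotation in the space of parameters is bounded from below as follows: $$\mathrm{Leb}(\alpha_\infty(\Theta))>\left[\mathrm{lip}_\Theta(\alpha)-\frac{\mathfrak{C}_2^{\mathrm{Lip}}\max\{\|e\|_{\Theta,\rho},\ \gamma\delta^{\tau+1}\mathrm{Lip}_{\Theta,\rho}(e)\}}{\gamma\rho^{\tau+1}}\right]\mathrm{Leb}(\Theta).$$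
   Context: Notation. $\mathbb{T}=\mathbb{R}/\mathbb{Z}$; $\mathbb{T}_\rho=\{x\in\mathbb{C}/\mathbb{Z}:|\mathrm{Im}\,x|<\rho\}$, with closure $\bar{\mathbb{T}}_\rho$ and boundary $\partial\mathbb{T}_\rho=\{|\mathrm{Im}\,x|=\rho\}$. $\mathrm{Per}(\mathbb{T}_\rho)$ is the Banach space of periodic continuous functions $f:\bar{\mathbb{T}}_\rho\to\mathbb{C}$, holomorphic in $\mathbb{T}_\rho$, with $f(\mathbb{T})\subset\mathbb{R}$, and norm $\|f\|_\rho=\sup_{x\in\mathbb{T}_\rho}|f(x)|$. $\langle f\rangle$ is the average (zeroth Fourier coefficient). $\mathcal{A}(\mathbb{T}_\rho)=\{f\in\mathrm{Hom}(\mathbb{T}):f-\mathrm{id}\in\mathrm{Per}(\mathbb{T}_\rho)\}$, where $\mathrm{Hom}(\mathbb{T})$ denotes the circle homeomorphisms. $\|\partial_{x,\alpha}^{i,j}f\|_{A,\rho}=\sup_{\alpha\in A}\|\partial_{x,\alpha}^{i,j}f_\alpha\|_\rho$, where $\partial_{x,\alpha}^{i,j}=\partial_x^i\partial_\alpha^j$. For $\gamma>0$, $\tau\ge1$: $\mathcal{D}(\gamma,\tau)=\{\theta\in\mathbb{R}:|q\theta-p|\ge\gamma|q|^{-\tau}\ \forall(p,q)\in\mathbb{Z}^2,\ q\ne0\}$. For functions $g$ on $\Theta$: $\|g\|_\Theta=\sup_{\theta\in\Theta}|g(\theta)|$, and $\mathrm{Lip}_\Theta(g)$, $\mathrm{lip}_\Theta(g)$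 are respectively the supremum and the infimum of $|g(\theta_2)-g(\theta_1)|/|\theta_2-\theta_1|$ over $\theta_1\ne\theta_2$ in $\Theta$. For families $\theta\in\Theta\mapsto g_\theta$: $\|g\|_{\Theta,\rho}=\sup_{\theta\in\Theta}\|g_\theta\|_\rho$ and $\mathrm{Lip}_{\Theta,\rho}(g)=\sup_{\theta_1\ne\theta_2}\|g_{\theta_2}-g_{\theta_1}\|_\rho/|\theta_2-\theta_1|$. $\mathrm{Leb}$ is Lebesgue measure. Constants entering $\mathfrak{C}_2$ and $\mathfrak{C}_3$: $c_R=\dfrac{\sqrt{\zeta(2,2^\tau)\Gamma(2\tau+1)}}{2(2\pi)^\tau}$ (Hurwitz zeta and Gamma functions), $a_1=\dfrac{\rho-\rho_\infty}{\rho-2\delta-\rho_\infty}$, $a_3=\rho/\delta$, $$C_1=(1+\sigma_1)c_R(1+c_\alpha\sigma_b\sigma_2)\sigma_2,$$ $$C_3=C_1\gamma\delta^{\tau-1}+\tfrac12c_{xx}(\sigma_1C_1)^2+c_{x\alpha}\sigma_b\sigma_1\sigma_2C_1\gamma\delta^\tau+\tfrac12c_{\alpha\alpha}(\sigma_b\sigma_2)^2\gamma^2\delta^{2\tau},$$ $$\kappa=\frac{C_3a_1^{2\tau}}{\gamma^2\delta^{2\tau}}\|e\|_{\Theta,\rho},\qquad\Sigma_{\kappa,\lambda}=\sum_{j=0}^\infty\kappa^{2^j-1}a_1^{-\lambda j},$$ the sum being convergent for every $\lambda\in\mathbb{R}$ when $\kappa<1$.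
   Formalization: Strict < in (T2) is claimed only if ‖e‖>0, and strict > in (T4) only if the error is nonzero and 0<Leb(Θ)<∞; otherwise ≤ and ≥ are proved, since strictness fails there (e=0 gives 0<0). (T4) takes Θ to be measurable. *)

theory Defs
  imports "HOL-Analysis.Analysis"
begin

text \<open>
  Functions on \<open>\<complex>/\<int>\<close> are represented by functions on the covering \<open>\<complex>\<close>, and circle maps by their lifts,
  so the condition \<open>f - id\<close> periodic reads \<open>f (z + 1) = f z + 1\<close>.
  Values outside the closed strip are irrelevant.
\<close>

definition strip :: "real \<Rightarrow> complex set" where
  "strip \<rho> = {z. \<bar>Im z\<bar> < \<rho>}"

definition cstrip :: "real \<Rightarrow> complex set" where
  "cstrip \<rho> = {z. \<bar>Im z\<bar> \<le> \<rho>}"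

definition strip_boundary :: "real \<Rightarrow> complex set" where
  "strip_boundary \<rho> = {z. \<bar>Im z\<bar> = \<rho>}"

definition Per :: "real \<Rightarrow> (complex \<Rightarrow> complex) set" where
  "Per \<rho> = {f. continuous_on (cstrip \<rho>) f \<and> f holomorphic_on strip \<rho> \<and>
               (\<forall>z\<in>cstrip \<rho>. f (z + 1) = f z) \<and> (\<forall>x::real. f (of_real x) \<in> \<real>)}"

text \<open>
  A lift \<open>f\<close> with \<open>f - id\<close> periodic covers a circle homeomorphism iff it is a homeomorphism of the line.
\<close>

definition circle_maps :: "real \<Rightarrow> (complex \<Rightarrow> complex) set" where
  "circle_maps \<rho> = {f. (\<lambda>z. f z - z) \<in> Per \<rho> \<and>
     (\<exists>g. homeomorphism UNIV UNIV (\<lambda>x::real. Re (f (of_real x))) g)}"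

text \<open>
  All suprema are taken in \<^typ>\<open>ennreal\<close>, so that an unbounded family has norm \<open>\<infinity>\<close>.
\<close>

definition strip_norm :: "real \<Rightarrow> (complex \<Rightarrow> complex) \<Rightarrow> ennreal" where
  "strip_norm \<rho> f = (SUP z\<in>strip \<rho>. ennreal (norm (f z)))"

definition fam_norm :: "real set \<Rightarrow> real \<Rightarrow> (real \<Rightarrow> complex \<Rightarrow> complex) \<Rightarrow> ennreal" where
  "fam_norm \<Theta> \<rho> g = (SUP \<theta>\<in>\<Theta>. strip_norm \<rho> (g \<theta>))"

definition fam_Lip :: "real set \<Rightarrow> real \<Rightarrow> (real \<Rightarrow> complex \<Rightarrow> complex) \<Rightarrow> ennreal" where
  "fam_Lip \<Theta> \<rho> g = (SUP (s, t)\<in>{(s, t). s \<in> \<Theta> \<and> t \<in> \<Theta> \<and> s \<noteq> t}.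
     strip_norm \<rho> (\<lambda>z. g t z - g s z) / ennreal \<bar>t - s\<bar>)"

definition sup_norm :: "real set \<Rightarrow> (real \<Rightarrow> 'a::real_normed_vector) \<Rightarrow> ennreal" where
  "sup_norm \<Theta> g = (SUP \<theta>\<in>\<Theta>. ennreal (norm (g \<theta>)))"

definition sup_Lip :: "real set \<Rightarrow> (real \<Rightarrow> real) \<Rightarrow> ennreal" where
  "sup_Lip \<Theta> g = (SUP (s, t)\<in>{(s, t). s \<in> \<Theta> \<and> t \<in> \<Theta> \<and> s \<noteq> t}. ennreal (\<bar>g t - g s\<bar> / \<bar>t - s\<bar>))"

definition inf_lip :: "real set \<Rightarrow> (real \<Rightarrow> real) \<Rightarrow> ennreal" where
  "inf_lip \<Theta> g = (INF (s, t)\<in>{(s, t). s \<in> \<Theta> \<and> t \<in> \<Theta> \<and> s \<noteq> t}. ennreal (\<bar>g t - g s\<bar> / \<bar>t - s\<bar>))"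

definition average :: "(complex \<Rightarrow> complex) \<Rightarrow> complex" where
  "average g = integral {0..1} (\<lambda>x::real. g (of_real x))"

definition Diophantine :: "real \<Rightarrow> real \<Rightarrow> real set" where
  "Diophantine \<gamma> \<tau> = {\<theta>. \<forall>p q::int. q \<noteq> 0 \<longrightarrow>
     \<bar>of_int q * \<theta> - of_int p\<bar> \<ge> \<gamma> * \<bar>of_int q\<bar> powr (- \<tau>)}"

primrec d_param :: "nat \<Rightarrow> (real \<Rightarrow> complex \<Rightarrow> complex) \<Rightarrow> real \<Rightarrow> complex \<Rightarrow> complex" where
  "d_param 0 f = f"
| "d_param (Suc j) f = (\<lambda>a z. vector_derivative (\<lambda>a'. d_param j f a' z) (at a))"

definition d_mixed :: "nat \<Rightarrow> nat \<Rightarrow> (real \<Rightarrow> complex \<Rightarrow> complex) \<Rightarrow> real \<Rightarrow> complex \<Rightarrow> complex" where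
  "d_mixed i j f = (\<lambda>a. (deriv ^^ i) (d_param j f a))"

text \<open>
  The closed strip modulo 1 is compact, so joint continuity of a family on \<open>A \<times> cstrip \<rho>\<close> is continuity
  in the parameter with respect to the sup norm. The conditions below therefore say that
  \<open>a \<mapsto> f a - id\<close> is three times continuously differentiable as a map into the Banach space \<open>Per \<rho>\<close>.
\<close>

definition C3_family :: "real set \<Rightarrow> real \<Rightarrow> (real \<Rightarrow> complex \<Rightarrow> complex) \<Rightarrow> bool" where
  "C3_family A \<rho> f \<longleftrightarrow>
     (\<forall>a\<in>A. f a \<in> circle_maps \<rho>) \<and>
     (\<forall>j<3. \<forall>a\<in>A. \<forall>z\<in>cstrip \<rho>. (\<lambda>a'. d_param j f a' z) differentiable (at a)) \<and>
     (\<forall>j\<le>3. continuous_on (A \<times> cstrip \<rho>) (\<lambda>(a, z). d_param j f a z))"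

text \<open>
  In the bounds \<open>c i j\<close> the first index counts derivatives in \<open>x\<close>, the second those in the parameter.
  Nonnegativity is explicit because \<^const>\<open>ennreal\<close> truncates negative numbers to 0.
\<close>

definition deriv_bounds ::
  "real set \<Rightarrow> real \<Rightarrow> (real \<Rightarrow> complex \<Rightarrow> complex) \<Rightarrow> (nat \<Rightarrow> nat \<Rightarrow> real) \<Rightarrow> bool" where
  "deriv_bounds A \<rho> f c \<longleftrightarrow>
     (\<forall>i j. 1 \<le> i + j \<and> i + j \<le> 3 \<longrightarrow> 0 \<le> c i j \<and> fam_norm A \<rho> (d_mixed i j f) \<le> ennreal (c i j))"

definition conj_bounds ::
  "real set \<Rightarrow> real \<Rightarrow> real \<Rightarrow> real \<Rightarrow> real \<Rightarrow> real \<Rightarrow> (real \<Rightarrow> complex \<Rightarrow> complex) \<Rightarrow> bool" where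
  "conj_bounds \<Theta> \<rho> \<rho>hat \<sigma>1 \<sigma>2 \<sigma>3 h \<longleftrightarrow>
     (\<forall>\<theta>\<in>\<Theta>. setdist (h \<theta> ` cstrip \<rho>) (strip_boundary \<rho>hat) > 0 \<and>
             average (\<lambda>z. h \<theta> z - z) = 0 \<and>
             (\<forall>z\<in>strip \<rho>. deriv (h \<theta>) z \<noteq> 0)) \<and>
     fam_norm \<Theta> \<rho> (\<lambda>\<theta>. deriv (h \<theta>)) < ennreal \<sigma>1 \<and>
     fam_norm \<Theta> \<rho> (\<lambda>\<theta> z. 1 / deriv (h \<theta>) z) < ennreal \<sigma>2 \<and>
     fam_norm \<Theta> \<rho> (\<lambda>\<theta>. deriv (deriv (h \<theta>))) < ennreal \<sigma>3"

definition twist ::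
  "(real \<Rightarrow> complex \<Rightarrow> complex) \<Rightarrow> (real \<Rightarrow> complex \<Rightarrow> complex) \<Rightarrow> (real \<Rightarrow> real) \<Rightarrow> real \<Rightarrow> complex \<Rightarrow> complex" where
  "twist f h \<alpha> \<theta> z = d_param 1 f (\<alpha> \<theta>) (h \<theta> z) / deriv (h \<theta>) (z + of_real \<theta>)"

definition twist_bound ::
  "real set \<Rightarrow> real \<Rightarrow> (real \<Rightarrow> complex \<Rightarrow> complex) \<Rightarrow> (real \<Rightarrow> complex \<Rightarrow> complex) \<Rightarrow> (real \<Rightarrow> real) \<Rightarrow> bool" where
  "twist_bound \<Theta> \<sigma>b f h \<alpha> \<longleftrightarrow>
     (\<forall>\<theta>\<in>\<Theta>. average (twist f h \<alpha> \<theta>) \<noteq> 0) \<and>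
     sup_norm \<Theta> (\<lambda>\<theta>. 1 / average (twist f h \<alpha> \<theta>)) < ennreal \<sigma>b"

definition Lip_bounds ::
  "real set \<Rightarrow> real \<Rightarrow> real \<Rightarrow> real \<Rightarrow> real \<Rightarrow> (real \<Rightarrow> complex \<Rightarrow> complex) \<Rightarrow> (real \<Rightarrow> real) \<Rightarrow> bool" where
  "Lip_bounds \<Theta> \<rho> \<beta>0 \<beta>1 \<beta>2 h \<alpha> \<longleftrightarrow>
     fam_Lip \<Theta> \<rho> (\<lambda>\<theta> z. h \<theta> z - z) < ennreal \<beta>0 \<and>
     fam_Lip \<Theta> \<rho> (\<lambda>\<theta>. deriv (h \<theta>)) < ennreal \<beta>1 \<and>
     sup_Lip \<Theta> \<alpha> < ennreal \<beta>2"

definition conj_error ::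
  "(real \<Rightarrow> complex \<Rightarrow> complex) \<Rightarrow> (real \<Rightarrow> complex \<Rightarrow> complex) \<Rightarrow> (real \<Rightarrow> real) \<Rightarrow> real \<Rightarrow> complex \<Rightarrow> complex" where
  "conj_error f h \<alpha> \<theta> z = f (\<alpha> \<theta>) (h \<theta> z) - h \<theta> (z + of_real \<theta>)"

text \<open>
  \<open>has_margin \<dots> m\<close>: each strict inequality required of the initial family holds with room at least \<open>m\<close>,
  uniformly in \<open>\<theta>\<close>, and \<open>\<alpha>(\<Theta>)\<close> stays at distance at least \<open>m\<close> from the boundary of \<open>A\<close>.
  It is not a hypothesis; it only serves to say on what the smallness constants depend. Constants that
  may depend on the whole family could be chosen so large that the smallness condition is never met.
\<close>

definition has_margin ::
  "real set \<Rightarrow> real set \<Rightarrow> real \<Rightarrow> real \<Rightarrow> real \<Rightarrow> real \<Rightarrow> real \<Rightarrow> real \<Rightarrow> real \<Rightarrow> real \<Rightarrow> real \<Rightarrow>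
   (real \<Rightarrow> complex \<Rightarrow> complex) \<Rightarrow> (real \<Rightarrow> complex \<Rightarrow> complex) \<Rightarrow> (real \<Rightarrow> real) \<Rightarrow> real \<Rightarrow> bool" where
  "has_margin A \<Theta> \<rho> \<rho>hat \<sigma>1 \<sigma>2 \<sigma>3 \<sigma>b \<beta>0 \<beta>1 \<beta>2 f h \<alpha> m \<longleftrightarrow>
     (\<forall>\<theta>\<in>\<Theta>. m \<le> setdist (h \<theta> ` cstrip \<rho>) (strip_boundary \<rho>hat)) \<and>
     (\<forall>\<theta>\<in>\<Theta>. \<forall>y\<in>frontier A. m \<le> dist (\<alpha> \<theta>) y) \<and>
     fam_norm \<Theta> \<rho> (\<lambda>\<theta>. deriv (h \<theta>)) + ennreal m \<le> ennreal \<sigma>1 \<and>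
     fam_norm \<Theta> \<rho> (\<lambda>\<theta> z. 1 / deriv (h \<theta>) z) + ennreal m \<le> ennreal \<sigma>2 \<and>
     fam_norm \<Theta> \<rho> (\<lambda>\<theta>. deriv (deriv (h \<theta>))) + ennreal m \<le> ennreal \<sigma>3 \<and>
     sup_norm \<Theta> (\<lambda>\<theta>. 1 / average (twist f h \<alpha> \<theta>)) + ennreal m \<le> ennreal \<sigma>b \<and>
     fam_Lip \<Theta> \<rho> (\<lambda>\<theta> z. h \<theta> z - z) + ennreal m \<le> ennreal \<beta>0 \<and>
     fam_Lip \<Theta> \<rho> (\<lambda>\<theta>. deriv (h \<theta>)) + ennreal m \<le> ennreal \<beta>1 \<and>
     sup_Lip \<Theta> \<alpha> + ennreal m \<le> ennreal \<beta>2"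

definition hurwitz_zeta :: "real \<Rightarrow> real \<Rightarrow> real" where
  "hurwitz_zeta s a = (\<Sum>n. (real n + a) powr (- s))"

definition const_R :: "real \<Rightarrow> real" where
  "const_R \<tau> = sqrt (hurwitz_zeta 2 (2 powr \<tau>) * Gamma (2 * \<tau> + 1)) / (2 * (2 * pi) powr \<tau>)"

definition const_a1 :: "real \<Rightarrow> real \<Rightarrow> real \<Rightarrow> real" where
  "const_a1 \<rho> \<rho>inf \<delta> = (\<rho> - \<rho>inf) / (\<rho> - 2 * \<delta> - \<rho>inf)"

definition const_a3 :: "real \<Rightarrow> real \<Rightarrow> real" where
  "const_a3 \<rho> \<delta> = \<rho> / \<delta>"

definition const_C1 :: "real \<Rightarrow> real \<Rightarrow> real \<Rightarrow> real \<Rightarrow> (nat \<Rightarrow> nat \<Rightarrow> real) \<Rightarrow> real" where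
  "const_C1 \<tau> \<sigma>1 \<sigma>2 \<sigma>b c = (1 + \<sigma>1) * const_R \<tau> * (1 + c 0 1 * \<sigma>b * \<sigma>2) * \<sigma>2"

definition const_C3 ::
  "real \<Rightarrow> real \<Rightarrow> real \<Rightarrow> real \<Rightarrow> real \<Rightarrow> real \<Rightarrow> (nat \<Rightarrow> nat \<Rightarrow> real) \<Rightarrow> real" where
  "const_C3 \<gamma> \<tau> \<delta> \<sigma>1 \<sigma>2 \<sigma>b c =
     (let C1 = const_C1 \<tau> \<sigma>1 \<sigma>2 \<sigma>b c in
       C1 * \<gamma> * \<delta> powr (\<tau> - 1)
       + 1 / 2 * c 2 0 * (\<sigma>1 * C1)\<^sup>2
       + c 1 1 * \<sigma>b * \<sigma>1 * \<sigma>2 * C1 * \<gamma> * \<delta> powr \<tau>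
       + 1 / 2 * c 0 2 * (\<sigma>b * \<sigma>2)\<^sup>2 * \<gamma>\<^sup>2 * \<delta> powr (2 * \<tau>))"

definition const_kappa ::
  "real \<Rightarrow> real \<Rightarrow> real \<Rightarrow> real \<Rightarrow> real \<Rightarrow> real \<Rightarrow> real \<Rightarrow> real \<Rightarrow> (nat \<Rightarrow> nat \<Rightarrow> real) \<Rightarrow> real \<Rightarrow> real" where
  "const_kappa \<rho> \<rho>inf \<delta> \<gamma> \<tau> \<sigma>1 \<sigma>2 \<sigma>b c err =
     const_C3 \<gamma> \<tau> \<delta> \<sigma>1 \<sigma>2 \<sigma>b c * const_a1 \<rho> \<rho>inf \<delta> powr (2 * \<tau>)
       / (\<gamma>\<^sup>2 * \<delta> powr (2 * \<tau>)) * err"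

definition Sigma_series :: "real \<Rightarrow> real \<Rightarrow> real \<Rightarrow> real" where
  "Sigma_series a1 \<kappa> l = (\<Sum>j::nat. \<kappa> ^ (2 ^ j - 1) * a1 powr (- l * real j))"

definition const_frakC2 ::
  "real \<Rightarrow> real \<Rightarrow> real \<Rightarrow> real \<Rightarrow> real \<Rightarrow> real \<Rightarrow> real \<Rightarrow> real \<Rightarrow> (nat \<Rightarrow> nat \<Rightarrow> real) \<Rightarrow> real \<Rightarrow> real" where
  "const_frakC2 \<rho> \<rho>inf \<delta> \<gamma> \<tau> \<sigma>1 \<sigma>2 \<sigma>b c err =
     const_a3 \<rho> \<delta> powr \<tau> * \<sigma>1 * const_C1 \<tau> \<sigma>1 \<sigma>2 \<sigma>b c *
     Sigma_series (const_a1 \<rho> \<rho>inf \<delta>) (const_kappa \<rho> \<rho>inf \<delta> \<gamma> \<tau> \<sigma>1 \<sigma>2 \<sigma>b c err) \<tau>"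

definition const_frakC3 ::
  "real \<Rightarrow> real \<Rightarrow> real \<Rightarrow> real \<Rightarrow> real \<Rightarrow> real \<Rightarrow> real \<Rightarrow> real \<Rightarrow> (nat \<Rightarrow> nat \<Rightarrow> real) \<Rightarrow> real \<Rightarrow> real" where
  "const_frakC3 \<rho> \<rho>inf \<delta> \<gamma> \<tau> \<sigma>1 \<sigma>2 \<sigma>b c err =
     \<sigma>b * \<sigma>2 *
     Sigma_series (const_a1 \<rho> \<rho>inf \<delta>) (const_kappa \<rho> \<rho>inf \<delta> \<gamma> \<tau> \<sigma>1 \<sigma>2 \<sigma>b c err) (2 * \<tau>)"

definition err_size ::
  "real set \<Rightarrow> real \<Rightarrow> real \<Rightarrow> real \<Rightarrow> real \<Rightarrow> (real \<Rightarrow> complex \<Rightarrow> complex) \<Rightarrow> ennreal" where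
  "err_size \<Theta> \<rho> \<delta> \<gamma> \<tau> e = max (fam_norm \<Theta> \<rho> e) (ennreal (\<gamma> * \<delta> powr (\<tau> + 1)) * fam_Lip \<Theta> \<rho> e)"

text \<open>
  Lower bound for the measure of the set of parameters. It may be negative, hence \<^typ>\<open>ereal\<close>.
\<close>

definition measure_bound ::
  "real set \<Rightarrow> real \<Rightarrow> real \<Rightarrow> real \<Rightarrow> (real \<Rightarrow> real) \<Rightarrow> real \<Rightarrow> ennreal \<Rightarrow> ereal" where
  "measure_bound \<Theta> \<rho> \<gamma> \<tau> \<alpha> C M =
     (enn2ereal (inf_lip \<Theta> \<alpha>) - enn2ereal (ennreal C * M / ennreal (\<gamma> * \<rho> powr (\<tau> + 1))))
       * enn2ereal (emeasure lebesgue \<Theta>)"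

end

theory Submission
  imports Defs "HOL-Complex_Analysis.Complex_Analysis"
begin

text \<open>
  A pair \<open>(h, a)\<close> with error \<open>e\<close> is corrected by \<open>h + h' u\<close>, where \<open>u\<close> solves the cohomological equation
  \<open>u (x + \<theta>) - u x = (e x + \<Delta> \<partial>\<^sub>\<alpha> f (h x)) / h' (x + \<theta>)\<close>, and the twist condition fixes the change \<open>\<Delta>\<close> of
  the parameter. Ruessmann's estimate bounds the loss of width in this equation by the power \<open>- \<tau>\<close>, so the new
  error is quadratic and the corrections converge. The sharp constants of the closeness statement come
  from the first step alone: all later steps are of second order in the error.
  Differences of solutions for two frequencies solve the linearized equation up to smaller terms, which makes
  the corrections Lipschitz in \<open>\<theta>\<close> with a constant proportional to the error; the measure estimate follows,
  since a perturbation with Lipschitz constant \<open>D\<close> lowers the expansion rate \<open>lip(\<alpha>)\<close> by at most \<open>D\<close>.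
\<close>

section \<open>Fourier coefficients on strips\<close>

text \<open>The obstacle is uniformity. The hypotheses are strict inequalities, and the room they
  leave decides how large an error can be tolerated. Thresholds are therefore found for a fixed room
  \<open>m\<close>, uniformly in all families; only the final proof passes to arbitrary families.

  Estimates without prescribed constants use one number \<open>S\<close> that dominates the bounds
  involved and the inverses of the distances. Iterates are always compared with the initial pair, so
  \<open>2 * S\<close> serves throughout. In the closeness bounds the room itself pays for the
  second-order terms: the first step, computed with \<open>\<sigma>1 - m\<close> and
  \<open>\<sigma>b - m\<close> in place of \<open>\<sigma>1\<close> and \<open>\<sigma>b\<close>,
  stays below the claim by an amount proportional to the error. That step may lose the width
  \<open>2 * \<delta>\<close>, which gains a factor \<open>2 powr \<tau>\<close> in the comparison
  of \<open>KR\<close> with \<open>const_R\<close>; of the series in the claim only the leading term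
  1 is used.

  Solutions for different frequencies are chosen independently. The comparison of two of them holds
  for any two sufficiently small corrections and thus contains local uniqueness, which makes the
  independent choices compatible.\<close>

lemma open_strip: "open (strip s)"
proof -
  have "strip s = {z. Im z < s} \<inter> {z. Im z > - s}"
    by (auto simp: strip_def)
  then show ?thesis
    by (simp add: open_Int open_halfspace_Im_lt open_halfspace_Im_gt)
qed

lemma convex_strip: "convex (strip s)"
proof -
  have "strip s = {z. Im z < s} \<inter> {z. Im z > - s}"
    by (auto simp: strip_def)
  then show ?thesis
    by (simp add: convex_Int convex_halfspace_Im_lt convex_halfspace_Im_gt)
qed

lemma strip_mono: "s \<le> t \<Longrightarrow> strip s \<subseteq> strip t"
  by (auto simp: strip_def)

lemma of_real_in_strip [simp]: "0 < s \<Longrightarrow> of_real x \<in> strip s"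
  by (simp add: strip_def)

lemma add_of_real_in_strip [simp]: "z + of_real x \<in> strip s \<longleftrightarrow> z \<in> strip s"
  "of_real x + z \<in> strip s \<longleftrightarrow> z \<in> strip s"
  by (simp_all add: strip_def)

lemma add_1_in_strip [simp]: "z + 1 \<in> strip s \<longleftrightarrow> z \<in> strip s"
  by (simp add: strip_def)

text \<open>Unlike \<open>Per\<close>, this refers to the open strip only: the derivatives and
  quotients formed below need not extend continuously to the boundary.\<close>

definition perhol :: "real \<Rightarrow> (complex \<Rightarrow> complex) \<Rightarrow> bool" where
  "perhol s g \<longleftrightarrow> g holomorphic_on strip s \<and> (\<forall>z\<in>strip s. g (z + 1) = g z)"

lemma perhol_mono: "perhol t g \<Longrightarrow> s \<le> t \<Longrightarrow> perhol s g"
  unfolding perhol_def using strip_mono holomorphic_on_subset by blast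

lemma perhol_add: "perhol s f \<Longrightarrow> perhol s g \<Longrightarrow> perhol s (\<lambda>z. f z + g z)"
  unfolding perhol_def by (auto intro!: holomorphic_intros)

lemma perhol_diff: "perhol s f \<Longrightarrow> perhol s g \<Longrightarrow> perhol s (\<lambda>z. f z - g z)"
  unfolding perhol_def by (auto intro!: holomorphic_intros)

lemma perhol_mult: "perhol s f \<Longrightarrow> perhol s g \<Longrightarrow> perhol s (\<lambda>z. f z * g z)"
  unfolding perhol_def by (auto intro!: holomorphic_intros)

lemma perhol_divide:
  "perhol s f \<Longrightarrow> perhol s g \<Longrightarrow> (\<And>z. z \<in> strip s \<Longrightarrow> g z \<noteq> 0) \<Longrightarrow> perhol s (\<lambda>z. f z / g z)"
  unfolding perhol_def by (auto intro!: holomorphic_intros)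

lemma perhol_const: "perhol s (\<lambda>z. c)"
  unfolding perhol_def by (auto intro!: holomorphic_intros)

lemma holomorphic_shift:
  assumes "g holomorphic_on strip s"
  shows "(\<lambda>z. g (z + of_real x)) holomorphic_on strip s"
proof -
  have "(\<lambda>z. z + of_real x) holomorphic_on strip s"
    by (intro holomorphic_intros)
  from holomorphic_on_compose_gen[OF this assms] have
    "(\<lambda>z. z + complex_of_real x) ` strip s \<subseteq> strip s \<Longrightarrow> (\<lambda>z. g (z + of_real x)) holomorphic_on strip s"
    by (simp add: o_def)
  then show ?thesis by (simp add: image_subset_iff)
qed

lemma perhol_shift: "perhol s g \<Longrightarrow> perhol s (\<lambda>z. g (z + of_real x))"
  unfolding perhol_def using holomorphic_shift[of g s x] add.assoc[of _ 1 "complex_of_real x"]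
    add.assoc[of _ "complex_of_real x" 1] add.commute[of 1 "complex_of_real x"]
  by (metis add_of_real_in_strip(1))

lemma deriv_shift:
  assumes "f holomorphic_on strip s" "z \<in> strip s"
  shows "deriv (\<lambda>w. f (w + of_real x)) z = deriv f (z + of_real x)"
proof -
  have "(f has_field_derivative deriv f (z + of_real x)) (at (z + of_real x))"
    using assms open_strip by (intro holomorphic_derivI) auto
  then have "((\<lambda>w. f (w + of_real x)) has_field_derivative deriv f (z + of_real x)) (at z)"
    by (simp add: DERIV_shift)
  then show ?thesis by (rule DERIV_imp_deriv)
qed

lemma deriv_cong_strip:
  assumes "\<And>w. w \<in> strip s \<Longrightarrow> f w = g w" "z \<in> strip s"
  shows "deriv f z = deriv g z"
  using eventually_nhds_in_open[OF open_strip assms(2)] assms(1)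
  by (intro deriv_cong_ev refl) (auto elim: eventually_mono)

lemma perhol_deriv:
  assumes "perhol s g"
  shows "perhol s (deriv g)"
proof -
  have "deriv g (z + 1) = deriv g z" if "z \<in> strip s" for z
    using deriv_shift[of g s z 1] deriv_cong_strip[of s "\<lambda>w. g (w + 1)" g z] assms that
    by (auto simp: perhol_def)
  then show ?thesis
    using assms unfolding perhol_def by (auto intro: holomorphic_deriv open_strip)
qed

lemma continuous_on_reals:
  assumes "g holomorphic_on strip s" "0 < s"
  shows "continuous_on X (\<lambda>x::real. g (of_real x))"
  by (rule continuous_on_compose2[OF holomorphic_on_imp_continuous_on[OF assms(1)]])
     (auto intro!: continuous_intros simp: assms)

section \<open>Averages over a period\<close>

lemma average_norm_le:
  assumes "continuous_on {0..1} (\<lambda>x::real. g (of_real x))" "\<And>x::real. norm (g (of_real x)) \<le> B"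
  shows "norm (average g) \<le> B"
  unfolding average_def using integral_bound[of 0 1 "\<lambda>x::real. g (of_real x)" B] assms by auto

lemma average_Re_le:
  assumes "continuous_on {0..1} (\<lambda>x::real. g (of_real x))" "\<And>x::real. Re (g (of_real x)) \<le> B"
  shows "Re (average g) \<le> B"
proof -
  have i: "((\<lambda>x::real. g (of_real x)) has_integral average g) {0..1}"
    unfolding average_def using assms(1) by (simp add: integrable_continuous_real integrable_integral)
  have "((\<lambda>x::real. Re (g (of_real x))) has_integral Re (average g)) {0..1}"
    using has_integral_linear[OF i bounded_linear_Re] by (simp add: o_def)
  moreover have "((\<lambda>x::real. B) has_integral B) {0..1}"
    using has_integral_const_real[of B 0 1] by simp
  ultimately show ?thesis
    using has_integral_le assms(2) by blast
qed

lemma average_real: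
  assumes "continuous_on {0..1} (\<lambda>x::real. g (of_real x))" "\<And>x::real. g (of_real x) \<in> \<real>"
  shows "average g \<in> \<real>"
proof -
  have i: "((\<lambda>x::real. g (of_real x)) has_integral average g) {0..1}"
    unfolding average_def using assms(1) by (simp add: integrable_continuous_real integrable_integral)
  have "((\<lambda>x::real. Im (g (of_real x))) has_integral Im (average g)) {0..1}"
    using has_integral_linear[OF i bounded_linear_Im] by (simp add: o_def)
  moreover have "Im (g (of_real x)) = 0" for x :: real
    using assms(2) complex_is_Real_iff by blast
  ultimately have "((\<lambda>x::real. 0) has_integral Im (average g)) {0..1::real}"
    by simp
  then show ?thesis
    by (simp add: complex_is_Real_iff)
qed

lemma average_add:
  assumes "continuous_on {0..1} (\<lambda>x::real. f (of_real x))" "continuous_on {0..1} (\<lambda>x::real. g (of_real x))"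
  shows "average (\<lambda>z. f z + g z) = average f + average g"
  unfolding average_def using assms by (simp add: integral_add integrable_continuous_real)

lemma average_diff:
  assumes "continuous_on {0..1} (\<lambda>x::real. f (of_real x))" "continuous_on {0..1} (\<lambda>x::real. g (of_real x))"
  shows "average (\<lambda>z. f z - g z) = average f - average g"
  unfolding average_def using assms by (simp add: integral_diff integrable_continuous_real)

lemma average_cmult: "average (\<lambda>z. c * g z) = c * average g"
  unfolding average_def by simp

lemma average_sum:
  assumes "finite F" "\<And>k. k \<in> F \<Longrightarrow> continuous_on {0..1} (\<lambda>x::real. f k (of_real x))"
  shows "average (\<lambda>z. \<Sum>k\<in>F. f k z) = (\<Sum>k\<in>F. average (f k))"
  unfolding average_def using assms by (simp add: integral_sum integrable_continuous_real)

lemma average_const: "average (\<lambda>z. c) = c"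
  unfolding average_def by simp

lemma average_cong: "(\<And>x::real. f (of_real x) = g (of_real x)) \<Longrightarrow> average f = average g"
  unfolding average_def by simp

text \<open>On the convex strip \<open>g\<close> has a primitive \<open>\<Phi>\<close>, and the
  average along the line through \<open>w\<close> is \<open>\<Phi> (w + 1) - \<Phi> w\<close>. This
  increment has derivative \<open>g (w + 1) - g w = 0\<close>, so it is the same for all
  lines.\<close>

lemma average_shift:
  assumes "perhol s g" "w \<in> strip s"
  shows "average (\<lambda>z. g (z + w)) = average g"
proof -
  have s: "0 < s" using assms(2) by (auto simp: strip_def)
  obtain \<Phi> where \<Phi>: "\<And>x. x \<in> strip s \<Longrightarrow> (\<Phi> has_field_derivative g x) (at x within strip s)"
    using holomorphic_convex_primitive'[OF convex_strip open_strip] assms(1) perhol_def by metis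
  then have \<Phi>': "\<And>x. x \<in> strip s \<Longrightarrow> (\<Phi> has_field_derivative g x) (at x)"
    using open_strip at_within_open by metis
  have F: "average (\<lambda>z. g (z + w)) = \<Phi> (w + 1) - \<Phi> w" if w: "w \<in> strip s" for w
  proof -
    have "((\<lambda>x. \<Phi> (of_real x + w)) has_vector_derivative g (of_real x + w)) (at x within {0..1})" for x :: real
      using \<Phi>'[of "of_real x + w"] w
      by (intro has_vector_derivative_real_field) (simp add: DERIV_shift)
    then have "((\<lambda>x::real. g (of_real x + w)) has_integral (\<Phi> (of_real 1 + w) - \<Phi> (of_real 0 + w))) {0..1}"
      by (intro fundamental_theorem_of_calculus) auto
    then show ?thesis unfolding average_def by (simp add: integral_unique add.commute)
  qed
  have "((\<lambda>z. \<Phi> (z + 1) - \<Phi> z) has_field_derivative 0) (at z within strip s)" if "z \<in> strip s" for z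
  proof -
    have "((\<lambda>z. \<Phi> (z + 1)) has_field_derivative g z) (at z)"
      using \<Phi>'[of "z + 1"] that assms(1) by (simp add: DERIV_shift perhol_def)
    from DERIV_diff[OF this \<Phi>'[OF that]] show ?thesis
      by (simp add: has_field_derivative_at_within)
  qed
  then obtain c where c: "\<And>z. z \<in> strip s \<Longrightarrow> \<Phi> (z + 1) - \<Phi> z = c"
    using has_field_derivative_zero_constant[OF convex_strip, of s "\<lambda>z. \<Phi> (z + 1) - \<Phi> z"] by auto
  have "average (\<lambda>z. g (z + 0)) = c" using F[of 0] c[of 0] s by (simp add: strip_def)
  then show ?thesis using F[OF assms(2)] c[OF assms(2)] by simp
qed

section \<open>Fourier coefficients and Bessel's inequality\<close>

definition ek :: "int \<Rightarrow> complex \<Rightarrow> complex" where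
  "ek k z = exp (2 * of_real pi * \<i> * of_int k * z)"

definition fc :: "(complex \<Rightarrow> complex) \<Rightarrow> int \<Rightarrow> complex" where
  "fc g k = average (\<lambda>z. g z * ek (- k) z)"

lemma ek_add_freq: "ek (j + k) z = ek j z * ek k z"
  by (simp add: ek_def exp_add [symmetric] algebra_simps)

lemma ek_add_arg: "ek k (z + w) = ek k z * ek k w"
  by (simp add: ek_def exp_add [symmetric] algebra_simps)

lemma ek_0 [simp]: "ek 0 z = 1" "ek k 0 = 1"
  by (simp_all add: ek_def)

lemma ek_minus_mult [simp]: "ek (- k) z * ek k z = 1" "ek k z * ek (- k) z = 1"
  using ek_add_freq[of "- k" k z] ek_add_freq[of k "- k" z] by simp_all

lemma ek_1: "ek k 1 = 1"
proof -
  have "ek k 1 = exp (0 + \<i> * (of_int k * (of_real pi * 2)))"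
    by (simp add: ek_def mult_ac)
  also have "\<dots> = 1"
    by (simp only: exp_plus_2pin exp_zero)
  finally show ?thesis .
qed

lemma ek_nonzero [simp]: "ek k z \<noteq> 0"
  by (simp add: ek_def)

lemma norm_ek: "norm (ek k z) = exp (- (2 * pi * of_int k * Im z))"
  by (simp add: ek_def)

lemma cnj_ek: "cnj (ek k (of_real x)) = ek (- k) (of_real x)"
  by (simp add: ek_def exp_cnj)

lemma ek_holomorphic [holomorphic_intros]: "ek k holomorphic_on X"
  unfolding ek_def by (intro holomorphic_intros)

lemma ek_continuous [continuous_intros]:
  "continuous_on X f \<Longrightarrow> continuous_on X (\<lambda>x. ek k (f x))"
  unfolding ek_def by (intro continuous_intros)

lemma perhol_ek: "perhol s (ek k)"
  unfolding perhol_def by (auto simp: ek_add_arg ek_1 intro: ek_holomorphic)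

text \<open>A shift by \<open>\<i>\<close> preserves the average but multiplies \<open>ek k\<close>
  by a number whose modulus differs from 1 when \<open>k \<noteq> 0\<close>.\<close>

lemma average_ek: "average (ek k) = (if k = 0 then 1 else 0)"
proof (cases "k = 0")
  case True
  then show ?thesis by (simp add: average_def)
next
  case False
  have "average (\<lambda>z. ek k (z + \<i>)) = average (ek k)"
    by (rule average_shift[OF perhol_ek[of 2]]) (simp add: strip_def)
  moreover have "average (\<lambda>z. ek k (z + \<i>)) = ek k \<i> * average (ek k)"
    unfolding ek_add_arg by (subst mult.commute) (rule average_cmult)
  moreover have "norm (ek k \<i>) \<noteq> 1"
    using False by (simp add: norm_ek)
  ultimately have "(ek k \<i> - 1) * average (ek k) = 0" "ek k \<i> \<noteq> 1"
    by (auto simp: algebra_simps)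
  then show ?thesis using False by simp
qed

text \<open>Projection onto a trigonometric polynomial \<open>T\<close>: the squared modulus of
  \<open>g - T\<close> is nonnegative. On the real line \<open>U\<close> is the conjugate of
  \<open>T\<close>, but written as a trigonometric sum, so that the averages can be computed
  termwise.\<close>

lemma bessel_inequality:
  assumes c: "continuous_on {0..1} (\<lambda>x::real. g (of_real x))"
    and B: "\<And>x::real. norm (g (of_real x)) \<le> B" and F: "finite F"
  shows "(\<Sum>k\<in>F. (norm (fc g k))\<^sup>2) \<le> B\<^sup>2"
proof -
  define T where "T z = (\<Sum>k\<in>F. fc g k * ek k z)" for z
  define U where "U z = (\<Sum>k\<in>F. cnj (fc g k) * ek (- k) z)" for z
  define S where "S = (\<Sum>k\<in>F. (norm (fc g k))\<^sup>2)"
  have UT: "U (of_real x) = cnj (T (of_real x))" for x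
    by (simp add: T_def U_def cnj_ek)
  have cT: "continuous_on {0..1} (\<lambda>x::real. T (of_real x))"
    and cU: "continuous_on {0..1} (\<lambda>x::real. U (of_real x))"
    unfolding T_def U_def by (auto intro!: continuous_intros)
  have gU: "average (\<lambda>z. g z * U z) = of_real S"
  proof -
    have "average (\<lambda>z. g z * U z) = average (\<lambda>z. \<Sum>k\<in>F. cnj (fc g k) * (g z * ek (- k) z))"
      by (simp add: U_def sum_distrib_left mult_ac)
    also have "\<dots> = (\<Sum>k\<in>F. average (\<lambda>z. cnj (fc g k) * (g z * ek (- k) z)))"
      using c F by (intro average_sum) (auto intro!: continuous_intros)
    also have "\<dots> = (\<Sum>k\<in>F. cnj (fc g k) * fc g k)"
      unfolding average_cmult fc_def ..
    also have "\<dots> = of_real S"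
      by (simp add: S_def complex_norm_square mult.commute del: of_real_power)
    finally show ?thesis .
  qed
  have TU: "average (\<lambda>z. T z * U z) = of_real S"
  proof -
    have "average (\<lambda>z. T z * U z)
        = average (\<lambda>z. \<Sum>j\<in>F. \<Sum>k\<in>F. (fc g j * cnj (fc g k)) * ek (j - k) z)"
      unfolding T_def U_def sum_product diff_conv_add_uminus ek_add_freq
      by (simp add: mult_ac)
    also have "\<dots> = (\<Sum>j\<in>F. average (\<lambda>z. \<Sum>k\<in>F. (fc g j * cnj (fc g k)) * ek (j - k) z))"
      using F by (intro average_sum continuous_intros)
    also have "\<dots> = (\<Sum>j\<in>F. \<Sum>k\<in>F. average (\<lambda>z. (fc g j * cnj (fc g k)) * ek (j - k) z))"
      using F by (intro sum.cong refl average_sum continuous_intros)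
    also have "\<dots> = (\<Sum>j\<in>F. \<Sum>k\<in>F. if k = j then (fc g j * cnj (fc g k)) else 0)"
      unfolding average_cmult average_ek by (intro sum.cong) auto
    also have "\<dots> = of_real S"
      using F by (simp add: sum.delta S_def complex_norm_square del: of_real_power)
    finally show ?thesis .
  qed
  have "average (\<lambda>z. 2 * (g z * U z) - T z * U z) = of_real S"
    using c cT cU gU TU
    by (subst average_diff) (auto intro!: continuous_intros simp: average_cmult)
  moreover have "Re (average (\<lambda>z. 2 * (g z * U z) - T z * U z)) \<le> B\<^sup>2"
  proof (rule average_Re_le)
    show "continuous_on {0..1} (\<lambda>x::real. 2 * (g (of_real x) * U (of_real x)) - T (of_real x) * U (of_real x))"
      using c cT cU by (intro continuous_intros)
    fix x :: real
    let ?a = "g (of_real x)" and ?b = "T (of_real x)"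
    \<comment> \<open>Completing the square bounds pointwise the real part of the integrand whose
      average has just been identified with \<open>S\<close>.\<close>
    have "Re (2 * (?a * cnj ?b) - ?b * cnj ?b) = (norm ?a)\<^sup>2 - (norm (?a - ?b))\<^sup>2"
      unfolding cmod_power2 by (simp add: power2_eq_square algebra_simps)
    also have "\<dots> \<le> (norm ?a)\<^sup>2" by simp
    also have "\<dots> \<le> B\<^sup>2" using B[of x] by (intro power_mono) auto
    finally show "Re (2 * (?a * U (of_real x)) - ?b * U (of_real x)) \<le> B\<^sup>2"
      by (simp add: UT)
  qed
  ultimately show ?thesis by (simp add: S_def)
qed

lemma fc_shift:
  assumes "perhol s g" "w \<in> strip s"
  shows "fc (\<lambda>z. g (z + w)) k = fc g k * ek k w"
proof -
  have "average (\<lambda>z. g (z + w) * ek (- k) (z + w)) = fc g k"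
    unfolding fc_def using average_shift[OF perhol_mult[OF assms(1) perhol_ek] assms(2)] .
  moreover have "(\<lambda>z. g (z + w) * ek (- k) (z + w)) = (\<lambda>z. ek (- k) w * (g (z + w) * ek (- k) z))"
    by (simp add: ek_add_arg mult_ac)
  ultimately have "ek (- k) w * fc (\<lambda>z. g (z + w)) k = fc g k"
    by (simp add: average_cmult fc_def)
  moreover have "fc (\<lambda>z. g (z + w)) k = (ek (- k) w * fc (\<lambda>z. g (z + w)) k) * ek k w"
    by (simp add: mult.commute mult.assoc [symmetric])
  ultimately show ?thesis by metis
qed

lemma holomorphic_shift_real:
  assumes "g holomorphic_on strip s" "w \<in> strip s"
  shows "continuous_on X (\<lambda>x::real. g (of_real x + w))"
  by (rule continuous_on_compose2[OF holomorphic_on_imp_continuous_on[OF assms(1)]])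
     (auto intro!: continuous_intros simp: assms)

text \<open>Moving the line of integration to height \<open>Im w\<close> multiplies the coefficient
  by \<open>ek k w\<close>, so a bound on this single line already gives exponential decay for one
  sign of \<open>k\<close>.\<close>

lemma fc_norm_le_line:
  assumes "perhol s g" "w \<in> strip s" "\<And>x::real. norm (g (of_real x + w)) \<le> B"
  shows "norm (fc g k) \<le> B * exp (2 * pi * of_int k * Im w)"
proof -
  have "norm (fc (\<lambda>z. g (z + w)) k) \<le> B"
    unfolding fc_def
    using assms holomorphic_shift_real[of g s w]
    by (intro average_norm_le) (auto intro!: continuous_intros simp: perhol_def norm_mult norm_ek)
  then have "norm (fc g k) * exp (- (2 * pi * of_int k * Im w)) \<le> B"
    by (simp add: fc_shift[OF assms(1,2)] norm_mult norm_ek)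
  then show ?thesis
    by (simp add: exp_minus field_simps)
qed

text \<open>The line is taken on the side where the exponential decays: below the real axis for
  \<open>k \<ge> 0\<close>, above it otherwise.\<close>

lemma fc_norm_le:
  assumes "perhol s g" "\<And>z. z \<in> strip s \<Longrightarrow> norm (g z) \<le> B" "0 < t" "t < s"
  shows "norm (fc g k) \<le> B * exp (- (2 * pi * \<bar>of_int k\<bar> * t))"
proof (cases "k \<ge> 0")
  case True
  then show ?thesis
    using fc_norm_le_line[OF assms(1), of "- of_real t * \<i>" B k] assms by (auto simp: strip_def)
next
  case False
  then show ?thesis
    using fc_norm_le_line[OF assms(1), of "of_real t * \<i>" B k] assms by (auto simp: strip_def)
qed

lemma perhol_add_int:
  assumes "perhol s g" "z \<in> strip s"
  shows "g (z + of_int n) = g z"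
proof -
  have nat: "g (w + of_nat m) = g w" if "w \<in> strip s" for w m
  proof (induction m)
    case (Suc m)
    have "w + of_nat m \<in> strip s" using that by (simp add: strip_def)
    then have "g ((w + of_nat m) + 1) = g w" using assms(1) Suc by (simp add: perhol_def)
    moreover have "w + of_nat (Suc m) = (w + of_nat m) + 1" by simp
    ultimately show ?case by metis
  qed simp
  show ?thesis
  proof (cases "n \<ge> 0")
    case True
    then show ?thesis using nat[OF assms(2), of "nat n"] by simp
  next
    case False
    have "z + of_int n \<in> strip s" using assms(2) by (simp add: strip_def)
    from nat[OF this, of "nat (- n)"] False show ?thesis by (simp add: add.assoc)
  qed
qed

text \<open>A function in \<open>perhol\<close> may be unbounded near the boundary of the strip, but
  a single line is controlled by the compactness of one period.\<close>

lemma perhol_bounded_line: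
  assumes "perhol s g" "w \<in> strip s"
  shows "\<exists>B. \<forall>x::real. norm (g (of_real x + w)) \<le> B"
proof -
  have "continuous_on {0..1} (\<lambda>x::real. g (of_real x + w))"
    using assms by (intro holomorphic_shift_real) (auto simp: perhol_def)
  then have "bounded ((\<lambda>x::real. g (of_real x + w)) ` {0..1})"
    by (intro compact_imp_bounded compact_continuous_image) auto
  then obtain B where "\<forall>y\<in>(\<lambda>x::real. g (of_real x + w)) ` {0..1}. norm y \<le> B"
    unfolding bounded_iff by blast
  then have B: "\<And>x. x \<in> {0..1::real} \<Longrightarrow> norm (g (of_real x + w)) \<le> B"
    by blast
  have "norm (g (of_real x + w)) \<le> B" for x :: real
  proof -
    have "of_real x + w = (of_real (frac x) + w) + of_int \<lfloor>x\<rfloor>"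
      by (simp add: frac_def)
    then have "g (of_real x + w) = g (of_real (frac x) + w)"
      using perhol_add_int[OF assms(1), of "of_real (frac x) + w"] assms(2)
      by (metis add_of_real_in_strip(2))
    then show ?thesis using B[of "frac x"] frac_ge_0[of x] frac_lt_1[of x] by auto
  qed
  then show ?thesis by blast
qed

lemma fc_tendsto_0:
  assumes "perhol s g" "0 < s"
  shows "(\<lambda>n. fc g (int n)) \<longlonglongrightarrow> 0" "(\<lambda>n. fc g (- int n)) \<longlonglongrightarrow> 0"
proof -
  have aux: "(\<lambda>n. B * exp (- (2 * pi * real n * (s / 2)))) \<longlonglongrightarrow> 0" for B
  proof -
    have "(\<lambda>n. B * exp (- (2 * pi * real n * (s / 2)))) = (\<lambda>n. B * (exp (- (pi * s))) ^ n)"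
      by (simp add: exp_of_nat_mult [symmetric] algebra_simps)
    also have "\<dots> \<longlonglongrightarrow> B * 0"
      using assms(2) by (intro tendsto_mult tendsto_const LIMSEQ_realpow_zero) auto
    finally show ?thesis by simp
  qed
  let ?w = "of_real (s / 2) * \<i>"
  have w: "?w \<in> strip s" "- ?w \<in> strip s" using assms(2) by (simp_all add: strip_def)
  obtain B where B: "\<And>x::real. norm (g (of_real x + - ?w)) \<le> B"
    using perhol_bounded_line[OF assms(1) w(2)] by blast
  have "norm (fc g (int n)) \<le> B * exp (- (2 * pi * real n * (s / 2)))" for n
    using fc_norm_le_line[OF assms(1) w(2) B, of "int n"] by simp
  then show "(\<lambda>n. fc g (int n)) \<longlonglongrightarrow> 0"
    by (intro Lim_null_comparison[OF always_eventually aux[of B]] allI)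
  obtain B where B: "\<And>x::real. norm (g (of_real x + ?w)) \<le> B"
    using perhol_bounded_line[OF assms(1) w(1)] by blast
  have "norm (fc g (- int n)) \<le> B * exp (- (2 * pi * real n * (s / 2)))" for n
    using fc_norm_le_line[OF assms(1) w(1) B, of "- int n"] by simp
  then show "(\<lambda>n. fc g (- int n)) \<longlonglongrightarrow> 0"
    by (intro Lim_null_comparison[OF always_eventually aux[of B]] allI)
qed

section \<open>Convergence of Fourier series\<close>

lemma ek_1_eq_1_iff: "ek 1 z = 1 \<longleftrightarrow> z \<in> \<int>"
proof
  assume "ek 1 z = 1"
  then obtain n :: int where "Im (2 * of_real pi * \<i> * z) = of_int (2 * n) * pi"
      "Re (2 * of_real pi * \<i> * z) = 0"
    by (auto simp: ek_def exp_eq_1)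
  then have "z = of_int n" by (simp add: complex_eq_iff)
  then show "z \<in> \<int>" by simp
next
  assume "z \<in> \<int>"
  then obtain n where "z = of_int n" by (auto elim: Ints_cases)
  then show "ek 1 z = 1"
    using perhol_add_int[OF perhol_ek[of 1 1], of 0 n] by (simp add: strip_def)
qed

text \<open>The zeros of \<open>ek 1 - 1\<close> are the integers, and they are simple; by
  periodicity \<open>G\<close> vanishes at all of them. Hence the quotient has only removable
  singularities.\<close>

lemma holomorphic_div_ek_minus_1:
  assumes G: "perhol s G" "0 < s" and G0: "G 0 = 0"
  obtains q where "perhol s q" "\<And>z. z \<in> strip s \<Longrightarrow> G z = q z * (ek 1 z - 1)"
proof -
  \<comment> \<open>At an integer the value is the quotient of the two derivatives. Prescribing it
    explicitly, instead of taking some holomorphic extension, lets the periodicity of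
    \<open>q\<close> be read off.\<close>
  define q where "q z = (if z \<in> \<int> then deriv G z / (2 * of_real pi * \<i>) else G z / (ek 1 z - 1))" for z
  have GZ: "G (of_int n) = 0" for n
    using perhol_add_int[OF G(1), of 0 n] G0 G(2) by (simp add: strip_def)
  have holZ: "q holomorphic_on (ball (of_int n) (1/2) \<inter> strip s)" for n
  proof (rule no_isolated_singularity'[where K = "{of_int n}"])
    let ?S = "ball (of_int n) (1/2) \<inter> strip s"
    have notint: "z \<notin> \<int>" if "z \<in> ball (of_int n) (1/2)" "z \<noteq> of_int n" for z :: complex
    proof
      assume "z \<in> \<int>"
      then obtain m where m: "z = of_int m" by (auto elim: Ints_cases)
      have "norm (of_int (n - m) :: complex) < 1/2"
        using that(1) m by (simp add: dist_norm)
      then have "\<bar>of_int (n - m) :: real\<bar> < 1/2"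
        by (simp only: norm_of_int)
      then have "n = m" by linarith
      with that m show False by simp
    qed
    have "q holomorphic_on (?S - {of_int n}) \<longleftrightarrow> (\<lambda>z. G z / (ek 1 z - 1)) holomorphic_on (?S - {of_int n})"
      by (rule holomorphic_cong) (use notint in \<open>auto simp: q_def\<close>)
    also have "\<dots>"
    proof (intro holomorphic_intros)
      show "G holomorphic_on (?S - {of_int n})"
        using G(1) holomorphic_on_subset by (auto simp: perhol_def)
      show "ek 1 z - 1 \<noteq> 0" if "z \<in> ?S - {of_int n}" for z
        using notint[of z] that ek_1_eq_1_iff[of z] by auto
    qed
    finally show "q holomorphic_on (?S - {of_int n})" .
    show "open ?S" by (intro open_Int open_strip) auto
    show "(q \<longlongrightarrow> q z) (at z within ?S)" if "z \<in> {of_int n}" for z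
    proof -
      have zn: "z = of_int n" using that by simp
      have ns: "of_int n \<in> strip s" using G(2) by (simp add: strip_def)
      have dG: "(G has_field_derivative deriv G z) (at z)"
        using G(1) ns zn by (intro holomorphic_derivI[OF _ open_strip]) (auto simp: perhol_def)
      have ez: "ek 1 z = 1" using zn ek_1_eq_1_iff by simp
      have "(ek 1 has_field_derivative (2 * of_real pi * \<i>) * ek 1 z) (at z)"
        unfolding ek_def by (auto intro!: derivative_eq_intros)
      then have dE: "(ek 1 has_field_derivative (2 * of_real pi * \<i>)) (at z)"
        using ez by simp
      have "((\<lambda>y. ((G y - G z) / (y - z)) / ((ek 1 y - ek 1 z) / (y - z)))
              \<longlongrightarrow> deriv G z / (2 * of_real pi * \<i>)) (at z)"
        using dG dE unfolding has_field_derivative_iff by (intro tendsto_divide) auto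
      moreover have "\<forall>\<^sub>F y in at z. ((G y - G z) / (y - z)) / ((ek 1 y - ek 1 z) / (y - z)) = q y"
      proof -
        have "\<forall>\<^sub>F y in at z. y \<in> ball (of_int n) (1/2) - {z}"
          unfolding zn by (intro eventually_at_in_open) auto
        then show ?thesis
          by eventually_elim (use notint zn ez GZ in \<open>auto simp: q_def divide_simps\<close>)
      qed
      ultimately have "(q \<longlongrightarrow> deriv G z / (2 * of_real pi * \<i>)) (at z)"
        by (rule Lim_transform_eventually)
      moreover have "q z = deriv G z / (2 * of_real pi * \<i>)"
        using zn by (simp add: q_def)
      ultimately show ?thesis
        by (metis tendsto_within_subset subset_UNIV)
    qed
  qed auto
  have "q holomorphic_on (\<Union>n. ball (of_int n) (1/2) \<inter> strip s)"
    by (intro holomorphic_on_UN_open holZ open_Int open_strip) auto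
  moreover have "q holomorphic_on (strip s - \<int>)"
  proof -
    have "q holomorphic_on (strip s - \<int>) \<longleftrightarrow> (\<lambda>z. G z / (ek 1 z - 1)) holomorphic_on (strip s - \<int>)"
      by (rule holomorphic_cong) (auto simp: q_def)
    also have "\<dots>"
      using G(1) by (intro holomorphic_intros) (auto simp: perhol_def ek_1_eq_1_iff intro: holomorphic_on_subset)
    finally show ?thesis .
  qed
  ultimately have "q holomorphic_on ((\<Union>n. ball (of_int n) (1/2) \<inter> strip s) \<union> (strip s - \<int>))"
    by (intro holomorphic_on_Un open_Diff open_strip closed_Ints open_UN ballI open_Int) auto
  moreover have "strip s \<subseteq> (\<Union>n. ball (of_int n) (1/2) \<inter> strip s) \<union> (strip s - \<int>)"
  proof
    fix z assume z: "z \<in> strip s"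
    show "z \<in> (\<Union>n. ball (of_int n) (1/2) \<inter> strip s) \<union> (strip s - \<int>)"
    proof (cases "z \<in> \<int>")
      case True
      then obtain n where "z = of_int n" by (auto elim: Ints_cases)
      then have "z \<in> ball (of_int n) (1/2) \<inter> strip s" using z by simp
      then show ?thesis by blast
    qed (use z in simp)
  qed
  ultimately have hol: "q holomorphic_on strip s"
    by (rule holomorphic_on_subset)
  have "q (z + 1) = q z" if "z \<in> strip s" for z
    using that perhol_deriv[OF G(1)] G(1) by (auto simp: q_def perhol_def ek_add_arg ek_1)
  with hol have "perhol s q" by (simp add: perhol_def)
  moreover have "G z = q z * (ek 1 z - 1)" if "z \<in> strip s" for z
    using ek_1_eq_1_iff[of z] GZ by (cases "z \<in> \<int>") (auto simp: q_def elim: Ints_cases)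
  ultimately show ?thesis using that by blast
qed

lemma sum_symmetric_Suc:
  fixes u :: "int \<Rightarrow> 'a::comm_monoid_add"
  shows "sum u {- int (Suc N)..int (Suc N)} = u (- int (Suc N)) + u (int (Suc N)) + sum u {- int N..int N}"
proof -
  have "{- int (Suc N)..int (Suc N)} = insert (- int (Suc N)) (insert (int (Suc N)) {- int N..int N})"
    by auto
  moreover have "- int (Suc N) \<notin> insert (int (Suc N)) {- int N..int N}" "int (Suc N) \<notin> {- int N..int N}"
    by auto
  ultimately show ?thesis by (simp add: add.assoc del: of_nat_Suc)
qed

lemma sum_symmetric_telescope:
  fixes u :: "int \<Rightarrow> 'a::ab_group_add"
  shows "(\<Sum>k\<in>{- int N..int N}. u (k - 1) - u k) = u (- int (Suc N)) - u (int N)"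
proof (induction N)
  case (Suc N)
  have "- int (Suc N) - 1 = - int (Suc (Suc N))" "int (Suc N) - 1 = int N" by simp_all
  then show ?case
    unfolding sum_symmetric_Suc Suc by (simp only:) simp
qed simp

text \<open>Chernoff's argument: dividing \<open>g (z + w) - g w\<close> by \<open>e\<^sub>1 - 1\<close> turns the partial sums
  of the Fourier series of \<open>g\<close> at \<open>w\<close> into a telescoping sum.\<close>

lemma fourier_sums:
  assumes g: "perhol s g" and w: "w \<in> strip s"
  shows "(\<lambda>N. \<Sum>k\<in>{- int N..int N}. fc g k * ek k w) \<longlonglongrightarrow> g w"
proof -
  \<comment> \<open>The width that remains around \<open>w\<close>: adding \<open>w\<close> maps
    \<open>strip t\<close> into \<open>strip s\<close>.\<close>
  define t where "t = s - \<bar>Im w\<bar>"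
  have t: "0 < t" using w by (simp add: t_def strip_def)
  have tw: "z + w \<in> strip s" if "z \<in> strip t" for z
    using that by (auto simp: t_def strip_def)
  define G where "G z = g (z + w) - g w" for z
  have "(\<lambda>z. z + w) holomorphic_on strip t"
    by (intro holomorphic_intros)
  from holomorphic_on_compose_gen[OF this, of g "strip s"]
  have "(\<lambda>z. g (z + w)) holomorphic_on strip t"
    using g tw by (auto simp: o_def perhol_def)
  moreover have "g (z + 1 + w) = g (z + w)" if "z \<in> strip t" for z
  proof -
    have "g (z + w + 1) = g (z + w)" using g tw[OF that] by (simp add: perhol_def)
    then show ?thesis by (simp add: add.commute add.left_commute)
  qed
  ultimately have pw: "perhol t (\<lambda>z. g (z + w))"
    by (simp add: perhol_def)
  have G: "perhol t G"
    unfolding G_def using pw by (intro perhol_diff perhol_const)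
  obtain q where q: "perhol t q" and Gq: "\<And>z. z \<in> strip t \<Longrightarrow> G z = q z * (ek 1 z - 1)"
    using holomorphic_div_ek_minus_1[OF G t] by (auto simp: G_def)
  have con: "continuous_on {0..1} (\<lambda>x::real. h (of_real x) * ek j (of_real x))" if "perhol t h" for h j
    using that t by (intro continuous_intros continuous_on_reals) (auto simp: perhol_def)
  \<comment> \<open>Multiplication by \<open>ek 1\<close> shifts the index of a coefficient by one,
    so multiplication by \<open>ek 1 - 1\<close> takes differences. Subtracting the constant
    \<open>g w\<close> affects the coefficient of index 0 only.\<close>
  have coef: "fc g k * ek k w - (if k = 0 then g w else 0) = fc q (k - 1) - fc q k" for k
  proof -
    have "fc G k = fc (\<lambda>z. g (z + w)) k - average (\<lambda>z. g w * ek (- k) z)"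
      unfolding G_def fc_def left_diff_distrib
      using con[OF pw] con[OF perhol_const] by (intro average_diff)
    also have "\<dots> = fc g k * ek k w - (if k = 0 then g w else 0)"
      by (simp add: fc_shift[OF g w] average_cmult average_ek)
    finally have 1: "fc G k = fc g k * ek k w - (if k = 0 then g w else 0)" .
    have "fc G k = average (\<lambda>z. q z * ek (- (k - 1)) z - q z * ek (- k) z)"
      unfolding fc_def
    proof (rule average_cong)
      fix x :: real
      have "ek (- (k - 1)) (of_real x) = ek 1 (of_real x) * ek (- k) (of_real x)"
        by (simp add: ek_add_freq [symmetric])
      then show "G (of_real x) * ek (- k) (of_real x)
          = q (of_real x) * ek (- (k - 1)) (of_real x) - q (of_real x) * ek (- k) (of_real x)"
        using t by (simp add: Gq algebra_simps)
    qed
    also have "\<dots> = fc q (k - 1) - fc q k"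
      unfolding fc_def using con[OF q] by (intro average_diff)
    finally show ?thesis using 1 by simp
  qed
  have tele: "(\<Sum>k\<in>{- int N..int N}. fc g k * ek k w) - g w = fc q (- int (Suc N)) - fc q (int N)" for N
  proof -
    have "(\<Sum>k\<in>{- int N..int N}. fc g k * ek k w) - g w
        = (\<Sum>k\<in>{- int N..int N}. fc g k * ek k w - (if k = 0 then g w else 0))"
      by (simp add: sum_subtractf)
    also have "\<dots> = (\<Sum>k\<in>{- int N..int N}. fc q (k - 1) - fc q k)"
      unfolding coef ..
    also have "\<dots> = fc q (- int (Suc N)) - fc q (int N)"
      by (rule sum_symmetric_telescope)
    finally show ?thesis .
  qed
  have "(\<lambda>N. fc q (- int (Suc N)) - fc q (int N)) \<longlonglongrightarrow> 0 - 0"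
    by (intro tendsto_diff LIMSEQ_Suc[of "\<lambda>n. fc q (- int n)"] fc_tendsto_0[OF q t])
  then have "(\<lambda>N. (\<Sum>k\<in>{- int N..int N}. fc g k * ek k w) - g w) \<longlonglongrightarrow> 0"
    unfolding tele by simp
  then show ?thesis by (rule LIM_zero_cancel)
qed

section \<open>Small divisors\<close>

text \<open>Jordan's inequality: by concavity the sine lies above its chord between 0 and
  \<open>pi / 2\<close>.\<close>

lemma sin_pi_ge:
  fixes x :: real
  assumes "\<bar>x\<bar> \<le> 1 / 2"
  shows "2 * \<bar>x\<bar> \<le> \<bar>sin (pi * x)\<bar>"
proof -
  have conc: "concave_on {0..pi} (sin :: real \<Rightarrow> real)"
  proof (rule f''_le0_imp_concave)
    show "DERIV sin x :> cos x" "DERIV cos x :> - sin x" for x :: real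
      by (auto intro!: derivative_eq_intros)
    show "- sin x \<le> 0" if "x \<in> {0..pi}" for x :: real
      using that sin_ge_zero by auto
  qed (rule convex_real_interval)
  have pos: "2 * y \<le> sin (pi * y)" if y: "0 \<le> y" "y \<le> 1 / 2" for y :: real
  proof -
    have "\<forall>u\<ge>0. \<forall>v\<ge>0. u + v = 1 \<longrightarrow> u * sin 0 + v * sin (pi / 2) \<le> sin (u *\<^sub>R 0 + v *\<^sub>R (pi / 2))"
    proof -
      have "(0::real) \<in> {0..pi}" "pi / 2 \<in> {0..pi}" by auto
      then show ?thesis using conc unfolding concave_on_iff by blast
    qed
    from this[rule_format, of "1 - 2 * y" "2 * y"] y show ?thesis
      by (simp add: mult.commute)
  qed
  show ?thesis
  proof (cases "x \<ge> 0")
    case True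
    then show ?thesis using pos[of x] assms by auto
  next
    case False
    then show ?thesis using pos[of "- x"] assms by auto
  qed
qed

text \<open>The small divisor: taking the difference between a function shifted by
  \<open>\<theta>\<close> and the function itself multiplies its \<open>k\<close>-th Fourier
  coefficient by this number.\<close>

definition lam :: "real \<Rightarrow> int \<Rightarrow> complex" where
  "lam \<theta> k = ek k (of_real \<theta>) - 1"

text \<open>The signed distance from \<open>k * \<theta>\<close> to the nearest integer. The sign
  matters when residues of different \<open>k\<close> are separated from each other.\<close>

definition nres :: "real \<Rightarrow> int \<Rightarrow> real" where
  "nres \<theta> k = of_int k * \<theta> - of_int (round (of_int k * \<theta>))"

text \<open>The integer nearest to \<open>k * \<theta>\<close> drops out of the exponential, and
  \<open>exp (2 * pi * \<i> * r) - 1\<close> has modulus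
  \<open>2 * \<bar>sin (pi * r)\<bar>\<close>; Jordan's inequality applies because the residue is at
  most one half.\<close>

lemma norm_lam_ge: "4 * \<bar>nres \<theta> k\<bar> \<le> norm (lam \<theta> k)"
proof -
  let ?r = "nres \<theta> k" and ?n = "round (of_int k * \<theta>)"
  have r: "\<bar>?r\<bar> \<le> 1 / 2"
    unfolding nres_def using of_int_round_abs_le[of "of_int k * \<theta>"] by (simp add: abs_minus_commute)
  have kt: "complex_of_int k * of_real \<theta> = of_real ?r + of_int ?n"
    by (simp add: nres_def)
  have "ek k (of_real \<theta>) = exp (\<i> * of_real (2 * pi * ?r) + \<i> * (of_int ?n * (of_real pi * 2)))"
  proof -
    have "2 * of_real pi * \<i> * of_int k * complex_of_real \<theta> = 2 * of_real pi * \<i> * (of_int k * of_real \<theta>)"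
      by simp
    also have "\<dots> = \<i> * of_real (2 * pi * ?r) + \<i> * (of_int ?n * (of_real pi * 2))"
      unfolding kt by (simp add: algebra_simps)
    finally show ?thesis unfolding ek_def by (rule arg_cong)
  qed
  then have "norm (lam \<theta> k) = 2 * \<bar>sin (pi * ?r)\<bar>"
    unfolding lam_def exp_plus_2pin using dist_exp_i_1[of "2 * pi * ?r"] by simp
  then show ?thesis using sin_pi_ge[OF r] by simp
qed

lemma norm_lam_minus: "norm (lam \<theta> (- k)) = norm (lam \<theta> k)"
proof -
  have "lam \<theta> (- k) = cnj (lam \<theta> k)"
    by (simp add: lam_def cnj_ek)
  then show ?thesis by simp
qed

lemma nres_ge:
  assumes "\<theta> \<in> Diophantine \<gamma> \<tau>" "k \<noteq> 0"
  shows "\<gamma> * \<bar>of_int k\<bar> powr (- \<tau>) \<le> \<bar>nres \<theta> k\<bar>"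
  using assms unfolding nres_def Diophantine_def by blast

lemma lam_nonzero:
  assumes "\<theta> \<in> Diophantine \<gamma> \<tau>" "0 < \<gamma>" "k \<noteq> 0"
  shows "lam \<theta> k \<noteq> 0"
proof -
  have "0 < \<gamma> * \<bar>real_of_int k\<bar> powr (- \<tau>)"
    using assms by simp
  then have "0 < norm (lam \<theta> k)"
    using nres_ge[OF assms(1,3)] norm_lam_ge[of \<theta> k] by linarith
  then show ?thesis by simp
qed

lemma sum_inverse_squares_int_le:
  assumes "finite X" "0 \<notin> X"
  shows "(\<Sum>j\<in>X. 1 / (real_of_int j)\<^sup>2) \<le> 4"
proof -
  \<comment> \<open>The subtracted term closes the induction: two new summands
    \<open>1 / (N + 2) ^ 2\<close> cost at most \<open>2 / (N + 1) - 2 / (N + 2)\<close>. The term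
    for \<open>j = 0\<close> is 0 by division by zero.\<close>
  have b: "(\<Sum>j\<in>{- int (Suc N)..int (Suc N)}. 1 / (real_of_int j)\<^sup>2) \<le> 4 - 2 / real (Suc N)" for N
  proof (induction N)
    case 0
    have "{- 1..1::int} = {-1, 0, 1}" by auto
    then show ?case by simp
  next
    case (Suc N)
    have "2 / (real (Suc (Suc N)))\<^sup>2 \<le> 2 / real (Suc N) - 2 / real (Suc (Suc N))"
    proof -
      have "real (Suc N) * real (Suc (Suc N)) \<le> (real (Suc (Suc N)))\<^sup>2"
        by (simp add: power2_eq_square)
      then have "2 / (real (Suc (Suc N)))\<^sup>2 \<le> 2 / (real (Suc N) * real (Suc (Suc N)))"
        by (intro divide_left_mono) auto
      also have "\<dots> = 2 / real (Suc N) - 2 / real (Suc (Suc N))"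
        by (simp add: field_simps)
      finally show ?thesis .
    qed
    moreover have "2 / (real (Suc (Suc N)))\<^sup>2 = 1 / (real (Suc (Suc N)))\<^sup>2 + 1 / (real (Suc (Suc N)))\<^sup>2"
      by simp
    ultimately show ?case
      using Suc unfolding sum_symmetric_Suc[of _ "Suc N"] of_int_minus of_int_of_nat_eq power2_minus by linarith
  qed
  define N where "N = nat (Max (insert 0 (abs ` X)))"
  have "X \<subseteq> {- int (Suc N)..int (Suc N)}"
  proof
    fix x assume "x \<in> X"
    then have "\<bar>x\<bar> \<le> Max (insert 0 (abs ` X))"
      using assms(1) by (intro Max_ge) auto
    then show "x \<in> {- int (Suc N)..int (Suc N)}"
      unfolding N_def by auto
  qed
  then have "(\<Sum>j\<in>X. 1 / (real_of_int j)\<^sup>2) \<le> (\<Sum>j\<in>{- int (Suc N)..int (Suc N)}. 1 / (real_of_int j)\<^sup>2)"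
    by (intro sum_mono2) auto
  also have "\<dots> \<le> 4"
    using b[of N] by (smt (verit) divide_nonneg_nonneg of_nat_0_le_iff)
  finally show ?thesis .
qed

text \<open>The residues of \<open>\<theta>, 2\<theta>, \<dots>, K\<theta>\<close> are \<open>\<mu>\<close>-separated, so measuring them in units of \<open>\<mu>\<close> and
  rounding towards 0 gives distinct nonzero integers.\<close>

lemma sum_small_divisors_le:
  assumes dio: "\<theta> \<in> Diophantine \<gamma> \<tau>" and pos: "0 < \<gamma>" "0 \<le> \<tau>" and K: "1 \<le> K"
  shows "(\<Sum>k\<in>{1..K}. 1 / (norm (lam \<theta> (int k)))\<^sup>2) \<le> real K powr (2 * \<tau>) / (4 * \<gamma>\<^sup>2)"
proof -
  define \<mu> where "\<mu> = \<gamma> * real K powr (- \<tau>)"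
  have \<mu>: "0 < \<mu>" using pos K by (simp add: \<mu>_def)
  let ?r = "\<lambda>k. nres \<theta> (int k)"
  have low: "\<mu> \<le> \<gamma> * \<bar>of_int q\<bar> powr (- \<tau>)" if "q \<noteq> 0" "\<bar>q\<bar> \<le> int K" for q :: int
  proof -
    have "\<bar>real_of_int q\<bar> \<le> real K" using that(2) by linarith
    then show ?thesis unfolding \<mu>_def using that pos
      by (intro mult_left_mono powr_mono2') auto
  qed
  have r: "\<mu> \<le> \<bar>?r k\<bar>" if "k \<in> {1..K}" for k
    using nres_ge[OF dio, of "int k"] low[of "int k"] that by auto
  \<comment> \<open>A difference of residues is \<open>(j - k) * \<theta>\<close> minus an integer,
    and \<open>j - k\<close> is again at most \<open>K\<close> in modulus, so the Diophantine lower
    bound applies to it too.\<close>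
  have sep: "\<mu> \<le> \<bar>?r j - ?r k\<bar>" if "j \<in> {1..K}" "k \<in> {1..K}" "j \<noteq> k" for j k
  proof -
    have "\<mu> \<le> \<gamma> * \<bar>of_int (int j - int k)\<bar> powr (- \<tau>)"
      using that by (intro low) auto
    also have "\<dots> \<le> \<bar>of_int (int j - int k) * \<theta> - of_int (round (of_int (int j) * \<theta>) - round (of_int (int k) * \<theta>))\<bar>"
    proof -
      have "\<gamma> * \<bar>of_int q\<bar> powr (- \<tau>) \<le> \<bar>of_int q * \<theta> - of_int p\<bar>" if "q \<noteq> 0" for p q
        using dio that unfolding Diophantine_def by blast
      from this[of "int j - int k" "round (of_int (int j) * \<theta>) - round (of_int (int k) * \<theta>)"]
      show ?thesis using that(3) by simp
    qed
    also have "of_int (int j - int k) * \<theta> - of_int (round (of_int (int j) * \<theta>) - round (of_int (int k) * \<theta>))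
        = ?r j - ?r k"
      by (simp add: nres_def algebra_simps)
    finally show ?thesis .
  qed
  \<comment> \<open>Rounding towards 0 does not increase the modulus, so
    \<open>\<mu> * \<bar>J k\<bar>\<close> is a lower bound for the residue. Since the residue is at
    least \<open>\<mu>\<close> in modulus, \<open>J k\<close> is nonzero.\<close>
  define J where "J k = (if 0 < ?r k then \<lfloor>?r k / \<mu>\<rfloor> else \<lceil>?r k / \<mu>\<rceil>)" for k
  have J1: "1 \<le> \<bar>J k\<bar>" "\<mu> * \<bar>of_int (J k)\<bar> \<le> \<bar>?r k\<bar>" if k: "k \<in> {1..K}" for k
  proof -
    show "1 \<le> \<bar>J k\<bar>"
    proof (cases "0 < ?r k")
      case True
      then have "1 \<le> ?r k / \<mu>" using r[OF k] \<mu> by (simp add: field_simps)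
      then show ?thesis using True by (simp add: J_def le_floor_iff)
    next
      case False
      then have "?r k / \<mu> \<le> - 1" using r[OF k] \<mu> by (simp add: field_simps)
      then have "\<lceil>?r k / \<mu>\<rceil> \<le> - 1" by (simp add: ceiling_le_iff)
      then show ?thesis using False by (simp add: J_def)
    qed
    show "\<mu> * \<bar>of_int (J k)\<bar> \<le> \<bar>?r k\<bar>"
    proof (cases "0 < ?r k")
      case True
      then have "0 \<le> ?r k / \<mu>" using \<mu> by simp
      then have "\<bar>of_int (J k)\<bar> \<le> ?r k / \<mu>"
        using True of_int_floor_le[of "?r k / \<mu>"] by (simp add: J_def)
      then show ?thesis using True \<mu> by (simp add: field_simps)
    next
      case False
      then have "?r k / \<mu> \<le> 0" using \<mu> by (simp add: divide_le_0_iff)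
      then have "\<lceil>?r k / \<mu>\<rceil> \<le> 0" by (simp add: ceiling_le_iff)
      then have "\<bar>of_int (J k)\<bar> \<le> - (?r k / \<mu>)"
        using False le_of_int_ceiling[of "?r k / \<mu>"] by (simp add: J_def)
      then show ?thesis using False \<mu> by (simp add: field_simps)
    qed
  qed
  have inj: "inj_on J {1..K}"
  proof (rule inj_onI, rule ccontr)
    fix j k assume jk: "j \<in> {1..K}" "k \<in> {1..K}" "J j = J k" "j \<noteq> k"
    \<comment> \<open>Equal values of \<open>J\<close> must come from the same kind of rounding;
      then the two residues are less than \<open>\<mu>\<close> apart, against
      \<open>sep\<close>.\<close>
    have J_sign: "0 < J i \<longleftrightarrow> 0 < ?r i" if "i \<in> {1..K}" for i
    proof (cases "0 < ?r i")
      case True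
      then have "0 \<le> ?r i / \<mu>" using \<mu> by simp
      then show ?thesis using True J1(1)[OF that] by (simp add: J_def)
    next
      case False
      then have "?r i / \<mu> \<le> 0" using \<mu> by (simp add: divide_le_0_iff)
      then show ?thesis using False by (simp add: J_def ceiling_le_iff not_less)
    qed
    have same: "0 < ?r j \<longleftrightarrow> 0 < ?r k"
      using J_sign[OF jk(1)] J_sign[OF jk(2)] jk(3) by metis
    have "\<bar>?r j / \<mu> - ?r k / \<mu>\<bar> < 1"
    proof (cases "0 < ?r j")
      case True
      then have "\<lfloor>?r j / \<mu>\<rfloor> = \<lfloor>?r k / \<mu>\<rfloor>"
        using same jk(3) by (simp add: J_def)
      then show ?thesis by linarith
    next
      case False
      then have "\<lceil>?r j / \<mu>\<rceil> = \<lceil>?r k / \<mu>\<rceil>"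
        using same jk(3) by (simp add: J_def)
      then show ?thesis by linarith
    qed
    then have "\<bar>?r j - ?r k\<bar> < \<mu>"
      using \<mu> by (simp add: diff_divide_distrib [symmetric] abs_divide field_simps)
    then show False using sep[OF jk(1,2,4)] by simp
  qed
  have "(\<Sum>k\<in>{1..K}. 1 / (norm (lam \<theta> (int k)))\<^sup>2) \<le> (\<Sum>k\<in>{1..K}. (1 / (16 * \<mu>\<^sup>2)) * (1 / (real_of_int (J k))\<^sup>2))"
  proof (rule sum_mono)
    fix k assume k: "k \<in> {1..K}"
    have "4 * (\<mu> * \<bar>of_int (J k)\<bar>) \<le> norm (lam \<theta> (int k))"
      using J1(2)[OF k] norm_lam_ge[of \<theta> "int k"] by linarith
    then have "(4 * (\<mu> * \<bar>of_int (J k)\<bar>))\<^sup>2 \<le> (norm (lam \<theta> (int k)))\<^sup>2"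
      using \<mu> by (intro power_mono) auto
    then have le: "16 * \<mu>\<^sup>2 * (real_of_int (J k))\<^sup>2 \<le> (norm (lam \<theta> (int k)))\<^sup>2"
      by (simp add: power_mult_distrib mult.assoc)
    have "J k \<noteq> 0" using J1(1)[OF k] by auto
    then have "0 < 16 * \<mu>\<^sup>2 * (real_of_int (J k))\<^sup>2" using \<mu> by simp
    then have "1 / (norm (lam \<theta> (int k)))\<^sup>2 \<le> 1 / (16 * \<mu>\<^sup>2 * (real_of_int (J k))\<^sup>2)"
      using le by (intro divide_left_mono mult_pos_pos) auto
    then show "1 / (norm (lam \<theta> (int k)))\<^sup>2 \<le> (1 / (16 * \<mu>\<^sup>2)) * (1 / (real_of_int (J k))\<^sup>2)"
      by simp
  qed
  also have "\<dots> = (1 / (16 * \<mu>\<^sup>2)) * (\<Sum>j\<in>J ` {1..K}. 1 / (real_of_int j)\<^sup>2)"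
    using sum.reindex[OF inj, of "\<lambda>j. 1 / (real_of_int j)\<^sup>2"] by (simp add: sum_distrib_left o_def)
  also have "\<dots> \<le> (1 / (16 * \<mu>\<^sup>2)) * 4"
  proof (intro mult_left_mono sum_inverse_squares_int_le)
    show "0 \<notin> J ` {1..K}" using J1(1) by force
  qed auto
  also have "\<dots> = real K powr (2 * \<tau>) / (4 * \<gamma>\<^sup>2)"
  proof -
    have "\<mu>\<^sup>2 = \<gamma>\<^sup>2 * real K powr (- (2 * \<tau>))"
      using K by (simp add: \<mu>_def power_mult_distrib powr_power mult.commute)
    then have "\<gamma>\<^sup>2 = \<mu>\<^sup>2 * real K powr (2 * \<tau>)"
      using K by (simp add: powr_minus field_simps)
    then show ?thesis using K \<mu> pos by (simp add: field_simps)
  qed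
  finally show ?thesis .
qed

text \<open>Abel summation in integral form: \<open>exp (- c k)\<close> is the integral of \<open>exp (- t)\<close> over \<open>{c k..}\<close>.\<close>

lemma sum_exp_le_Gamma:
  fixes a :: "nat \<Rightarrow> real"
  assumes a: "\<And>k. 0 \<le> a k" and S: "\<And>K. 1 \<le> K \<Longrightarrow> (\<Sum>k\<in>{1..K}. a k) \<le> C * real K powr b"
    and c: "0 < c" and b: "0 \<le> b" and C: "0 \<le> C"
  shows "(\<Sum>k\<in>{1..n}. a k * exp (- (c * real k))) \<le> C * Gamma (b + 1) / c powr b"
proof -
  have 1: "((\<lambda>t. \<Sum>k\<in>{1..n}. a k * (if t \<in> {c * real k..} then exp (- t) else 0))
      has_integral (\<Sum>k\<in>{1..n}. a k * exp (- (c * real k)))) {0..}"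
  proof (intro has_integral_sum has_integral_mult_right)
    fix k
    have "((\<lambda>x::real. exp (-1*x)) has_integral exp (-1*(c * real k))/1) {c * real k..}"
      by (rule has_integral_exp_minus_to_infinity) simp
    then have "((\<lambda>x::real. exp (- x)) has_integral exp (- (c * real k))) {c * real k..}"
      by simp
    then show "((\<lambda>t. if t \<in> {c * real k..} then exp (- t) else 0) has_integral exp (- (c * real k))) {0..}"
      using c by (subst has_integral_restrict) auto
  qed auto
  have 2: "((\<lambda>t. C / c powr b * (t powr b / exp t)) has_integral C / c powr b * Gamma (b + 1)) {0..}"
    using Gamma_integral_real[of "b + 1"] b by (intro has_integral_mult_right) auto
  have "(\<Sum>k\<in>{1..n}. a k * (if t \<in> {c * real k..} then exp (- t) else 0)) \<le> C / c powr b * (t powr b / exp t)"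
    if t: "t \<in> {0..}" for t
  proof -
    \<comment> \<open>At \<open>t\<close> exactly the indices with \<open>c * real k \<le> t\<close>
      contribute, and \<open>K\<close> is the last of them; the hypothesis on partial sums then
      gives the integrand of the Gamma function.\<close>
    define K where "K = nat \<lfloor>t / c\<rfloor>"
    have t0: "0 \<le> t" using t by simp
    have tc: "0 \<le> t / c" using t0 c by simp
    have K: "real K \<le> t / c" "\<And>k. real k \<le> t / c \<Longrightarrow> k \<le> K"
      using tc unfolding K_def by (auto simp: le_nat_floor of_nat_floor)
    have "(\<Sum>k\<in>{1..n}. a k * (if t \<in> {c * real k..} then exp (- t) else 0))
        = (\<Sum>k\<in>{k\<in>{1..n}. c * real k \<le> t}. a k) * exp (- t)"
    proof -
      have "(\<Sum>k\<in>{k\<in>{1..n}. c * real k \<le> t}. a k) * exp (- t)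
          = (\<Sum>k\<in>{1..n}. if c * real k \<le> t then a k * exp (- t) else 0)"
        by (subst sum.inter_filter [symmetric]) (auto simp: sum_distrib_right)
      then show ?thesis by (auto intro!: sum.cong)
    qed
    also have "\<dots> \<le> (\<Sum>k\<in>{1..K}. a k) * exp (- t)"
      using a K(2) c by (intro mult_right_mono sum_mono2) (auto simp: field_simps)
    also have "(\<Sum>k\<in>{1..K}. a k) \<le> C * (t / c) powr b"
    proof (cases "1 \<le> K")
      case True
      from S[OF this] have "(\<Sum>k\<in>{1..K}. a k) \<le> C * real K powr b" .
      also have "\<dots> \<le> C * (t / c) powr b"
        using K(1) b C by (intro mult_left_mono powr_mono2) auto
      finally show ?thesis .
    next
      case False
      then show ?thesis using C by (simp add: not_le)
    qed
    finally show ?thesis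
      using c t0 by (simp add: powr_divide exp_minus field_simps)
  qed
  from has_integral_le[OF 1 2 this] show ?thesis by simp
qed

lemma sum_small_divisors_exp_le:
  assumes "\<theta> \<in> Diophantine \<gamma> \<tau>" "0 < \<gamma>" "0 \<le> \<tau>" "0 < c"
  shows "(\<Sum>k\<in>{1..n}. 1 / (norm (lam \<theta> (int k)))\<^sup>2 * exp (- (c * real k)))
    \<le> Gamma (2 * \<tau> + 1) / (4 * \<gamma>\<^sup>2 * c powr (2 * \<tau>))"
proof -
  have "(\<Sum>k\<in>{1..n}. 1 / (norm (lam \<theta> (int k)))\<^sup>2 * exp (- (c * real k)))
      \<le> (1 / (4 * \<gamma>\<^sup>2)) * Gamma (2 * \<tau> + 1) / c powr (2 * \<tau>)"
    by (rule sum_exp_le_Gamma) (use sum_small_divisors_le[OF assms(1-3)] assms in auto)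
  then show ?thesis by simp
qed

text \<open>The constant that Ruessmann's argument leaves: Bessel's inequality on two lines gives
  \<open>2 * B\<^sup>2\<close>, the small divisors summed with \<open>c = 4 * pi * d\<close> give
  \<open>2 * Q\<close>, and the square root of the product is
  \<open>KR \<tau> * B / (\<gamma> * d powr \<tau>)\<close>.\<close>

definition KR :: "real \<Rightarrow> real" where
  "KR \<tau> = sqrt (Gamma (2 * \<tau> + 1)) / (4 * pi) powr \<tau>"

lemma KR_pos: "0 \<le> \<tau> \<Longrightarrow> 0 < KR \<tau>"
  by (simp add: KR_def Gamma_real_pos)

section \<open>The cohomological equation\<close>

lemma perhol_cong:
  assumes "perhol s f" "\<And>z. z \<in> strip s \<Longrightarrow> f z = g z"
  shows "perhol s g"
proof -
  have "g holomorphic_on strip s"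
    using assms holomorphic_transform[of f "strip s" g] by (auto simp: perhol_def)
  moreover have "g (z + 1) = g z" if "z \<in> strip s" for z
    using assms(1) assms(2)[of z] assms(2)[of "z + 1"] that by (simp add: perhol_def)
  ultimately show ?thesis by (simp add: perhol_def)
qed

lemma sum_symmetric:
  fixes u :: "int \<Rightarrow> 'a::comm_monoid_add"
  shows "sum u {- int N..int N} = u 0 + (\<Sum>k\<in>{1..N}. u (int k) + u (- int k))"
proof (induction N)
  case (Suc N)
  then show ?case
    unfolding sum_symmetric_Suc by (simp add: ac_simps del: of_nat_Suc)
qed simp

lemma fc_cohomological:
  assumes \<xi>: "perhol s \<xi>" and s: "0 < s"
    and eq: "\<And>z. z \<in> strip s \<Longrightarrow> \<xi> (z + of_real \<theta>) - \<xi> z = g z"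
  shows "fc g k = fc \<xi> k * lam \<theta> k"
proof -
  have w: "of_real \<theta> \<in> strip s" using s by simp
  have "fc g k = average (\<lambda>z. \<xi> (z + of_real \<theta>) * ek (- k) z - \<xi> z * ek (- k) z)"
    unfolding fc_def using eq s by (intro average_cong) (simp add: algebra_simps)
  also have "\<dots> = fc (\<lambda>z. \<xi> (z + of_real \<theta>)) k - fc \<xi> k"
    unfolding fc_def using perhol_shift[OF \<xi>, of \<theta>] \<xi> s
    by (intro average_diff continuous_intros continuous_on_reals[of _ s]) (auto simp: perhol_def)
  also have "\<dots> = fc \<xi> k * lam \<theta> k"
    by (simp add: fc_shift[OF \<xi> w] lam_def algebra_simps)
  finally show ?thesis .
qed

text \<open>Ruessmann's estimate: Bessel's inequality on the two lines \<open>Im z = \<plusminus> t\<close> and the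
  Cauchy-Schwarz inequality give the exponent \<open>\<tau>\<close> without any additional loss.\<close>

lemma cohomological_estimate:
  assumes dio: "\<theta> \<in> Diophantine \<gamma> \<tau>" and pos: "0 < \<gamma>" "0 \<le> \<tau>"
    and \<xi>: "perhol s \<xi>" and av: "average \<xi> = 0"
    and eq: "\<And>z. z \<in> strip s \<Longrightarrow> \<xi> (z + of_real \<theta>) - \<xi> z = g z"
    and B: "\<And>z. z \<in> strip s \<Longrightarrow> norm (g z) \<le> B"
    and d: "0 < d" and z: "z \<in> strip (s - d)"
  shows "norm (\<xi> z) \<le> KR \<tau> * B / (\<gamma> * d powr \<tau>)"
proof -
  \<comment> \<open>The coefficients of \<open>g\<close> are weighed on the lines at height
    \<open>t\<close> and \<open>- t\<close>, a distance \<open>d\<close> beyond \<open>z\<close>.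
    The excess leaves the factor \<open>exp (- 2 * pi * \<bar>k\<bar> * d)\<close> that compensates
    the small divisors.\<close>
  define t where "t = \<bar>Im z\<bar> + d"
  have ts: "0 < t" "t < s" using z d by (auto simp: t_def strip_def)
  have s: "0 < s" using ts by simp
  have zs: "z \<in> strip s" using z d by (auto simp: strip_def)
  have B0: "0 \<le> B" using B[OF zs] norm_ge_zero order_trans by blast
  have g: "perhol s g"
  proof -
    have "perhol s (\<lambda>z. \<xi> (z + of_real \<theta>) - \<xi> z)"
      by (intro perhol_diff perhol_shift \<xi>)
    then show ?thesis
      using eq by (rule perhol_cong)
  qed
  have fc0: "fc \<xi> 0 = 0" using av by (simp add: fc_def)
  have fck: "norm (fc \<xi> k) = norm (fc g k) / norm (lam \<theta> k)" if "k \<noteq> 0" for k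
    using fc_cohomological[OF \<xi> s eq, of k] lam_nonzero[OF dio pos(1) that]
    by (simp add: norm_mult)
  have bes: "(\<Sum>k\<in>F. (norm (fc g k))\<^sup>2 * exp (- (4 * pi * of_int k * y))) \<le> B\<^sup>2"
    if F: "finite F" and y: "\<bar>y\<bar> < s" for F y
  proof -
    let ?w = "of_real y * \<i>"
    have w: "?w \<in> strip s" using y by (simp add: strip_def)
    have "(\<Sum>k\<in>F. (norm (fc (\<lambda>z. g (z + ?w)) k))\<^sup>2) \<le> B\<^sup>2"
      using g w F B
      by (intro bessel_inequality holomorphic_shift_real[of g s]) (auto simp: perhol_def)
    moreover have "(norm (fc (\<lambda>z. g (z + ?w)) k))\<^sup>2 = (norm (fc g k))\<^sup>2 * exp (- (4 * pi * of_int k * y))" for k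
      unfolding fc_shift[OF g w]
      by (simp add: norm_mult norm_ek power_mult_distrib exp_double [symmetric])
    ultimately show ?thesis by simp
  qed
  define Q where "Q = Gamma (2 * \<tau> + 1) / (4 * \<gamma>\<^sup>2 * (4 * pi * d) powr (2 * \<tau>))"
  have part: "norm (\<Sum>k\<in>{- int N..int N}. fc \<xi> k * ek k z) \<le> KR \<tau> * B / (\<gamma> * d powr \<tau>)" for N
  proof -
    let ?X = "{- int N..int N} - {0}"
    define a where "a k = norm (fc g k) * exp (2 * pi * \<bar>of_int k\<bar> * t)" for k
    define b where "b k = exp (- (2 * pi * \<bar>of_int k\<bar> * d)) / norm (lam \<theta> k)" for k
    have "norm (\<Sum>k\<in>{- int N..int N}. fc \<xi> k * ek k z) = norm (\<Sum>k\<in>?X. fc \<xi> k * ek k z)"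
      by (rule arg_cong[where f = norm], rule sum.mono_neutral_right) (auto simp: fc0)
    also have "\<dots> \<le> (\<Sum>k\<in>?X. a k * b k)"
    proof (rule sum_norm_le)
      fix k assume k: "k \<in> ?X"
      have "- (of_int k * Im z) \<le> \<bar>of_int k\<bar> * \<bar>Im z\<bar>"
        by (metis abs_ge_minus_self abs_mult)
      then have "- (2 * pi * of_int k * Im z) \<le> 2 * pi * (\<bar>of_int k\<bar> * \<bar>Im z\<bar>)"
        using mult_left_mono[of "- (of_int k * Im z)" "\<bar>of_int k\<bar> * \<bar>Im z\<bar>" "2 * pi"] by simp
      also have "\<dots> = 2 * pi * \<bar>of_int k\<bar> * t + - (2 * pi * \<bar>of_int k\<bar> * d)"
        by (simp add: t_def algebra_simps)
      finally have "norm (ek k z) \<le> exp (2 * pi * \<bar>of_int k\<bar> * t) * exp (- (2 * pi * \<bar>of_int k\<bar> * d))"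
        unfolding norm_ek exp_add [symmetric] by simp
      then have "norm (fc \<xi> k) * norm (ek k z)
          \<le> norm (fc \<xi> k) * (exp (2 * pi * \<bar>of_int k\<bar> * t) * exp (- (2 * pi * \<bar>of_int k\<bar> * d)))"
        by (intro mult_left_mono) auto
      then show "norm (fc \<xi> k * ek k z) \<le> a k * b k"
        using k by (simp add: norm_mult fck a_def b_def)
    qed
    also have "\<dots> \<le> sqrt ((\<Sum>k\<in>?X. (a k)\<^sup>2) * (\<Sum>k\<in>?X. (b k)\<^sup>2))"
      by (intro real_le_rsqrt Cauchy_Schwarz_ineq_sum)
    also have "\<dots> \<le> sqrt ((2 * B\<^sup>2) * (2 * Q))"
    proof (intro real_sqrt_le_mono mult_mono sum_nonneg)
      have "(\<Sum>k\<in>?X. (a k)\<^sup>2) \<le> (\<Sum>k\<in>?X. (norm (fc g k))\<^sup>2 * exp (- (4 * pi * of_int k * t))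
            + (norm (fc g k))\<^sup>2 * exp (- (4 * pi * of_int k * - t)))"
      proof (rule sum_mono)
        fix k
        have "(exp (2 * pi * \<bar>of_int k\<bar> * t))\<^sup>2 \<le> exp (- (4 * pi * of_int k * t)) + exp (- (4 * pi * of_int k * - t))"
          \<comment> \<open>According to the sign of \<open>k\<close>, one of the two summands
            equals the left side. Keeping both lets Bessel's inequality be used on each line, at the
            cost of a factor 2.\<close>
          by (cases "k \<ge> 0") (auto simp: exp_double [symmetric] mult_ac)
        then have "(norm (fc g k))\<^sup>2 * (exp (2 * pi * \<bar>of_int k\<bar> * t))\<^sup>2
            \<le> (norm (fc g k))\<^sup>2 * (exp (- (4 * pi * of_int k * t)) + exp (- (4 * pi * of_int k * - t)))"
          by (intro mult_left_mono) auto
        then show "(a k)\<^sup>2 \<le> (norm (fc g k))\<^sup>2 * exp (- (4 * pi * of_int k * t))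
            + (norm (fc g k))\<^sup>2 * exp (- (4 * pi * of_int k * - t))"
          by (simp only: a_def power_mult_distrib distrib_left)
      qed
      also have "\<dots> \<le> B\<^sup>2 + B\<^sup>2"
        unfolding sum.distrib using ts by (intro add_mono bes) auto
      finally show "(\<Sum>k\<in>?X. (a k)\<^sup>2) \<le> 2 * B\<^sup>2" by simp
      have "(\<Sum>k\<in>?X. (b k)\<^sup>2) = (\<Sum>k\<in>{- int N..int N}. if k = 0 then 0 else (b k)\<^sup>2)"
        by (rule sum.mono_neutral_cong_left) auto
      also have "\<dots> = (\<Sum>k\<in>{1..N}. (b (int k))\<^sup>2 + (b (- int k))\<^sup>2)"
      proof -
        have "(\<Sum>k\<in>{1..N}. (if int k = 0 then 0 else (b (int k))\<^sup>2) + (if - int k = 0 then 0 else (b (- int k))\<^sup>2))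
          = (\<Sum>k\<in>{1..N}. (b (int k))\<^sup>2 + (b (- int k))\<^sup>2)"
          by (intro sum.cong) auto
        then show ?thesis unfolding sum_symmetric by simp
      qed
      also have "\<dots> = (\<Sum>k\<in>{1..N}. 2 * (1 / (norm (lam \<theta> (int k)))\<^sup>2 * exp (- (4 * pi * d * real k))))"
        by (intro sum.cong refl)
           (simp add: b_def norm_lam_minus power_divide exp_double [symmetric] mult_ac)
      also have "\<dots> = 2 * (\<Sum>k\<in>{1..N}. 1 / (norm (lam \<theta> (int k)))\<^sup>2 * exp (- (4 * pi * d * real k)))"
        by (simp only: sum_distrib_left)
      also have "\<dots> \<le> 2 * Q"
        unfolding Q_def using d sum_small_divisors_exp_le[OF dio pos, of "4 * pi * d" N] by simp
      finally show "(\<Sum>k\<in>?X. (b k)\<^sup>2) \<le> 2 * Q" .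
    qed auto
    also have "\<dots> = KR \<tau> * B / (\<gamma> * d powr \<tau>)"
    proof -
      have p: "sqrt ((4 * pi * d) powr (2 * \<tau>)) = (4 * pi) powr \<tau> * d powr \<tau>"
      proof -
        have "(4 * pi * d) powr (2 * \<tau>) = ((4 * pi) powr \<tau> * d powr \<tau>)\<^sup>2"
          using d by (simp add: powr_mult power_mult_distrib powr_power mult.commute)
        then show ?thesis by simp
      qed
      have "(2 * B\<^sup>2) * (2 * Q) = B\<^sup>2 * Gamma (2 * \<tau> + 1) / (\<gamma>\<^sup>2 * (4 * pi * d) powr (2 * \<tau>))"
        by (simp add: Q_def)
      then have "sqrt ((2 * B\<^sup>2) * (2 * Q)) = B * sqrt (Gamma (2 * \<tau> + 1)) / (\<gamma> * ((4 * pi) powr \<tau> * d powr \<tau>))"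
        using B0 pos by (simp only: real_sqrt_divide real_sqrt_mult p) simp
      then show ?thesis
        by (simp add: KR_def mult_ac)
    qed
    finally show ?thesis .
  qed
  have "(\<lambda>N. norm (\<Sum>k\<in>{- int N..int N}. fc \<xi> k * ek k z)) \<longlonglongrightarrow> norm (\<xi> z)"
    by (intro tendsto_norm fourier_sums[OF \<xi> zs])
  then show ?thesis
    by (rule LIMSEQ_le_const2) (use part in blast)
qed

text \<open>The convergence of the solution series involves first powers of the divisors, whereas
  their squares have been summed; \<open>x \<le> x\<^sup>2 + 1\<close> bridges the gap.\<close>

lemma summable_small_divisors:
  assumes dio: "\<theta> \<in> Diophantine \<gamma> \<tau>" and pos: "0 < \<gamma>" "0 \<le> \<tau>" and c: "0 < c"
  shows "summable (\<lambda>n. 1 / norm (lam \<theta> (int (Suc n))) * exp (- (c * real (Suc n))))"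
proof -
  have "summable (\<lambda>n. 1 / (norm (lam \<theta> (int (Suc n))))\<^sup>2 * exp (- (c * real (Suc n))))"
  proof (rule summableI_nonneg_bounded)
    fix n
    have "(\<Sum>i<n. 1 / (norm (lam \<theta> (int (Suc i))))\<^sup>2 * exp (- (c * real (Suc i))))
      = (\<Sum>k\<in>{1..n}. 1 / (norm (lam \<theta> (int k)))\<^sup>2 * exp (- (c * real k)))"
      by (rule sum.reindex_bij_witness[of _ "\<lambda>k. k - 1" Suc]) auto
    also have "\<dots> \<le> Gamma (2 * \<tau> + 1) / (4 * \<gamma>\<^sup>2 * c powr (2 * \<tau>))"
      by (rule sum_small_divisors_exp_le[OF dio pos c])
    finally show "(\<Sum>i<n. 1 / (norm (lam \<theta> (int (Suc i))))\<^sup>2 * exp (- (c * real (Suc i))))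
      \<le> Gamma (2 * \<tau> + 1) / (4 * \<gamma>\<^sup>2 * c powr (2 * \<tau>))" .
  qed auto
  moreover have "summable (\<lambda>n. exp (- (c * real (Suc n))))"
  proof -
    have "summable (\<lambda>n. exp (- c) * exp (- c) ^ n)"
      using c by (intro summable_mult summable_geometric) auto
    moreover have "(\<lambda>n. exp (- c) * exp (- c) ^ n) = (\<lambda>n. exp (- (c * real (Suc n))))"
      by (simp add: exp_of_nat_mult [symmetric] exp_add [symmetric] algebra_simps)
    ultimately show ?thesis by simp
  qed
  ultimately have "summable (\<lambda>n. 1 / (norm (lam \<theta> (int (Suc n))))\<^sup>2 * exp (- (c * real (Suc n)))
      + exp (- (c * real (Suc n))))"
    by (rule summable_add)
  then show ?thesis
  proof (rule summable_comparison_test'[where N = 0])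
    fix n
    let ?l = "norm (lam \<theta> (int (Suc n)))"
    have "1 / ?l \<le> 1 / ?l\<^sup>2 + 1"
    proof -
      have "x \<le> x\<^sup>2 + 1" for x :: real by sos
      from this[of "1 / ?l"] show ?thesis by (simp add: power_divide)
    qed
    then have "1 / ?l * exp (- (c * real (Suc n))) \<le> (1 / ?l\<^sup>2 + 1) * exp (- (c * real (Suc n)))"
      by (intro mult_right_mono) auto
    then show "norm (1 / ?l * exp (- (c * real (Suc n))))
      \<le> 1 / ?l\<^sup>2 * exp (- (c * real (Suc n))) + exp (- (c * real (Suc n)))"
      by (simp add: distrib_right)
  qed
qed

lemma cohomological_exists:
  assumes dio: "\<theta> \<in> Diophantine \<gamma> \<tau>" and pos: "0 < \<gamma>" "0 \<le> \<tau>" and s: "0 < s"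
    and g: "perhol s g" and av: "average g = 0" and real: "\<And>x::real. g (of_real x) \<in> \<real>"
  obtains \<xi> where "perhol s \<xi>" "average \<xi> = 0" "\<And>x::real. \<xi> (of_real x) \<in> \<real>"
    "\<And>z. z \<in> strip s \<Longrightarrow> \<xi> (z + of_real \<theta>) - \<xi> z = g z"
proof -
  define c where "c k = fc g k / lam \<theta> k" for k
  \<comment> \<open>Opposite frequencies are taken together: each term is then real on the real
    line, and the partial sums match the symmetric sums of \<open>fourier_sums\<close>. Index 0 is
    left out, since the divisor vanishes there.\<close>
  define T where "T n z = c (int (Suc n)) * ek (int (Suc n)) z + c (- int (Suc n)) * ek (- int (Suc n)) z" for n z
  define \<xi>0 where "\<xi>0 z = (\<Sum>n. T n z)" for z
  have unif: "\<exists>M. summable M \<and> (\<forall>n. \<forall>z. \<bar>Im z\<bar> \<le> t0 \<longrightarrow> norm (T n z) \<le> M n)"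
    if t0: "0 < t0" "t0 < s" for t0
  proof -
    \<comment> \<open>The coefficients decay at the rate given by an intermediate line; the gap
      \<open>t1 - t0\<close> then controls the small divisors uniformly up to height
      \<open>t0\<close>.\<close>
    define t1 where "t1 = (t0 + s) / 2"
    have t1: "t0 < t1" "t1 < s" using t0 by (auto simp: t1_def)
    have w: "of_real t1 * \<i> \<in> strip s" "- of_real t1 * \<i> \<in> strip s"
      using t0 t1 by (auto simp: strip_def)
    obtain B1 where B1: "\<And>x::real. norm (g (of_real x + of_real t1 * \<i>)) \<le> B1"
      using perhol_bounded_line[OF g w(1)] by blast
    obtain B2 where B2: "\<And>x::real. norm (g (of_real x + - of_real t1 * \<i>)) \<le> B2"
      using perhol_bounded_line[OF g w(2)] by blast
    define B where "B = max B1 B2"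
    have B0: "0 \<le> B" using order_trans[OF norm_ge_zero B1[of 0]] by (simp add: B_def le_max_iff_disj)
    have fcb: "norm (fc g k) \<le> B * exp (- (2 * pi * \<bar>of_int k\<bar> * t1))" for k
    proof (cases "k \<ge> 0")
      case True
      have "norm (fc g k) \<le> B2 * exp (- (2 * pi * \<bar>of_int k\<bar> * t1))"
        using fc_norm_le_line[OF g w(2) B2, of k] True by simp
      also have "\<dots> \<le> B * exp (- (2 * pi * \<bar>of_int k\<bar> * t1))"
        by (intro mult_right_mono) (auto simp: B_def)
      finally show ?thesis .
    next
      case False
      have "norm (fc g k) \<le> B1 * exp (- (2 * pi * \<bar>of_int k\<bar> * t1))"
        using fc_norm_le_line[OF g w(1) B1, of k] False by simp
      also have "\<dots> \<le> B * exp (- (2 * pi * \<bar>of_int k\<bar> * t1))"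
        by (intro mult_right_mono) (auto simp: B_def)
      finally show ?thesis .
    qed
    have trm: "norm (c k * ek k z) \<le> B * (1 / norm (lam \<theta> (int n)) * exp (- (2 * pi * (t1 - t0) * real n)))"
      if z: "\<bar>Im z\<bar> \<le> t0" and k: "k = int n \<or> k = - int n" for k n z
    proof -
      have l: "norm (lam \<theta> k) = norm (lam \<theta> (int n))" using k norm_lam_minus by auto
      have kn: "\<bar>of_int k\<bar> = real n" using k by auto
      have "- (of_int k * Im z) \<le> \<bar>of_int k\<bar> * \<bar>Im z\<bar>"
        by (metis abs_ge_minus_self abs_mult)
      also have "\<dots> \<le> real n * t0" using z kn by (simp add: mult_left_mono)
      finally have "2 * pi * (- (of_int k * Im z)) \<le> 2 * pi * (real n * t0)"
        by (intro mult_left_mono) auto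
      then have e: "norm (ek k z) \<le> exp (2 * pi * (real n * t0))"
        by (simp add: norm_ek mult_ac)
      have "norm (fc g k) * norm (ek k z) \<le> (B * exp (- (2 * pi * real n * t1))) * exp (2 * pi * (real n * t0))"
        using fcb[of k] e B0 unfolding kn by (intro mult_mono) auto
      also have "\<dots> = B * exp (- (2 * pi * (t1 - t0) * real n))"
        by (simp add: mult.assoc exp_add [symmetric] algebra_simps)
      finally have "norm (fc g k) * norm (ek k z) / norm (lam \<theta> (int n))
          \<le> B * exp (- (2 * pi * (t1 - t0) * real n)) / norm (lam \<theta> (int n))"
        by (intro divide_right_mono) auto
      then show ?thesis by (simp add: c_def norm_mult norm_divide l)
    qed
    let ?M = "\<lambda>n. 2 * (B * (1 / norm (lam \<theta> (int (Suc n))) * exp (- (2 * pi * (t1 - t0) * real (Suc n)))))"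
    have "summable ?M"
      using t1 by (intro summable_mult summable_small_divisors[OF dio pos]) auto
    moreover have "norm (T n z) \<le> ?M n" if "\<bar>Im z\<bar> \<le> t0" for n z
      unfolding T_def
      using norm_triangle_ineq[of "c (int (Suc n)) * ek (int (Suc n)) z" "c (- int (Suc n)) * ek (- int (Suc n)) z"]
        trm[OF that, of "int (Suc n)" "Suc n"] trm[OF that, of "- int (Suc n)" "Suc n"]
      by linarith
    ultimately show ?thesis by blast
  qed
  have sumT: "(\<lambda>n. T n z) sums \<xi>0 z" if z: "z \<in> strip s" for z
  proof -
    have "0 < (\<bar>Im z\<bar> + s) / 2" "(\<bar>Im z\<bar> + s) / 2 < s" "\<bar>Im z\<bar> \<le> (\<bar>Im z\<bar> + s) / 2"
      using z by (auto simp: strip_def)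
    then obtain M where "summable M" "\<And>n. norm (T n z) \<le> M n"
      using unif[of "(\<bar>Im z\<bar> + s) / 2"] by blast
    then have "summable (\<lambda>n. T n z)"
      by (rule summable_comparison_test'[where N = 0])
    then show ?thesis unfolding \<xi>0_def by (rule summable_sums)
  qed
  have holT: "T n holomorphic_on X" for n X
    unfolding T_def by (intro holomorphic_intros)
  have hol: "\<xi>0 holomorphic_on strip s"
  proof (rule holomorphic_uniform_sequence[OF open_strip])
    show "(\<lambda>z. \<Sum>i<n. T i z) holomorphic_on strip s" for n
      by (intro holomorphic_on_sum holT)
    fix x assume x: "x \<in> strip s"
    define d where "d = (s - \<bar>Im x\<bar>) / 2"
    have d: "0 < d" and t0: "0 < \<bar>Im x\<bar> + d" "\<bar>Im x\<bar> + d < s"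
      using x by (auto simp: d_def strip_def field_simps)
    have cb: "\<bar>Im z\<bar> \<le> \<bar>Im x\<bar> + d" if "z \<in> cball x d" for z
    proof -
      have "\<bar>Im (z - x)\<bar> \<le> d"
        using that abs_Im_le_cmod[of "z - x"] by (simp add: dist_norm norm_minus_commute)
      then show ?thesis by simp
    qed
    obtain M where "summable M" "\<And>n z. \<bar>Im z\<bar> \<le> \<bar>Im x\<bar> + d \<Longrightarrow> norm (T n z) \<le> M n"
      using unif[OF t0] by blast
    then have "uniform_limit (cball x d) (\<lambda>n z. \<Sum>i<n. T i z) \<xi>0 sequentially"
      unfolding \<xi>0_def using cb by (intro Weierstrass_m_test) auto
    moreover have "cball x d \<subseteq> strip s"
      using cb t0 by (force simp: strip_def)
    ultimately show "\<exists>d>0. cball x d \<subseteq> strip s \<and> uniform_limit (cball x d) (\<lambda>n z. \<Sum>i<n. T i z) \<xi>0 sequentially"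
      using d by blast
  qed
  have per: "perhol s \<xi>0"
    unfolding perhol_def using hol by (simp add: \<xi>0_def T_def ek_add_arg ek_1)
  have rl: "\<xi>0 (of_real x) \<in> \<real>" for x :: real
  proof -
    have cnjfc: "cnj (fc g k) = fc g (- k)" for k
    proof -
      have con: "continuous_on {0..1} (\<lambda>x::real. g (of_real x) * ek (- k) (of_real x))"
        using g s by (intro continuous_intros continuous_on_reals) (auto simp: perhol_def)
      then have "((\<lambda>x::real. g (of_real x) * ek (- k) (of_real x)) has_integral fc g k) {0..1}"
        unfolding fc_def average_def by (simp add: integrable_continuous_real integrable_integral)
      from has_integral_linear[OF this bounded_linear_cnj]
      have "((\<lambda>x::real. cnj (g (of_real x)) * ek k (of_real x)) has_integral cnj (fc g k)) {0..1}"
        by (simp add: o_def cnj_ek)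
      moreover have "cnj (g (of_real x)) = g (of_real x)" for x :: real
        using real Reals_cnj_iff by blast
      ultimately show ?thesis
        unfolding fc_def average_def by (simp add: integral_unique)
    qed
    have "cnj (c k) = c (- k)" for k
    proof -
      have "cnj (lam \<theta> k) = lam \<theta> (- k)" by (simp add: lam_def cnj_ek)
      then show ?thesis by (simp add: c_def cnjfc)
    qed
    then have "cnj (T n (of_real x)) = T n (of_real x)" for n
      by (simp add: T_def cnj_ek add.commute)
    then have "(\<lambda>n. T n (of_real x)) = (\<lambda>n. cnj (T n (of_real x)))" by simp
    moreover have "(\<lambda>n. T n (of_real x)) sums \<xi>0 (of_real x)"
      using sumT s by simp
    moreover from this have "(\<lambda>n. cnj (T n (of_real x))) sums cnj (\<xi>0 (of_real x))"
      by (simp add: sums_cnj)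
    ultimately have "cnj (\<xi>0 (of_real x)) = \<xi>0 (of_real x)"
      using sums_unique2 by metis
    then show ?thesis by (simp add: Reals_cnj_iff)
  qed
  have eq: "\<xi>0 (z + of_real \<theta>) - \<xi>0 z = g z" if z: "z \<in> strip s" for z
  proof -
    have cl: "c k * ek k (z + of_real \<theta>) - c k * ek k z = fc g k * ek k z" if "k \<noteq> 0" for k
    proof -
      have "c k * ek k (z + of_real \<theta>) - c k * ek k z = c k * lam \<theta> k * ek k z"
        by (simp add: ek_add_arg lam_def algebra_simps)
      then show ?thesis
        using lam_nonzero[OF dio pos(1) that] by (simp add: c_def)
    qed
    have "(\<lambda>n. T n (z + of_real \<theta>) - T n z) sums (\<xi>0 (z + of_real \<theta>) - \<xi>0 z)"
      using z by (intro sums_diff sumT) auto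
    moreover have "T n (z + of_real \<theta>) - T n z
        = fc g (int (Suc n)) * ek (int (Suc n)) z + fc g (- int (Suc n)) * ek (- int (Suc n)) z" for n
      using cl[of "int (Suc n)"] cl[of "- int (Suc n)"] by (simp add: T_def algebra_simps)
    moreover have "(\<lambda>n. fc g (int (Suc n)) * ek (int (Suc n)) z + fc g (- int (Suc n)) * ek (- int (Suc n)) z) sums g z"
      unfolding sums_def
    proof -
      have "(\<Sum>i<n. fc g (int (Suc i)) * ek (int (Suc i)) z + fc g (- int (Suc i)) * ek (- int (Suc i)) z)
          = (\<Sum>k\<in>{- int n..int n}. fc g k * ek k z)" for n
      proof -
        have "fc g 0 = 0" using av by (simp add: fc_def)
        then have "(\<Sum>k\<in>{- int n..int n}. fc g k * ek k z)
           = (\<Sum>k\<in>{1..n}. fc g (int k) * ek (int k) z + fc g (- int k) * ek (- int k) z)"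
          by (simp add: sum_symmetric)
        also have "\<dots> = (\<Sum>i<n. fc g (int (Suc i)) * ek (int (Suc i)) z + fc g (- int (Suc i)) * ek (- int (Suc i)) z)"
          by (rule sum.reindex_bij_witness[of _ Suc "\<lambda>k. k - 1"]) auto
        finally show ?thesis by simp
      qed
      then show "(\<lambda>n. \<Sum>i<n. fc g (int (Suc i)) * ek (int (Suc i)) z + fc g (- int (Suc i)) * ek (- int (Suc i)) z)
          \<longlonglongrightarrow> g z"
        using fourier_sums[OF g z] by simp
    qed
    ultimately show ?thesis by (simp only: sums_unique2)
  qed
  have con: "continuous_on {0..1} (\<lambda>x::real. \<xi>0 (of_real x))"
    using hol s by (rule continuous_on_reals)
  \<comment> \<open>Subtracting the average restores the normalization; the equation does not see
    constants.\<close>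
  show ?thesis
  proof
    show "perhol s (\<lambda>z. \<xi>0 z - average \<xi>0)"
      by (intro perhol_diff per perhol_const)
    show "average (\<lambda>z. \<xi>0 z - average \<xi>0) = 0"
      using con by (subst average_diff) (auto simp: average_const)
    show "\<xi>0 (of_real x) - average \<xi>0 \<in> \<real>" for x :: real
      using average_real[OF con rl] rl by simp
    show "(\<xi>0 (z + of_real \<theta>) - average \<xi>0) - (\<xi>0 z - average \<xi>0) = g z" if "z \<in> strip s" for z
      using eq[OF that] by simp
  qed
qed

lemma fc_norm_le_closure:
  assumes g: "perhol s g" and B: "\<And>z. z \<in> strip s \<Longrightarrow> norm (g z) \<le> B" and s: "0 < s"
  shows "norm (fc g k) \<le> B * exp (- (2 * pi * \<bar>of_int k\<bar> * s))"
proof (rule LIMSEQ_le_const)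
  have "(\<lambda>n. B * exp (- (2 * pi * \<bar>of_int k\<bar> * (s - s / 2 * (1 / real (Suc n))))))
      \<longlonglongrightarrow> B * exp (- (2 * pi * \<bar>of_int k\<bar> * (s - s / 2 * 0)))"
    by (intro tendsto_intros LIMSEQ_Suc[OF lim_1_over_n])
  then show "(\<lambda>n. B * exp (- (2 * pi * \<bar>of_int k\<bar> * (s - s / 2 * (1 / real (Suc n))))))
      \<longlonglongrightarrow> B * exp (- (2 * pi * \<bar>of_int k\<bar> * s))" by simp
  have "s / 2 * (1 / real (Suc n)) \<le> s / 2" "0 < s / 2 * (1 / real (Suc n))" for n
    using s by (auto simp: field_simps)
  then have "norm (fc g k) \<le> B * exp (- (2 * pi * \<bar>of_int k\<bar> * (s - s / 2 * (1 / real (Suc n)))))" for n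
    using s by (intro fc_norm_le[OF g B]) (smt (verit) field_sum_of_halves)+
  then show "\<exists>N. \<forall>n\<ge>N. norm (fc g k) \<le> B * exp (- (2 * pi * \<bar>of_int k\<bar> * (s - s / 2 * (1 / real (Suc n)))))"
    by blast
qed

text \<open>A substitute for Hadamard's three lines theorem.\<close>

lemma interpolation_estimate:
  assumes w: "perhol s2 w" and s: "0 < s1" "s1 \<le> s2" and m: "2 * m < s1 + s2" "m \<le> s2"
    and B1: "\<And>z. z \<in> strip s1 \<Longrightarrow> norm (w z) \<le> B1"
    and B2: "\<And>z. z \<in> strip s2 \<Longrightarrow> norm (w z) \<le> B2"
    and z: "z \<in> strip m"
  shows "norm (w z) \<le> 2 / (1 - exp (- (pi * (s1 + s2 - 2 * m)))) * sqrt (B1 * B2)"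
proof -
  define q where "q = exp (- (pi * (s1 + s2 - 2 * m)))"
  have q: "0 < q" "q < 1" using m by (auto simp: q_def)
  have zs: "z \<in> strip s2" using z m strip_mono by blast
  have B0: "0 \<le> B1" "0 \<le> B2"
    using order_trans[OF norm_ge_zero B1[of 0]] order_trans[OF norm_ge_zero B2[of 0]] s
    by (simp_all add: strip_def)
  \<comment> \<open>The geometric mean of the two decay estimates. It beats the growth
    \<open>exp (2 * pi * \<bar>k\<bar> * m)\<close> of \<open>ek k\<close> on \<open>strip m\<close>
    because \<open>2 * m < s1 + s2\<close>, and a geometric series in \<open>q\<close>
    remains.\<close>
  have fcb: "norm (fc w k) \<le> sqrt (B1 * B2) * exp (- (pi * \<bar>of_int k\<bar> * (s1 + s2)))" for k
  proof -
    have "norm (fc w k) \<le> B1 * exp (- (2 * pi * \<bar>of_int k\<bar> * s1))"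
      using perhol_mono[OF w s(2)] B1 s by (intro fc_norm_le_closure) auto
    moreover have "norm (fc w k) \<le> B2 * exp (- (2 * pi * \<bar>of_int k\<bar> * s2))"
      using w B2 s by (intro fc_norm_le_closure) auto
    ultimately have "norm (fc w k) * norm (fc w k)
        \<le> (B1 * exp (- (2 * pi * \<bar>of_int k\<bar> * s1))) * (B2 * exp (- (2 * pi * \<bar>of_int k\<bar> * s2)))"
      using B0 by (intro mult_mono) auto
    also have "\<dots> = (B1 * B2) * (exp (- (2 * pi * \<bar>of_int k\<bar> * s1)) * exp (- (2 * pi * \<bar>of_int k\<bar> * s2)))"
      by simp
    also have "exp (- (2 * pi * \<bar>of_int k\<bar> * s1)) * exp (- (2 * pi * \<bar>of_int k\<bar> * s2))
        = (exp (- (pi * \<bar>of_int k\<bar> * (s1 + s2))))\<^sup>2"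
      by (simp add: exp_add [symmetric] exp_double [symmetric] algebra_simps)
    finally have "(norm (fc w k))\<^sup>2 \<le> (B1 * B2) * (exp (- (pi * \<bar>of_int k\<bar> * (s1 + s2))))\<^sup>2"
      by (simp add: power2_eq_square)
    then have "norm (fc w k) \<le> sqrt ((B1 * B2) * (exp (- (pi * \<bar>of_int k\<bar> * (s1 + s2))))\<^sup>2)"
      by (rule real_le_rsqrt)
    then show ?thesis by (simp add: real_sqrt_mult)
  qed
  have part: "norm (\<Sum>k\<in>{- int N..int N}. fc w k * ek k z) \<le> 2 / (1 - q) * sqrt (B1 * B2)" for N
  proof -
    have trm: "norm (fc w k * ek k z) \<le> sqrt (B1 * B2) * q ^ n" if k: "k = int n \<or> k = - int n" for k n
    proof -
      have kn: "\<bar>of_int k\<bar> = real n" using k by auto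
      have "- (of_int k * Im z) \<le> \<bar>of_int k\<bar> * \<bar>Im z\<bar>"
        by (metis abs_ge_minus_self abs_mult)
      also have "\<dots> \<le> real n * m" using z kn by (simp add: mult_left_mono strip_def)
      finally have "2 * pi * (- (of_int k * Im z)) \<le> 2 * pi * (real n * m)"
        by (intro mult_left_mono) auto
      then have e: "norm (ek k z) \<le> exp (2 * pi * (real n * m))"
        by (simp add: norm_ek mult_ac)
      have "norm (fc w k) * norm (ek k z)
          \<le> (sqrt (B1 * B2) * exp (- (pi * real n * (s1 + s2)))) * exp (2 * pi * (real n * m))"
        using fcb[of k] e B0 unfolding kn by (intro mult_mono) auto
      also have "\<dots> = sqrt (B1 * B2) * q ^ n"
        by (simp add: q_def mult.assoc exp_add [symmetric] exp_of_nat_mult [symmetric] algebra_simps)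
      finally show ?thesis by (simp add: norm_mult)
    qed
    have "norm (\<Sum>k\<in>{- int N..int N}. fc w k * ek k z)
        \<le> norm (fc w 0 * ek 0 z) + (\<Sum>k\<in>{1..N}. norm (fc w (int k) * ek (int k) z) + norm (fc w (- int k) * ek (- int k) z))"
      unfolding sum_symmetric
      by (intro order_trans[OF norm_triangle_ineq] add_mono order_refl sum_norm_le norm_triangle_ineq)
    also have "\<dots> \<le> sqrt (B1 * B2) * q ^ 0 + (\<Sum>k\<in>{1..N}. sqrt (B1 * B2) * q ^ k + sqrt (B1 * B2) * q ^ k)"
      by (intro add_mono sum_mono trm) auto
    also have "\<dots> \<le> 2 * sqrt (B1 * B2) * (q ^ 0 + (\<Sum>k\<in>{1..N}. q ^ k))"
      using B0 by (simp add: sum_distrib_left algebra_simps)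
    also have "q ^ 0 + (\<Sum>k\<in>{1..N}. q ^ k) = (\<Sum>k\<le>N. q ^ k)"
      by (simp add: sum.atMost_shift atMost_atLeast0 sum.atLeast_Suc_atMost)
    also have "2 * sqrt (B1 * B2) * (\<Sum>k\<le>N. q ^ k) \<le> 2 * sqrt (B1 * B2) * (1 / (1 - q))"
    proof -
      have "(\<Sum>k\<le>N. q ^ k) = (1 - q ^ Suc N) / (1 - q)"
        using sum_gp_basic[of q N] q by (simp add: field_simps)
      also have "\<dots> \<le> 1 / (1 - q)"
        using q by (intro divide_right_mono) auto
      finally show ?thesis using B0 by (intro mult_left_mono) auto
    qed
    finally show ?thesis by simp
  qed
  have "(\<lambda>N. norm (\<Sum>k\<in>{- int N..int N}. fc w k * ek k z)) \<longlonglongrightarrow> norm (w z)"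
    by (intro tendsto_norm fourier_sums[OF w zs])
  then show ?thesis
    unfolding q_def [symmetric] by (rule LIMSEQ_le_const2) (use part in blast)
qed

section \<open>The linearized equation and the Newton step\<close>

lemma Cauchy_strip:
  assumes g: "g holomorphic_on strip s" and B: "\<And>z. z \<in> strip s \<Longrightarrow> norm (g z) \<le> B"
    and d: "0 < d" and z: "z \<in> strip (s - d)"
  shows "norm (deriv g z) \<le> B / d"
proof -
  have sub: "cball z d \<subseteq> strip s"
  proof
    fix w assume "w \<in> cball z d"
    then have "\<bar>Im (w - z)\<bar> \<le> d"
      using abs_Im_le_cmod[of "w - z"] by (simp add: dist_norm norm_minus_commute)
    then show "w \<in> strip s" using z by (auto simp: strip_def)
  qed
  have "norm ((deriv ^^ 1) g z) \<le> fact 1 * B / d ^ 1"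
  proof (rule Cauchy_inequality)
    show "g holomorphic_on ball z d" "continuous_on (cball z d) g"
      using g sub ball_subset_cball holomorphic_on_subset holomorphic_on_imp_continuous_on by blast+
    show "norm (g x) \<le> B" if "norm (z - x) = d" for x
      using that sub by (intro B) (auto simp: dist_norm)
  qed (use d in auto)
  then show ?thesis by simp
qed

lemma has_vector_derivative_real:
  fixes g :: "real \<Rightarrow> complex"
  assumes g: "(g has_vector_derivative D) (at x)" and X: "open X" "x \<in> X" "\<And>y. y \<in> X \<Longrightarrow> g y \<in> \<real>"
  shows "D \<in> \<real>"
proof -
  have "((\<lambda>y. Im (g y)) has_vector_derivative Im D) (at x)"
    using bounded_linear.has_vector_derivative[OF bounded_linear_Im g] .
  then have "((\<lambda>y. 0) has_vector_derivative Im D) (at x)"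
    by (rule has_vector_derivative_transform_within_open[OF _ X(1,2)])
       (use X(3) in \<open>auto simp: complex_is_Real_iff\<close>)
  then have "Im D = 0"
    using vector_derivative_unique_at has_vector_derivative_const by metis
  then show ?thesis by (simp add: complex_is_Real_iff)
qed

lemma deriv_real:
  assumes "g holomorphic_on strip s" "0 < s" "\<And>x::real. g (of_real x) \<in> \<real>"
  shows "deriv g (of_real x) \<in> \<real>"
proof (rule has_vector_derivative_real[where X = UNIV])
  have "(g has_field_derivative deriv g (of_real x)) (at (of_real x))"
    using assms by (intro holomorphic_derivI[OF _ open_strip]) auto
  then show "((\<lambda>y::real. g (of_real y)) has_vector_derivative deriv g (of_real x)) (at x)"
    by (intro has_vector_derivative_real_field)
qed (use assms in auto)

lemma vector_derivative_bound_segment: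
  fixes g :: "real \<Rightarrow> 'a::real_normed_vector"
  assumes "\<And>x. x \<in> closed_segment a b \<Longrightarrow> (g has_vector_derivative g' x) (at x)"
    and "\<And>x. x \<in> closed_segment a b \<Longrightarrow> norm (g' x) \<le> B"
  shows "norm (g b - g a) \<le> B * \<bar>b - a\<bar>"
proof -
  have "norm (g b - g a) \<le> B * norm (b - a)"
  proof (rule differentiable_bound[of "closed_segment a b"])
    show "(g has_derivative (\<lambda>h. h *\<^sub>R g' x)) (at x within closed_segment a b)" if "x \<in> closed_segment a b" for x
      using assms(1)[OF that] by (simp add: has_vector_derivative_def has_derivative_at_withinI)
    show "onorm (\<lambda>h. h *\<^sub>R g' x) \<le> B" if "x \<in> closed_segment a b" for x
    proof (rule onorm_le)
      fix h :: real
      show "norm (h *\<^sub>R g' x) \<le> B * norm h"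
        using mult_right_mono[OF assms(2)[OF that], of "\<bar>h\<bar>"] by (simp add: mult.commute)
    qed
  qed auto
  then show ?thesis by simp
qed

lemma field_derivative_bound_segment:
  fixes g :: "complex \<Rightarrow> complex"
  assumes "\<And>x. x \<in> closed_segment a b \<Longrightarrow> (g has_field_derivative g' x) (at x)"
    and "\<And>x. x \<in> closed_segment a b \<Longrightarrow> norm (g' x) \<le> B"
  shows "norm (g b - g a) \<le> B * norm (b - a)"
  using assms by (intro field_differentiable_bound[of "closed_segment a b"])
    (auto intro: has_field_derivative_at_within)

lemma closed_segment_strip: "z \<in> strip s \<Longrightarrow> w \<in> strip s \<Longrightarrow> closed_segment z w \<subseteq> strip s"
  by (rule closed_segment_subset[OF _ _ convex_strip])

lemma norm_diff_le_segment:
  fixes a b x :: "'a::euclidean_space"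
  shows "x \<in> closed_segment a b \<Longrightarrow> norm (x - a) \<le> norm (b - a)"
  using dist_in_closed_segment(1)[of x a b] by (simp add: dist_norm norm_minus_commute)

text \<open>\<open>G\<close> and \<open>G2\<close> are the first and second parameter derivatives;
  as parameters of the locale they keep \<open>vector_derivative\<close> out of the estimates. A
  single \<open>S\<close> serves as every bound, and \<open>1 / S\<close> will serve as every
  distance, so that all results can be reused with \<open>2 * S\<close>.\<close>

locale kam_family =
  fixes A :: "real set" and P S :: real and f G G2 :: "real \<Rightarrow> complex \<Rightarrow> complex"
  assumes open_A: "open A" and S_ge_1: "1 \<le> S" and P_pos: "0 < P"
    and hol: "\<And>a. a \<in> A \<Longrightarrow> f a holomorphic_on strip P"
    and per: "\<And>a z. a \<in> A \<Longrightarrow> z \<in> strip P \<Longrightarrow> f a (z + 1) = f a z + 1"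
    and real: "\<And>a x. a \<in> A \<Longrightarrow> f a (of_real x) \<in> \<real>"
    and dG: "\<And>a z. a \<in> A \<Longrightarrow> z \<in> strip P \<Longrightarrow> ((\<lambda>a'. f a' z) has_vector_derivative G a z) (at a)"
    and dG2: "\<And>a z. a \<in> A \<Longrightarrow> z \<in> strip P \<Longrightarrow> ((\<lambda>a'. G a' z) has_vector_derivative G2 a z) (at a)"
    and bz: "\<And>a z. a \<in> A \<Longrightarrow> z \<in> strip P \<Longrightarrow> norm (deriv (f a) z) \<le> S"
    and bzz: "\<And>a z. a \<in> A \<Longrightarrow> z \<in> strip P \<Longrightarrow> norm (deriv (deriv (f a)) z) \<le> S"
    and bG: "\<And>a z. a \<in> A \<Longrightarrow> z \<in> strip P \<Longrightarrow> norm (G a z) \<le> S"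
    and bG2: "\<And>a z. a \<in> A \<Longrightarrow> z \<in> strip P \<Longrightarrow> norm (G2 a z) \<le> S"
    and bGz: "\<And>a z. a \<in> A \<Longrightarrow> z \<in> strip P \<Longrightarrow> norm (deriv (G a) z) \<le> S"
begin

lemma mono_S: "S \<le> T \<Longrightarrow> kam_family A P T f G G2"
  using S_ge_1 open_A P_pos hol per real dG dG2
  by (intro kam_family.intro) (auto intro: order_trans[OF bz] order_trans[OF bzz] order_trans[OF bG]
    order_trans[OF bG2] order_trans[OF bGz])

lemma f_deriv: "a \<in> A \<Longrightarrow> z \<in> strip P \<Longrightarrow> (f a has_field_derivative deriv (f a) z) (at z)"
  by (rule holomorphic_derivI[OF hol open_strip])

lemma f_deriv2: "a \<in> A \<Longrightarrow> z \<in> strip P \<Longrightarrow> (deriv (f a) has_field_derivative deriv (deriv (f a)) z) (at z)"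
  by (rule holomorphic_derivI[OF holomorphic_deriv[OF hol open_strip] open_strip])

lemma f_lip_a:
  assumes "closed_segment a b \<subseteq> A" "z \<in> strip P"
  shows "norm (f b z - f a z) \<le> S * \<bar>b - a\<bar>"
  using assms by (intro vector_derivative_bound_segment[where g' = "\<lambda>a. G a z"]) (auto intro: dG bG)

lemma G_lip_a:
  assumes "closed_segment a b \<subseteq> A" "z \<in> strip P"
  shows "norm (G b z - G a z) \<le> S * \<bar>b - a\<bar>"
  using assms by (intro vector_derivative_bound_segment[where g' = "\<lambda>a. G2 a z"]) (auto intro: dG2 bG2)

lemma f_lip_z:
  assumes "a \<in> A" "z \<in> strip P" "w \<in> strip P"
  shows "norm (f a w - f a z) \<le> S * norm (w - z)"
  using closed_segment_strip[OF assms(2,3)] assms(1)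
  by (intro field_derivative_bound_segment[where g' = "deriv (f a)"]) (auto intro: f_deriv bz)

lemma fz_lip_z:
  assumes "a \<in> A" "z \<in> strip P" "w \<in> strip P"
  shows "norm (deriv (f a) w - deriv (f a) z) \<le> S * norm (w - z)"
  using closed_segment_strip[OF assms(2,3)] assms(1)
  by (intro field_derivative_bound_segment[where g' = "deriv (deriv (f a))"]) (auto intro: f_deriv2 bzz)

lemma f_taylor_z:
  assumes "a \<in> A" "z \<in> strip P" "w \<in> strip P"
  shows "norm (f a w - f a z - deriv (f a) z * (w - z)) \<le> S * (norm (w - z))\<^sup>2"
proof -
  have sub: "closed_segment z w \<subseteq> strip P" using closed_segment_strip[OF assms(2,3)] .
  have "norm ((f a w - deriv (f a) z * w) - (f a z - deriv (f a) z * z)) \<le> (S * norm (w - z)) * norm (w - z)"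
  proof (rule field_derivative_bound_segment[where g' = "\<lambda>x. deriv (f a) x - deriv (f a) z"])
    fix x assume x: "x \<in> closed_segment z w"
    then have xs: "x \<in> strip P" using sub by auto
    show "((\<lambda>x. f a x - deriv (f a) z * x) has_field_derivative deriv (f a) x - deriv (f a) z) (at x)"
      using f_deriv[OF assms(1) xs] by (auto intro!: derivative_eq_intros)
    have "norm (deriv (f a) x - deriv (f a) z) \<le> S * norm (x - z)"
      by (rule fz_lip_z[OF assms(1,2) xs])
    also have "\<dots> \<le> S * norm (w - z)"
      using norm_diff_le_segment[OF x] S_ge_1 by (intro mult_left_mono) auto
    finally show "norm (deriv (f a) x - deriv (f a) z) \<le> S * norm (w - z)" .
  qed
  then show ?thesis by (simp add: power2_eq_square algebra_simps)
qed

lemma f_taylor_a: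
  assumes "closed_segment a b \<subseteq> A" "z \<in> strip P"
  shows "norm (f b z - f a z - of_real (b - a) * G a z) \<le> S * (b - a)\<^sup>2"
proof -
  have "norm ((f b z - of_real b * G a z) - (f a z - of_real a * G a z)) \<le> (S * \<bar>b - a\<bar>) * \<bar>b - a\<bar>"
  proof (rule vector_derivative_bound_segment[where g' = "\<lambda>x. G x z - G a z"])
    fix x assume x: "x \<in> closed_segment a b"
    then have xA: "x \<in> A" using assms by auto
    show "((\<lambda>x. f x z - of_real x * G a z) has_vector_derivative G x z - G a z) (at x)"
      using dG[OF xA assms(2)]
      by (auto intro!: derivative_eq_intros has_vector_derivative_diff has_vector_derivative_mult_left
          simp: scaleR_conv_of_real [symmetric])
    have "closed_segment a x \<subseteq> A"
      using x assms(1) subset_closed_segment[of a x a b] by auto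
    then have "norm (G x z - G a z) \<le> S * \<bar>x - a\<bar>"
      by (rule G_lip_a[OF _ assms(2)])
    also have "\<dots> \<le> S * \<bar>b - a\<bar>"
      using norm_diff_le_segment[OF x] S_ge_1 by (intro mult_left_mono) auto
    finally show "norm (G x z - G a z) \<le> S * \<bar>b - a\<bar>" .
  qed
  then show ?thesis by (simp add: power2_eq_square algebra_simps)
qed

text \<open>The assumptions give differentiability in the parameter for each point separately. The
  bound on \<open>G2\<close> makes the difference quotients converge uniformly, at the rate
  \<open>S * t\<close>, and a uniform limit of holomorphic functions is holomorphic.\<close>

lemma G_hol:
  assumes a: "a \<in> A"
  shows "G a holomorphic_on strip P"
proof -
  obtain e where e: "0 < e" "cball a e \<subseteq> A"
    using open_A a open_contains_cball by blast
  define t where "t n = e / real (Suc n)" for n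
  have t: "0 < t n" "t n \<le> e" for n
    using e by (auto simp: t_def field_simps)
  have seg: "closed_segment a (a + t n) \<subseteq> A" for n
  proof -
    have "closed_segment a (a + t n) \<subseteq> cball a e"
      using t[of n] e by (auto simp: closed_segment_eq_real_ivl dist_real_def)
    then show ?thesis using e by blast
  qed
  define q where "q n z = (f (a + t n) z - f a z) / of_real (t n)" for n z
  have err: "norm (q n z - G a z) \<le> S * t n" if "z \<in> strip P" for n z
  proof -
    have "norm (f (a + t n) z - f a z - of_real (t n) * G a z) \<le> S * (t n)\<^sup>2"
      using f_taylor_a[OF seg[of n] that] by simp
    moreover have "q n z - G a z = (f (a + t n) z - f a z - of_real (t n) * G a z) / of_real (t n)"
      using t(1)[of n] by (simp add: q_def field_simps)
    ultimately show ?thesis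
      using t(1)[of n] by (simp add: norm_divide power2_eq_square pos_divide_le_eq mult.assoc)
  qed
  have t0: "(\<lambda>n. S * t n) \<longlonglongrightarrow> 0"
  proof -
    have "(\<lambda>n. S * (e * (1 / real (Suc n)))) \<longlonglongrightarrow> S * (e * 0)"
      by (intro tendsto_intros LIMSEQ_Suc[OF lim_1_over_n])
    then show ?thesis by (simp add: t_def)
  qed
  show ?thesis
  proof (rule holomorphic_uniform_sequence[OF open_strip])
    show "q n holomorphic_on strip P" for n
    proof -
      have "a + t n \<in> A" using seg[of n] by auto
      then show ?thesis unfolding q_def using hol a t(1)[of n]
        by (intro holomorphic_intros) auto
    qed
    fix x assume "x \<in> strip P"
    then obtain d where d: "0 < d" "cball x d \<subseteq> strip P"
      using open_strip open_contains_cball by blast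
    have "uniform_limit (cball x d) q (G a) sequentially"
    proof (rule uniform_limitI)
      fix r :: real assume "0 < r"
      then have "\<forall>\<^sub>F n in sequentially. S * t n < r"
        using order_tendstoD(2)[OF t0] by simp
      then show "\<forall>\<^sub>F n in sequentially. \<forall>z\<in>cball x d. dist (q n z) (G a z) < r"
      proof eventually_elim
        case (elim n)
        have "norm (q n z - G a z) < r" if "z \<in> cball x d" for z
          using err[of z n] that d elim by (meson le_less_trans subsetD)
        then show ?case by (simp add: dist_norm)
      qed
    qed
    with d show "\<exists>d>0. cball x d \<subseteq> strip P \<and> uniform_limit (cball x d) q (G a) sequentially"
      by blast
  qed
qed

lemma G_per:
  assumes a: "a \<in> A" and z: "z \<in> strip P"
  shows "G a (z + 1) = G a z"
proof -
  have "((\<lambda>a'. f a' (z + 1)) has_vector_derivative G a (z + 1)) (at a)"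
    using z by (intro dG[OF a]) auto
  then have "((\<lambda>a'. f a' z + 1) has_vector_derivative G a (z + 1)) (at a)"
    by (rule has_vector_derivative_transform_within_open[OF _ open_A a]) (use per z in auto)
  moreover have "((\<lambda>a'. f a' z + 1) has_vector_derivative G a z + 0) (at a)"
    using dG[OF a z] by (intro has_vector_derivative_add has_vector_derivative_const)
  ultimately show ?thesis
    using vector_derivative_unique_at by fastforce
qed

lemma G_real: "a \<in> A \<Longrightarrow> G a (of_real x) \<in> \<real>"
  using has_vector_derivative_real[OF dG open_A] real P_pos by auto

lemma G_lip_z:
  assumes "a \<in> A" "z \<in> strip P" "w \<in> strip P"
  shows "norm (G a w - G a z) \<le> S * norm (w - z)"
  using closed_segment_strip[OF assms(2,3)] assms(1)
  by (intro field_derivative_bound_segment[where g' = "deriv (G a)"])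
     (auto intro: bGz holomorphic_derivI[OF G_hol open_strip])

text \<open>Cauchy's estimate with loss \<open>1 / S\<close>, applied to \<open>f b - f a\<close>,
  which is at most \<open>S * \<bar>b - a\<bar>\<close>. Hence the square of \<open>S\<close> and
  the smaller strip.\<close>

lemma fz_lip_a:
  assumes seg: "closed_segment a b \<subseteq> A" and z: "z \<in> strip (P - 1 / S)"
  shows "norm (deriv (f b) z - deriv (f a) z) \<le> S\<^sup>2 * \<bar>b - a\<bar>"
proof -
  have ab: "a \<in> A" "b \<in> A" using seg by auto
  have zP: "z \<in> strip P" using z S_ge_1 strip_mono[of "P - 1 / S" P] by auto
  have "norm (deriv (\<lambda>w. f b w - f a w) z) \<le> (S * \<bar>b - a\<bar>) / (1 / S)"
  proof (rule Cauchy_strip)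
    show "(\<lambda>w. f b w - f a w) holomorphic_on strip P"
      using hol ab by (intro holomorphic_intros) auto
  qed (use f_lip_a[OF seg] S_ge_1 z in auto)
  moreover have "deriv (\<lambda>w. f b w - f a w) z = deriv (f b) z - deriv (f a) z"
    using f_deriv ab zP by (intro deriv_diff) (auto simp: field_differentiable_def)
  ultimately show ?thesis by (simp add: power2_eq_square mult_ac)
qed

text \<open>The increment is split into the expansion in the argument at the parameter
  \<open>b\<close>, the change of the slope from \<open>b\<close> to \<open>a\<close>, and the
  expansion in the parameter at the argument \<open>z\<close>. Each remainder is of second order in
  the two displacements.\<close>

lemma taylor2:
  assumes seg: "closed_segment a b \<subseteq> A" and z: "z \<in> strip (P - 1 / S)" and w: "w \<in> strip P"
  shows "norm (f b w - f a z - deriv (f a) z * (w - z) - of_real (b - a) * G a z)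
    \<le> S\<^sup>2 * (norm (w - z) + \<bar>b - a\<bar>)\<^sup>2"
proof -
  have ab: "a \<in> A" "b \<in> A" using seg by auto
  have zP: "z \<in> strip P" using z S_ge_1 strip_mono[of "P - 1 / S" P] by auto
  let ?x = "norm (w - z)" and ?y = "\<bar>b - a\<bar>"
  have SS: "S \<le> S\<^sup>2" using S_ge_1 by (simp add: power2_eq_square)
  have "norm (f b w - f b z - deriv (f b) z * (w - z)) \<le> S * ?x\<^sup>2"
    by (rule f_taylor_z[OF ab(2) zP w])
  moreover have "norm ((deriv (f b) z - deriv (f a) z) * (w - z)) \<le> (S\<^sup>2 * ?y) * ?x"
    unfolding norm_mult using fz_lip_a[OF seg z] by (intro mult_right_mono) auto
  moreover have "norm (f b z - f a z - of_real (b - a) * G a z) \<le> S * ?y\<^sup>2"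
    using f_taylor_a[OF seg zP] by simp
  ultimately have "norm ((f b w - f b z - deriv (f b) z * (w - z)) + (deriv (f b) z - deriv (f a) z) * (w - z)
      + (f b z - f a z - of_real (b - a) * G a z)) \<le> S * ?x\<^sup>2 + (S\<^sup>2 * ?y) * ?x + S * ?y\<^sup>2"
    by (intro order_trans[OF norm_triangle_ineq] add_mono)
  also have "\<dots> \<le> S\<^sup>2 * ?x\<^sup>2 + (S\<^sup>2 * ?y) * ?x + S\<^sup>2 * ?y\<^sup>2"
    using SS by (intro add_mono mult_right_mono) auto
  also have "\<dots> \<le> S\<^sup>2 * (?x + ?y)\<^sup>2"
  proof -
    have "?x\<^sup>2 + ?y * ?x + ?y\<^sup>2 \<le> (?x + ?y)\<^sup>2" by (simp add: power2_sum)
    from mult_left_mono[OF this, of "S\<^sup>2"] show ?thesis by (simp add: algebra_simps)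
  qed
  finally show ?thesis by (simp add: algebra_simps)
qed

text \<open>A second difference is a product of two displacements: applying the same increment
  \<open>(v, u)\<close> at two base points \<open>(a, z)\<close> and \<open>(b, w)\<close>, one
  factor comes from the increment and one from the distance of the base points.\<close>

lemma second_difference:
  assumes A: "\<And>x. x \<in> closed_segment 0 v \<Longrightarrow> closed_segment (a + x) (b + x) \<subseteq> A"
    and z: "z \<in> strip (P - 1 / S)" "z + u \<in> strip (P - 1 / S)"
    and w: "w \<in> strip (P - 1 / S)" "w + u \<in> strip (P - 1 / S)"
  shows "norm ((f (b + v) (w + u) - f b w) - (f (a + v) (z + u) - f a z))
    \<le> S\<^sup>2 * (\<bar>v\<bar> + norm u) * (\<bar>b - a\<bar> + norm (w - z))"
proof -
  have sP: "x \<in> strip P" if "x \<in> strip (P - 1 / S)" for x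
    using that S_ge_1 strip_mono[of "P - 1 / S" P] by auto
  have SS: "S \<le> S\<^sup>2" using S_ge_1 by (simp add: power2_eq_square)
  have inA: "a + x \<in> A" "b + x \<in> A" if "x \<in> closed_segment 0 v" for x
    using A[OF that] by auto
  have ab: "a \<in> A" "b \<in> A" using inA[of 0] by auto
  \<comment> \<open>First the increment \<open>v\<close> is removed with the arguments kept at
    \<open>w + u\<close> and \<open>z + u\<close>, then \<open>u\<close> at the fixed parameters
    \<open>b\<close> and \<open>a\<close>. Each time one factor comes from the mean value theorem,
    the other from the Lipschitz bounds of the derivative.\<close>
  have "norm ((f (b + v) (w + u) - f (a + v) (z + u)) - (f (b + 0) (w + u) - f (a + 0) (z + u)))
      \<le> (S * (\<bar>b - a\<bar> + norm (w - z))) * \<bar>v - 0\<bar>"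
  proof (rule vector_derivative_bound_segment[where g' = "\<lambda>x. G (b + x) (w + u) - G (a + x) (z + u)"])
    fix x assume x: "x \<in> closed_segment 0 v"
    have sh: "((\<lambda>x. f (c + x) y) has_vector_derivative G (c + x) y) (at x)"
      if "c + x \<in> A" "y \<in> strip P" for c y
    proof -
      have "((\<lambda>x. c + x) has_vector_derivative 1) (at x)"
        by (auto intro!: derivative_eq_intros simp: has_vector_derivative_def)
      from vector_diff_chain_at[OF this, of "\<lambda>a. f a y" "G (c + x) y"] dG[OF that]
      show ?thesis by (simp add: o_def)
    qed
    show "((\<lambda>x. f (b + x) (w + u) - f (a + x) (z + u)) has_vector_derivative
        G (b + x) (w + u) - G (a + x) (z + u)) (at x)"
      using inA[OF x] z w sP by (intro has_vector_derivative_diff sh) auto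
    have "norm (G (b + x) (w + u) - G (a + x) (z + u))
        \<le> norm (G (b + x) (w + u) - G (a + x) (w + u)) + norm (G (a + x) (w + u) - G (a + x) (z + u))"
      by norm
    also have "\<dots> \<le> S * \<bar>(b + x) - (a + x)\<bar> + S * norm ((w + u) - (z + u))"
      using A[OF x] inA[OF x] z w sP by (intro add_mono G_lip_a G_lip_z) auto
    finally show "norm (G (b + x) (w + u) - G (a + x) (z + u)) \<le> S * (\<bar>b - a\<bar> + norm (w - z))"
      by (simp add: algebra_simps)
  qed
  then have 1: "norm ((f (b + v) (w + u) - f (a + v) (z + u)) - (f b (w + u) - f a (z + u)))
      \<le> (S * (\<bar>b - a\<bar> + norm (w - z))) * \<bar>v\<bar>"
    by simp
  have "norm ((f b (w + u) - f a (z + u)) - (f b (w + 0) - f a (z + 0)))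
      \<le> (S\<^sup>2 * (\<bar>b - a\<bar> + norm (w - z))) * norm (u - 0)"
  proof (rule field_derivative_bound_segment[where g' = "\<lambda>x. deriv (f b) (w + x) - deriv (f a) (z + x)"])
    fix x assume x: "x \<in> closed_segment 0 u"
    then obtain t where t: "x = of_real t * u" "0 \<le> t" "t \<le> 1"
      by (auto simp: in_segment scaleR_conv_of_real)
    have inS: "y + x \<in> strip (P - 1 / S)" if y: "y \<in> strip (P - 1 / S)" "y + u \<in> strip (P - 1 / S)" for y
    proof -
      have "y + x = (1 - t) *\<^sub>R y + t *\<^sub>R (y + u)"
        using t by (simp add: algebra_simps scaleR_conv_of_real)
      then show ?thesis using convex_strip[of "P - 1 / S"] y t unfolding convex_alt by metis
    qed
    have zx: "z + x \<in> strip (P - 1 / S)" and wx: "w + x \<in> strip (P - 1 / S)"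
      using inS z w by auto
    have sh: "((\<lambda>x. f c (y + x)) has_field_derivative deriv (f c) (y + x)) (at x)"
      if "c \<in> A" "y + x \<in> strip P" for c y
      using f_deriv[OF that] DERIV_shift[of "f c" "deriv (f c) (y + x)" x y] by (simp add: add.commute)
    show "((\<lambda>x. f b (w + x) - f a (z + x)) has_field_derivative deriv (f b) (w + x) - deriv (f a) (z + x)) (at x)"
      using zx wx sP ab by (intro DERIV_diff sh) auto
    have "norm (deriv (f b) (w + x) - deriv (f a) (z + x))
        \<le> norm (deriv (f b) (w + x) - deriv (f a) (w + x)) + norm (deriv (f a) (w + x) - deriv (f a) (z + x))"
      by norm
    also have "\<dots> \<le> S\<^sup>2 * \<bar>b - a\<bar> + S * norm ((w + x) - (z + x))"
      using A[of 0] ab zx wx sP by (intro add_mono fz_lip_a fz_lip_z) auto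
    also have "\<dots> \<le> S\<^sup>2 * \<bar>b - a\<bar> + S\<^sup>2 * norm (w - z)"
      using SS by (simp add: mult_right_mono)
    finally show "norm (deriv (f b) (w + x) - deriv (f a) (z + x)) \<le> S\<^sup>2 * (\<bar>b - a\<bar> + norm (w - z))"
      by (simp add: algebra_simps)
  qed
  then have 2: "norm ((f b (w + u) - f a (z + u)) - (f b w - f a z)) \<le> (S\<^sup>2 * (\<bar>b - a\<bar> + norm (w - z))) * norm u"
    by simp
  have e: "(f (b + v) (w + u) - f b w) - (f (a + v) (z + u) - f a z)
    = ((f (b + v) (w + u) - f (a + v) (z + u)) - (f b (w + u) - f a (z + u)))
      + ((f b (w + u) - f a (z + u)) - (f b w - f a z))"
    by simp
  have "norm ((f (b + v) (w + u) - f b w) - (f (a + v) (z + u) - f a z))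
    \<le> (S * (\<bar>b - a\<bar> + norm (w - z))) * \<bar>v\<bar> + (S\<^sup>2 * (\<bar>b - a\<bar> + norm (w - z))) * norm u"
    unfolding e by (rule norm_triangle_mono[OF 1 2])
  also have "\<dots> \<le> (S\<^sup>2 * (\<bar>b - a\<bar> + norm (w - z))) * \<bar>v\<bar> + (S\<^sup>2 * (\<bar>b - a\<bar> + norm (w - z))) * norm u"
    using SS by (intro add_right_mono mult_right_mono) auto
  finally show ?thesis by (simp add: algebra_simps)
qed

end

text \<open>Here \<open>p\<close> plays the derivative of a conjugacy and \<open>c\<close> the
  coefficient of the parameter. With \<open>w = p * \<zeta>\<close>, division by the shifted
  \<open>p\<close> leaves a cohomological equation for \<open>\<zeta>\<close>; its right side must
  have average zero, which determines \<open>v\<close>.\<close>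

lemma linear_estimate:
  assumes dio: "\<theta> \<in> Diophantine \<gamma> \<tau>" and pos: "0 < \<gamma>" "0 \<le> \<tau>"
    and p: "perhol s p" "average p = 1" and p0: "\<And>z. z \<in> strip s \<Longrightarrow> p z \<noteq> 0"
    and p1: "\<And>z. z \<in> strip s \<Longrightarrow> norm (p z) \<le> s1" and p2: "\<And>z. z \<in> strip s \<Longrightarrow> norm (1 / p z) \<le> s2"
    and c: "perhol s c" "\<And>z. z \<in> strip s \<Longrightarrow> norm (c z) \<le> ca"
    and b: "average (\<lambda>z. c z / p (z + of_real \<theta>)) \<noteq> 0"
      "norm (1 / average (\<lambda>z. c z / p (z + of_real \<theta>))) \<le> sb"
    and w: "perhol s w" "average w = 0"
    and eq: "\<And>z. z \<in> strip s \<Longrightarrow> p (z + of_real \<theta>) * (w z / p z) - w (z + of_real \<theta>) + c z * v + g z = 0"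
    and B: "\<And>z. z \<in> strip s \<Longrightarrow> norm (g z) \<le> B"
    and d: "0 < d" "d < s"
  shows "norm v \<le> sb * s2 * B"
    and "z \<in> strip (s - d) \<Longrightarrow> norm (w z) \<le> s1 * (1 + s1) * KR \<tau> * (1 + ca * sb * s2) * s2 * B / (\<gamma> * d powr \<tau>)"
proof -
  have s: "0 < s" using d by simp
  let ?sh = "\<lambda>z. z + complex_of_real \<theta>"
  have nn: "0 \<le> s1" "0 \<le> s2" "0 \<le> ca" "0 \<le> sb" "0 \<le> B"
    using order_trans[OF norm_ge_zero p1[of 0]] order_trans[OF norm_ge_zero p2[of 0]]
      order_trans[OF norm_ge_zero c(2)[of 0]] order_trans[OF norm_ge_zero b(2)]
      order_trans[OF norm_ge_zero B[of 0]] s by (auto simp: strip_def)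
  have psh: "perhol s (\<lambda>z. p (?sh z))" by (rule perhol_shift[OF p(1)])
  have psh0: "p (?sh z) \<noteq> 0" if "z \<in> strip s" for z using p0 that by simp
  have ps2: "norm (x / p (?sh z)) \<le> norm x * s2" if "z \<in> strip s" for x z
    using mult_left_mono[OF p2[of "?sh z"], of "norm x"] that by (simp add: norm_divide)
  define \<zeta> where "\<zeta> z = w z / p z" for z
  have \<zeta>: "perhol s \<zeta>" unfolding \<zeta>_def using w p p0 by (intro perhol_divide)
  have g: "perhol s g"
  proof (rule perhol_cong)
    have "perhol s (\<lambda>z. w z / p z)" using w(1) p(1) p0 by (rule perhol_divide)
    then show "perhol s (\<lambda>z. w (?sh z) - p (?sh z) * (w z / p z) - c z * v)"
      by (rule perhol_diff[OF perhol_diff[OF perhol_shift[OF w(1)] perhol_mult[OF psh]] perhol_mult[OF c(1) perhol_const]])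
    show "w (?sh z) - p (?sh z) * (w z / p z) - c z * v = g z" if "z \<in> strip s" for z
      using eq[OF that] by algebra
  qed
  define \<eta> where "\<eta> z = v * (c z / p (?sh z)) + g z / p (?sh z)" for z
  have gp: "perhol s (\<lambda>z. g z / p (?sh z))" using g psh psh0 by (rule perhol_divide)
  have bp: "perhol s (\<lambda>z. c z / p (?sh z))" using c(1) psh psh0 by (rule perhol_divide)
  have coh: "\<zeta> (?sh z) - \<zeta> z = \<eta> z" if z: "z \<in> strip s" for z
  proof -
    have "w (?sh z) = p (?sh z) * \<zeta> z + c z * v + g z" using eq[OF z] by (simp add: \<zeta>_def algebra_simps)
    then show ?thesis using psh0[OF z] by (simp add: \<zeta>_def \<eta>_def field_simps)
  qed
  have con: "continuous_on {0..1} (\<lambda>x::real. q (of_real x))" if "perhol s q" for q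
    using that s by (intro continuous_on_reals) (auto simp: perhol_def)
  have "average \<eta> = average (\<lambda>z. \<zeta> (?sh z) - \<zeta> z)"
    using coh s by (intro average_cong) simp
  also have "\<dots> = average (\<lambda>z. \<zeta> (?sh z)) - average \<zeta>"
    using con[OF \<zeta>] con[OF perhol_shift[OF \<zeta>]] by (intro average_diff)
  also have "\<dots> = 0" using average_shift[OF \<zeta>, of "of_real \<theta>"] s by simp
  finally have av\<eta>: "average \<eta> = 0" .
  have "average \<eta> = average (\<lambda>z. v * (c z / p (?sh z))) + average (\<lambda>z. g z / p (?sh z))"
    unfolding \<eta>_def by (intro average_add continuous_on_mult_left con[OF bp] con[OF gp])
  then have "v * average (\<lambda>z. c z / p (?sh z)) = - average (\<lambda>z. g z / p (?sh z))"
    using av\<eta> by (simp only: average_cmult) (simp add: eq_neg_iff_add_eq_0)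
  then have v: "v = - average (\<lambda>z. g z / p (?sh z)) * (1 / average (\<lambda>z. c z / p (?sh z)))"
    using b(1) by (simp add: field_simps)
  have "norm (average (\<lambda>z. g z / p (?sh z))) \<le> B * s2"
  proof (rule average_norm_le[OF con[OF gp]])
    fix x :: real
    show "norm (g (of_real x) / p (?sh (of_real x))) \<le> B * s2"
      using ps2[of "of_real x" "g (of_real x)"] mult_right_mono[OF B[of "of_real x"], of s2] s nn by simp
  qed
  then have "norm v \<le> (B * s2) * sb"
    unfolding v norm_mult norm_minus_cancel using b(2) nn by (intro mult_mono) auto
  then show nv: "norm v \<le> sb * s2 * B" by (simp add: mult_ac)
  define H where "H = (1 + ca * sb * s2) * s2 * B"
  have \<eta>H: "norm (\<eta> z) \<le> H" if z: "z \<in> strip s" for z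
  proof -
    have "norm (\<eta> z) \<le> norm (v * c z / p (?sh z)) + norm (g z / p (?sh z))"
      unfolding \<eta>_def by (rule order_trans[OF norm_triangle_ineq]) simp
    also have "\<dots> \<le> norm (v * c z) * s2 + norm (g z) * s2"
      by (intro add_mono ps2 z)
    also have "\<dots> \<le> (sb * s2 * B * ca) * s2 + B * s2"
      unfolding norm_mult using nv c(2)[OF z] B[OF z] nn
      by (intro add_mono mult_right_mono mult_mono) auto
    finally show ?thesis by (simp add: H_def algebra_simps)
  qed
  define \<zeta>0 where "\<zeta>0 z = \<zeta> z - average \<zeta>" for z
  have \<zeta>0: "perhol s \<zeta>0" unfolding \<zeta>0_def by (intro perhol_diff \<zeta> perhol_const)
  have av0: "average \<zeta>0 = 0"
    unfolding \<zeta>0_def using con[OF \<zeta>] con[OF perhol_const] by (subst average_diff) (auto simp: average_const)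
  define R where "R = KR \<tau> * H / (\<gamma> * d powr \<tau>)"
  have \<zeta>0R: "norm (\<zeta>0 z) \<le> R" if "z \<in> strip (s - d)" for z
    unfolding R_def using coh \<eta>H d
    by (intro cohomological_estimate[OF dio pos \<zeta>0 av0 _ _ d(1) that]) (auto simp: \<zeta>0_def)
  \<comment> \<open>The normalization fixes the free constant: \<open>average w = 0\<close> and
    \<open>average p = 1\<close> force \<open>average \<zeta>\<close> to be minus the average of
    \<open>p * \<zeta>0\<close>. This is the origin of the factor \<open>1 + s1\<close>.\<close>
  have "average (\<lambda>z. p z * \<zeta>0 z) = average (\<lambda>z. w z - average \<zeta> * p z)"
    using p0 s by (intro average_cong) (simp add: \<zeta>0_def \<zeta>_def field_simps)
  also have "\<dots> = average w - average (\<lambda>z. average \<zeta> * p z)"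
    using con[OF w(1)] con[OF p(1)] by (intro average_diff continuous_intros)
  also have "\<dots> = - average \<zeta>" by (simp add: average_cmult w p)
  finally have av\<zeta>: "average \<zeta> = - average (\<lambda>z. p z * \<zeta>0 z)" by simp
  have "norm (average \<zeta>) \<le> s1 * R"
    unfolding av\<zeta> norm_minus_cancel
  proof (rule average_norm_le[OF con[OF perhol_mult[OF p(1) \<zeta>0]]])
    fix x :: real
    show "norm (p (of_real x) * \<zeta>0 (of_real x)) \<le> s1 * R"
      unfolding norm_mult using p1[of "of_real x"] \<zeta>0R[of "of_real x"] s d nn by (intro mult_mono) auto
  qed
  then have n\<zeta>: "norm (\<zeta> z) \<le> (1 + s1) * R" if "z \<in> strip (s - d)" for z
    using \<zeta>0R[OF that] norm_triangle_ineq[of "\<zeta>0 z" "average \<zeta>"] by (simp add: \<zeta>0_def algebra_simps)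
  show "norm (w z) \<le> s1 * (1 + s1) * KR \<tau> * (1 + ca * sb * s2) * s2 * B / (\<gamma> * d powr \<tau>)"
    if z: "z \<in> strip (s - d)"
  proof -
    have zs: "z \<in> strip s" using z d strip_mono[of "s - d" s] by auto
    have "norm (w z) = norm (p z) * norm (\<zeta> z)" using p0[OF zs] by (simp add: \<zeta>_def norm_divide)
    also have "\<dots> \<le> s1 * ((1 + s1) * R)" using p1[OF zs] n\<zeta>[OF z] nn by (intro mult_mono) auto
    finally show ?thesis by (simp add: R_def H_def mult_ac)
  qed
qed

lemma linear_exists:
  assumes dio: "\<theta> \<in> Diophantine \<gamma> \<tau>" and pos: "0 < \<gamma>" "0 \<le> \<tau>" and s: "0 < s"
    and p: "perhol s p" "average p = 1" and p0: "\<And>z. z \<in> strip s \<Longrightarrow> p z \<noteq> 0"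
    and pr: "\<And>x::real. p (of_real x) \<in> \<real>"
    and c: "perhol s c" "\<And>x::real. c (of_real x) \<in> \<real>"
    and b: "average (\<lambda>z. c z / p (z + of_real \<theta>)) \<noteq> 0"
    and g: "perhol s g" "\<And>x::real. g (of_real x) \<in> \<real>"
  obtains w and v :: real where "perhol s w" "average w = 0" "\<And>x::real. w (of_real x) \<in> \<real>"
    "\<And>z. z \<in> strip s \<Longrightarrow> p (z + of_real \<theta>) * (w z / p z) - w (z + of_real \<theta>) + c z * of_real v + g z = 0"
proof -
  let ?sh = "\<lambda>z. z + complex_of_real \<theta>"
  have psh: "perhol s (\<lambda>z. p (?sh z))" by (rule perhol_shift[OF p(1)])
  have psh0: "p (?sh z) \<noteq> 0" if "z \<in> strip s" for z using p0 that by simp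
  have con: "continuous_on {0..1} (\<lambda>x::real. q (of_real x))" if "perhol s q" for q
    using that s by (intro continuous_on_reals) (auto simp: perhol_def)
  have gp: "perhol s (\<lambda>z. g z / p (?sh z))" using g(1) psh psh0 by (rule perhol_divide)
  have bp: "perhol s (\<lambda>z. c z / p (?sh z))" using c(1) psh psh0 by (rule perhol_divide)
  have shr: "p (?sh (of_real x)) \<in> \<real>" for x :: real
    using pr[of "x + \<theta>"] by simp
  have "average (\<lambda>z. g z / p (?sh z)) \<in> \<real>" "average (\<lambda>z. c z / p (?sh z)) \<in> \<real>"
    using con[OF gp] con[OF bp] g(2) c(2) shr by (intro average_real; simp)+
  then have "- average (\<lambda>z. g z / p (?sh z)) / average (\<lambda>z. c z / p (?sh z)) \<in> \<real>" by simp
  then obtain v :: real where v: "of_real v = - average (\<lambda>z. g z / p (?sh z)) / average (\<lambda>z. c z / p (?sh z))"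
    by (metis Reals_cases)
  define \<eta> where "\<eta> z = of_real v * (c z / p (?sh z)) + g z / p (?sh z)" for z
  have \<eta>: "perhol s \<eta>" unfolding \<eta>_def using bp gp by (intro perhol_add perhol_mult perhol_const)
  have "average \<eta> = average (\<lambda>z. of_real v * (c z / p (?sh z))) + average (\<lambda>z. g z / p (?sh z))"
    unfolding \<eta>_def by (intro average_add continuous_on_mult_left con[OF bp] con[OF gp])
  also have "\<dots> = 0" unfolding average_cmult v using b by simp
  finally have av\<eta>: "average \<eta> = 0" .
  have \<eta>r: "\<eta> (of_real x) \<in> \<real>" for x :: real
    unfolding \<eta>_def using g(2) c(2) shr by simp
  obtain \<xi> where \<xi>: "perhol s \<xi>" "average \<xi> = 0" "\<And>x::real. \<xi> (of_real x) \<in> \<real>"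
    "\<And>z. z \<in> strip s \<Longrightarrow> \<xi> (?sh z) - \<xi> z = \<eta> z"
    by (rule cohomological_exists[OF dio pos s \<eta> av\<eta> \<eta>r]) (rule that)
  \<comment> \<open>The cohomological equation determines \<open>\<xi>\<close> up to a constant;
    replacing \<open>\<xi>\<close> by \<open>\<xi> - k\<close> gives
    \<open>w = p * (\<xi> - k)\<close> average zero, because \<open>p\<close> has average 1.\<close>
  define k where "k = average (\<lambda>z. p z * \<xi> z)"
  define w where "w z = p z * \<xi> z - k * p z" for z
  have kr: "k \<in> \<real>"
    unfolding k_def using con[OF perhol_mult[OF p(1) \<xi>(1)]] pr \<xi>(3) by (intro average_real) auto
  show ?thesis
  proof
    show "perhol s w" unfolding w_def
      by (rule perhol_diff[OF perhol_mult[OF p(1) \<xi>(1)] perhol_mult[OF perhol_const p(1)]])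
    have "average w = k - average (\<lambda>z. k * p z)"
      unfolding w_def k_def [symmetric] using con[OF perhol_mult[OF p(1) \<xi>(1)]] con[OF p(1)]
      by (subst average_diff) (auto intro!: continuous_intros simp: k_def)
    then show "average w = 0" unfolding average_cmult p(2) by simp
    show "w (of_real x) \<in> \<real>" for x :: real
      unfolding w_def using kr pr \<xi>(3) by simp
    fix z assume z: "z \<in> strip s"
    have 1: "w (?sh z) = p (?sh z) * (\<xi> z + \<eta> z - k)"
      using \<xi>(4)[OF z] by (simp add: w_def algebra_simps)
    have 2: "w z / p z = \<xi> z - k" using p0[OF z] by (simp add: w_def field_simps)
    have 3: "p (?sh z) * \<eta> z = c z * of_real v + g z"
      using psh0[OF z] by (simp add: \<eta>_def field_simps)
    show "p (?sh z) * (w z / p z) - w (?sh z) + c z * of_real v + g z = 0"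
      unfolding 1 2 using 3 by (simp add: algebra_simps)
  qed
qed

text \<open>All quantitative conditions on a pair are expressed by one number: \<open>T\<close>
  bounds the derivative, its reciprocal and the reciprocal twist, and \<open>1 / T\<close> is the
  room left in the strip and in the parameter set. Passing to \<open>2 * T\<close> therefore makes
  room for a correction in every respect at once.\<close>

definition adm ::
  "real set \<Rightarrow> real \<Rightarrow> (real \<Rightarrow> complex \<Rightarrow> complex) \<Rightarrow> real \<Rightarrow> real \<Rightarrow> (complex \<Rightarrow> complex) \<Rightarrow> real \<Rightarrow> real \<Rightarrow> bool" where
  "adm A P G T s h a \<theta> \<longleftrightarrow>
     perhol s (\<lambda>z. h z - z) \<and> (\<forall>x::real. h (of_real x) \<in> \<real>) \<and> average (\<lambda>z. h z - z) = 0 \<and>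
     (\<forall>z\<in>strip s. norm (deriv h z) \<le> T \<and> deriv h z \<noteq> 0 \<and> norm (1 / deriv h z) \<le> T \<and> h z \<in> strip (P - 1 / T)) \<and>
     cball a (1 / T) \<subseteq> A \<and>
     average (\<lambda>z. G a (h z) / deriv h (z + of_real \<theta>)) \<noteq> 0 \<and>
     norm (1 / average (\<lambda>z. G a (h z) / deriv h (z + of_real \<theta>))) \<le> T"

definition cerr :: "(real \<Rightarrow> complex \<Rightarrow> complex) \<Rightarrow> (complex \<Rightarrow> complex) \<Rightarrow> real \<Rightarrow> real \<Rightarrow> complex \<Rightarrow> complex" where
  "cerr f h a \<theta> z = f a (h z) - h (z + of_real \<theta>)"

lemma near_id_hol: "perhol s (\<lambda>z. h z - z) \<Longrightarrow> h holomorphic_on strip s"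
proof -
  assume "perhol s (\<lambda>z. h z - z)"
  then have "(\<lambda>z. h z - z) holomorphic_on strip s" by (simp add: perhol_def)
  then have "(\<lambda>z. (h z - z) + z) holomorphic_on strip s"
    by (rule holomorphic_on_add[OF _ holomorphic_on_ident])
  then show ?thesis by simp
qed

lemma near_id_per: "perhol s (\<lambda>z. h z - z) \<Longrightarrow> z \<in> strip s \<Longrightarrow> h (z + 1) = h z + 1"
  by (auto simp: perhol_def algebra_simps)

lemma perhol_near_id_deriv:
  assumes "perhol s (\<lambda>z. h z - z)"
  shows "perhol s (deriv h)"
proof -
  have hol: "h holomorphic_on strip s" by (rule near_id_hol[OF assms])
  have "deriv h (z + 1) = deriv h z" if z: "z \<in> strip s" for z
  proof -
    have "deriv h (z + of_real 1) = deriv (\<lambda>w. h (w + of_real 1)) z"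
      by (rule deriv_shift[OF hol z, symmetric])
    also have "\<dots> = deriv (\<lambda>w. h w + 1) z"
      using near_id_per[OF assms] by (intro deriv_cong_strip[OF _ z]) auto
    also have "\<dots> = deriv h z"
      using holomorphic_derivI[OF hol open_strip z]
      by (intro DERIV_imp_deriv) (auto intro!: derivative_eq_intros)
    finally show ?thesis by simp
  qed
  then show ?thesis
    using hol by (simp add: perhol_def holomorphic_deriv open_strip)
qed

lemma average_deriv_near_id:
  assumes h: "perhol s (\<lambda>z. h z - z)" and s: "0 < s"
  shows "average (deriv h) = 1"
proof -
  have hol: "h holomorphic_on strip s" by (rule near_id_hol[OF h])
  have "((\<lambda>x::real. h (of_real x)) has_vector_derivative deriv h (of_real x)) (at x within {0..1})" for x :: real
    using holomorphic_derivI[OF hol open_strip, of "of_real x"] s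
    by (intro has_vector_derivative_real_field) auto
  then have "((\<lambda>x::real. deriv h (of_real x)) has_integral (h (of_real 1) - h (of_real 0))) {0..1}"
    by (intro fundamental_theorem_of_calculus) auto
  moreover have "h (of_real 1) - h (of_real 0) = 1"
    using near_id_per[OF h, of 0] s by (simp add: strip_def)
  ultimately show ?thesis unfolding average_def by (simp add: integral_unique)
qed

lemma norm_le_all_imp_zero:
  fixes x :: "'a::real_normed_vector"
  assumes "0 < C" "\<And>r. 0 < r \<Longrightarrow> norm x \<le> C * r"
  shows "x = 0"
proof (rule ccontr)
  assume "x \<noteq> 0"
  then have "norm x \<le> C * (norm x / (2 * C))" using assms(1) by (intro assms(2)) auto
  then show False using assms(1) \<open>x \<noteq> 0\<close> by simp
qed

context kam_family
begin

lemma inv_S: "0 < 1 / S" using S_ge_1 by simp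

lemma strip_P: "z \<in> strip (P - 1 / S) \<Longrightarrow> z \<in> strip P"
  using inv_S strip_mono[of "P - 1 / S" P] by auto

lemma comp_hol:
  assumes "g holomorphic_on strip P" "h holomorphic_on strip s" "\<And>z. z \<in> strip s \<Longrightarrow> h z \<in> strip P"
  shows "(\<lambda>z. g (h z)) holomorphic_on strip s"
  using holomorphic_on_compose_gen[OF assms(2,1)] assms(3) by (auto simp: o_def)

context
  fixes s h a \<theta>
  assumes adm: "adm A P G S s h a \<theta>" and s: "0 < s"
begin

lemma adm_near: "perhol s (\<lambda>z. h z - z)"
  and adm_real: "h (of_real x) \<in> \<real>"
  and adm_avg: "average (\<lambda>z. h z - z) = 0"
  and adm_d1: "z \<in> strip s \<Longrightarrow> norm (deriv h z) \<le> S"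
  and adm_d0: "z \<in> strip s \<Longrightarrow> deriv h z \<noteq> 0"
  and adm_d2: "z \<in> strip s \<Longrightarrow> norm (1 / deriv h z) \<le> S"
  and adm_in: "z \<in> strip s \<Longrightarrow> h z \<in> strip (P - 1 / S)"
  and adm_A: "cball a (1 / S) \<subseteq> A"
  and adm_b0: "average (\<lambda>z. G a (h z) / deriv h (z + of_real \<theta>)) \<noteq> 0"
  and adm_b1: "norm (1 / average (\<lambda>z. G a (h z) / deriv h (z + of_real \<theta>))) \<le> S"
  using adm unfolding adm_def by auto

lemma adm_a: "a \<in> A"
  using adm_A inv_S by (meson centre_in_cball less_imp_le subsetD)

lemma adm_hol: "h holomorphic_on strip s" by (rule near_id_hol[OF adm_near])

lemma adm_coef: "perhol s (\<lambda>z. G a (h z))"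
proof -
  have "(\<lambda>z. G a (h z)) holomorphic_on strip s"
    using strip_P[OF adm_in] by (intro comp_hol[OF G_hol[OF adm_a] adm_hol])
  moreover have "G a (h (z + 1)) = G a (h z)" if "z \<in> strip s" for z
    using near_id_per[OF adm_near that] G_per[OF adm_a strip_P[OF adm_in[OF that]]] by simp
  ultimately show ?thesis by (simp add: perhol_def)
qed

lemma adm_coef_real: "G a (h (of_real x)) \<in> \<real>"
  using adm_real[of x] G_real[OF adm_a] by (auto elim!: Reals_cases)

lemma adm_cerr: "perhol s (cerr f h a \<theta>)"
proof -
  have "(\<lambda>z. f a (h z)) holomorphic_on strip s"
    using strip_P[OF adm_in] by (intro comp_hol[OF hol[OF adm_a] adm_hol])
  then have "(\<lambda>z. f a (h z) - h (z + of_real \<theta>)) holomorphic_on strip s"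
    using holomorphic_shift[OF adm_hol] by (intro holomorphic_intros)
  moreover have "f a (h (z + 1)) - h (z + 1 + of_real \<theta>) = f a (h z) - h (z + of_real \<theta>)"
    if z: "z \<in> strip s" for z
  proof -
    have "h ((z + of_real \<theta>) + 1) = h (z + of_real \<theta>) + 1"
      using z by (intro near_id_per[OF adm_near]) simp
    moreover have "z + 1 + of_real \<theta> = (z + of_real \<theta>) + 1" by simp
    ultimately have "h (z + 1 + of_real \<theta>) = h (z + of_real \<theta>) + 1" by (simp only:)
    then show ?thesis
      using near_id_per[OF adm_near z] per[OF adm_a strip_P[OF adm_in[OF z]]] by simp
  qed
  ultimately show ?thesis unfolding perhol_def cerr_def[abs_def] by blast
qed

lemma adm_cerr_real: "cerr f h a \<theta> (of_real x) \<in> \<real>"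
proof -
  have "h (of_real (x + \<theta>)) \<in> \<real>" by (rule adm_real)
  moreover have "f a (h (of_real x)) \<in> \<real>"
    using adm_real[of x] real[OF adm_a] by (auto elim!: Reals_cases)
  ultimately show ?thesis by (simp add: cerr_def)
qed

text \<open>Differentiating the conjugacy relation gives \<open>deriv (f a) (h z) * deriv h z =
  deriv h (z + of_real \<theta>)\<close> up to the derivative of the error. So the coefficient
  \<open>deriv (f a) (h z)\<close> of the true linearization is replaced by a quotient of
  derivatives of \<open>h\<close>, for which the equation can be solved exactly.\<close>

lemma step_exists:
  assumes dio: "\<theta> \<in> Diophantine \<gamma> \<tau>" and pos: "0 < \<gamma>" "0 \<le> \<tau>"
  obtains w and v :: real where "perhol s w" "average w = 0" "\<And>x::real. w (of_real x) \<in> \<real>"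
    "\<And>z. z \<in> strip s \<Longrightarrow> deriv h (z + of_real \<theta>) * (w z / deriv h z) - w (z + of_real \<theta>)
        + G a (h z) * of_real v + cerr f h a \<theta> z = 0"
  by (rule linear_exists[OF dio pos s perhol_near_id_deriv[OF adm_near] average_deriv_near_id[OF adm_near s]
      adm_d0 deriv_real[OF adm_hol s adm_real] adm_coef adm_coef_real adm_b0 adm_cerr adm_cerr_real])
    (auto intro: that)

lemma cerr_deriv:
  assumes z: "z \<in> strip s"
  shows "deriv (cerr f h a \<theta>) z = deriv (f a) (h z) * deriv h z - deriv h (z + of_real \<theta>)"
proof -
  have h: "(h has_field_derivative deriv h z) (at z)"
    by (rule holomorphic_derivI[OF adm_hol open_strip z])
  have "(h has_field_derivative deriv h (z + of_real \<theta>)) (at (z + of_real \<theta>))"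
    using z by (intro holomorphic_derivI[OF adm_hol open_strip]) simp
  then have sh: "((\<lambda>z. h (z + of_real \<theta>)) has_field_derivative deriv h (z + of_real \<theta>)) (at z)"
    by (simp add: DERIV_shift)
  have "((\<lambda>z. f a (h z)) has_field_derivative deriv (f a) (h z) * deriv h z) (at z)"
    by (rule DERIV_chain2[OF f_deriv[OF adm_a strip_P[OF adm_in[OF z]]] h])
  from DERIV_diff[OF this sh] show ?thesis
    unfolding cerr_def[abs_def] by (rule DERIV_imp_deriv)
qed

text \<open>The equation cancels all first-order terms. There remain the price of the modified
  coefficient, which is the derivative of the error times \<open>w / deriv h\<close>, and the Taylor
  remainder. The former is a product of two small factors, by Cauchy's estimate with loss
  \<open>d\<close>.\<close>

lemma step_error:
  assumes eq: "\<And>z. z \<in> strip s \<Longrightarrow> deriv h (z + of_real \<theta>) * (w z / deriv h z) - w (z + of_real \<theta>)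
        + G a (h z) * of_real v + cerr f h a \<theta> z = 0"
    and e: "\<And>z. z \<in> strip s \<Longrightarrow> norm (cerr f h a \<theta> z) \<le> \<epsilon>"
    and d: "0 < d" "d < s" and w: "norm (w z) \<le> \<omega>" "\<omega> \<le> 1 / S" and v: "\<bar>v\<bar> \<le> \<omega>'" "\<omega>' \<le> 1 / S"
    and z: "z \<in> strip (s - d)"
  shows "norm (cerr f (\<lambda>z. h z + w z) (a + v) \<theta> z) \<le> S * \<omega> * \<epsilon> / d + S\<^sup>2 * (\<omega> + \<omega>')\<^sup>2"
proof -
  have zs: "z \<in> strip s" using z d strip_mono[of "s - d" s] by auto
  have e0: "0 \<le> \<epsilon>" using order_trans[OF norm_ge_zero e[OF zs]] .
  have w0: "0 \<le> \<omega>" using order_trans[OF norm_ge_zero w(1)] .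
  let ?h' = "deriv h z" and ?T = "f (a + v) (h z + w z) - f a (h z) - deriv (f a) (h z) * ((h z + w z) - h z)
      - of_real ((a + v) - a) * G a (h z)"
  have seg: "closed_segment a (a + v) \<subseteq> A"
  proof -
    have "closed_segment a (a + v) \<subseteq> cball a (1 / S)"
      using v inv_S by (intro closed_segment_subset convex_cball) (auto simp: dist_real_def)
    then show ?thesis using adm_A by blast
  qed
  have hw: "h z + w z \<in> strip P"
    using adm_in[OF zs] w abs_Im_le_cmod[of "w z"] by (auto simp: strip_def)
  have "norm ?T \<le> S\<^sup>2 * (norm ((h z + w z) - h z) + \<bar>(a + v) - a\<bar>)\<^sup>2"
    by (rule taylor2[OF seg adm_in[OF zs] hw])
  also have "\<dots> \<le> S\<^sup>2 * (\<omega> + \<omega>')\<^sup>2"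
    using w v by (intro mult_left_mono power_mono add_mono) auto
  finally have T: "norm ?T \<le> S\<^sup>2 * (\<omega> + \<omega>')\<^sup>2" .
  have D: "norm (deriv (cerr f h a \<theta>) z) \<le> \<epsilon> / d"
    using adm_cerr e d z by (intro Cauchy_strip[of _ s]) (auto simp: perhol_def)
  have wh: "norm (w z / ?h') \<le> \<omega> * S"
    using mult_mono[OF w(1) adm_d2[OF zs]] w0 by (simp add: norm_divide)
  have "cerr f (\<lambda>z. h z + w z) (a + v) \<theta> z = deriv (cerr f h a \<theta>) z * (w z / ?h') + ?T"
  proof -
    define q where "q = w z / ?h'"
    have w: "w z = q * ?h'" using adm_d0[OF zs] by (simp add: q_def)
    have F1: "deriv h (z + of_real \<theta>) * q - w (z + of_real \<theta>) + G a (h z) * of_real v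
        + (f a (h z) - h (z + of_real \<theta>)) = 0"
      using eq[OF zs] by (simp add: q_def cerr_def)
    have T: "?T = f (a + v) (h z + w z) - f a (h z) - deriv (f a) (h z) * (q * ?h') - of_real v * G a (h z)"
      by (simp add: w)
    show ?thesis
      unfolding T unfolding cerr_deriv[OF zs] cerr_def q_def [symmetric] using F1 by algebra
  qed
  also have "norm \<dots> \<le> (\<epsilon> / d) * (\<omega> * S) + S\<^sup>2 * (\<omega> + \<omega>')\<^sup>2"
  proof (rule norm_triangle_mono[OF _ T])
    show "norm (deriv (cerr f h a \<theta>) z * (w z / ?h')) \<le> (\<epsilon> / d) * (\<omega> * S)"
      unfolding norm_mult using D wh e0 d by (intro mult_mono) auto
  qed
  finally show ?thesis by (simp add: mult_ac)
qed

text \<open>The condition on \<open>r\<close> keeps the derivative of \<open>h'\<close> above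
  \<open>1 / (2 * S)\<close> in modulus. In the twist average, the change of the numerator
  contributes at most \<open>4 * S\<^sup>2 * r\<close> and that of the reciprocal derivative at most
  \<open>2 * S ^ 3 * r\<close>.\<close>

lemma adm_twist_close:
  assumes h': "\<And>z. z \<in> strip s' \<Longrightarrow> norm (h' z - h z) \<le> r"
    and dh': "\<And>z. z \<in> strip s' \<Longrightarrow> norm (deriv h' z - deriv h z) \<le> r"
    and n': "perhol s' (\<lambda>z. h' z - z)"
    and a': "\<bar>a' - a\<bar> \<le> r" and s': "0 < s'" "s' \<le> s" and r: "r \<le> 1 / (2 * S)"
  shows "norm (average (\<lambda>z. G a' (h' z) / deriv h' (z + of_real \<theta>)) - average (\<lambda>z. G a (h z) / deriv h (z + of_real \<theta>)))
      \<le> 6 * S ^ 3 * r"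
    and "z \<in> strip s' \<Longrightarrow> deriv h' z \<noteq> 0" and "z \<in> strip s' \<Longrightarrow> norm (1 / deriv h' z) \<le> 2 * S"
    and "z \<in> strip s' \<Longrightarrow> norm (1 / deriv h' z - 1 / deriv h z) \<le> 2 * S\<^sup>2 * r"
proof -
  have r0: "0 \<le> r" using a' by linarith
  have ss: "z \<in> strip s" if "z \<in> strip s'" for z using that s' strip_mono[of s' s] by auto
  have low: "1 / (2 * S) \<le> norm (deriv h' z)" if z: "z \<in> strip s'" for z
  proof -
    have "1 / S \<le> norm (deriv h z)"
      using adm_d2[OF ss[OF z]] adm_d0[OF ss[OF z]] S_ge_1 by (simp add: norm_divide field_simps)
    moreover have "norm (deriv h z) \<le> norm (deriv h' z) + r"
      using dh'[OF z] norm_triangle_ineq2[of "deriv h z" "deriv h' z"] by (simp add: norm_minus_commute)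
    moreover have "1 / S = 1 / (2 * S) + 1 / (2 * S)" by simp
    ultimately show ?thesis using r by linarith
  qed
  show d0: "deriv h' z \<noteq> 0" if z: "z \<in> strip s'" for z
    using low[OF z] inv_S by auto
  show d2: "norm (1 / deriv h' z) \<le> 2 * S" if z: "z \<in> strip s'" for z
    using low[OF z] d0[OF z] S_ge_1 by (simp add: norm_divide field_simps)
  show dd: "norm (1 / deriv h' z - 1 / deriv h z) \<le> 2 * S\<^sup>2 * r" if z: "z \<in> strip s'" for z
  proof -
    have "1 / deriv h' z - 1 / deriv h z = - (deriv h' z - deriv h z) * ((1 / deriv h' z) * (1 / deriv h z))"
      using d0[OF z] adm_d0[OF ss[OF z]] by (simp add: field_simps)
    then have "norm (1 / deriv h' z - 1 / deriv h z)
        = norm (deriv h' z - deriv h z) * (norm (1 / deriv h' z) * norm (1 / deriv h z))"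
      by (simp only: norm_mult norm_minus_cancel)
    also have "\<dots> \<le> r * ((2 * S) * S)"
      using dh'[OF z] d2[OF z] adm_d2[OF ss[OF z]] r0 S_ge_1 by (intro mult_mono) auto
    finally show ?thesis by (simp add: power2_eq_square mult_ac)
  qed
  have S3: "S \<le> S ^ 3" "S\<^sup>2 \<le> S ^ 3"
    using power_increasing[of 1 3 S] power_increasing[of 2 3 S] S_ge_1 by auto
  have seg: "closed_segment a a' \<subseteq> A"
  proof -
    have "r \<le> 1 / S" using r inv_S by (simp add: field_simps)
    then have "closed_segment a a' \<subseteq> cball a (1 / S)"
      using a' inv_S by (intro closed_segment_subset convex_cball) (auto simp: dist_real_def)
    then show ?thesis using adm_A by blast
  qed
  have h'P: "h' z \<in> strip P" if z: "z \<in> strip s'" for z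
  proof -
    have "\<bar>Im (h' z)\<bar> \<le> \<bar>Im (h z)\<bar> + \<bar>Im (h' z - h z)\<bar>" by simp
    also have "\<dots> \<le> \<bar>Im (h z)\<bar> + r" using h'[OF z] abs_Im_le_cmod[of "h' z - h z"] by linarith
    also have "\<dots> < P - 1 / S + 1 / (2 * S)"
      using adm_in[OF ss[OF z]] r by (simp add: strip_def)
    also have "\<dots> \<le> P" using S_ge_1 by (simp add: field_simps)
    finally show ?thesis by (simp add: strip_def)
  qed
  have a'A: "a' \<in> A" using seg by auto
  let ?b' = "\<lambda>z. G a' (h' z) / deriv h' (z + of_real \<theta>)" and ?b = "\<lambda>z. G a (h z) / deriv h (z + of_real \<theta>)"
  have bd: "norm (?b' z - ?b z) \<le> 6 * S ^ 3 * r" if z: "z \<in> strip s'" for z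
  proof -
    have z\<theta>: "z + of_real \<theta> \<in> strip s'" using z by simp
    have "norm (G a' (h' z) - G a (h z)) \<le> norm (G a' (h' z) - G a (h' z)) + norm (G a (h' z) - G a (h z))"
      by norm
    also have "\<dots> \<le> S * \<bar>a' - a\<bar> + S * norm (h' z - h z)"
      using seg h'P[OF z] strip_P[OF adm_in[OF ss[OF z]]] adm_a by (intro add_mono G_lip_a G_lip_z) auto
    also have "\<dots> \<le> S * r + S * r"
      using a' h'[OF z] S_ge_1 by (intro add_mono mult_left_mono) auto
    finally have g: "norm (G a' (h' z) - G a (h z)) \<le> 2 * S * r" by simp
    have "?b' z - ?b z = (G a' (h' z) - G a (h z)) * (1 / deriv h' (z + of_real \<theta>))
        + G a (h z) * (1 / deriv h' (z + of_real \<theta>) - 1 / deriv h (z + of_real \<theta>))"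
      by (simp add: algebra_simps)
    also have "norm \<dots> \<le> (2 * S * r) * (2 * S) + S * (2 * S\<^sup>2 * r)"
    proof (rule norm_triangle_mono)
      show "norm ((G a' (h' z) - G a (h z)) * (1 / deriv h' (z + of_real \<theta>))) \<le> (2 * S * r) * (2 * S)"
        unfolding norm_mult using g d2[OF z\<theta>] r0 S_ge_1 by (intro mult_mono) auto
      show "norm (G a (h z) * (1 / deriv h' (z + of_real \<theta>) - 1 / deriv h (z + of_real \<theta>))) \<le> S * (2 * S\<^sup>2 * r)"
        unfolding norm_mult using dd[OF z\<theta>] bG[OF adm_a strip_P[OF adm_in[OF ss[OF z]]]] r0 S_ge_1
        by (intro mult_mono) auto
    qed
    also have "\<dots> = (4 * S\<^sup>2 + 2 * S ^ 3) * r" by (simp add: power2_eq_square power3_eq_cube algebra_simps)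
    also have "\<dots> \<le> (6 * S ^ 3) * r" using S3 r0 by (intro mult_right_mono) auto
    finally show ?thesis .
  qed
  have con: "continuous_on {0..1} (\<lambda>x::real. q (of_real x))" if "q holomorphic_on strip s'" for q
    using that s' by (intro continuous_on_reals) auto
  have hol': "?b' holomorphic_on strip s'"
    using h'P d0 near_id_hol[OF n']
    by (intro holomorphic_on_divide comp_hol[OF G_hol[OF a'A]] holomorphic_shift holomorphic_deriv open_strip) auto
  have "?b holomorphic_on strip s"
    using adm_coef adm_d0 adm_hol
    by (intro holomorphic_on_divide holomorphic_shift holomorphic_deriv open_strip) (auto simp: perhol_def)
  then have hol: "?b holomorphic_on strip s'"
    using s' strip_mono holomorphic_on_subset by blast
  have "average ?b' - average ?b = average (\<lambda>z. ?b' z - ?b z)"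
    using con[OF hol'] con[OF hol] by (intro average_diff[symmetric])
  also have "norm \<dots> \<le> 6 * S ^ 3 * r"
  proof (rule average_norm_le)
    show "continuous_on {0..1} (\<lambda>x::real. ?b' (of_real x) - ?b (of_real x))"
      by (intro continuous_on_diff con[OF hol'] con[OF hol])
    show "norm (?b' (of_real x) - ?b (of_real x)) \<le> 6 * S ^ 3 * r" for x :: real
      using bd s' by simp
  qed
  finally show "norm (average ?b' - average ?b) \<le> 6 * S ^ 3 * r" .
qed

text \<open>A displacement of this size uses up at most half of every margin, so the constant
  doubles. The fourth power is dictated by the twist: its change \<open>6 * S ^ 3 * r\<close> must
  not exceed \<open>1 / (2 * S)\<close>.\<close>

lemma adm_close:
  assumes h': "\<And>z. z \<in> strip s' \<Longrightarrow> norm (h' z - h z) \<le> r"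
    and dh': "\<And>z. z \<in> strip s' \<Longrightarrow> norm (deriv h' z - deriv h z) \<le> r"
    and n': "perhol s' (\<lambda>z. h' z - z)" "\<And>x::real. h' (of_real x) \<in> \<real>" "average (\<lambda>z. h' z - z) = 0"
    and a': "\<bar>a' - a\<bar> \<le> r" and s': "0 < s'" "s' \<le> s" and r: "r \<le> 1 / (12 * S ^ 4)"
  shows "adm A P G (2 * S) s' h' a' \<theta>"
proof -
  have ss: "z \<in> strip s" if "z \<in> strip s'" for z using that s' strip_mono[of s' s] by auto
  have "S \<le> S ^ 4" using power_increasing[of 1 4 S] S_ge_1 by simp
  then have "1 / (12 * S ^ 4) \<le> 1 / (2 * S)"
    using S_ge_1 by (intro divide_left_mono) auto
  then have r2: "r \<le> 1 / (2 * S)" using r by linarith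
  have half: "1 / S = 1 / (2 * S) + 1 / (2 * S)" by simp
  note tc = adm_twist_close[OF h' dh' n'(1) a' s' r2]
  have "norm (deriv h' z) \<le> 2 * S \<and> deriv h' z \<noteq> 0 \<and> norm (1 / deriv h' z) \<le> 2 * S \<and> h' z \<in> strip (P - 1 / (2 * S))"
    if z: "z \<in> strip s'" for z
  proof (intro conjI tc(2,3) z)
    have "1 / (2 * S) \<le> 1" using S_ge_1 by (simp add: field_simps)
    then have "1 / (2 * S) \<le> S" using S_ge_1 by linarith
    then show "norm (deriv h' z) \<le> 2 * S"
      using dh'[OF z] adm_d1[OF ss[OF z]] norm_triangle_ineq2[of "deriv h' z" "deriv h z"] r2 by linarith
    have "\<bar>Im (h' z)\<bar> \<le> \<bar>Im (h z)\<bar> + \<bar>Im (h' z - h z)\<bar>" by simp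
    also have "\<dots> \<le> \<bar>Im (h z)\<bar> + r" using h'[OF z] abs_Im_le_cmod[of "h' z - h z"] by linarith
    also have "\<dots> < P - 1 / (2 * S)"
    proof -
      have "\<bar>Im (h z)\<bar> < P - 1 / S" using adm_in[OF ss[OF z]] by (simp add: strip_def)
      then show ?thesis using r2 half by linarith
    qed
    finally show "h' z \<in> strip (P - 1 / (2 * S))" by (simp add: strip_def)
  qed
  moreover have "cball a' (1 / (2 * S)) \<subseteq> A"
  proof -
    have "cball a' (1 / (2 * S)) \<subseteq> cball a (1 / S)"
    proof
      fix x assume "x \<in> cball a' (1 / (2 * S))"
      then have "\<bar>a' - x\<bar> \<le> 1 / (2 * S)" by (simp add: dist_real_def)
      then have "\<bar>a - x\<bar> \<le> 1 / S" using a' r2 half by linarith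
      then show "x \<in> cball a (1 / S)" by (simp add: dist_real_def)
    qed
    then show ?thesis using adm_A by blast
  qed
  moreover define b' where "b' = average (\<lambda>z. G a' (h' z) / deriv h' (z + of_real \<theta>))"
  define b where "b = average (\<lambda>z. G a (h z) / deriv h (z + of_real \<theta>))"
  have "1 / (2 * S) \<le> norm b'"
  proof -
    have "1 / S \<le> norm b"
      using adm_b0 adm_b1 S_ge_1 by (simp add: b_def norm_divide field_simps)
    moreover have "norm b \<le> norm b' + norm (b' - b)"
      using norm_triangle_ineq2[of b b'] by (simp add: norm_minus_commute)
    moreover have "norm (b' - b) \<le> 6 * S ^ 3 * r" using tc(1) by (simp add: b_def b'_def)
    moreover have "6 * S ^ 3 * r \<le> 6 * S ^ 3 * (1 / (12 * S ^ 4))"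
      using r S_ge_1 by (intro mult_left_mono) auto
    moreover have "6 * S ^ 3 * (1 / (12 * S ^ 4)) = 1 / (2 * S)"
      using S_ge_1 by (simp add: field_simps power3_eq_cube power4_eq_xxxx)
    ultimately show ?thesis using half by linarith
  qed
  moreover from this have "b' \<noteq> 0" using inv_S by auto
  moreover from calculation have "norm (1 / b') \<le> 2 * S"
    using S_ge_1 by (simp add: norm_divide field_simps)
  ultimately show ?thesis
    using n' unfolding adm_def b'_def by blast
qed

text \<open>One loss \<open>d\<close> goes into the solution of the linear equation, the other into
  Cauchy's estimate for \<open>deriv w\<close>. The natural number \<open>p\<close> replaces the
  exponent \<open>\<tau>\<close>, so that the widths of the iteration enter through ordinary
  powers.\<close>

lemma kam_step:
  fixes p :: nat
  assumes dio: "\<theta> \<in> Diophantine \<gamma> \<tau>" and pos: "0 < \<gamma>" "0 \<le> \<tau>" and KR: "KR \<tau> / \<gamma> \<le> S" and p: "\<tau> \<le> real p"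
    and e: "\<And>z. z \<in> strip s \<Longrightarrow> norm (cerr f h a \<theta> z) \<le> \<epsilon>"
    and d: "0 < d" "d \<le> 1" "2 * d < s"
    and small: "80 * S ^ 16 * \<epsilon> / d ^ (2 * p + 1) \<le> 1 / S"
  obtains w and v :: real where "perhol s w" "average w = 0" "\<And>x::real. w (of_real x) \<in> \<real>"
    "\<And>z. z \<in> strip (s - 2 * d) \<Longrightarrow> norm (w z) \<le> 80 * S ^ 16 * \<epsilon> / d ^ (2 * p + 1)"
    "\<And>z. z \<in> strip (s - 2 * d) \<Longrightarrow> norm (deriv w z) \<le> 80 * S ^ 16 * \<epsilon> / d ^ (2 * p + 1)"
    "\<bar>v\<bar> \<le> 80 * S ^ 16 * \<epsilon> / d ^ (2 * p + 1)"
    "\<And>z. z \<in> strip (s - 2 * d) \<Longrightarrow> norm (cerr f (\<lambda>z. h z + w z) (a + v) \<theta> z) \<le> 80 * S ^ 16 * \<epsilon>\<^sup>2 / d ^ (2 * p + 1)"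
proof -
  obtain w and v :: real where w: "perhol s w" "average w = 0" "\<And>x::real. w (of_real x) \<in> \<real>"
    and eq: "\<And>z. z \<in> strip s \<Longrightarrow> deriv h (z + of_real \<theta>) * (w z / deriv h z) - w (z + of_real \<theta>)
        + G a (h z) * of_real v + cerr f h a \<theta> z = 0"
    by (rule step_exists[OF dio pos]) (rule that)
  have e0: "0 \<le> \<epsilon>" using order_trans[OF norm_ge_zero e[of 0]] s by (simp add: strip_def)
  have ds: "d < s" using d by simp
  note S = S_ge_1
  note le = linear_estimate[OF dio pos perhol_near_id_deriv[OF adm_near] average_deriv_near_id[OF adm_near s]
      adm_d0 adm_d1 adm_d2 adm_coef _ adm_b0 adm_b1 w(1,2) eq e d(1) ds, where ca = S]
  have G: "norm (G a (h z)) \<le> S" if "z \<in> strip s" for z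
    using bG[OF adm_a strip_P[OF adm_in[OF that]]] .
  \<comment> \<open>The constant of \<open>linear_estimate\<close> after the simplifications
    \<open>1 + S \<le> 2 * S\<close>, \<open>1 + S * S * S \<le> 2 * S ^ 3\<close> and
    \<open>KR \<tau> / \<gamma> \<le> S\<close>; the power \<open>d ^ p\<close> is at most
    \<open>d powr \<tau>\<close> because \<open>d \<le> 1\<close>.\<close>
  define W where "W = 4 * S ^ 7 / d ^ p"
  have dp: "0 < d ^ p" "d ^ p \<le> 1" using d by (auto intro: power_le_one)
  have S7: "1 \<le> S ^ 7" using S one_le_power by blast
  have W1: "1 \<le> W"
  proof -
    have "d ^ p \<le> 4 * S ^ 7" using dp S7 by linarith
    then show ?thesis using dp by (simp add: W_def field_simps)
  qed
  have wW: "norm (w z) \<le> W * \<epsilon>" if z: "z \<in> strip (s - d)" for z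
  proof -
    have "norm (w z) \<le> S * (1 + S) * KR \<tau> * (1 + S * S * S) * S * \<epsilon> / (\<gamma> * d powr \<tau>)"
      using le(2) G z by blast
    also have "\<dots> = (S * (1 + S)) * (KR \<tau> / \<gamma>) * (1 + S * S * S) * S * \<epsilon> / d powr \<tau>"
      by simp
    also have "\<dots> \<le> (S * (1 + S)) * S * (1 + S * S * S) * S * \<epsilon> / d powr \<tau>"
      using KR S e0 by (intro divide_right_mono mult_right_mono mult_left_mono) auto
    also have "\<dots> \<le> (S * (2 * S)) * S * (2 * S ^ 3) * S * \<epsilon> / d powr \<tau>"
    proof -
      have "1 \<le> S ^ 3" using S one_le_power by blast
      then have "1 + S * S * S \<le> 2 * S ^ 3" by (simp add: power3_eq_cube)
      then show ?thesis using S e0 by (intro divide_right_mono mult_right_mono mult_mono) auto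
    qed
    also have "\<dots> = 4 * S ^ 7 * \<epsilon> / d powr \<tau>" by (simp add: power_numeral_reduce)
    also have "\<dots> \<le> 4 * S ^ 7 * \<epsilon> / d ^ p"
    proof -
      have "d powr (real p) \<le> d powr \<tau>" using d p by (intro powr_mono') auto
      then have "d ^ p \<le> d powr \<tau>" using d by (simp add: powr_realpow)
      then show ?thesis using dp S e0 by (intro divide_left_mono mult_pos_pos) auto
    qed
    finally show ?thesis by (simp add: W_def)
  qed
  have vW: "\<bar>v\<bar> \<le> W * \<epsilon>"
  proof -
    have "norm (complex_of_real v) \<le> S * S * \<epsilon>" using le(1) G by blast
    then have "\<bar>v\<bar> \<le> S\<^sup>2 * \<epsilon>" by (simp add: power2_eq_square)
    also have "\<dots> \<le> W * \<epsilon>"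
    proof (rule mult_right_mono[OF _ e0])
      have "S\<^sup>2 \<le> S ^ 7" using S by (intro power_increasing) auto
      also have "\<dots> \<le> 4 * S ^ 7" using S7 by linarith
      also have "\<dots> \<le> W" unfolding W_def using dp S7 S by (simp add: pos_le_divide_eq mult_left_le)
      finally show "S\<^sup>2 \<le> W" .
    qed
    finally show ?thesis .
  qed
  \<comment> \<open>This is \<open>5 * S\<^sup>2 * W\<^sup>2 / d\<close>, the coefficient of
    \<open>step_error\<close> when both displacements are at most \<open>W * \<epsilon>\<close>. It
    also dominates \<open>W\<close> and \<open>W / d\<close>, so one constant serves all
    conclusions.\<close>
  define Q where "Q = 80 * S ^ 16 / d ^ (2 * p + 1)"
  have QW: "5 * S\<^sup>2 * W\<^sup>2 / d = Q"
  proof -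
    have "W\<^sup>2 = 16 * S ^ 14 / d ^ (2 * p)"
      by (simp add: W_def power_divide power_mult_distrib mult.commute flip: power_mult)
    then have "5 * S\<^sup>2 * W\<^sup>2 / d = 80 * (S\<^sup>2 * S ^ 14) / (d ^ (2 * p) * d)" by simp
    also have "S\<^sup>2 * S ^ 14 = S ^ 16" by (simp flip: power_add)
    finally show ?thesis by (simp add: Q_def mult.commute)
  qed
  have S2: "1 \<le> S\<^sup>2" using S one_le_power by blast
  have WQ: "W / d \<le> Q" "W \<le> Q"
  proof -
    have "W * 1 \<le> W * (5 * S\<^sup>2 * W)"
      using W1 S2 by (intro mult_left_mono) (auto intro!: mult_ge1_I)
    then have "W \<le> 5 * S\<^sup>2 * W\<^sup>2" by (simp add: power2_eq_square mult_ac)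
    then show "W / d \<le> Q" unfolding QW[symmetric] using d by (intro divide_right_mono) auto
    moreover have "W \<le> W / d" using d W1 by (simp add: pos_le_divide_eq)
    ultimately show "W \<le> Q" by linarith
  qed
  have Qe: "80 * S ^ 16 * x / d ^ (2 * p + 1) = Q * x" for x by (simp add: Q_def)
  have smallQ: "Q * \<epsilon> \<le> 1 / S" using small unfolding Qe .
  have WeQ: "W * \<epsilon> \<le> Q * \<epsilon>" using WQ e0 by (intro mult_right_mono) auto
  then have We: "W * \<epsilon> \<le> 1 / S" using smallQ by linarith
  have sub: "z \<in> strip (s - d)" if "z \<in> strip (s - 2 * d)" for z
    using that d strip_mono[of "s - 2 * d" "s - d"] by auto
  show ?thesis
  proof (rule that[OF w, of v, unfolded Qe])
    show "norm (w z) \<le> Q * \<epsilon>" if "z \<in> strip (s - 2 * d)" for z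
      using wW[OF sub[OF that]] WeQ by linarith
    show "\<bar>v\<bar> \<le> Q * \<epsilon>" using vW WeQ by linarith
    show "norm (deriv w z) \<le> Q * \<epsilon>" if z: "z \<in> strip (s - 2 * d)" for z
    proof -
      have "w holomorphic_on strip (s - d)"
        using w(1) d strip_mono[of "s - d" s] by (auto simp: perhol_def intro: holomorphic_on_subset)
      then have "norm (deriv w z) \<le> (W * \<epsilon>) / d"
        using wW d z by (intro Cauchy_strip[of _ "s - d"]) auto
      also have "\<dots> = W / d * \<epsilon>" by simp
      also have "\<dots> \<le> Q * \<epsilon>" using WQ e0 by (intro mult_right_mono) auto
      finally show ?thesis .
    qed
    show "norm (cerr f (\<lambda>z. h z + w z) (a + v) \<theta> z) \<le> Q * \<epsilon>\<^sup>2" if z: "z \<in> strip (s - 2 * d)" for z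
    proof -
      have "norm (cerr f (\<lambda>z. h z + w z) (a + v) \<theta> z) \<le> S * (W * \<epsilon>) * \<epsilon> / d + S\<^sup>2 * (W * \<epsilon> + W * \<epsilon>)\<^sup>2"
        by (rule step_error[OF eq e d(1) ds wW[OF sub[OF z]] We vW We sub[OF z]])
      also have "\<dots> = (S * W / d + 4 * S\<^sup>2 * W\<^sup>2) * \<epsilon>\<^sup>2"
        by (simp add: power2_eq_square algebra_simps)
      also have "\<dots> \<le> Q * \<epsilon>\<^sup>2"
      proof (rule mult_right_mono)
        have "(S * W) * 1 \<le> (S * W) * (S * W)"
          using W1 S by (intro mult_left_mono) (auto intro!: mult_ge1_I)
        then have "S * W / d \<le> S\<^sup>2 * W\<^sup>2 / d"
          using d by (intro divide_right_mono) (auto simp: power2_eq_square mult_ac)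
        moreover have "4 * S\<^sup>2 * W\<^sup>2 \<le> 4 * S\<^sup>2 * W\<^sup>2 / d"
        proof -
          have "0 \<le> 4 * S\<^sup>2 * W\<^sup>2" by simp
          then show ?thesis using d by (simp add: pos_le_divide_eq mult_left_le)
        qed
        moreover have "5 * S\<^sup>2 * W\<^sup>2 / d = S\<^sup>2 * W\<^sup>2 / d + 4 * S\<^sup>2 * W\<^sup>2 / d" by (simp add: add_divide_distrib [symmetric])
        ultimately show "S * W / d + 4 * S\<^sup>2 * W\<^sup>2 \<le> Q" unfolding QW[symmetric] by linarith
      qed simp
      finally show ?thesis .
    qed
  qed
qed

end

end

section \<open>Convergence of the iteration\<close>

text \<open>The last factor belongs to one step with bound \<open>2 * S\<close> and the first loss
  \<open>d0 = min (1 / 2) (g / 4)\<close>. The power of 2 is the rate at which the errors will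
  decay, and \<open>24 * S ^ 4\<close> keeps the total displacement inside the radius of
  \<open>adm_close\<close>.\<close>

definition kam_const :: "real \<Rightarrow> nat \<Rightarrow> real \<Rightarrow> real" where
  "kam_const S p g = 24 * S ^ 4 * 2 ^ (2 * p + 2) * (80 * (2 * S) ^ 16 / (min (1 / 2) (g / 4)) ^ (2 * p + 1))"

lemma kam_const_pos: "1 \<le> S \<Longrightarrow> 0 < g \<Longrightarrow> 0 < kam_const S p g"
  unfolding kam_const_def by (auto intro!: mult_pos_pos divide_pos_pos zero_less_power simp: min_def)

context kam_family
begin

text \<open>The widths decrease by \<open>2 d\<^sub>n\<close> with \<open>d\<^sub>n = d\<^sub>0 / 2\<^sup>n\<close>. Geometric decay of the errors,
  \<open>\<epsilon>\<^sub>n = \<epsilon> / B\<^sup>n\<close> with \<open>B\<close> large enough to beat the small divisors, already suffices.\<close>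

lemma kam_solution:
  fixes p :: nat
  assumes adm0: "adm A P G S s0 h0 a0 \<theta>"
    and dio: "\<theta> \<in> Diophantine \<gamma> \<tau>" and pos: "0 < \<gamma>" "0 \<le> \<tau>" and KR: "KR \<tau> / \<gamma> \<le> S" and p: "\<tau> \<le> real p"
    and e: "\<And>z. z \<in> strip s0 \<Longrightarrow> norm (cerr f h0 a0 \<theta> z) \<le> \<epsilon>"
    and s: "0 < s1" "s1 < s0" and small: "kam_const S p (s0 - s1) * \<epsilon> \<le> 1"
  obtains H and aa :: real where "perhol s1 (\<lambda>z. H z - z)" "\<And>x::real. H (of_real x) \<in> \<real>"
    "average (\<lambda>z. H z - z) = 0"
    "\<And>z. z \<in> strip s1 \<Longrightarrow> norm (H z - h0 z) \<le> kam_const S p (s0 - s1) * \<epsilon>"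
    "\<bar>aa - a0\<bar> \<le> kam_const S p (s0 - s1) * \<epsilon>"
    "\<And>z. z \<in> strip s1 \<Longrightarrow> f aa (H z) = H (z + of_real \<theta>)"
proof -
  interpret T: kam_family A P "2 * S" f G G2
    by (rule mono_S) (use S_ge_1 in simp)
  have s0: "0 < s0" using s by simp
  have e0: "0 \<le> \<epsilon>" using order_trans[OF norm_ge_zero e[of 0]] s0 by (simp add: strip_def)
  define d0 where "d0 = min (1 / 2) ((s0 - s1) / 4)"
  define q where "q = 2 * p + 1"
  define Q where "Q = 80 * (2 * S) ^ 16"
  define B where "B = (2::real) ^ (2 * p + 2)"
  \<comment> \<open>The size of the first correction. The later ones will be at most
    \<open>\<eta> / 2 ^ n\<close>, so the whole displacement stays below
    \<open>2 * \<eta>\<close>.\<close>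
  define \<eta> where "\<eta> = Q / d0 ^ q * \<epsilon>"
  define w where "w n = s1 + 4 * d0 / 2 ^ n" for n :: nat
  define d where "d n = d0 / 2 ^ n" for n :: nat
  have d0: "0 < d0" "d0 \<le> 1 / 2" "4 * d0 \<le> s0 - s1" using s by (auto simp: d0_def min_def)
  have B1: "1 \<le> B" unfolding B_def by (rule one_le_power) simp
  have S4: "1 \<le> S ^ 4" using S_ge_1 one_le_power by blast
  have \<eta>0: "0 \<le> \<eta>" unfolding \<eta>_def Q_def using d0 e0 S_ge_1 by auto
  have K: "kam_const S p (s0 - s1) * \<epsilon> = 24 * S ^ 4 * B * \<eta>"
    unfolding kam_const_def \<eta>_def Q_def B_def q_def d0_def by simp
  have B\<eta>: "B * \<eta> \<le> 1"
  proof -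
    have "1 * (B * \<eta>) \<le> (24 * S ^ 4) * (B * \<eta>)"
      using S4 B1 \<eta>0 by (intro mult_right_mono) auto
    then show ?thesis using small K by (simp add: mult.assoc)
  qed
  have S\<eta>: "24 * S ^ 4 * \<eta> \<le> 1"
  proof -
    have "(24 * S ^ 4 * \<eta>) * 1 \<le> (24 * S ^ 4 * \<eta>) * B"
      using S4 B1 \<eta>0 by (intro mult_left_mono) auto
    then show ?thesis using small K by (simp add: mult_ac)
  qed
  have \<eta>K: "2 * \<eta> \<le> kam_const S p (s0 - s1) * \<epsilon>"
  proof -
    have "1 * B \<le> S ^ 4 * B" using S4 B1 by (intro mult_right_mono) auto
    then have "2 \<le> 24 * S ^ 4 * B" using B1 by linarith
    then show ?thesis unfolding K using \<eta>0 by (intro mult_right_mono) auto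
  qed
  have \<eta>r: "2 * \<eta> \<le> 1 / (12 * S ^ 4)" using S\<eta> S_ge_1 by (simp add: field_simps)
  have "S \<le> S ^ 4" using power_increasing[of 1 4 S] S_ge_1 by simp
  then have "1 / (12 * S ^ 4) \<le> 1 / (2 * S)" using S_ge_1 by (intro divide_left_mono) auto
  then have \<eta>S: "2 * \<eta> \<le> 1 / (2 * S)" using \<eta>r by linarith
  have \<eta>S1: "2 * \<eta> \<le> 1 / S" using \<eta>S S_ge_1 by (simp add: field_simps)
  have w: "s1 \<le> w n" "w n \<le> s0" "w (Suc n) = w n - 2 * d n" "0 < d n" "d n \<le> 1" "2 * d n < w n" "w (Suc n) \<le> w n" for n
  proof -
    have p2: "1 \<le> (2::real) ^ n" by simp
    have wn: "w n = s1 + 4 * d n" by (simp add: w_def d_def)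
    show dn: "0 < d n" using d0 by (simp add: d_def)
    have dd: "d n \<le> d0" unfolding d_def using d0 p2 by (simp add: divide_le_eq mult_le_cancel_left1)
    show "s1 \<le> w n" "2 * d n < w n" "w n \<le> s0" "d n \<le> 1" using wn dn dd d0 s by linarith+
    show "w (Suc n) = w n - 2 * d n" by (simp add: w_def d_def field_simps)
    then show "w (Suc n) \<le> w n" using dn by simp
  qed
  \<comment> \<open>The choice of \<open>B\<close>: of \<open>B ^ n = 2 ^ (n * q) * 2 ^ n\<close>
    the first factor absorbs the shrinking losses \<open>d n ^ q\<close>, and the second makes the
    corrections summable.\<close>
  have Qd: "80 * (2 * S) ^ 16 * (\<epsilon> / B ^ n) / d n ^ q = \<eta> / 2 ^ n" for n
  proof -
    have "B ^ n = 2 ^ (n * q) * 2 ^ n"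
    proof -
      have "(2 * p + 2) * n = n * q + n" by (simp add: q_def algebra_simps)
      then show ?thesis unfolding B_def by (metis power_mult power_add)
    qed
    moreover have "d n ^ q = d0 ^ q / 2 ^ (n * q)" by (simp add: d_def power_divide power_mult)
    ultimately show ?thesis using d0 by (simp add: \<eta>_def Q_def field_simps)
  qed
  \<comment> \<open>Distances are measured from the initial pair and stay below
    \<open>2 * \<eta>\<close>. Thus \<open>adm_close\<close> always starts from that pair and yields
    the bound \<open>2 * S\<close> at every stage, instead of doubling the constant at each
    step.\<close>
  define Inv where "Inv n x \<longleftrightarrow> perhol (w n) (\<lambda>z. fst x z - z) \<and> (\<forall>y::real. fst x (of_real y) \<in> \<real>) \<and>
      average (\<lambda>z. fst x z - z) = 0 \<and>
      (\<forall>z\<in>strip (w n). norm (fst x z - h0 z) \<le> 2 * \<eta> * (1 - 1 / 2 ^ n) \<and>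
         norm (deriv (fst x) z - deriv h0 z) \<le> 2 * \<eta> * (1 - 1 / 2 ^ n) \<and>
         norm (cerr f (fst x) (snd x) \<theta> z) \<le> \<epsilon> / B ^ n) \<and>
      \<bar>snd x - a0\<bar> \<le> 2 * \<eta> * (1 - 1 / 2 ^ n)" for n and x :: "(complex \<Rightarrow> complex) \<times> real"
  define Rel where "Rel n x y \<longleftrightarrow> (\<forall>z\<in>strip (w (Suc n)). norm (fst y z - fst x z) \<le> \<eta> / 2 ^ n) \<and>
      \<bar>snd y - snd x\<bar> \<le> \<eta> / 2 ^ n" for n and x y :: "(complex \<Rightarrow> complex) \<times> real"
  have "\<exists>X. \<forall>n. Inv n (X n) \<and> Rel n (X n) (X (Suc n))"
  proof (rule dependent_nat_choice)
    have "Inv 0 (h0, a0)"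
      using adm0 e perhol_mono[OF _ w(2)[of 0]] strip_mono[OF w(2)[of 0]] by (auto simp: Inv_def adm_def)
    then show "\<exists>x. Inv 0 x" by blast
  next
    fix x n assume I: "Inv n x"
    obtain h a where x: "x = (h, a)" by (cases x)
    have le: "2 * \<eta> * (1 - 1 / 2 ^ n) \<le> 2 * \<eta>" using \<eta>0 by (simp add: mult_left_le)
    have wpos: "0 < w n" using w(1)[of n] s by linarith
    have h: "perhol (w n) (\<lambda>z. h z - z)" "\<And>y::real. h (of_real y) \<in> \<real>" "average (\<lambda>z. h z - z) = 0"
      and hh: "\<And>z. z \<in> strip (w n) \<Longrightarrow> norm (h z - h0 z) \<le> 2 * \<eta> * (1 - 1 / 2 ^ n)"
      and dh: "\<And>z. z \<in> strip (w n) \<Longrightarrow> norm (deriv h z - deriv h0 z) \<le> 2 * \<eta> * (1 - 1 / 2 ^ n)"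
      and eh: "\<And>z. z \<in> strip (w n) \<Longrightarrow> norm (cerr f h a \<theta> z) \<le> \<epsilon> / B ^ n"
      and aa: "\<bar>a - a0\<bar> \<le> 2 * \<eta> * (1 - 1 / 2 ^ n)"
      using I unfolding x Inv_def by auto
    have admn: "adm A P G (2 * S) (w n) h a \<theta>"
      using adm_close[OF adm0 s0 hh dh h aa wpos w(2)] le \<eta>r by linarith
    have sm: "80 * (2 * S) ^ 16 * (\<epsilon> / B ^ n) / d n ^ (2 * p + 1) \<le> 1 / (2 * S)"
    proof -
      have "\<eta> / 2 ^ n \<le> \<eta>" using \<eta>0 by (simp add: divide_le_eq mult_le_cancel_left1)
      then show ?thesis using Qd[of n] \<eta>S \<eta>0 unfolding q_def by linarith
    qed
    have KR2: "KR \<tau> / \<gamma> \<le> 2 * S" using KR S_ge_1 by linarith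
    obtain u and v :: real where u: "perhol (w n) u" "average u = 0" "\<And>x::real. u (of_real x) \<in> \<real>"
      and u1: "\<And>z. z \<in> strip (w (Suc n)) \<Longrightarrow> norm (u z) \<le> \<eta> / 2 ^ n"
      and u2: "\<And>z. z \<in> strip (w (Suc n)) \<Longrightarrow> norm (deriv u z) \<le> \<eta> / 2 ^ n"
      and v: "\<bar>v\<bar> \<le> \<eta> / 2 ^ n"
      and er: "\<And>z. z \<in> strip (w (Suc n)) \<Longrightarrow> norm (cerr f (\<lambda>z. h z + u z) (a + v) \<theta> z)
           \<le> 80 * (2 * S) ^ 16 * (\<epsilon> / B ^ n)\<^sup>2 / d n ^ q"
      using T.kam_step[OF admn wpos dio pos KR2 p eh w(4) w(5) w(6) sm]
      unfolding w(3)[symmetric] Qd[unfolded q_def] q_def by blast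
    have "Inv (Suc n) (\<lambda>z. h z + u z, a + v)"
    proof -
      have up: "perhol (w (Suc n)) u" "perhol (w (Suc n)) (\<lambda>z. h z - z)"
        using perhol_mono[OF _ w(7)] u(1) h(1) by auto
      have sub: "z \<in> strip (w n)" if "z \<in> strip (w (Suc n))" for z
        using that strip_mono[OF w(7)] by blast
      have half: "2 * \<eta> * (1 - 1 / 2 ^ n) + \<eta> / 2 ^ n = 2 * \<eta> * (1 - 1 / 2 ^ Suc n)"
        by (simp add: field_simps)
      have "perhol (w (Suc n)) (\<lambda>z. (h z - z) + u z)" using up by (intro perhol_add)
      then have 1: "perhol (w (Suc n)) (\<lambda>z. h z + u z - z)" by (simp add: algebra_simps)
      have con: "continuous_on {0..1} (\<lambda>x::real. h (of_real x) - of_real x)" "continuous_on {0..1} (\<lambda>x::real. u (of_real x))"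
        using h(1) u(1) wpos continuous_on_reals[of "\<lambda>z. h z - z" "w n"] continuous_on_reals[of u "w n"]
        by (auto simp: perhol_def)
      have "average (\<lambda>z. (h z - z) + u z) = 0"
        using con by (subst average_add) (auto simp: h(3) u(2))
      then have 2: "average (\<lambda>z. h z + u z - z) = 0" by (simp add: algebra_simps)
      have 3: "norm (h z + u z - h0 z) \<le> 2 * \<eta> * (1 - 1 / 2 ^ Suc n)" if z: "z \<in> strip (w (Suc n))" for z
        using norm_triangle_mono[OF hh[OF sub[OF z]] u1[OF z]] unfolding half by (simp only: diff_add_eq)
      have 4: "norm (deriv (\<lambda>z. h z + u z) z - deriv h0 z) \<le> 2 * \<eta> * (1 - 1 / 2 ^ Suc n)" if z: "z \<in> strip (w (Suc n))" for z
      proof -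
        have "deriv (\<lambda>z. h z + u z) z = deriv h z + deriv u z"
          using holomorphic_derivI[OF near_id_hol[OF h(1)] open_strip sub[OF z]]
            holomorphic_derivI[OF _ open_strip sub[OF z], of u] u(1)
          by (intro deriv_add) (auto simp: field_differentiable_def perhol_def)
        then show ?thesis
          using norm_triangle_mono[OF dh[OF sub[OF z]] u2[OF z]] unfolding half by (simp only: diff_add_eq)
      qed
      have 5: "norm (cerr f (\<lambda>z. h z + u z) (a + v) \<theta> z) \<le> \<epsilon> / B ^ Suc n" if z: "z \<in> strip (w (Suc n))" for z
      proof -
        have "norm (cerr f (\<lambda>z. h z + u z) (a + v) \<theta> z) \<le> (80 * (2 * S) ^ 16 * (\<epsilon> / B ^ n) / d n ^ q) * (\<epsilon> / B ^ n)"
          using er[OF z] by (simp add: power2_eq_square mult_ac)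
        also have "\<dots> = \<eta> / 2 ^ n * (\<epsilon> / B ^ n)" unfolding Qd ..
        \<comment> \<open>One of the two error factors is spent on the small divisors and becomes
          \<open>\<eta> / 2 ^ n\<close>, which is at most \<open>1 / B\<close> by the smallness
          assumption; the other one carries the induction.\<close>
        also have "\<dots> \<le> 1 / B * (\<epsilon> / B ^ n)"
        proof (rule mult_right_mono)
          have "\<eta> / 2 ^ n \<le> \<eta>" using \<eta>0 by (simp add: divide_le_eq mult_le_cancel_left1)
          also have "\<dots> \<le> 1 / B" using B\<eta> B1 by (simp add: field_simps)
          finally show "\<eta> / 2 ^ n \<le> 1 / B" .
        qed (use e0 B1 in simp)
        finally show ?thesis by simp
      qed
      have 6: "\<bar>a + v - a0\<bar> \<le> 2 * \<eta> * (1 - 1 / 2 ^ Suc n)" using aa v half by linarith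
      show ?thesis unfolding Inv_def fst_conv snd_conv using 1 2 3 4 5 6 h(2) u(3) by (blast intro: Reals_add)
    qed
    moreover have "Rel n x (\<lambda>z. h z + u z, a + v)"
      unfolding Rel_def x using u1 v by simp
    ultimately show "\<exists>y. Inv (Suc n) y \<and> Rel n x y" by blast
  qed
  then obtain X where X: "\<And>n. Inv n (X n)" "\<And>n. Rel n (X n) (X (Suc n))" by blast
  define h where "h n = fst (X n)" for n
  define a where "a n = snd (X n)" for n
  have ws: "z \<in> strip (w n)" if "z \<in> strip s1" for z n using that strip_mono[OF w(1)] by blast
  have h: "perhol (w n) (\<lambda>z. h n z - z)" "\<And>y::real. h n (of_real y) \<in> \<real>" "average (\<lambda>z. h n z - z) = 0" for n
    using X(1)[of n] unfolding Inv_def h_def by auto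
  have hp: "perhol s1 (\<lambda>z. h n z - z)" for n by (rule perhol_mono[OF h(1) w(1)])
  have le: "2 * \<eta> * (1 - 1 / 2 ^ n) \<le> 2 * \<eta>" for n using \<eta>0 by (simp add: mult_left_le)
  have hh: "norm (h n z - h0 z) \<le> 2 * \<eta>" and eh: "norm (cerr f (h n) (a n) \<theta> z) \<le> \<epsilon> / B ^ n"
    if z: "z \<in> strip s1" for n z
  proof -
    have "norm (h n z - h0 z) \<le> 2 * \<eta> * (1 - 1 / 2 ^ n)" "norm (cerr f (h n) (a n) \<theta> z) \<le> \<epsilon> / B ^ n"
      using X(1)[of n] ws[OF z, of n] unfolding Inv_def h_def a_def by blast+
    then show "norm (h n z - h0 z) \<le> 2 * \<eta>" "norm (cerr f (h n) (a n) \<theta> z) \<le> \<epsilon> / B ^ n"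
      using le[of n] by auto
  qed
  have aa: "\<bar>a n - a0\<bar> \<le> 2 * \<eta>" for n
    using X(1)[of n] le[of n] unfolding Inv_def a_def by linarith
  have dh: "norm (h (Suc n) z - h n z) \<le> \<eta> / 2 ^ n" if "z \<in> strip s1" for n z
    using X(2)[of n] ws[OF that, of "Suc n"] unfolding Rel_def h_def by blast
  have da: "norm (a (Suc n) - a n) \<le> \<eta> / 2 ^ n" for n
    using X(2)[of n] unfolding Rel_def a_def by simp
  have sm: "summable (\<lambda>n. \<eta> / 2 ^ n)"
  proof -
    have "summable (\<lambda>n. \<eta> * (1 / 2) ^ n)" by (intro summable_mult summable_geometric) simp
    then show ?thesis by (simp add: power_divide)
  qed
  define H where "H z = h 0 z + (\<Sum>n. h (Suc n) z - h n z)" for z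
  have "uniform_limit (strip s1) (\<lambda>n z. \<Sum>i<n. h (Suc i) z - h i z) (\<lambda>z. \<Sum>i. h (Suc i) z - h i z) sequentially"
    by (rule Weierstrass_m_test[OF dh sm])
  moreover have "dist (\<Sum>i<n. h (Suc i) z - h i z) (\<Sum>i. h (Suc i) z - h i z) = dist (h n z) (H z)" for n z
    using sum_lessThan_telescope[of "\<lambda>i. h i z" n] by (simp add: H_def dist_norm diff_diff_eq)
  ultimately have ul: "uniform_limit (strip s1) h H sequentially"
    unfolding uniform_limit_iff by simp
  have "summable (\<lambda>n. a (Suc n) - a n)"
    by (rule summable_comparison_test'[OF sm, of 0]) (use da in simp)
  then have "(\<lambda>n. \<Sum>i<n. a (Suc i) - a i) \<longlonglongrightarrow> (\<Sum>n. a (Suc n) - a n)"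
    by (rule summable_LIMSEQ)
  then have "(\<lambda>n. a n - a 0) \<longlonglongrightarrow> (\<Sum>n. a (Suc n) - a n)"
    by (simp add: sum_lessThan_telescope)
  then have "(\<lambda>n. a n - a 0 + a 0) \<longlonglongrightarrow> (\<Sum>n. a (Suc n) - a n) + a 0"
    by (intro tendsto_add tendsto_const)
  then obtain ai where ai: "a \<longlonglongrightarrow> ai" by auto
  have Be: "(\<lambda>n. \<epsilon> / B ^ n) \<longlonglongrightarrow> 0"
  proof -
    have "1 < B" unfolding B_def by (rule one_less_power) auto
    then show ?thesis by (intro LIMSEQ_divide_realpow_zero)
  qed
  \<comment> \<open>One index that is good in all three respects. The bounds, the reality, the
    normalization and the conjugacy equation of the limit are then obtained from the approximants,
    with \<open>r\<close> arbitrary.\<close>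
  have approx: "\<exists>n. (\<forall>z\<in>strip s1. norm (H z - h n z) < r) \<and> \<bar>ai - a n\<bar> < r \<and> \<epsilon> / B ^ n < r" if r: "0 < r" for r
  proof -
    have "\<forall>\<^sub>F n in sequentially. \<forall>z\<in>strip s1. dist (h n z) (H z) < r"
      using uniform_limitD[OF ul r] .
    moreover have "\<forall>\<^sub>F n in sequentially. dist (a n) ai < r" using tendstoD[OF ai r] .
    moreover have "\<forall>\<^sub>F n in sequentially. \<epsilon> / B ^ n < r" using order_tendstoD(2)[OF Be r] .
    ultimately have "\<forall>\<^sub>F n in sequentially. (\<forall>z\<in>strip s1. norm (H z - h n z) < r) \<and> \<bar>ai - a n\<bar> < r \<and> \<epsilon> / B ^ n < r"
      by eventually_elim (simp add: dist_norm norm_minus_commute abs_minus_commute)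
    then show ?thesis using eventually_happens'[OF sequentially_bot] by blast
  qed
  have Hh: "norm (H z - h0 z) \<le> 2 * \<eta>" if z: "z \<in> strip s1" for z
  proof (rule field_le_epsilon)
    fix r :: real assume "0 < r"
    then obtain n where "norm (H z - h n z) < r" using approx z by blast
    then show "norm (H z - h0 z) \<le> 2 * \<eta> + r"
      using hh[OF z, of n] norm_triangle_ineq[of "H z - h n z" "h n z - h0 z"] by simp
  qed
  have aia: "\<bar>ai - a0\<bar> \<le> 2 * \<eta>"
  proof (rule field_le_epsilon)
    fix r :: real assume "0 < r"
    then obtain n where "\<bar>ai - a n\<bar> < r" using approx by blast
    then show "\<bar>ai - a0\<bar> \<le> 2 * \<eta> + r" using aa[of n] by linarith
  qed
  have Hhol: "H holomorphic_on strip s1"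
  proof (rule holomorphic_uniform_sequence[OF open_strip near_id_hol[OF hp]])
    fix x assume "x \<in> strip s1"
    then obtain d where d: "0 < d" "cball x d \<subseteq> strip s1"
      using open_strip open_contains_cball by blast
    then show "\<exists>d>0. cball x d \<subseteq> strip s1 \<and> uniform_limit (cball x d) h H sequentially"
      using uniform_limit_on_subset[OF ul] by blast
  qed
  have "H (z + 1) - (z + 1) = H z - z" if z: "z \<in> strip s1" for z
  proof -
    have "h n (z + 1) = h n z + 1" for n using near_id_per[OF hp z] .
    then show ?thesis by (simp add: H_def)
  qed
  then have Hp: "perhol s1 (\<lambda>z. H z - z)"
    unfolding perhol_def using Hhol by (auto intro!: holomorphic_on_diff holomorphic_on_ident)
  have Hr: "H (of_real x) \<in> \<real>" for x :: real
  proof -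
    have "Im (H (of_real x)) = 0"
    proof (rule norm_le_all_imp_zero[of 1])
      fix r :: real assume "0 < r"
      then obtain n where n: "norm (H (of_real x) - h n (of_real x)) < r"
        using approx s by (meson of_real_in_strip)
      have "Im (h n (of_real x)) = 0" using h(2)[of n x] complex_is_Real_iff by blast
      then have "\<bar>Im (H (of_real x))\<bar> = \<bar>Im (H (of_real x) - h n (of_real x))\<bar>" by simp
      then show "norm (Im (H (of_real x))) \<le> 1 * r"
        using n abs_Im_le_cmod[of "H (of_real x) - h n (of_real x)"] by simp
    qed simp
    then show ?thesis by (simp add: complex_is_Real_iff)
  qed
  have Hav: "average (\<lambda>z. H z - z) = 0"
  proof (rule norm_le_all_imp_zero[of 1])
    fix r :: real assume "0 < r"
    then obtain n where n: "\<And>z. z \<in> strip s1 \<Longrightarrow> norm (H z - h n z) < r"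
      using approx by blast
    have con: "continuous_on {0..1} (\<lambda>x::real. H (of_real x) - of_real x)"
        "continuous_on {0..1} (\<lambda>x::real. h n (of_real x) - of_real x)"
      using Hp hp[of n] s continuous_on_reals[of "\<lambda>z. H z - z" s1] continuous_on_reals[of "\<lambda>z. h n z - z" s1]
      by (auto simp: perhol_def)
    have "average (\<lambda>z. H z - z) = average (\<lambda>z. (H z - z) - (h n z - z))"
      using con by (subst average_diff) (auto simp: h(3))
    also have "norm \<dots> \<le> r"
    proof (rule average_norm_le)
      show "continuous_on {0..1} (\<lambda>x::real. (H (of_real x) - of_real x) - (h n (of_real x) - of_real x))"
        by (rule continuous_on_diff[OF con])
      show "norm ((H (of_real x) - of_real x) - (h n (of_real x) - of_real x)) \<le> r" for x :: real
        using n[of "of_real x"] s by simp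
    qed
    finally show "norm (average (\<lambda>z. H z - z)) \<le> 1 * r" by simp
  qed simp
  have cba: "b \<in> cball a0 (1 / S)" if "\<bar>b - a0\<bar> \<le> 2 * \<eta>" for b
    using that \<eta>S1 by (simp add: dist_real_def)
  have inP: "y \<in> strip P" if z: "z \<in> strip s1" and y: "norm (y - h0 z) \<le> 2 * \<eta>" for y z
  proof -
    have "z \<in> strip s0" using z s strip_mono[of s1 s0] by auto
    then have "\<bar>Im (h0 z)\<bar> < P - 1 / S" using adm_in[OF adm0 s0] by (simp add: strip_def)
    moreover have "\<bar>Im y\<bar> \<le> \<bar>Im (h0 z)\<bar> + \<bar>Im (y - h0 z)\<bar>" by simp
    ultimately show ?thesis
      using y \<eta>S1 abs_Im_le_cmod[of "y - h0 z"] by (simp add: strip_def)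
  qed
  have Heq: "f ai (H z) = H (z + of_real \<theta>)" if z: "z \<in> strip s1" for z
  proof -
    have "f ai (H z) - H (z + of_real \<theta>) = 0"
    \<comment> \<open>Two Lipschitz bounds of \<open>f\<close>, for the parameter and for the
      argument, contribute \<open>2 * S\<close>; the error of the approximant and the replacement of
      \<open>H\<close> at the shifted point contribute 1 each.\<close>
    proof (rule norm_le_all_imp_zero[of "2 * S + 2"])
      fix r :: real assume "0 < r"
      then obtain n where n: "\<And>z. z \<in> strip s1 \<Longrightarrow> norm (H z - h n z) < r" "\<bar>ai - a n\<bar> < r" "\<epsilon> / B ^ n < r"
        using approx by blast
      have seg: "closed_segment (a n) ai \<subseteq> A"
        using closed_segment_subset[OF cba[OF aa] cba[OF aia] convex_cball] adm_A[OF adm0 s0] by blast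
      have "norm (f ai (H z) - f (a n) (H z)) \<le> S * \<bar>ai - a n\<bar>"
        by (rule f_lip_a[OF seg inP[OF z Hh[OF z]]])
      also have "\<dots> \<le> S * r" using n(2) S_ge_1 by (intro mult_left_mono) auto
      finally have 1: "norm (f ai (H z) - f (a n) (H z)) \<le> S * r" .
      have "norm (f (a n) (H z) - f (a n) (h n z)) \<le> S * norm (H z - h n z)"
        using seg by (intro f_lip_z inP[OF z] Hh[OF z] hh[OF z]) auto
      also have "\<dots> \<le> S * r" using n(1)[OF z] S_ge_1 by (intro mult_left_mono) auto
      finally have 2: "norm (f (a n) (H z) - f (a n) (h n z)) \<le> S * r" .
      have 3: "norm (cerr f (h n) (a n) \<theta> z) \<le> r" using eh[OF z, of n] n(3) by linarith
      have 4: "norm (h n (z + of_real \<theta>) - H (z + of_real \<theta>)) \<le> r"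
        using n(1)[of "z + of_real \<theta>"] z by (simp add: norm_minus_commute less_imp_le)
      have "f ai (H z) - H (z + of_real \<theta>) = (f ai (H z) - f (a n) (H z)) + (f (a n) (H z) - f (a n) (h n z))
          + cerr f (h n) (a n) \<theta> z + (h n (z + of_real \<theta>) - H (z + of_real \<theta>))"
        by (simp add: cerr_def)
      also have "norm \<dots> \<le> S * r + S * r + r + r"
        by (intro norm_triangle_mono 1 2 3 4)
      finally show "norm (f ai (H z) - H (z + of_real \<theta>)) \<le> (2 * S + 2) * r" by (simp add: algebra_simps)
    qed (use S_ge_1 in simp)
    then show ?thesis by simp
  qed
  show ?thesis
    by (rule that[OF Hp Hr Hav _ _ Heq]) (use Hh aia \<eta>K in \<open>force+\<close>)
qed

end

section \<open>Dependence on the frequency\<close>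

text \<open>The constants of \<open>linear_estimate\<close> for the function and for the parameter,
  added up, with every bound equal to \<open>S\<close> and a loss of a quarter of the gap
  \<open>g\<close>.\<close>

definition lip_loss :: "real \<Rightarrow> real \<Rightarrow> real \<Rightarrow> real \<Rightarrow> real" where
  "lip_loss S \<gamma> \<tau> g = S * (1 + S) * KR \<tau> * (1 + S * S * S) * S / (\<gamma> * (g / 4) powr \<tau>) + S * S"

text \<open>The constant of \<open>interpolation_estimate\<close> for an intermediate strip one
  quarter of the gap above the inner one, where \<open>s1 + s2 - 2 * m\<close> equals
  \<open>g / 2\<close>.\<close>

definition lip_interp :: "real \<Rightarrow> real" where
  "lip_interp g = 2 / (1 - exp (- (pi * (g / 2))))"

text \<open>The summands have separate duties: the first is the actual Lipschitz constant, the
  second lets the quadratic term be absorbed, \<open>4 * S\<^sup>2\<close> covers frequencies that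
  are far apart, and \<open>2 * S\<close> keeps the points compared inside the domain.\<close>

definition lip_const :: "real \<Rightarrow> real \<Rightarrow> real \<Rightarrow> real \<Rightarrow> real" where
  "lip_const S \<gamma> \<tau> g = 2 * lip_loss S \<gamma> \<tau> g * (1 + 4 * S ^ 3 + 2 / g)
     + 2 * lip_loss S \<gamma> \<tau> g * (4 * S\<^sup>2 * (lip_interp g)\<^sup>2) + 4 * S\<^sup>2 + 2 * S"

lemma lip_interp_ge: "0 < g \<Longrightarrow> 2 \<le> lip_interp g"
  unfolding lip_interp_def by (simp add: pos_le_divide_eq)

lemma lip_loss_pos:
  assumes "1 \<le> S" "0 < \<gamma>" "0 \<le> \<tau>" "0 < g"
  shows "0 < lip_loss S \<gamma> \<tau> g"
  unfolding lip_loss_def using assms KR_pos[of \<tau>]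
  by (intro add_nonneg_pos divide_nonneg_nonneg mult_nonneg_nonneg) auto

context kam_family
begin

text \<open>The difference \<open>w\<close> of the corrections for two frequencies solves the linearized equation at the
  exact solution \<open>H1\<close>, up to a term quadratic in \<open>w\<close>. Interpolation turns the
  square on the intermediate strip into the product of the small outer norm and the inner norm,
  so no further iteration is needed.\<close>

lemma lipschitz_estimate:
  assumes adm1: "adm A P G S s0 H1 b1 \<theta>1" and dio: "\<theta>1 \<in> Diophantine \<gamma> \<tau>" and pos: "0 < \<gamma>" "0 \<le> \<tau>"
    and s: "0 < s1" "s1 < s0"
    and H2: "perhol s0 (\<lambda>z. H2 z - z)" "average (\<lambda>z. H2 z - z) = 0"
    and h1: "perhol s0 (\<lambda>z. h1 z - z)" "average (\<lambda>z. h1 z - z) = 0"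
    and h2: "perhol s0 (\<lambda>z. h2 z - z)" "average (\<lambda>z. h2 z - z) = 0"
    and h1in: "\<And>z. z \<in> strip s0 \<Longrightarrow> h1 z \<in> strip (P - 2 / S)"
    and h2in: "\<And>z. z \<in> strip s0 \<Longrightarrow> h2 z \<in> strip (P - 2 / S)"
    and a1: "cball a1 (1 / S) \<subseteq> A"
    and ex1: "\<And>z. z \<in> strip s0 \<Longrightarrow> f b1 (H1 z) = H1 (z + of_real \<theta>1)"
    and ex2: "\<And>z. z \<in> strip s0 \<Longrightarrow> f b2 (H2 z) = H2 (z + of_real \<theta>2)"
    and u1: "\<And>z. z \<in> strip s0 \<Longrightarrow> norm (H1 z - h1 z) \<le> \<mu>" and u2: "\<And>z. z \<in> strip s0 \<Longrightarrow> norm (H2 z - h2 z) \<le> \<mu>"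
    and v1: "\<bar>b1 - a1\<bar> \<le> \<mu>" and v2: "\<bar>b2 - a2\<bar> \<le> \<mu>"
    and e: "\<And>z. z \<in> strip s0 \<Longrightarrow> norm (cerr f h1 a1 \<theta>1 z - cerr f h2 a2 \<theta>2 z) \<le> \<mu> * \<bar>\<theta>1 - \<theta>2\<bar>"
    and dh: "\<And>z. z \<in> strip s0 \<Longrightarrow> norm (h1 z - h2 z) \<le> S * \<bar>\<theta>1 - \<theta>2\<bar>"
    and da: "\<bar>a1 - a2\<bar> \<le> S * \<bar>\<theta>1 - \<theta>2\<bar>"
    and small: "lip_const S \<gamma> \<tau> (s0 - s1) * \<mu> \<le> 1"
  shows "z \<in> strip s1 \<Longrightarrow> norm ((H1 z - h1 z) - (H2 z - h2 z)) \<le> lip_const S \<gamma> \<tau> (s0 - s1) * \<mu> * \<bar>\<theta>1 - \<theta>2\<bar>"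
    and "\<bar>(b1 - a1) - (b2 - a2)\<bar> \<le> lip_const S \<gamma> \<tau> (s0 - s1) * \<mu> * \<bar>\<theta>1 - \<theta>2\<bar>"
proof -
  define t where "t = \<bar>\<theta>1 - \<theta>2\<bar>"
  define g where "g = s0 - s1"
  define C where "C = lip_interp g"
  define L where "L = lip_loss S \<gamma> \<tau> g"
  define k1 where "k1 = 1 + 4 * S ^ 3 + 2 / g"
  define k2 where "k2 = 4 * S\<^sup>2 * C\<^sup>2"
  define K where "K = lip_const S \<gamma> \<tau> g"
  have K: "K = 2 * L * k1 + 2 * L * k2 + 4 * S\<^sup>2 + 2 * S"
    unfolding K_def lip_const_def L_def k1_def k2_def C_def ..
  have g: "0 < g" using s by (simp add: g_def)
  have t0: "0 \<le> t" by (simp add: t_def)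
  have \<mu>0: "0 \<le> \<mu>" using v1 by linarith
  have L0: "0 < L" unfolding L_def using lip_loss_pos[OF S_ge_1 pos g] .
  have k10: "1 \<le> k1" using g S_ge_1 by (simp add: k1_def)
  have k20: "0 \<le> k2" by (simp add: k2_def)
  have C2: "2 \<le> C" unfolding C_def by (rule lip_interp_ge[OF g])
  have S2: "1 \<le> S\<^sup>2" using S_ge_1 one_le_power by blast
  have Kge: "2 * L * k1 \<le> K" "2 * L * k2 \<le> K" "4 * S\<^sup>2 \<le> K" "2 * S \<le> K"
    unfolding K using L0 k10 k20 S2 S_ge_1 by (auto simp: add_nonneg_nonneg)
  have K\<mu>: "x * \<mu> \<le> 1" if "x \<le> K" for x
    using mult_right_mono[OF that \<mu>0] small by (simp add: K_def g_def)
  have \<mu>S: "2 * \<mu> \<le> 1 / S"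
    using K\<mu>[OF Kge(4)] S_ge_1 by (simp add: field_simps)
  have S2S: "2 / S = 1 / S + 1 / S" by simp
  define w where "w z = (H1 z - h1 z) - (H2 z - h2 z)" for z
  define a where "a = (b1 - a1) - (b2 - a2)"
  have w2\<mu>: "norm (w z) \<le> 2 * \<mu>" if "z \<in> strip s0" for z
    using norm_triangle_ineq4[of "H1 z - h1 z" "H2 z - h2 z"] u1[OF that] u2[OF that] by (simp add: w_def)
  have a2\<mu>: "\<bar>a\<bar> \<le> 2 * \<mu>" using v1 v2 by (simp add: a_def)
  have goal: "(\<forall>z\<in>strip s1. norm (w z) \<le> K * \<mu> * t) \<and> \<bar>a\<bar> \<le> K * \<mu> * t"
  \<comment> \<open>For frequencies far apart the trivial bound \<open>2 * \<mu>\<close> is already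
    proportional to \<open>t\<close>. For close ones the parameters \<open>a1\<close> and
    \<open>a2\<close> are so near that the segments between them and their perturbations stay in
    \<open>A\<close>.\<close>
  proof (cases "1 \<le> 2 * S\<^sup>2 * t")
    case True
    have "2 * \<mu> * 1 \<le> 2 * \<mu> * (2 * S\<^sup>2 * t)" using True \<mu>0 by (intro mult_left_mono) auto
    also have "\<dots> = 4 * S\<^sup>2 * (\<mu> * t)" by simp
    also have "\<dots> \<le> K * (\<mu> * t)" using Kge \<mu>0 t0 by (intro mult_right_mono) auto
    finally have le: "2 * \<mu> \<le> K * \<mu> * t" by (simp add: mult.assoc)
    have "z \<in> strip s0" if "z \<in> strip s1" for z using that s strip_mono[of s1 s0] by auto
    then show ?thesis using w2\<mu> a2\<mu> le by (meson order_trans)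
  next
    case False
    have St: "S * t \<le> 1 / (2 * S)"
      using False S_ge_1 by (simp add: field_simps power2_eq_square)
    \<comment> \<open>The equation is considered on this intermediate strip: a quarter of the gap is
      lost in solving it, and the remaining three quarters serve interpolation and Cauchy's
      estimate.\<close>
    define sm where "sm = s1 + g / 4"
    have sm: "s1 < sm" "sm < s0" "0 < sm" "sm - g / 4 = s1" "s1 + s0 - 2 * sm = g / 2" "sm = s0 - 3 * g / 4"
      using g s by (auto simp: sm_def g_def field_simps)
    have sub: "z \<in> strip s0" if "z \<in> strip sm" for z using that sm strip_mono[of sm s0] by auto
    have s00: "0 < s0" using s by simp
    have con: "continuous_on {0..1} (\<lambda>x::real. q (of_real x))" if "perhol s0 q" for q
      using that s00 by (intro continuous_on_reals) (auto simp: perhol_def)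
    have H1: "perhol s0 (\<lambda>z. H1 z - z)" "average (\<lambda>z. H1 z - z) = 0"
      using adm1 by (auto simp: adm_def)
    have w': "w = (\<lambda>z. ((H1 z - z) - (h1 z - z)) - ((H2 z - z) - (h2 z - z)))"
      by (auto simp: w_def)
    have wp: "perhol s0 w" unfolding w' by (rule perhol_diff[OF perhol_diff[OF H1(1) h1(1)] perhol_diff[OF H2(1) h2(1)]])
    have wav: "average w = 0"
      unfolding w' average_diff[OF con[OF perhol_diff[OF H1(1) h1(1)]] con[OF perhol_diff[OF H2(1) h2(1)]]]
        average_diff[OF con[OF H1(1)] con[OF h1(1)]] average_diff[OF con[OF H2(1)] con[OF h2(1)]]
      using H1 H2 h1 h2 by simp
    note adm = adm1 s00
    have fz: "deriv (f b1) (H1 z) * w z = deriv H1 (z + of_real \<theta>1) * (w z / deriv H1 z)" if z: "z \<in> strip s0" for z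
    proof -
      have "deriv (cerr f H1 b1 \<theta>1) z = deriv (\<lambda>z. 0) z"
        using ex1 by (intro deriv_cong_strip[OF _ z]) (simp add: cerr_def)
      then have "deriv (f b1) (H1 z) * deriv H1 z = deriv H1 (z + of_real \<theta>1)"
        using cerr_deriv[OF adm z] by simp
      then show ?thesis using adm_d0[OF adm z] by (simp add: field_simps)
    qed
    \<comment> \<open>The second correction is transplanted to the first pair: the resulting point
      and parameter differ from the exact solution \<open>(H1, b1)\<close> by \<open>- w\<close> and
      \<open>- a\<close>. \<open>T\<close> is the Taylor remainder there, \<open>D\<close> compares
      the effect of this one correction on the two pairs, and \<open>U\<close> evaluates it at the
      two shifts.\<close>
    define T where "T z = f (a1 + (b2 - a2)) (h1 z + (H2 z - h2 z)) - f b1 (H1 z)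
        - deriv (f b1) (H1 z) * ((h1 z + (H2 z - h2 z)) - H1 z) - of_real ((a1 + (b2 - a2)) - b1) * G b1 (H1 z)" for z
    define D where "D z = (f (a1 + (b2 - a2)) (h1 z + (H2 z - h2 z)) - f a1 (h1 z))
        - (f b2 (H2 z) - f a2 (h2 z))" for z
    define U where "U z = (H2 (z + of_real \<theta>1) - h2 (z + of_real \<theta>1)) - (H2 (z + of_real \<theta>2) - h2 (z + of_real \<theta>2))" for z
    define gg where "gg z = D z - T z - U z + (cerr f h1 a1 \<theta>1 z - cerr f h2 a2 \<theta>2 z)" for z
    have eq: "deriv H1 (z + of_real \<theta>1) * (w z / deriv H1 z) - w (z + of_real \<theta>1) + G b1 (H1 z) * of_real a + gg z = 0"
      if z: "z \<in> strip s0" for z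
    proof -
      have "of_real ((a1 + (b2 - a2)) - b1) = - complex_of_real a" by (simp add: a_def)
      moreover have "(h1 z + (H2 z - h2 z)) - H1 z = - w z" by (simp add: w_def)
      ultimately have Tz: "T z = f (a1 + (b2 - a2)) (h1 z + (H2 z - h2 z)) - f b1 (H1 z)
        + deriv (f b1) (H1 z) * w z + of_real a * G b1 (H1 z)" by (simp only: T_def) simp
      have W: "w (z + of_real \<theta>1) = (H1 (z + of_real \<theta>1) - h1 (z + of_real \<theta>1)) - (H2 (z + of_real \<theta>1) - h2 (z + of_real \<theta>1))"
        by (simp add: w_def)
      show ?thesis
        unfolding fz[OF z, symmetric] gg_def Tz D_def U_def W cerr_def
        using ex1[OF z] ex2[OF z] by (simp add: algebra_simps)
    qed
    have inS: "y \<in> strip (P - 1 / S)" if "x \<in> strip (P - 2 / S)" "norm (y - x) \<le> \<mu>" for x y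
    proof -
      have "\<bar>Im y\<bar> \<le> \<bar>Im x\<bar> + \<bar>Im (y - x)\<bar>" by simp
      moreover have "\<bar>Im (y - x)\<bar> \<le> \<mu>" using that abs_Im_le_cmod[of "y - x"] by linarith
      moreover have "\<bar>Im x\<bar> < P - 2 / S" using that by (simp add: strip_def)
      ultimately have "\<bar>Im y\<bar> < P - 1 / S" using \<mu>S \<mu>0 S2S by linarith
      then show ?thesis by (simp add: strip_def)
    qed
    have segA: "closed_segment x y \<subseteq> A" if "\<bar>x - a1\<bar> \<le> 1 / S" "\<bar>y - a1\<bar> \<le> 1 / S" for x y
    proof -
      have "closed_segment x y \<subseteq> cball a1 (1 / S)"
        using that by (intro closed_segment_subset convex_cball) (auto simp: dist_real_def)
      then show ?thesis using a1 by blast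
    qed
    have half: "1 / S = 1 / (2 * S) + 1 / (2 * S)" by simp
    have D: "norm (D z) \<le> 4 * S ^ 3 * \<mu> * t" if z: "z \<in> strip s0" for z
    proof -
      have "norm ((f (a2 + (b2 - a2)) (h2 z + (H2 z - h2 z)) - f a2 (h2 z))
          - (f (a1 + (b2 - a2)) (h1 z + (H2 z - h2 z)) - f a1 (h1 z)))
        \<le> S\<^sup>2 * (\<bar>b2 - a2\<bar> + norm (H2 z - h2 z)) * (\<bar>a2 - a1\<bar> + norm (h2 z - h1 z))"
      proof (rule second_difference)
        fix x assume "x \<in> closed_segment 0 (b2 - a2)"
        then have "\<bar>x\<bar> \<le> \<mu>" using v2 by (auto simp: closed_segment_eq_real_ivl split: if_splits)
        moreover have "\<bar>a2 - a1\<bar> \<le> 1 / (2 * S)" using da St by (simp add: t_def abs_minus_commute)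
        ultimately show "closed_segment (a1 + x) (a2 + x) \<subseteq> A"
          using \<mu>S \<mu>0 half by (intro segA) linarith+
      next
        show "h1 z \<in> strip (P - 1 / S)" "h2 z \<in> strip (P - 1 / S)"
          using inS[OF h1in[OF z], of "h1 z"] inS[OF h2in[OF z], of "h2 z"] \<mu>0 by auto
        show "h1 z + (H2 z - h2 z) \<in> strip (P - 1 / S)" "h2 z + (H2 z - h2 z) \<in> strip (P - 1 / S)"
          using inS[OF h1in[OF z], of "h1 z + (H2 z - h2 z)"] inS[OF h2in[OF z], of "h2 z + (H2 z - h2 z)"] u2[OF z] by auto
      qed
      also have "\<dots> \<le> S\<^sup>2 * (\<mu> + \<mu>) * (S * t + S * t)"
        using v2 u2[OF z] da dh[OF z] S2 \<mu>0 unfolding t_def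
        by (intro mult_mono mult_left_mono add_mono) (auto simp: norm_minus_commute abs_minus_commute)
      also have "\<dots> = 4 * S ^ 3 * \<mu> * t" by (simp add: power2_eq_square power3_eq_cube)
      finally show ?thesis by (simp add: D_def norm_minus_commute)
    qed
    have T: "norm (T z) \<le> S\<^sup>2 * (norm (w z) + \<bar>a\<bar>)\<^sup>2" if z: "z \<in> strip s0" for z
    proof -
      have "norm (T z) \<le> S\<^sup>2 * (norm ((h1 z + (H2 z - h2 z)) - H1 z) + \<bar>(a1 + (b2 - a2)) - b1\<bar>)\<^sup>2"
        unfolding T_def
      proof (rule taylor2)
        have "\<mu> \<le> 1 / S" using \<mu>S \<mu>0 by linarith
        then show "closed_segment b1 (a1 + (b2 - a2)) \<subseteq> A"
          using v1 v2 by (intro segA) auto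
        show "H1 z \<in> strip (P - 1 / S)" by (rule adm_in[OF adm z])
        show "h1 z + (H2 z - h2 z) \<in> strip P"
          using inS[OF h1in[OF z], of "h1 z + (H2 z - h2 z)"] u2[OF z] by (intro strip_P) simp
      qed
      also have "(h1 z + (H2 z - h2 z)) - H1 z = - w z" by (simp add: w_def)
      also have "(a1 + (b2 - a2)) - b1 = - a" by (simp add: a_def)
      also have "norm (- w z) + \<bar>- a\<bar> = norm (w z) + \<bar>a\<bar>" by simp
      finally show ?thesis .
    qed
    have U: "norm (U z) \<le> 2 / g * \<mu> * t" if z: "z \<in> strip sm" for z
    proof -
      define q where "q x = H2 x - h2 x" for x
      have "perhol s0 (\<lambda>z. (H2 z - z) - (h2 z - z))" by (rule perhol_diff[OF H2(1) h2(1)])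
      then have q: "q holomorphic_on strip s0" by (simp add: perhol_def q_def[abs_def])
      have "norm (q (z + of_real \<theta>1) - q (z + of_real \<theta>2)) \<le> (2 / g * \<mu>) * norm ((z + of_real \<theta>1) - (z + of_real \<theta>2))"
      proof (rule field_derivative_bound_segment[where g' = "deriv q"])
        fix x assume "x \<in> closed_segment (z + complex_of_real \<theta>2) (z + complex_of_real \<theta>1)"
        then have xm: "x \<in> strip sm" using closed_segment_strip[of "z + complex_of_real \<theta>2" sm "z + complex_of_real \<theta>1"] z by auto
        show "(q has_field_derivative deriv q x) (at x)"
          by (rule holomorphic_derivI[OF q open_strip sub[OF xm]])
        have "norm (deriv q x) \<le> \<mu> / (3 * g / 4)"
          using q u2 g xm sm(6) by (intro Cauchy_strip[of _ s0]) (auto simp: q_def)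
        also have "\<dots> \<le> 2 / g * \<mu>" using g \<mu>0 by (simp add: field_simps)
        finally show "norm (deriv q x) \<le> 2 / g * \<mu>" .
      qed
      also have "norm ((z + of_real \<theta>1) - (z + of_real \<theta>2)) = t"
        unfolding t_def by (metis add_diff_cancel_left norm_of_real of_real_diff)
      finally show ?thesis by (simp add: U_def q_def)
    qed
    \<comment> \<open>Finite because of the bound \<open>2 * \<mu>\<close> on the outer strip; only
      a finite quantity can be absorbed at the end.\<close>
    define \<phi> where "\<phi> = (SUP z\<in>strip s1. norm (w z))"
    have bdd: "bdd_above ((\<lambda>z. norm (w z)) ` strip s1)"
      using w2\<mu> s strip_mono[of s1 s0] by (intro bdd_aboveI2[of _ _ "2 * \<mu>"]) auto
    have \<phi>: "norm (w z) \<le> \<phi>" if "z \<in> strip s1" for z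
      unfolding \<phi>_def using that bdd by (rule cSUP_upper)
    have \<phi>0: "0 \<le> \<phi>" using order_trans[OF norm_ge_zero \<phi>[of 0]] s by (simp add: strip_def)
    \<comment> \<open>The quadratic term becomes linear in \<open>\<phi>\<close> with the small
      factor \<open>\<mu>\<close>, although \<open>\<phi>\<close> itself refers to the inner strip
      only.\<close>
    have wm: "(norm (w z))\<^sup>2 \<le> C\<^sup>2 * (\<phi> * (2 * \<mu>))" if z: "z \<in> strip sm" for z
    proof -
      have "norm (w z) \<le> 2 / (1 - exp (- (pi * (s1 + s0 - 2 * sm)))) * sqrt (\<phi> * (2 * \<mu>))"
        using sm g by (intro interpolation_estimate[OF wp s(1) less_imp_le[OF s(2)] _ _ \<phi> w2\<mu> z]) linarith+
      then have "norm (w z) \<le> C * sqrt (\<phi> * (2 * \<mu>))"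
        unfolding sm(5) C_def lip_interp_def .
      then have "(norm (w z))\<^sup>2 \<le> (C * sqrt (\<phi> * (2 * \<mu>)))\<^sup>2" by (intro power_mono) auto
      then show ?thesis using \<phi>0 \<mu>0 by (simp add: power_mult_distrib)
    qed
    define \<psi> where "\<psi> = \<phi> + \<bar>a\<bar>"
    define B where "B = k1 * \<mu> * t + k2 * \<mu> * \<psi>"
    have gB: "norm (gg z) \<le> B" if z: "z \<in> strip sm" for z
    proof -
      have "norm (gg z) \<le> norm (D z) + norm (T z) + norm (U z) + norm (cerr f h1 a1 \<theta>1 z - cerr f h2 a2 \<theta>2 z)"
        unfolding gg_def by (intro norm_triangle_mono order_trans[OF norm_triangle_ineq4] add_mono order_refl)
      also have "\<dots> \<le> 4 * S ^ 3 * \<mu> * t + S\<^sup>2 * (norm (w z) + \<bar>a\<bar>)\<^sup>2 + 2 / g * \<mu> * t + \<mu> * t"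
        using D[OF sub[OF z]] T[OF sub[OF z]] U[OF z] e[OF sub[OF z]] unfolding t_def by (intro add_mono)
      also have "\<dots> \<le> 4 * S ^ 3 * \<mu> * t + S\<^sup>2 * (4 * C\<^sup>2 * \<mu> * \<psi>) + 2 / g * \<mu> * t + \<mu> * t"
      proof -
        have "(norm (w z) + \<bar>a\<bar>)\<^sup>2 \<le> 2 * (norm (w z))\<^sup>2 + 2 * a\<^sup>2"
          using sum_squares_bound[of "norm (w z)" "\<bar>a\<bar>"] by (simp add: power2_sum)
        also have "\<dots> \<le> 2 * (C\<^sup>2 * (\<phi> * (2 * \<mu>))) + 2 * ((2 * \<mu>) * \<bar>a\<bar>)"
        proof -
          have "a\<^sup>2 = \<bar>a\<bar> * \<bar>a\<bar>" by (simp add: power2_eq_square)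
          also have "\<dots> \<le> (2 * \<mu>) * \<bar>a\<bar>" using a2\<mu> by (intro mult_right_mono) auto
          finally show ?thesis using wm[OF z] by linarith
        qed
        also have "\<dots> \<le> 4 * C\<^sup>2 * \<mu> * \<phi> + 4 * C\<^sup>2 * \<mu> * \<bar>a\<bar>"
        proof -
          have "1 \<le> C\<^sup>2" using C2 one_le_power[of C 2] by linarith
          then have "1 * (4 * \<mu> * \<bar>a\<bar>) \<le> C\<^sup>2 * (4 * \<mu> * \<bar>a\<bar>)" using \<mu>0 by (intro mult_right_mono) auto
          then show ?thesis by (simp add: mult_ac)
        qed
        also have "\<dots> = 4 * C\<^sup>2 * \<mu> * \<psi>" by (simp add: \<psi>_def algebra_simps)
        finally have "S\<^sup>2 * (norm (w z) + \<bar>a\<bar>)\<^sup>2 \<le> S\<^sup>2 * (4 * C\<^sup>2 * \<mu> * \<psi>)" by (intro mult_left_mono) auto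
        then show ?thesis by linarith
      qed
      also have "\<dots> = B" by (simp add: B_def k1_def k2_def algebra_simps)
      finally show ?thesis .
    qed
    have smle: "sm \<le> s0" using sm by simp
    have le0: "norm (G b1 (H1 z)) \<le> S" if "z \<in> strip sm" for z
      using bG[OF adm_a[OF adm] strip_P[OF adm_in[OF adm sub[OF that]]]] .
    have d: "0 < g / 4" "g / 4 < sm" using g s by (auto simp: sm_def)
    note le = linear_estimate[OF dio pos perhol_mono[OF perhol_near_id_deriv[OF H1(1)] smle] average_deriv_near_id[OF H1(1) s00]
        adm_d0[OF adm sub] adm_d1[OF adm sub] adm_d2[OF adm sub] perhol_mono[OF adm_coef[OF adm] smle] le0
        adm_b0[OF adm] adm_b1[OF adm] perhol_mono[OF wp smle] wav eq[OF sub] gB d]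
    have "norm (complex_of_real a) \<le> S * S * B" by (rule le(1))
    then have aB: "\<bar>a\<bar> \<le> S * S * B" by simp
    define L1 where "L1 = S * (1 + S) * KR \<tau> * (1 + S * S * S) * S / (\<gamma> * (g / 4) powr \<tau>)"
    have wB: "norm (w z) \<le> L1 * B" if "z \<in> strip s1" for z
      using le(2)[of z] that unfolding sm(4) L1_def by simp
    have "\<phi> \<le> L1 * B"
      unfolding \<phi>_def using wB s by (intro cSUP_least) (auto simp: strip_def intro!: exI[of _ 0])
    then have "\<psi> \<le> L1 * B + S * S * B" unfolding \<psi>_def using aB by linarith
    also have "\<dots> = L * B" by (simp add: L_def lip_loss_def L1_def algebra_simps)
    also have "\<dots> = L * k1 * \<mu> * t + (L * k2 * \<mu>) * \<psi>" by (simp add: B_def algebra_simps)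
    \<comment> \<open>\<open>\<psi>\<close> stands on both sides; by the smallness assumption its
      coefficient on the right is at most one half, so it can be moved to the left.\<close>
    also have "\<dots> \<le> L * k1 * \<mu> * t + 1 / 2 * \<psi>"
    proof -
      have "L * k2 * \<mu> \<le> 1 / 2" using K\<mu>[OF Kge(2)] by simp
      moreover have "0 \<le> \<psi>" using \<phi>0 by (simp add: \<psi>_def)
      ultimately show ?thesis by (intro add_left_mono mult_right_mono)
    qed
    finally have "\<psi> \<le> 2 * L * k1 * (\<mu> * t)" by (simp add: mult_ac)
    also have "\<dots> \<le> K * (\<mu> * t)" using Kge \<mu>0 t0 by (intro mult_right_mono) auto
    finally have "\<psi> \<le> K * \<mu> * t" by (simp add: mult.assoc)
    then show ?thesis using \<phi> \<phi>0 unfolding \<psi>_def by fastforce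
  qed
  show "\<bar>(b1 - a1) - (b2 - a2)\<bar> \<le> lip_const S \<gamma> \<tau> (s0 - s1) * \<mu> * \<bar>\<theta>1 - \<theta>2\<bar>"
    using goal unfolding K_def g_def t_def a_def by blast
  show "norm ((H1 z - h1 z) - (H2 z - h2 z)) \<le> lip_const S \<gamma> \<tau> (s0 - s1) * \<mu> * \<bar>\<theta>1 - \<theta>2\<bar>" if "z \<in> strip s1"
    using goal that unfolding K_def g_def t_def w_def by blast
qed

end

section \<open>Measure and norms\<close>

text \<open>A Lipschitz map is continuous and maps null sets to null sets; together these preserve
  Lebesgue measurability.\<close>

lemma lipschitz_image_sets_lebesgue:
  fixes \<alpha> :: "real \<Rightarrow> real"
  assumes \<Theta>: "\<Theta> \<in> sets lebesgue" and L: "\<And>s t. s \<in> \<Theta> \<Longrightarrow> t \<in> \<Theta> \<Longrightarrow> \<bar>\<alpha> t - \<alpha> s\<bar> \<le> L * \<bar>t - s\<bar>"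
  shows "\<alpha> ` \<Theta> \<in> sets lebesgue"
proof (rule sets_lebesgue_continuous_image[OF \<Theta>])
  show "continuous_on \<Theta> \<alpha>"
  proof (rule continuous_onI)
    fix x e :: real assume x: "x \<in> \<Theta>" and e: "0 < e"
    show "\<exists>d>0. \<forall>y\<in>\<Theta>. dist y x < d \<longrightarrow> dist (\<alpha> y) (\<alpha> x) \<le> e"
    proof (intro exI conjI ballI impI)
      show "0 < e / (\<bar>L\<bar> + 1)" using e by simp
      fix y assume y: "y \<in> \<Theta>" "dist y x < e / (\<bar>L\<bar> + 1)"
      have "\<bar>\<alpha> y - \<alpha> x\<bar> \<le> L * \<bar>y - x\<bar>" using L[OF x y(1)] .
      also have "\<dots> \<le> (\<bar>L\<bar> + 1) * \<bar>y - x\<bar>" by (intro mult_right_mono) auto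
      also have "\<dots> \<le> e" using y(2) by (simp add: dist_real_def field_simps)
      finally show "dist (\<alpha> y) (\<alpha> x) \<le> e" by (simp add: dist_real_def)
    qed
  qed
  show "negligible (\<alpha> ` T)" if "negligible T" "T \<subseteq> \<Theta>" for T
  proof (rule negligible_locally_Lipschitz_image)
    fix x assume "x \<in> T"
    then show "\<exists>U B. open U \<and> x \<in> U \<and> (\<forall>y\<in>T \<inter> U. norm (\<alpha> y - \<alpha> x) \<le> B * norm (y - x))"
      using L that by (intro exI[of _ UNIV] exI[of _ L]) auto
  qed (use that in auto)
qed auto

text \<open>Cover the image by an open set of almost the same measure; the preimage of each of its
  components has diameter at most \<open>1 / l\<close> times the length of the component.\<close>

lemma emeasure_expansive_image:
  fixes \<alpha> :: "real \<Rightarrow> real"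
  assumes Y: "\<alpha> ` \<Theta> \<in> sets lebesgue" and l: "0 < l"
    and ex: "\<And>s t. s \<in> \<Theta> \<Longrightarrow> t \<in> \<Theta> \<Longrightarrow> l * \<bar>t - s\<bar> \<le> \<bar>\<alpha> t - \<alpha> s\<bar>"
  shows "ennreal l * emeasure lebesgue \<Theta> \<le> emeasure lebesgue (\<alpha> ` \<Theta>)"
proof (rule ennreal_le_epsilon)
  fix e :: real assume e: "0 < e"
  obtain T where T: "open T" "\<alpha> ` \<Theta> \<subseteq> T" "T - \<alpha> ` \<Theta> \<in> lmeasurable" "emeasure lebesgue (T - \<alpha> ` \<Theta>) < ennreal e"
    using sets_lebesgue_outer_open[OF Y e] by blast
  define CC where "CC = components T"
  have opC: "open C" if "C \<in> CC" for C using that T(1) open_components unfolding CC_def by blast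
  have cC: "countable CC"
    using pairwise_disjoint_components[of T] opC
    by (intro countable_disjoint_open_subsets) (auto simp: CC_def pairwise_def disjnt_def)
  define F where "F n = (if n \<in> to_nat_on CC ` CC then from_nat_into CC n else {})" for n
  have FC: "F n \<in> CC \<or> F n = {}" for n
    using from_nat_into_to_nat_on[OF cC] by (auto simp: F_def)
  have dis: "disjoint_family F"
    unfolding disjoint_family_on_def
  proof (intro ballI impI)
    fix i j :: nat assume ij: "i \<noteq> j"
    show "F i \<inter> F j = {}"
    proof (cases "i \<in> to_nat_on CC ` CC \<and> j \<in> to_nat_on CC ` CC")
      case True
      then obtain C D where "C \<in> CC" "D \<in> CC" "i = to_nat_on CC C" "j = to_nat_on CC D" by blast
      then have "F i = C" "F j = D" "C \<noteq> D" "C \<in> CC" "D \<in> CC"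
        using ij from_nat_into_to_nat_on[OF cC] by (auto simp: F_def)
      then show ?thesis using components_nonoverlap[of C T D] by (simp add: CC_def)
    qed (auto simp: F_def)
  qed
  have UF: "(\<Union>n. F n) = T"
  proof
    show "(\<Union>n. F n) \<subseteq> T" using FC in_components_subset unfolding CC_def by fastforce
    show "T \<subseteq> (\<Union>n. F n)"
    proof
      fix x assume "x \<in> T"
      then obtain C where C: "C \<in> CC" "x \<in> C" using Union_components[of T] unfolding CC_def by blast
      then have "x \<in> F (to_nat_on CC C)" using from_nat_into_to_nat_on[OF cC C(1)] by (simp add: F_def)
      then show "x \<in> (\<Union>n. F n)" by blast
    qed
  qed
  have Fopen: "open (F n)" for n using FC[of n] opC by auto
  have Fsets: "F n \<in> sets lebesgue" for n
    using Fopen[of n] by (simp add: borel_open)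
  have Fcon: "connected (F n)" for n
    using FC[of n] in_components_connected unfolding CC_def by auto
  have diam: "ennreal \<bar>y - x\<bar> \<le> emeasure lebesgue (F n)" if "x \<in> F n" "y \<in> F n" for x y n
  proof -
    have "ennreal (y - x) \<le> emeasure lebesgue (F n)" if "x \<in> F n" "y \<in> F n" "x \<le> y" for x y
    proof -
      have "{x..y} \<subseteq> F n" using connected_contains_Icc[OF Fcon] that by blast
      then have "emeasure lebesgue {x..y} \<le> emeasure lebesgue (F n)"
        using Fsets by (intro emeasure_mono)
      then show ?thesis using that by simp
    qed
    from this[of x y] this[of y x] that show ?thesis by (cases "x \<le> y") auto
  qed
  \<comment> \<open>The preimage of a component is enclosed in a measurable set instead of being
    measured itself: in the interval between its infimum and supremum, or in the whole line if the
    component has infinite measure.\<close>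
  have "\<exists>J. J \<in> sets lebesgue \<and> {s\<in>\<Theta>. \<alpha> s \<in> F n} \<subseteq> J \<and> ennreal l * emeasure lebesgue J \<le> emeasure lebesgue (F n)" for n
  proof (cases "emeasure lebesgue (F n) = \<infinity> \<or> {s\<in>\<Theta>. \<alpha> s \<in> F n} = {}")
    case True
    then show ?thesis
    proof
      assume "emeasure lebesgue (F n) = \<infinity>"
      then show ?thesis by (intro exI[of _ UNIV]) auto
    next
      assume "{s\<in>\<Theta>. \<alpha> s \<in> F n} = {}"
      then show ?thesis by (intro exI[of _ "{}"]) auto
    qed
  next
    case False
    define X where "X = {s\<in>\<Theta>. \<alpha> s \<in> F n}"
    obtain D where D: "emeasure lebesgue (F n) = ennreal D" "0 \<le> D"
      using False by (cases "emeasure lebesgue (F n)") auto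
    have close: "\<bar>t - s\<bar> \<le> D / l" if "s \<in> X" "t \<in> X" for s t
    proof -
      have "ennreal \<bar>\<alpha> t - \<alpha> s\<bar> \<le> ennreal D" using diam[of "\<alpha> s" n "\<alpha> t"] that D by (simp add: X_def)
      then have "\<bar>\<alpha> t - \<alpha> s\<bar> \<le> D" using D by simp
      then have "l * \<bar>t - s\<bar> \<le> D" using ex[of s t] that by (simp add: X_def)
      then show ?thesis using l by (simp add: field_simps)
    qed
    obtain x0 where x0: "x0 \<in> X" using False by (auto simp: X_def)
    have bd: "bdd_below X" "bdd_above X"
      using close[OF x0] by (auto intro!: bdd_belowI[of _ "x0 - D / l"] bdd_aboveI[of _ "x0 + D / l"] simp: abs_le_iff) force+
    have sub: "X \<subseteq> {Inf X..Sup X}"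
      using bd by (auto intro: cInf_lower cSup_upper)
    have "Sup X \<le> Inf X + D / l"
    proof (rule cSup_least)
      show "X \<noteq> {}" using x0 by auto
      fix t assume t: "t \<in> X"
      have "t - D / l \<le> Inf X"
        using x0 close[OF _ t] by (intro cInf_greatest) (auto simp: abs_le_iff, fastforce)
      then show "t \<le> Inf X + D / l" by simp
    qed
    then have "l * (Sup X - Inf X) \<le> D" using l by (simp add: field_simps)
    moreover have "Inf X \<le> Sup X" using sub x0 by fastforce
    ultimately have "ennreal l * emeasure lebesgue {Inf X..Sup X} \<le> emeasure lebesgue (F n)"
      using l D by (simp add: ennreal_mult [symmetric])
    then show ?thesis using sub unfolding X_def by (intro exI[of _ "{Inf X..Sup X}"]) (auto simp: X_def)
  qed
  then obtain J where J: "\<And>n. J n \<in> sets lebesgue" "\<And>n. {s\<in>\<Theta>. \<alpha> s \<in> F n} \<subseteq> J n"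
      "\<And>n. ennreal l * emeasure lebesgue (J n) \<le> emeasure lebesgue (F n)"
    by metis
  have "\<Theta> \<subseteq> (\<Union>n. J n)"
  proof
    fix s assume s: "s \<in> \<Theta>"
    then have "\<alpha> s \<in> (\<Union>n. F n)" using T(2) UF by blast
    then show "s \<in> (\<Union>n. J n)" using J(2) s by blast
  qed
  then have "emeasure lebesgue \<Theta> \<le> emeasure lebesgue (\<Union>n. J n)"
    using J(1) by (intro emeasure_mono) auto
  also have "\<dots> \<le> (\<Sum>n. emeasure lebesgue (J n))"
    using J(1) by (intro emeasure_subadditive_countably) auto
  finally have "ennreal l * emeasure lebesgue \<Theta> \<le> ennreal l * (\<Sum>n. emeasure lebesgue (J n))"
    by (intro mult_left_mono) auto
  also have "\<dots> = (\<Sum>n. ennreal l * emeasure lebesgue (J n))" by simp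
  also have "\<dots> \<le> (\<Sum>n. emeasure lebesgue (F n))"
    by (intro suminf_le J(3) summableI)
  also have "\<dots> = emeasure lebesgue T"
    using suminf_emeasure[of F lebesgue] Fsets dis UF by auto
  also have "\<dots> = emeasure lebesgue (\<alpha> ` \<Theta>) + emeasure lebesgue (T - \<alpha> ` \<Theta>)"
  proof -
    have "emeasure lebesgue (\<alpha> ` \<Theta> \<union> (T - \<alpha> ` \<Theta>)) = emeasure lebesgue (\<alpha> ` \<Theta>) + emeasure lebesgue (T - \<alpha> ` \<Theta>)"
      using Y T(3) by (intro plus_emeasure[symmetric]) auto
    moreover have "\<alpha> ` \<Theta> \<union> (T - \<alpha> ` \<Theta>) = T" using T(2) by auto
    ultimately show ?thesis by simp
  qed
  also have "\<dots> \<le> emeasure lebesgue (\<alpha> ` \<Theta>) + ennreal e"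
    using T(4) by (intro add_left_mono less_imp_le)
  finally show "ennreal l * emeasure lebesgue \<Theta> \<le> emeasure lebesgue (\<alpha> ` \<Theta>) + ennreal e" .
qed

section \<open>Extended norms as pointwise bounds\<close>

lemma strip_norm_le_iff: "0 \<le> B \<Longrightarrow> strip_norm s g \<le> ennreal B \<longleftrightarrow> (\<forall>z\<in>strip s. norm (g z) \<le> B)"
  unfolding strip_norm_def by (simp add: SUP_le_iff)

lemma fam_norm_le_iff:
  "0 \<le> B \<Longrightarrow> fam_norm \<Theta> s g \<le> ennreal B \<longleftrightarrow> (\<forall>\<theta>\<in>\<Theta>. \<forall>z\<in>strip s. norm (g \<theta> z) \<le> B)"
  unfolding fam_norm_def by (simp add: SUP_le_iff strip_norm_le_iff)

lemma sup_norm_le_iff: "0 \<le> B \<Longrightarrow> sup_norm \<Theta> g \<le> ennreal B \<longleftrightarrow> (\<forall>\<theta>\<in>\<Theta>. norm (g \<theta>) \<le> B)"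
  unfolding sup_norm_def by (simp add: SUP_le_iff)

lemma sup_Lip_le_iff:
  "0 \<le> L \<Longrightarrow> sup_Lip \<Theta> g \<le> ennreal L \<longleftrightarrow> (\<forall>s\<in>\<Theta>. \<forall>t\<in>\<Theta>. \<bar>g t - g s\<bar> \<le> L * \<bar>t - s\<bar>)"
proof -
  assume L: "0 \<le> L"
  have *: "\<bar>g t - g s\<bar> / \<bar>t - s\<bar> \<le> L \<longleftrightarrow> \<bar>g t - g s\<bar> \<le> L * \<bar>t - s\<bar>" if "s \<noteq> t" for s t
    using that by (simp add: pos_divide_le_eq)
  have "sup_Lip \<Theta> g \<le> ennreal L \<longleftrightarrow> (\<forall>s\<in>\<Theta>. \<forall>t\<in>\<Theta>. s \<noteq> t \<longrightarrow> \<bar>g t - g s\<bar> / \<bar>t - s\<bar> \<le> L)"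
    unfolding sup_Lip_def using L by (auto simp: SUP_le_iff)
  then show ?thesis using * by (metis abs_zero diff_self mult_zero_right order_refl)
qed

lemma divide_ennreal_le_iff: "0 < r \<Longrightarrow> 0 \<le> L \<Longrightarrow> x / ennreal r \<le> ennreal L \<longleftrightarrow> x \<le> ennreal (L * r)"
proof (cases x)
  case (real y)
  assume "0 < r" "0 \<le> L"
  then show ?thesis using real by (simp add: divide_ennreal pos_divide_le_eq)
next
  case top
  assume "0 < r" "0 \<le> L"
  then show ?thesis using top by (simp add: ennreal_top_divide top_unique)
qed

lemma fam_Lip_le_iff:
  "0 \<le> L \<Longrightarrow> fam_Lip \<Theta> \<rho> g \<le> ennreal L \<longleftrightarrow>
    (\<forall>s\<in>\<Theta>. \<forall>t\<in>\<Theta>. \<forall>z\<in>strip \<rho>. norm (g t z - g s z) \<le> L * \<bar>t - s\<bar>)"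
proof -
  assume L: "0 \<le> L"
  have *: "strip_norm \<rho> (\<lambda>z. g t z - g s z) / ennreal \<bar>t - s\<bar> \<le> ennreal L
      \<longleftrightarrow> (\<forall>z\<in>strip \<rho>. norm (g t z - g s z) \<le> L * \<bar>t - s\<bar>)" if "s \<noteq> t" for s t
    using that L by (simp add: divide_ennreal_le_iff strip_norm_le_iff)
  have "fam_Lip \<Theta> \<rho> g \<le> ennreal L \<longleftrightarrow>
     (\<forall>s\<in>\<Theta>. \<forall>t\<in>\<Theta>. s \<noteq> t \<longrightarrow> strip_norm \<rho> (\<lambda>z. g t z - g s z) / ennreal \<bar>t - s\<bar> \<le> ennreal L)"
    unfolding fam_Lip_def by (auto simp: SUP_le_iff)
  also have "\<dots> \<longleftrightarrow> (\<forall>s\<in>\<Theta>. \<forall>t\<in>\<Theta>. s \<noteq> t \<longrightarrow> (\<forall>z\<in>strip \<rho>. norm (g t z - g s z) \<le> L * \<bar>t - s\<bar>))"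
    using * by blast
  also have "\<dots> \<longleftrightarrow> (\<forall>s\<in>\<Theta>. \<forall>t\<in>\<Theta>. \<forall>z\<in>strip \<rho>. norm (g t z - g s z) \<le> L * \<bar>t - s\<bar>)"
    by (metis abs_zero diff_self mult_zero_right norm_zero order_refl)
  finally show ?thesis .
qed

lemma margin_realE:
  assumes "x + ennreal m \<le> ennreal B" "0 < m"
  obtains r where "x = ennreal r" "0 \<le> r" "r + m \<le> B"
proof (cases x)
  case (real r)
  then have "ennreal (r + m) \<le> ennreal B" using assms by simp
  moreover have "0 < r + m" using real assms by simp
  ultimately have "r + m \<le> B" by (simp add: ennreal_le_iff2)
  then show ?thesis using that real by blast
next
  case top
  then show ?thesis using assms by (simp add: top_unique)
qed

section \<open>Circle maps, ranges and the given family\<close>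

lemma strip_subset_cstrip: "strip s \<subseteq> cstrip s"
  by (auto simp: strip_def cstrip_def)

lemma cstrip_subset_strip: "s < t \<Longrightarrow> cstrip s \<subseteq> strip t"
  by (auto simp: strip_def cstrip_def)

lemma circle_mapsD:
  assumes "h \<in> circle_maps s"
  shows "perhol s (\<lambda>z. h z - z)" "continuous_on (cstrip s) h" "h (of_real x) \<in> \<real>"
proof -
  have P: "continuous_on (cstrip s) (\<lambda>z. h z - z)" "(\<lambda>z. h z - z) holomorphic_on strip s"
    "\<And>z. z \<in> cstrip s \<Longrightarrow> h (z + 1) - (z + 1) = h z - z" "\<And>x::real. h (of_real x) - of_real x \<in> \<real>"
    using assms unfolding circle_maps_def Per_def by auto
  show "perhol s (\<lambda>z. h z - z)" using P(2,3) strip_subset_cstrip by (auto simp: perhol_def)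
  have "continuous_on (cstrip s) (\<lambda>z. (h z - z) + z)" by (intro continuous_on_add P(1) continuous_on_id)
  then show "continuous_on (cstrip s) h" by simp
  have "(h (of_real x) - of_real x) + of_real x \<in> \<real>" by (intro Reals_add P(4)) auto
  then show "h (of_real x) \<in> \<real>" by simp
qed

text \<open>On the real line the derivative is real and nonzero, so the lift is injective by Rolle's
  theorem; it is onto by the intermediate value theorem, since it commutes with integer
  translations, and a homeomorphism by invariance of domain. The inequality \<open>s' < s\<close>
  provides continuity on the closed strip.\<close>

lemma circle_mapsI:
  assumes H: "perhol s (\<lambda>z. H z - z)" and real: "\<And>x::real. H (of_real x) \<in> \<real>"
    and d0: "\<And>z. z \<in> strip s \<Longrightarrow> deriv H z \<noteq> 0" and s: "0 < s" "s' < s"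
  shows "H \<in> circle_maps s'"
proof -
  have hol: "H holomorphic_on strip s" by (rule near_id_hol[OF H])
  have "(\<lambda>z. H z - z) \<in> Per s'"
  proof -
    have "(\<lambda>z. H z - z) holomorphic_on strip s" using H by (simp add: perhol_def)
    moreover have "strip s' \<subseteq> strip s" "cstrip s' \<subseteq> strip s"
      using s strip_mono cstrip_subset_strip by auto
    ultimately show ?thesis
      unfolding Per_def using H real
      by (auto simp: perhol_def subset_iff intro: holomorphic_on_subset continuous_on_subset
          holomorphic_on_imp_continuous_on)
  qed
  moreover have "\<exists>g. homeomorphism UNIV UNIV (\<lambda>x::real. Re (H (of_real x))) g"
  proof -
    define g where "g x = Re (H (of_real x))" for x :: real
    have dg: "(g has_real_derivative Re (deriv H (of_real x))) (at x)" for x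
    proof -
      have "(H has_field_derivative deriv H (of_real x)) (at (of_real x))"
        using s by (intro holomorphic_derivI[OF hol open_strip]) auto
      then have "((\<lambda>y::real. H (of_real y)) has_vector_derivative deriv H (of_real x)) (at x)"
        by (intro has_vector_derivative_real_field)
      from bounded_linear.has_vector_derivative[OF bounded_linear_Re this] show ?thesis
        by (simp add: g_def[abs_def] has_real_derivative_iff_has_vector_derivative)
    qed
    have dn: "Re (deriv H (of_real x)) \<noteq> 0" for x
    proof -
      have "deriv H (of_real x) \<in> \<real>" by (rule deriv_real[OF hol s(1) real])
      moreover have "deriv H (of_real x) \<noteq> 0" using d0 s by simp
      ultimately show ?thesis by (auto simp: complex_is_Real_iff complex_eq_iff)
    qed
    have cont: "continuous_on UNIV g"
      using dg DERIV_isCont by (metis continuous_at_imp_continuous_on)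
    have neq: "g x \<noteq> g y" if xy: "x < y" for x y
    proof
      assume eq: "g x = g y"
      obtain z where "DERIV g z :> 0"
        using Rolle[OF xy eq] dg continuous_on_subset[OF cont subset_UNIV] real_differentiable_def by metis
      then show False using dn[of z] dg[of z] DERIV_unique by metis
    qed
    have inj: "inj_on g UNIV"
      by (rule inj_onI) (metis neq linorder_neqE_linordered_idom)
    have g1: "g (x + 1) = g x + 1" for x
    proof -
      have "H (of_real x + 1) = H (of_real x) + 1" using near_id_per[OF H] s by simp
      then show ?thesis by (simp add: g_def)
    qed
    have gn: "g (x + real n) = g x + real n" for x n
    proof (induction n)
      case (Suc n)
      have "g (x + real (Suc n)) = g ((x + real n) + 1)" by (simp add: algebra_simps)
      then show ?case using g1 Suc by simp
    qed simp
    have surj: "range g = UNIV"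
    proof -
      have "y \<in> range g" for y
      proof -
        obtain n :: nat where n: "\<bar>y - g 0\<bar> < real n" using reals_Archimedean2 by blast
        have "g (- real n) = g 0 - real n" using gn[of "- real n" n] by simp
        moreover have "g (real n) = g 0 + real n" using gn[of 0 n] by simp
        ultimately have "g (- real n) \<le> y" "y \<le> g (real n)" using n by linarith+
        then obtain x where "g x = y"
          using IVT'[of g "- real n" y "real n"] continuous_on_subset[OF cont subset_UNIV] by auto
        then show ?thesis by blast
      qed
      then show ?thesis by blast
    qed
    obtain k where "homeomorphism UNIV (g ` UNIV) g k"
      using invariance_of_domain_homeomorphism[OF open_UNIV cont _ inj] by auto
    then show ?thesis using surj unfolding g_def[abs_def] by auto
  qed
  ultimately show ?thesis by (simp add: circle_maps_def)
qed

text \<open>The distance condition only says that the image stays away from the boundary. That it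
  lies inside follows along the vertical segment from the real line to \<open>z\<close>: the
  imaginary part of \<open>h\<close> starts at 0 and cannot reach modulus \<open>P\<close>.\<close>

lemma range_in_strip:
  assumes cont: "continuous_on (cstrip \<rho>) h" and real: "\<And>x::real. h (of_real x) \<in> \<real>"
    and m: "m \<le> setdist (h ` cstrip \<rho>) (strip_boundary P)" "0 < m" and P: "0 < P" and z: "z \<in> cstrip \<rho>"
  shows "\<bar>Im (h z)\<bar> \<le> P - m"
proof -
  have sd: "m \<le> dist (h w) y" if "w \<in> cstrip \<rho>" "\<bar>Im y\<bar> = P" for w y
    using setdist_le_dist[of "h w" "h ` cstrip \<rho>" y "strip_boundary P"] that m by (auto simp: strip_boundary_def)
  have lt: "\<bar>Im (h z)\<bar> < P"
  proof (rule ccontr)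
    assume "\<not> \<bar>Im (h z)\<bar> < P"
    define q where "q t = Complex (Re z) (t * Im z)" for t
    have q: "q t \<in> cstrip \<rho>" if "t \<in> {0..1}" for t
    proof -
      have "\<bar>t * Im z\<bar> \<le> 1 * \<bar>Im z\<bar>" unfolding abs_mult using that by (intro mult_right_mono) auto
      then show ?thesis using z by (simp add: q_def cstrip_def)
    qed
    have "continuous_on {0..1} q" unfolding q_def Complex_eq by (intro continuous_intros)
    then have "continuous_on {0..1} (\<lambda>t. h (q t))"
      using q by (intro continuous_on_compose2[OF cont]) auto
    then have "continuous_on {0..1} (\<lambda>t. \<bar>Im (h (q t))\<bar>)" by (intro continuous_intros)
    moreover have "q 0 = of_real (Re z)" "q 1 = z" by (auto simp: q_def complex_eq_iff)
    moreover have "Im (h (of_real (Re z))) = 0" using real complex_is_Real_iff by blast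
    ultimately obtain t where "0 \<le> t" "t \<le> 1" "\<bar>Im (h (q t))\<bar> = P"
      using IVT'[of "\<lambda>t. \<bar>Im (h (q t))\<bar>" 0 P 1] P \<open>\<not> \<bar>Im (h z)\<bar> < P\<close> by auto
    then show False using sd[OF q, of t "h (q t)"] m by simp
  qed
  define y where "y = Complex (Re (h z)) (if 0 \<le> Im (h z) then P else - P)"
  have "m \<le> dist (h z) y" using P by (intro sd z) (simp add: y_def)
  also have "dist (h z) y = P - \<bar>Im (h z)\<bar>"
    using lt P by (simp add: y_def dist_norm cmod_def)
  finally show ?thesis by simp
qed

lemma kam_family_of_C3:
  assumes A: "open A" and P: "0 < P" and C3: "C3_family A P f" and b: "deriv_bounds A P f c"
    and S: "1 \<le> S" "c 1 0 \<le> S" "c 2 0 \<le> S" "c 0 1 \<le> S" "c 0 2 \<le> S" "c 1 1 \<le> S"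
  shows "kam_family A P S f (d_param 1 f) (d_param 2 f)"
proof -
  have cm: "f a \<in> circle_maps P" if "a \<in> A" for a using C3 that by (auto simp: C3_family_def)
  have bd: "norm (d_mixed i j f a z) \<le> c i j" if "1 \<le> i + j" "i + j \<le> 3" "a \<in> A" "z \<in> strip P" for i j a z
    using b that unfolding deriv_bounds_def by (metis fam_norm_le_iff)
  have df: "((\<lambda>a'. d_param j f a' z) has_vector_derivative d_param (Suc j) f a z) (at a)"
    if "j < 3" "a \<in> A" "z \<in> strip P" for j a z
  proof -
    have "z \<in> cstrip P" using that(3) strip_subset_cstrip by blast
    then show ?thesis using C3 that(1,2) unfolding C3_family_def by (auto simp: vector_derivative_works)
  qed
  show ?thesis
  proof
    show "open A" "1 \<le> S" "0 < P" by fact+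
    fix a assume a: "a \<in> A"
    show "f a holomorphic_on strip P" by (rule near_id_hol[OF circle_mapsD(1)[OF cm[OF a]]])
    show "f a (of_real x) \<in> \<real>" for x by (rule circle_mapsD(3)[OF cm[OF a]])
    fix z assume z: "z \<in> strip P"
    show "f a (z + 1) = f a z + 1" by (rule near_id_per[OF circle_mapsD(1)[OF cm[OF a]] z])
    show "((\<lambda>a'. f a' z) has_vector_derivative d_param 1 f a z) (at a)"
      using df[of 0, OF _ a z] by simp
    show "((\<lambda>a'. d_param 1 f a' z) has_vector_derivative d_param 2 f a z) (at a)"
      using df[of 1, OF _ a z] by (simp add: numeral_2_eq_2)
    show "norm (deriv (f a) z) \<le> S" using bd[of 1 0, OF _ _ a z] S by (simp add: d_mixed_def)
    show "norm (deriv (deriv (f a)) z) \<le> S" using bd[of 2 0, OF _ _ a z] S by (simp add: d_mixed_def numeral_2_eq_2)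
    show "norm (d_param 1 f a z) \<le> S" using bd[of 0 1, OF _ _ a z] S by (simp add: d_mixed_def)
    show "norm (d_param 2 f a z) \<le> S" using bd[of 0 2, OF _ _ a z] S by (simp add: d_mixed_def)
    show "norm (deriv (d_param 1 f a) z) \<le> S" using bd[of 1 1, OF _ _ a z] S by (simp add: d_mixed_def)
  qed
qed

text \<open>The constant of \<open>linear_estimate\<close> for the function, with every individual
  bound replaced by \<open>S\<close>.\<close>

definition step_const :: "real \<Rightarrow> real \<Rightarrow> real \<Rightarrow> real \<Rightarrow> real" where
  "step_const S \<gamma> \<tau> d = S * (1 + S) * KR \<tau> * (1 + S * S * S) * S / (\<gamma> * d powr \<tau>)"

text \<open>The first summand is \<open>kam_const\<close> times the coefficient of the quadratic
  error after the first step. The second keeps that step within the radius of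
  \<open>adm_close\<close>, including its derivative, and the 1 ensures that the error is at most
  1.\<close>

definition pw_const :: "real \<Rightarrow> real \<Rightarrow> real \<Rightarrow> nat \<Rightarrow> real \<Rightarrow> real \<Rightarrow> real" where
  "pw_const S \<gamma> \<tau> p d d' = kam_const (2 * S) p d' * (S * step_const S \<gamma> \<tau> d / d + S\<^sup>2 * (step_const S \<gamma> \<tau> d + S\<^sup>2)\<^sup>2)
     + 12 * S ^ 4 * (step_const S \<gamma> \<tau> d + step_const S \<gamma> \<tau> d / d' + S\<^sup>2) + 1"

context kam_family
begin

text \<open>The first step is estimated separately, with sharp constants and the full loss \<open>d\<close> of width;
  everything after it is quadratically small.\<close>

lemma pointwise_solution:
  fixes p :: nat
  assumes adm: "adm A P G S s0 h a \<theta>" and s0: "0 < s0"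
    and dio: "\<theta> \<in> Diophantine \<gamma> \<tau>" and pos: "0 < \<gamma>" "0 \<le> \<tau>" and KR: "KR \<tau> / \<gamma> \<le> S" and p: "\<tau> \<le> real p"
    and e: "\<And>z. z \<in> strip s0 \<Longrightarrow> norm (cerr f h a \<theta> z) \<le> \<epsilon>"
    and d: "0 < d" "0 < d'" "0 < s0 - d - 2 * d'"
    and p1: "\<And>z. z \<in> strip s0 \<Longrightarrow> norm (deriv h z) \<le> x1" "x1 \<le> S"
    and p2: "\<And>z. z \<in> strip s0 \<Longrightarrow> norm (1 / deriv h z) \<le> x2" "x2 \<le> S"
    and ca: "\<And>z. z \<in> strip s0 \<Longrightarrow> norm (G a (h z)) \<le> ca" "ca \<le> S"
    and sb: "norm (1 / average (\<lambda>z. G a (h z) / deriv h (z + of_real \<theta>))) \<le> sb" "sb \<le> S"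
    and small: "pw_const S \<gamma> \<tau> p d d' * \<epsilon> \<le> 1"
  obtains H and b :: real where "perhol (s0 - d - 2 * d') (\<lambda>z. H z - z)" "\<And>x::real. H (of_real x) \<in> \<real>"
    "average (\<lambda>z. H z - z) = 0"
    "\<And>z. z \<in> strip (s0 - d - 2 * d') \<Longrightarrow> f b (H z) = H (z + of_real \<theta>)"
    "\<And>z. z \<in> strip (s0 - d - 2 * d') \<Longrightarrow> norm (H z - h z)
       \<le> x1 * (1 + x1) * KR \<tau> * (1 + ca * sb * x2) * x2 * \<epsilon> / (\<gamma> * d powr \<tau>) + pw_const S \<gamma> \<tau> p d d' * \<epsilon>\<^sup>2"
    "\<bar>b - a\<bar> \<le> sb * x2 * \<epsilon> + pw_const S \<gamma> \<tau> p d d' * \<epsilon>\<^sup>2"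
proof -
  interpret T: kam_family A P "2 * S" f G G2
    by (rule mono_S) (use S_ge_1 in simp)
  note S = S_ge_1
  have z0: "0 \<in> strip s0" using s0 by (simp add: strip_def)
  have nn: "0 \<le> x1" "0 \<le> x2" "0 \<le> ca" "0 \<le> sb" "0 \<le> \<epsilon>"
    using order_trans[OF norm_ge_zero p1(1)[OF z0]] order_trans[OF norm_ge_zero p2(1)[OF z0]]
      order_trans[OF norm_ge_zero ca(1)[OF z0]] order_trans[OF norm_ge_zero sb(1)]
      order_trans[OF norm_ge_zero e[OF z0]] by auto
  define X where "X = step_const S \<gamma> \<tau> d"
  define Y where "Y = S * X / d + S\<^sup>2 * (X + S\<^sup>2)\<^sup>2"
  define K' where "K' = kam_const (2 * S) p d'"
  define K where "K = pw_const S \<gamma> \<tau> p d d'"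
  have K: "K = K' * Y + 12 * S ^ 4 * (X + X / d' + S\<^sup>2) + 1"
    unfolding K_def pw_const_def K'_def Y_def X_def ..
  have KRp: "0 < KR \<tau>" by (rule KR_pos[OF pos(2)])
  have X0: "0 \<le> X" unfolding X_def step_const_def using S KRp pos by simp
  have Y0: "0 \<le> Y" unfolding Y_def using X0 S d by simp
  have K'0: "0 < K'" unfolding K'_def using S d by (intro kam_const_pos) auto
  have S4: "0 < S ^ 4" using S by simp
  have K0: "1 \<le> K" unfolding K using X0 Y0 K'0 S4 d S by simp
  have Ke: "x * \<epsilon> \<le> 1" if "x \<le> K" for x
    using mult_right_mono[OF that nn(5)] small by (simp add: K_def)
  have e1: "\<epsilon> \<le> 1" using Ke[of 1] K0 by simp
  have KY: "K' * Y \<le> K" unfolding K using X0 S4 d S by simp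
  obtain w and v :: real where w: "perhol s0 w" "average w = 0" "\<And>x::real. w (of_real x) \<in> \<real>"
    and eq: "\<And>z. z \<in> strip s0 \<Longrightarrow> deriv h (z + of_real \<theta>) * (w z / deriv h z) - w (z + of_real \<theta>)
        + G a (h z) * of_real v + cerr f h a \<theta> z = 0"
    by (rule step_exists[OF adm s0 dio pos]) (rule that)
  have ds: "d < s0" using d by linarith
  note near = adm_near[OF adm s0]
  note le = linear_estimate[OF dio pos perhol_near_id_deriv[OF near] average_deriv_near_id[OF near s0]
      adm_d0[OF adm s0] p1(1) p2(1) adm_coef[OF adm s0] ca(1) adm_b0[OF adm s0] sb(1) w(1,2) eq e d(1) ds]
  define x where "x = x1 * (1 + x1) * KR \<tau> * (1 + ca * sb * x2) * x2 * \<epsilon> / (\<gamma> * d powr \<tau>)"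
  have wx: "norm (w z) \<le> x" if "z \<in> strip (s0 - d)" for z
    using le(2)[of z] that unfolding x_def by simp
  have v: "\<bar>v\<bar> \<le> sb * x2 * \<epsilon>"
  proof -
    have "norm (complex_of_real v) \<le> sb * x2 * \<epsilon>" by (rule le(1))
    then show ?thesis by simp
  qed
  have xX: "x \<le> X * \<epsilon>"
  proof -
    have "x1 * (1 + x1) * KR \<tau> * (1 + ca * sb * x2) * x2 * \<epsilon> / (\<gamma> * d powr \<tau>)
        \<le> S * (1 + S) * KR \<tau> * (1 + S * S * S) * S * \<epsilon> / (\<gamma> * d powr \<tau>)"
      using p1(2) p2(2) ca(2) sb(2) nn KRp pos S
      by (intro divide_right_mono mult_right_mono mult_mono add_mono order_refl) auto
    then show ?thesis by (simp add: x_def X_def step_const_def)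
  qed
  have vS: "\<bar>v\<bar> \<le> S\<^sup>2 * \<epsilon>"
  proof -
    have "sb * x2 * \<epsilon> \<le> S * S * \<epsilon>" using sb(2) p2(2) nn S by (intro mult_right_mono mult_mono) auto
    then show ?thesis using v by (simp add: power2_eq_square)
  qed
  have r: "X * \<epsilon> \<le> 1 / (12 * S ^ 4)" "X * \<epsilon> / d' \<le> 1 / (12 * S ^ 4)" "S\<^sup>2 * \<epsilon> \<le> 1 / (12 * S ^ 4)"
  proof -
    have Xd: "0 \<le> X / d'" using X0 d by simp
    have y: "y * \<epsilon> \<le> 1 / (12 * S ^ 4)" if "0 \<le> y" "y \<le> X + X / d' + S\<^sup>2" for y
    proof -
      have "12 * S ^ 4 * y \<le> 12 * S ^ 4 * (X + X / d' + S\<^sup>2)" using that S4 by (intro mult_left_mono) auto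
      also have "\<dots> \<le> K" unfolding K using K'0 Y0 by simp
      finally have "12 * S ^ 4 * y * \<epsilon> \<le> 1" by (rule Ke)
      then show ?thesis using S4 by (simp add: pos_le_divide_eq mult_ac)
    qed
    show "X * \<epsilon> \<le> 1 / (12 * S ^ 4)" "S\<^sup>2 * \<epsilon> \<le> 1 / (12 * S ^ 4)" using y[of X] y[of "S\<^sup>2"] X0 Xd by auto
    show "X * \<epsilon> / d' \<le> 1 / (12 * S ^ 4)" using y[of "X / d'"] X0 Xd by simp
  qed
  have rS: "1 / (12 * S ^ 4) \<le> 1 / S"
  proof -
    have "S \<le> S ^ 4" using power_increasing[of 1 4 S] S by simp
    then have "S \<le> 12 * S ^ 4" using S4 by linarith
    then show ?thesis using S by (intro divide_left_mono) auto
  qed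
  define h1 where "h1 z = h z + w z" for z
  define a1 where "a1 = a + v"
  \<comment> \<open>The first \<open>d'\<close> pays for the derivative of \<open>w\<close>, which
    \<open>adm_close\<close> has to control; the second is the gap handed to the iteration.\<close>
  define s1 where "s1 = s0 - d - d'"
  have s1: "0 < s1" "s1 \<le> s0" "s1 = (s0 - d) - d'" using d by (auto simp: s1_def)
  have sub: "z \<in> strip (s0 - d)" "z \<in> strip s0" if "z \<in> strip s1" for z
    using that d strip_mono[of s1 "s0 - d"] strip_mono[of s1 s0] by (auto simp: s1_def)
  have err1: "norm (cerr f h1 a1 \<theta> z) \<le> Y * \<epsilon>\<^sup>2" if z: "z \<in> strip s1" for z
  proof -
    have "norm (cerr f h1 a1 \<theta> z) \<le> S * (X * \<epsilon>) * \<epsilon> / d + S\<^sup>2 * (X * \<epsilon> + S\<^sup>2 * \<epsilon>)\<^sup>2"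
      unfolding h1_def[abs_def] a1_def
      using order_trans[OF wx[OF sub(1)[OF z]] xX] vS r rS
      by (intro step_error[OF adm s0 eq e d(1) ds _ _ _ _ sub(1)[OF z]]) auto
    also have "\<dots> = Y * \<epsilon>\<^sup>2" by (simp add: Y_def power2_eq_square algebra_simps)
    finally show ?thesis .
  qed
  have adm1: "adm A P G (2 * S) s1 h1 a1 \<theta>"
  proof (rule adm_close[OF adm s0, where r = "1 / (12 * S ^ 4)"])
    have wh: "w holomorphic_on strip s0" using w(1) by (simp add: perhol_def)
    show "norm (h1 z - h z) \<le> 1 / (12 * S ^ 4)" if "z \<in> strip s1" for z
      using wx[OF sub(1)[OF that]] xX r by (simp add: h1_def)
    show "norm (deriv h1 z - deriv h z) \<le> 1 / (12 * S ^ 4)" if z: "z \<in> strip s1" for z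
    proof -
      have "deriv h1 z = deriv h z + deriv w z"
        unfolding h1_def[abs_def]
        using holomorphic_derivI[OF adm_hol[OF adm s0] open_strip sub(2)[OF z]]
          holomorphic_derivI[OF wh open_strip sub(2)[OF z]]
        by (intro deriv_add) (auto simp: field_differentiable_def)
      moreover have "norm (deriv w z) \<le> (X * \<epsilon>) / d'"
        using wh d z s1(3) order_trans[OF wx xX] strip_mono[of "s0 - d" s0]
        by (intro Cauchy_strip[of _ "s0 - d"]) (auto intro: holomorphic_on_subset)
      ultimately show ?thesis using r by simp
    qed
    have h1w: "(\<lambda>z. h1 z - z) = (\<lambda>z. (h z - z) + w z)" by (auto simp: h1_def)
    show "perhol s1 (\<lambda>z. h1 z - z)"
      unfolding h1w by (rule perhol_mono[OF perhol_add[OF near w(1)] s1(2)])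
    show "h1 (of_real x) \<in> \<real>" for x :: real
      using adm_real[OF adm s0] w(3) by (simp add: h1_def)
    have "average (\<lambda>z. h1 z - z) = average (\<lambda>z. h z - z) + average w"
      unfolding h1w using near wh s0 continuous_on_reals[of "\<lambda>z. h z - z" s0]
      by (intro average_add continuous_on_reals[of w s0]) (auto simp: perhol_def)
    then show "average (\<lambda>z. h1 z - z) = 0" using adm_avg[OF adm s0] w(2) by simp
    show "\<bar>a1 - a\<bar> \<le> 1 / (12 * S ^ 4)" using vS r by (simp add: a1_def)
  qed (use s1 in auto)
  have KR2: "KR \<tau> / \<gamma> \<le> 2 * S" using KR S by linarith
  have s2: "0 < s0 - d - 2 * d'" "s0 - d - 2 * d' < s1" "s1 - (s0 - d - 2 * d') = d'"
    using d by (auto simp: s1_def)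
  \<comment> \<open>After the first step the error is only \<open>Y * \<epsilon>\<^sup>2\<close>, so
    the whole iteration displaces the pair by this second-order amount.\<close>
  have K'e: "K' * (Y * \<epsilon>\<^sup>2) \<le> K * \<epsilon>\<^sup>2"
    using KY by (simp add: mult.assoc [symmetric] mult_right_mono)
  also have "\<dots> \<le> 1"
    using mult_mono[OF Ke[OF order_refl] e1] nn K0 by (simp add: power2_eq_square mult_ac)
  finally have sm: "kam_const (2 * S) p (s1 - (s0 - d - 2 * d')) * (Y * \<epsilon>\<^sup>2) \<le> 1"
    unfolding s2(3) K'_def .
  obtain H and b :: real where H: "perhol (s0 - d - 2 * d') (\<lambda>z. H z - z)" "\<And>x::real. H (of_real x) \<in> \<real>"
    "average (\<lambda>z. H z - z) = 0"
    and Hh: "\<And>z. z \<in> strip (s0 - d - 2 * d') \<Longrightarrow> norm (H z - h1 z) \<le> K' * (Y * \<epsilon>\<^sup>2)"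
    and ba: "\<bar>b - a1\<bar> \<le> K' * (Y * \<epsilon>\<^sup>2)"
    and ex: "\<And>z. z \<in> strip (s0 - d - 2 * d') \<Longrightarrow> f b (H z) = H (z + of_real \<theta>)"
    using T.kam_solution[OF adm1 dio pos KR2 p err1 s2(1,2) sm] unfolding s2(3) K'_def by blast
  show ?thesis
  proof (rule that[OF H ex])
    show "norm (H z - h z) \<le> x1 * (1 + x1) * KR \<tau> * (1 + ca * sb * x2) * x2 * \<epsilon> / (\<gamma> * d powr \<tau>)
        + pw_const S \<gamma> \<tau> p d d' * \<epsilon>\<^sup>2" if z: "z \<in> strip (s0 - d - 2 * d')" for z
    proof -
      have "z \<in> strip s1" using z s2 strip_mono[of "s0 - d - 2 * d'" s1] by auto
      then have "norm (w z) \<le> x" by (intro wx sub)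
      moreover have "norm (H z - h1 z) \<le> K * \<epsilon>\<^sup>2" using Hh[OF z] K'e by linarith
      ultimately have "norm (w z + (H z - h1 z)) \<le> x + K * \<epsilon>\<^sup>2" by (rule norm_triangle_mono)
      moreover have "w z + (H z - h1 z) = H z - h z" by (simp add: h1_def)
      ultimately show ?thesis unfolding x_def K_def by (simp only:)
    qed
    show "\<bar>b - a\<bar> \<le> sb * x2 * \<epsilon> + pw_const S \<gamma> \<tau> p d d' * \<epsilon>\<^sup>2"
      using ba K'e v unfolding K_def a1_def by linarith
  qed
qed

end

section \<open>Solutions with sharp first step\<close>

text \<open>Multiplied by the error size \<open>M\<close>, it bounds the displacement of the
  conjugacy as well as that of the parameter.\<close>

definition core_amp :: "real \<Rightarrow> real \<Rightarrow> real \<Rightarrow> nat \<Rightarrow> real \<Rightarrow> real \<Rightarrow> real" where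
  "core_amp S \<gamma> \<tau> p d d' = step_const S \<gamma> \<tau> d + S\<^sup>2 + pw_const S \<gamma> \<tau> p d d'"

text \<open>The second summand covers two applications of Cauchy's estimate with loss
  \<open>d'\<close>, and its factor \<open>12 * S ^ 5\<close> comes from the reciprocal twist. In
  the third, \<open>core_amp + S\<close> is the size fed to \<open>lipschitz_estimate\<close>, where
  \<open>S\<close> stands for the Lipschitz bound of the errors.\<close>

definition core_const :: "real \<Rightarrow> real \<Rightarrow> real \<Rightarrow> nat \<Rightarrow> real \<Rightarrow> real \<Rightarrow> real" where
  "core_const S \<gamma> \<tau> p d d' = pw_const S \<gamma> \<tau> p d d'
     + 12 * S ^ 5 * (core_amp S \<gamma> \<tau> p d d' * (1 + 1 / d' + 1 / d'\<^sup>2))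
     + lip_const (2 * S) \<gamma> \<tau> d' * (core_amp S \<gamma> \<tau> p d d' + S) * (1 + 1 / d')"

lemma step_const_nonneg: "1 \<le> S \<Longrightarrow> 0 < \<gamma> \<Longrightarrow> 0 \<le> \<tau> \<Longrightarrow> 0 \<le> step_const S \<gamma> \<tau> d"
  unfolding step_const_def using KR_pos[of \<tau>] by simp

lemma pw_const_ge_1:
  assumes "1 \<le> S" "0 < \<gamma>" "0 \<le> \<tau>" "0 < d" "0 < d'"
  shows "1 \<le> pw_const S \<gamma> \<tau> p d d'"
proof -
  have "0 \<le> step_const S \<gamma> \<tau> d" using assms by (intro step_const_nonneg)
  moreover have "0 < kam_const (2 * S) p d'" using assms by (intro kam_const_pos) auto
  ultimately show ?thesis using assms unfolding pw_const_def by simp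
qed

lemma lip_const_nonneg:
  assumes "1 \<le> S" "0 < \<gamma>" "0 \<le> \<tau>" "0 < g"
  shows "0 \<le> lip_const S \<gamma> \<tau> g"
  unfolding lip_const_def using lip_loss_pos[OF assms] assms by (simp add: add_nonneg_nonneg)

lemma core_const_props:
  assumes "1 \<le> S" "0 < \<gamma>" "0 \<le> \<tau>" "0 < d" "0 < d'"
  shows "1 \<le> core_amp S \<gamma> \<tau> p d d'" "1 \<le> core_const S \<gamma> \<tau> p d d'"
    "pw_const S \<gamma> \<tau> p d d' \<le> core_const S \<gamma> \<tau> p d d'"
    "12 * S ^ 5 * (core_amp S \<gamma> \<tau> p d d' * (1 + 1 / d' + 1 / d'\<^sup>2)) \<le> core_const S \<gamma> \<tau> p d d'"
    "lip_const (2 * S) \<gamma> \<tau> d' * (core_amp S \<gamma> \<tau> p d d' + S) * (1 + 1 / d') \<le> core_const S \<gamma> \<tau> p d d'"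
proof -
  have 1: "1 \<le> pw_const S \<gamma> \<tau> p d d'" by (rule pw_const_ge_1[OF assms])
  have "0 \<le> step_const S \<gamma> \<tau> d" using assms by (intro step_const_nonneg)
  then show 2: "1 \<le> core_amp S \<gamma> \<tau> p d d'"
    using 1 zero_le_power2[of S] unfolding core_amp_def by linarith
  have 3: "0 \<le> lip_const (2 * S) \<gamma> \<tau> d'" using assms by (intro lip_const_nonneg) auto
  have 4: "0 \<le> 12 * S ^ 5 * (core_amp S \<gamma> \<tau> p d d' * (1 + 1 / d' + 1 / d'\<^sup>2))"
    "0 \<le> lip_const (2 * S) \<gamma> \<tau> d' * (core_amp S \<gamma> \<tau> p d d' + S) * (1 + 1 / d')"
    using 2 3 assms by auto
  show "1 \<le> core_const S \<gamma> \<tau> p d d'" "pw_const S \<gamma> \<tau> p d d' \<le> core_const S \<gamma> \<tau> p d d'"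
    "12 * S ^ 5 * (core_amp S \<gamma> \<tau> p d d' * (1 + 1 / d' + 1 / d'\<^sup>2)) \<le> core_const S \<gamma> \<tau> p d d'"
    "lip_const (2 * S) \<gamma> \<tau> d' * (core_amp S \<gamma> \<tau> p d d' + S) * (1 + 1 / d') \<le> core_const S \<gamma> \<tau> p d d'"
    using 1 4 unfolding core_const_def by linarith+
qed

context kam_family
begin

text \<open>Two measures of the error are kept apart: the sharp closeness bounds involve the sup
  norm \<open>E\<close>, while derivatives and Lipschitz constants are measured by \<open>M\<close>.
  All bounds concern the change from \<open>h\<close> to \<open>H\<close>, so that they can be added
  to whatever is known about \<open>h\<close>.\<close>

lemma core_solution:
  fixes p :: nat and \<Theta> :: "real set" and h :: "real \<Rightarrow> complex \<Rightarrow> complex" and \<alpha> :: "real \<Rightarrow> real"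
  assumes adm: "\<And>\<theta>. \<theta> \<in> \<Theta> \<Longrightarrow> adm A P G S s0 (h \<theta>) (\<alpha> \<theta>) \<theta>" and s0: "0 < s0"
    and dio: "\<And>\<theta>. \<theta> \<in> \<Theta> \<Longrightarrow> \<theta> \<in> Diophantine \<gamma> \<tau>"
    and pos: "0 < \<gamma>" "0 \<le> \<tau>" and KR: "KR \<tau> / \<gamma> \<le> S" and p: "\<tau> \<le> real p"
    and e: "\<And>\<theta> z. \<theta> \<in> \<Theta> \<Longrightarrow> z \<in> strip s0 \<Longrightarrow> norm (cerr f (h \<theta>) (\<alpha> \<theta>) \<theta> z) \<le> E"
    and eL: "\<And>s t z. s \<in> \<Theta> \<Longrightarrow> t \<in> \<Theta> \<Longrightarrow> z \<in> strip s0 \<Longrightarrow>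
        norm (cerr f (h t) (\<alpha> t) t z - cerr f (h s) (\<alpha> s) s z) \<le> S * M * \<bar>t - s\<bar>"
    and E: "0 \<le> E" "E \<le> M"
    and hL: "\<And>s t z. s \<in> \<Theta> \<Longrightarrow> t \<in> \<Theta> \<Longrightarrow> z \<in> strip s0 \<Longrightarrow> norm (h t z - h s z) \<le> S * \<bar>t - s\<bar>"
    and aL: "\<And>s t. s \<in> \<Theta> \<Longrightarrow> t \<in> \<Theta> \<Longrightarrow> \<bar>\<alpha> t - \<alpha> s\<bar> \<le> S * \<bar>t - s\<bar>"
    and d: "0 < d" "0 < d'" "0 < s0 - d - 5 * d'"
    and p1: "\<And>\<theta> z. \<theta> \<in> \<Theta> \<Longrightarrow> z \<in> strip s0 \<Longrightarrow> norm (deriv (h \<theta>) z) \<le> x1" "x1 \<le> S"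
    and p2: "\<And>\<theta> z. \<theta> \<in> \<Theta> \<Longrightarrow> z \<in> strip s0 \<Longrightarrow> norm (1 / deriv (h \<theta>) z) \<le> x2" "x2 \<le> S"
    and ca: "\<And>\<theta> z. \<theta> \<in> \<Theta> \<Longrightarrow> z \<in> strip s0 \<Longrightarrow> norm (G (\<alpha> \<theta>) (h \<theta> z)) \<le> ca" "ca \<le> S"
    and sb: "\<And>\<theta>. \<theta> \<in> \<Theta> \<Longrightarrow> norm (1 / average (\<lambda>z. G (\<alpha> \<theta>) (h \<theta> z) / deriv (h \<theta>) (z + of_real \<theta>))) \<le> sb" "sb \<le> S"
    and small: "core_const S \<gamma> \<tau> p d d' * M \<le> 1"
  obtains H b where
    "\<And>\<theta>. \<theta> \<in> \<Theta> \<Longrightarrow> adm A P G (2 * S) (s0 - d - 5 * d') (H \<theta>) (b \<theta>) \<theta>"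
    "\<And>\<theta> z. \<theta> \<in> \<Theta> \<Longrightarrow> z \<in> strip (s0 - d - 5 * d') \<Longrightarrow> f (b \<theta>) (H \<theta> z) = H \<theta> (z + of_real \<theta>)"
    "\<And>\<theta> z. \<theta> \<in> \<Theta> \<Longrightarrow> z \<in> strip (s0 - d - 5 * d') \<Longrightarrow> norm (H \<theta> z - h \<theta> z)
       \<le> x1 * (1 + x1) * KR \<tau> * (1 + ca * sb * x2) * x2 * E / (\<gamma> * d powr \<tau>) + core_const S \<gamma> \<tau> p d d' * E\<^sup>2"
    "\<And>\<theta>. \<theta> \<in> \<Theta> \<Longrightarrow> \<bar>b \<theta> - \<alpha> \<theta>\<bar> \<le> sb * x2 * E + core_const S \<gamma> \<tau> p d d' * E\<^sup>2"
    "\<And>\<theta> z. \<theta> \<in> \<Theta> \<Longrightarrow> z \<in> strip (s0 - d - 5 * d') \<Longrightarrow>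
       norm (deriv (H \<theta>) z - deriv (h \<theta>) z) \<le> core_const S \<gamma> \<tau> p d d' * M"
    "\<And>\<theta> z. \<theta> \<in> \<Theta> \<Longrightarrow> z \<in> strip (s0 - d - 5 * d') \<Longrightarrow>
       norm (1 / deriv (H \<theta>) z - 1 / deriv (h \<theta>) z) \<le> core_const S \<gamma> \<tau> p d d' * M"
    "\<And>\<theta> z. \<theta> \<in> \<Theta> \<Longrightarrow> z \<in> strip (s0 - d - 5 * d') \<Longrightarrow>
       norm (deriv (deriv (H \<theta>)) z - deriv (deriv (h \<theta>)) z) \<le> core_const S \<gamma> \<tau> p d d' * M"
    "\<And>\<theta>. \<theta> \<in> \<Theta> \<Longrightarrow> norm (1 / average (\<lambda>z. G (b \<theta>) (H \<theta> z) / deriv (H \<theta>) (z + of_real \<theta>))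
        - 1 / average (\<lambda>z. G (\<alpha> \<theta>) (h \<theta> z) / deriv (h \<theta>) (z + of_real \<theta>))) \<le> core_const S \<gamma> \<tau> p d d' * M"
    "\<And>s t z. s \<in> \<Theta> \<Longrightarrow> t \<in> \<Theta> \<Longrightarrow> z \<in> strip (s0 - d - 5 * d') \<Longrightarrow>
       norm ((H t z - h t z) - (H s z - h s z)) \<le> core_const S \<gamma> \<tau> p d d' * M * \<bar>t - s\<bar>"
    "\<And>s t z. s \<in> \<Theta> \<Longrightarrow> t \<in> \<Theta> \<Longrightarrow> z \<in> strip (s0 - d - 5 * d') \<Longrightarrow>
       norm ((deriv (H t) z - deriv (h t) z) - (deriv (H s) z - deriv (h s) z)) \<le> core_const S \<gamma> \<tau> p d d' * M * \<bar>t - s\<bar>"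
    "\<And>s t. s \<in> \<Theta> \<Longrightarrow> t \<in> \<Theta> \<Longrightarrow> \<bar>(b t - \<alpha> t) - (b s - \<alpha> s)\<bar> \<le> core_const S \<gamma> \<tau> p d d' * M * \<bar>t - s\<bar>"
proof -
  interpret T: kam_family A P "2 * S" f G G2
    by (rule mono_S) (use S_ge_1 in simp)
  note S = S_ge_1
  define N where "N = core_const S \<gamma> \<tau> p d d'"
  define W where "W = pw_const S \<gamma> \<tau> p d d'"
  define k where "k = core_amp S \<gamma> \<tau> p d d'"
  define l where "l = lip_const (2 * S) \<gamma> \<tau> d'"
  note cp = core_const_props[OF S pos d(1,2), of p, folded N_def W_def k_def l_def]
  have W1: "1 \<le> W" unfolding W_def by (rule pw_const_ge_1[OF S pos d(1,2)])
  have l0: "0 \<le> l" unfolding l_def using S pos d by (intro lip_const_nonneg) auto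
  have M0: "0 \<le> M" using E by simp
  have NM: "x * M \<le> N * M" if "x \<le> N" for x using that M0 by (rule mult_right_mono)
  have NM1: "x * M \<le> 1" if "x \<le> N" for x using NM[OF that] small unfolding N_def by linarith
  have WE: "W * E \<le> 1"
  proof -
    have "W * E \<le> W * M" using E W1 by (intro mult_left_mono) auto
    then show ?thesis using NM1[OF cp(3)] by linarith
  qed
  have E1: "E \<le> 1" using NM1[of 1] cp(2) E by simp
  \<comment> \<open>The five losses \<open>d'\<close>: two for \<open>pointwise_solution\<close>,
    one for the first derivative, one for the second derivative and likewise for the gap of the
    Lipschitz estimate, one for the derivative of a difference between two frequencies.\<close>
  define r0 where "r0 = s0 - d - 2 * d'"
  define r1 where "r1 = r0 - d'"
  define r2 where "r2 = r1 - d'"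
  define r3 where "r3 = r2 - d'"
  have r3: "s0 - d - 5 * d' = r3" by (simp add: r3_def r2_def r1_def r0_def)
  have r: "0 < r3" "r3 < r2" "r2 < r1" "r1 < r0" "r0 < s0" "0 < r0" "0 < r1" "0 < r2" "r1 - r2 = d'"
    using d by (auto simp: r3_def r2_def r1_def r0_def)
  have sub: "strip r3 \<subseteq> strip r2" "strip r2 \<subseteq> strip r1" "strip r1 \<subseteq> strip r0" "strip r0 \<subseteq> strip s0"
    using r by (auto intro!: strip_mono)
  define X where "X = x1 * (1 + x1) * KR \<tau> * (1 + ca * sb * x2) * x2 * E / (\<gamma> * d powr \<tau>)"
  \<comment> \<open>The solution for one frequency as a single object, so that a family arises by
    choice. No regularity in \<open>\<theta>\<close> is built in; it comes from the comparison of
    pairs below.\<close>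
  define PW where "PW \<theta> x \<longleftrightarrow> perhol r0 (\<lambda>z. fst x z - z) \<and> (\<forall>y::real. fst x (of_real y) \<in> \<real>) \<and>
      average (\<lambda>z. fst x z - z) = 0 \<and> (\<forall>z\<in>strip r0. f (snd x) (fst x z) = fst x (z + of_real \<theta>)) \<and>
      (\<forall>z\<in>strip r0. norm (fst x z - h \<theta> z) \<le> X + W * E\<^sup>2) \<and> \<bar>snd x - \<alpha> \<theta>\<bar> \<le> sb * x2 * E + W * E\<^sup>2"
    for \<theta> and x :: "(complex \<Rightarrow> complex) \<times> real"
  have "\<exists>x. PW \<theta> x" if \<theta>: "\<theta> \<in> \<Theta>" for \<theta>
  proof -
    have d2: "0 < s0 - d - 2 * d'" using r(6) by (simp add: r0_def)
    obtain H b where "perhol r0 (\<lambda>z. H z - z)" "\<And>x::real. H (of_real x) \<in> \<real>"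
      "average (\<lambda>z. H z - z) = 0" "\<And>z. z \<in> strip r0 \<Longrightarrow> f b (H z) = H (z + of_real \<theta>)"
      "\<And>z. z \<in> strip r0 \<Longrightarrow> norm (H z - h \<theta> z) \<le> X + W * E\<^sup>2" "\<bar>b - \<alpha> \<theta>\<bar> \<le> sb * x2 * E + W * E\<^sup>2"
      by (rule pointwise_solution[OF adm[OF \<theta>] s0 dio[OF \<theta>] pos KR p e[OF \<theta>] d(1,2) d2 p1(1)[OF \<theta>] p1(2)
          p2(1)[OF \<theta>] p2(2) ca(1)[OF \<theta>] ca(2) sb(1)[OF \<theta>] sb(2) WE[unfolded W_def],
          folded W_def r0_def X_def]) (assumption, assumption, assumption, assumption, rule that)
    then have "PW \<theta> (H, b)" unfolding PW_def by simp
    then show ?thesis by blast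
  qed
  then obtain x where x: "\<And>\<theta>. \<theta> \<in> \<Theta> \<Longrightarrow> PW \<theta> (x \<theta>)" by metis
  define H where "H \<theta> = fst (x \<theta>)" for \<theta>
  define b where "b \<theta> = snd (x \<theta>)" for \<theta>
  have H: "perhol r0 (\<lambda>z. H \<theta> z - z)" "H \<theta> (of_real y) \<in> \<real>" "average (\<lambda>z. H \<theta> z - z) = 0"
    and ex: "\<And>z. z \<in> strip r0 \<Longrightarrow> f (b \<theta>) (H \<theta> z) = H \<theta> (z + of_real \<theta>)"
    and Hh: "\<And>z. z \<in> strip r0 \<Longrightarrow> norm (H \<theta> z - h \<theta> z) \<le> X + W * E\<^sup>2"
    and ba: "\<bar>b \<theta> - \<alpha> \<theta>\<bar> \<le> sb * x2 * E + W * E\<^sup>2"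
    if "\<theta> \<in> \<Theta>" for \<theta> and y :: real
    using x[OF that] unfolding PW_def H_def b_def by auto
  show ?thesis
  \<comment> \<open>A frequency is used to see that the bounds \<open>x1\<close>, \<open>x2\<close>,
    \<open>ca\<close> and \<open>sb\<close> are nonnegative.\<close>
  proof (cases "\<Theta> = {}")
    case True
    show ?thesis by (rule that[of H b]) (use True in auto)
  next
    case False
    then obtain \<theta>0 where \<theta>0: "\<theta>0 \<in> \<Theta>" by blast
    have z0: "0 \<in> strip s0" using s0 by (simp add: strip_def)
    have nn: "0 \<le> x1" "0 \<le> x2" "0 \<le> ca" "0 \<le> sb"
      using order_trans[OF norm_ge_zero p1(1)[OF \<theta>0 z0]] order_trans[OF norm_ge_zero p2(1)[OF \<theta>0 z0]]
        order_trans[OF norm_ge_zero ca(1)[OF \<theta>0 z0]] order_trans[OF norm_ge_zero sb(1)[OF \<theta>0]] by auto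
    have E2: "W * E\<^sup>2 \<le> W * M"
    proof -
      have "E * E \<le> 1 * M" using E E1 M0 by (intro mult_mono) auto
      then show ?thesis using W1 by (simp add: power2_eq_square)
    qed
    have XkM: "X + W * E\<^sup>2 \<le> k * M"
    proof -
      have "X \<le> S * (1 + S) * KR \<tau> * (1 + S * S * S) * S * M / (\<gamma> * d powr \<tau>)"
        unfolding X_def using p1(2) p2(2) ca(2) sb(2) nn KR_pos[OF pos(2)] pos S E
        by (intro divide_right_mono mult_mono add_mono order_refl) auto
      also have "\<dots> = step_const S \<gamma> \<tau> d * M" by (simp add: step_const_def)
      finally have "X \<le> step_const S \<gamma> \<tau> d * M" .
      moreover have "0 \<le> S\<^sup>2 * M" using M0 by simp
      ultimately show ?thesis using E2 unfolding k_def core_amp_def W_def by (simp add: algebra_simps)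
    qed
    have bkM: "sb * x2 * E + W * E\<^sup>2 \<le> k * M"
    proof -
      have "sb * x2 * E \<le> S * S * M" using p2(2) sb(2) nn S E by (intro mult_mono) auto
      moreover have "0 \<le> step_const S \<gamma> \<tau> d * M" using step_const_nonneg[OF S pos] M0 by simp
      ultimately show ?thesis using E2 unfolding k_def core_amp_def W_def by (simp add: algebra_simps power2_eq_square)
    qed
    note hn = adm_near[OF adm s0]
    have hhol: "h \<theta> holomorphic_on strip s0" if "\<theta> \<in> \<Theta>" for \<theta> by (rule near_id_hol[OF hn[OF that]])
    have Hhol: "H \<theta> holomorphic_on strip r0" if "\<theta> \<in> \<Theta>" for \<theta> by (rule near_id_hol[OF H(1)[OF that]])
    define u where "u \<theta> z = H \<theta> z - h \<theta> z" for \<theta> z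
    have uhol: "u \<theta> holomorphic_on strip r0" if "\<theta> \<in> \<Theta>" for \<theta>
      unfolding u_def[abs_def] using Hhol[OF that] hhol[OF that] sub(4)
      by (intro holomorphic_on_diff) (auto intro: holomorphic_on_subset)
    have ub: "norm (u \<theta> z) \<le> k * M" if "\<theta> \<in> \<Theta>" "z \<in> strip r0" for \<theta> z
      using Hh[OF that] XkM unfolding u_def by linarith
    have du: "deriv (u \<theta>) z = deriv (H \<theta>) z - deriv (h \<theta>) z" if "\<theta> \<in> \<Theta>" "z \<in> strip r0" for \<theta> z
      unfolding u_def[abs_def] using that sub(4)
        holomorphic_on_imp_differentiable_at[OF Hhol open_strip] holomorphic_on_imp_differentiable_at[OF hhol open_strip]
      by (intro deriv_diff) auto
    have dub: "norm (deriv (u \<theta>) z) \<le> k * M / d'" if "\<theta> \<in> \<Theta>" "z \<in> strip r1" for \<theta> z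
      using that d by (intro Cauchy_strip[OF uhol ub]) (auto simp: r1_def)
    \<comment> \<open>One radius for the displacement of the conjugacy and of its first two
      derivatives.\<close>
    define rr where "rr = k * M * (1 + 1 / d' + 1 / d'\<^sup>2)"
    have k0: "0 \<le> k * M" using cp(1) M0 by simp
    have rr: "k * M \<le> rr" "k * M / d' \<le> rr" "k * M / d'\<^sup>2 \<le> rr" "0 \<le> rr"
      using k0 d unfolding rr_def by (auto simp: distrib_left)
    have S5: "1 \<le> S ^ 5" "S ^ 4 \<le> S ^ 5" "S\<^sup>2 \<le> S ^ 5"
      using power_increasing[of 0 5 S] power_increasing[of 4 5 S] power_increasing[of 2 5 S] S by auto
    have rrN: "12 * S ^ 5 * rr \<le> N * M"
      using NM[OF cp(4)] by (simp add: rr_def mult_ac)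
    have rr4: "rr \<le> 1 / (12 * S ^ 4)"
    proof -
      have "12 * S ^ 4 * rr \<le> 12 * S ^ 5 * rr" using S5 rr by (intro mult_right_mono) auto
      also have "\<dots> \<le> 1" using rrN NM1[OF order_refl] by linarith
      finally show ?thesis using S by (simp add: pos_le_divide_eq mult_ac)
    qed
    have rr2: "rr \<le> 1 / (2 * S)"
    proof -
      have "S \<le> S ^ 4" using power_increasing[of 1 4 S] S by simp
      then have "2 * S \<le> 12 * S ^ 4" using S by linarith
      then have "1 / (12 * S ^ 4) \<le> 1 / (2 * S)" using S by (intro divide_left_mono) auto
      then show ?thesis using rr4 by linarith
    qed
    have rrN1: "rr \<le> N * M" and rrN2: "2 * S\<^sup>2 * rr \<le> N * M"
    proof -
      have "1 * rr \<le> 12 * S ^ 5 * rr" "2 * S\<^sup>2 * rr \<le> 12 * S ^ 5 * rr"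
        using S5 rr by (intro mult_right_mono; linarith)+
      then show "rr \<le> N * M" "2 * S\<^sup>2 * rr \<le> N * M" using rrN by linarith+
    qed
    have c0: "norm (H \<theta> z - h \<theta> z) \<le> rr" and c1: "norm (deriv (H \<theta>) z - deriv (h \<theta>) z) \<le> rr"
      if "\<theta> \<in> \<Theta>" "z \<in> strip r1" for \<theta> z
      using ub[OF that(1), of z] dub[OF that] du[OF that(1), of z] that sub rr unfolding u_def by fastforce+
    have c2: "\<bar>b \<theta> - \<alpha> \<theta>\<bar> \<le> rr" if "\<theta> \<in> \<Theta>" for \<theta> using ba[OF that] bkM rr by linarith
    have H1: "perhol r1 (\<lambda>z. H \<theta> z - z)" if "\<theta> \<in> \<Theta>" for \<theta>
      using perhol_mono[OF H(1)[OF that]] r by simp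
    have r1s0: "r1 \<le> s0" using r by simp
    have admH: "adm A P G (2 * S) r1 (H \<theta>) (b \<theta>) \<theta>" if \<theta>: "\<theta> \<in> \<Theta>" for \<theta>
      by (rule adm_close[OF adm[OF \<theta>] s0 c0[OF \<theta>] c1[OF \<theta>] H1[OF \<theta>] H(2)[OF \<theta>] H(3)[OF \<theta>] c2[OF \<theta>] r(7) r1s0 rr4])
    have tc: "norm (average (\<lambda>z. G (b \<theta>) (H \<theta> z) / deriv (H \<theta>) (z + of_real \<theta>))
        - average (\<lambda>z. G (\<alpha> \<theta>) (h \<theta> z) / deriv (h \<theta>) (z + of_real \<theta>))) \<le> 6 * S ^ 3 * rr"
      and tc': "z \<in> strip r1 \<Longrightarrow> norm (1 / deriv (H \<theta>) z - 1 / deriv (h \<theta>) z) \<le> 2 * S\<^sup>2 * rr"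
      if \<theta>: "\<theta> \<in> \<Theta>" for \<theta> z
      using adm_twist_close[OF adm[OF \<theta>] s0 c0[OF \<theta>] c1[OF \<theta>] H1[OF \<theta>] c2[OF \<theta>] r(7) r1s0 rr2] by blast+
    have lip: "norm ((H t z - h t z) - (H s z - h s z)) \<le> l * ((k + S) * M) * \<bar>t - s\<bar>"
      and lipb: "\<bar>(b t - \<alpha> t) - (b s - \<alpha> s)\<bar> \<le> l * ((k + S) * M) * \<bar>t - s\<bar>"
      if st: "s \<in> \<Theta>" "t \<in> \<Theta>" and z: "z \<in> strip r2" for s t z
    proof -
      have kM: "k * M \<le> (k + S) * M" using S M0 by (intro mult_right_mono) auto
      have hn1: "perhol r1 (\<lambda>z. h \<theta> z - z)" if "\<theta> \<in> \<Theta>" for \<theta>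
        using perhol_mono[OF hn[OF that]] r by simp
      have hin: "h \<theta> z \<in> strip (P - 2 / (2 * S))" if "\<theta> \<in> \<Theta>" "z \<in> strip r1" for \<theta> z
        using adm_in[OF adm[OF that(1)] s0, of z] that sub by auto
      have cb: "cball (\<alpha> t) (1 / (2 * S)) \<subseteq> A"
      proof -
        have "cball (\<alpha> t) (1 / (2 * S)) \<subseteq> cball (\<alpha> t) (1 / S)" using S by (intro subset_cball) (simp add: field_simps)
        then show ?thesis using adm_A[OF adm[OF st(2)] s0] by blast
      qed
      have sm: "l * ((k + S) * M) \<le> 1"
      proof -
        have "l * (k + S) * 1 \<le> l * (k + S) * (1 + 1 / d')"
          using l0 cp(1) S d by (intro mult_left_mono) auto
        then have "l * (k + S) \<le> N" using cp(5) by linarith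
        from NM1[OF this] show ?thesis by (simp add: mult_ac)
      qed
      have e': "norm (cerr f (h t) (\<alpha> t) t z - cerr f (h s) (\<alpha> s) s z) \<le> (k + S) * M * \<bar>t - s\<bar>" if "z \<in> strip r1" for z
      proof -
        have "S * M * \<bar>t - s\<bar> \<le> (k + S) * M * \<bar>t - s\<bar>"
          using cp(1) M0 by (intro mult_right_mono) auto
        then show ?thesis using eL[OF st, of z] that sub by fastforce
      qed
      have u': "norm (H \<theta> z - h \<theta> z) \<le> (k + S) * M" if "\<theta> \<in> \<Theta>" "z \<in> strip r1" for \<theta> z
        using ub[OF that(1), of z] that sub kM unfolding u_def by fastforce
      have v': "\<bar>b \<theta> - \<alpha> \<theta>\<bar> \<le> (k + S) * M" if "\<theta> \<in> \<Theta>" for \<theta>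
        using ba[OF that] bkM kM by linarith
      have h': "norm (h t z - h s z) \<le> 2 * S * \<bar>t - s\<bar>" if "z \<in> strip r1" for z
      proof -
        have "S * \<bar>t - s\<bar> \<le> 2 * S * \<bar>t - s\<bar>" using S by (intro mult_right_mono) auto
        then show ?thesis using hL[OF st, of z] that sub by fastforce
      qed
      have a': "\<bar>\<alpha> t - \<alpha> s\<bar> \<le> 2 * S * \<bar>t - s\<bar>"
      proof -
        have "S * \<bar>t - s\<bar> \<le> 2 * S * \<bar>t - s\<bar>" using S by (intro mult_right_mono) auto
        then show ?thesis using aL[OF st] by linarith
      qed
      have exr: "f (b \<theta>) (H \<theta> z) = H \<theta> (z + of_real \<theta>)" if "\<theta> \<in> \<Theta>" "z \<in> strip r1" for \<theta> z
        using ex[OF that(1)] that sub by blast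
      \<comment> \<open>The estimate is used in the locale with \<open>2 * S\<close>, the bound
        valid for the exact solutions. Its domain condition for the original maps, with
        \<open>2 / (2 * S)\<close>, is then exactly admissibility with \<open>S\<close>.\<close>
      note le = T.lipschitz_estimate[OF admH[OF st(2)] dio[OF st(2)] pos r(8) r(3) H1[OF st(1)] H(3)[OF st(1)]
        hn1[OF st(2)] adm_avg[OF adm[OF st(2)] s0] hn1[OF st(1)] adm_avg[OF adm[OF st(1)] s0]
        hin[OF st(2)] hin[OF st(1)] cb exr[OF st(2)] exr[OF st(1)] u'[OF st(2)] u'[OF st(1)] v'[OF st(2)] v'[OF st(1)]
        e' h' a', unfolded r(9), folded l_def, OF _ _ _ _ _ _ _ _ sm]
      show "norm ((H t z - h t z) - (H s z - h s z)) \<le> l * ((k + S) * M) * \<bar>t - s\<bar>"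
        by (rule le(1)) (use z in auto)
      show "\<bar>(b t - \<alpha> t) - (b s - \<alpha> s)\<bar> \<le> l * ((k + S) * M) * \<bar>t - s\<bar>"
        by (rule le(2)) auto
    qed
    have lN: "l * ((k + S) * M) \<le> N * M" "l * ((k + S) * M) / d' \<le> N * M"
    proof -
      have "l * (k + S) * 1 \<le> l * (k + S) * (1 + 1 / d')" "l * (k + S) * (1 / d') \<le> l * (k + S) * (1 + 1 / d')"
        using l0 cp(1) S d by (intro mult_left_mono; simp)+
      then have "l * (k + S) \<le> N" "l * (k + S) / d' \<le> N" using cp(5) by simp_all
      from NM[OF this(1)] NM[OF this(2)] show "l * ((k + S) * M) \<le> N * M" "l * ((k + S) * M) / d' \<le> N * M"
        by (simp_all add: mult_ac)
    qed
    have s31: "z \<in> strip r1" "z \<in> strip r2" "z \<in> strip r0" if "z \<in> strip r3" for z using that sub by auto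
    show ?thesis
    proof (rule that[of H b, unfolded r3, folded N_def])
      fix \<theta> assume \<theta>: "\<theta> \<in> \<Theta>"
      show "adm A P G (2 * S) r3 (H \<theta>) (b \<theta>) \<theta>"
        using admH[OF \<theta>] perhol_mono[of r1 "\<lambda>z. H \<theta> z - z" r3] s31(1) r unfolding adm_def by auto
      show "\<bar>b \<theta> - \<alpha> \<theta>\<bar> \<le> sb * x2 * E + N * E\<^sup>2"
        using ba[OF \<theta>] mult_right_mono[OF cp(3), of "E\<^sup>2"] by simp
      show "norm (1 / average (\<lambda>z. G (b \<theta>) (H \<theta> z) / deriv (H \<theta>) (z + of_real \<theta>))
        - 1 / average (\<lambda>z. G (\<alpha> \<theta>) (h \<theta> z) / deriv (h \<theta>) (z + of_real \<theta>))) \<le> N * M"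
      proof -
        define q where "q = average (\<lambda>z. G (b \<theta>) (H \<theta> z) / deriv (H \<theta>) (z + of_real \<theta>))"
        define q0 where "q0 = average (\<lambda>z. G (\<alpha> \<theta>) (h \<theta> z) / deriv (h \<theta>) (z + of_real \<theta>))"
        have q: "q \<noteq> 0" "norm (1 / q) \<le> 2 * S"
          using T.adm_b0[OF admH[OF \<theta>] r(7)] T.adm_b1[OF admH[OF \<theta>] r(7)] by (simp_all add: q_def)
        have q0: "q0 \<noteq> 0" "norm (1 / q0) \<le> S"
          using adm_b0[OF adm[OF \<theta>] s0] adm_b1[OF adm[OF \<theta>] s0] by (simp_all add: q0_def)
        have "1 / q - 1 / q0 = - (q - q0) * ((1 / q) * (1 / q0))"
          using q q0 by (simp add: field_simps)
        then have "norm (1 / q - 1 / q0) = norm (q - q0) * (norm (1 / q) * norm (1 / q0))"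
          by (simp only: norm_mult norm_minus_cancel)
        also have "\<dots> \<le> (6 * S ^ 3 * rr) * ((2 * S) * S)"
          using tc[OF \<theta>] q q0 S rr by (intro mult_mono) (auto simp: q_def q0_def)
        also have "\<dots> = 12 * S ^ 5 * rr" by (simp add: power_numeral_reduce)
        finally show ?thesis using rrN by (simp add: q_def q0_def)
      qed
      fix z assume z: "z \<in> strip r3"
      show "f (b \<theta>) (H \<theta> z) = H \<theta> (z + of_real \<theta>)" by (rule ex[OF \<theta> s31(3)[OF z]])
      show "norm (H \<theta> z - h \<theta> z)
        \<le> x1 * (1 + x1) * KR \<tau> * (1 + ca * sb * x2) * x2 * E / (\<gamma> * d powr \<tau>) + N * E\<^sup>2"
        using Hh[OF \<theta> s31(3)[OF z]] mult_right_mono[OF cp(3), of "E\<^sup>2"] by (simp add: X_def)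
      show "norm (deriv (H \<theta>) z - deriv (h \<theta>) z) \<le> N * M"
        using c1[OF \<theta> s31(1)[OF z]] rrN1 by linarith
      show "norm (1 / deriv (H \<theta>) z - 1 / deriv (h \<theta>) z) \<le> N * M"
        using tc'[OF \<theta> s31(1)[OF z]] rrN2 by linarith
      show "norm (deriv (deriv (H \<theta>)) z - deriv (deriv (h \<theta>)) z) \<le> N * M"
      proof -
        have dh: "deriv (u \<theta>) holomorphic_on strip r1"
          using holomorphic_deriv[OF uhol[OF \<theta>] open_strip] sub(3) by (rule holomorphic_on_subset)
        have "deriv (deriv (u \<theta>)) z = deriv (\<lambda>z. deriv (H \<theta>) z - deriv (h \<theta>) z) z"
          by (rule deriv_cong_strip[OF du[OF \<theta>] s31(3)[OF z]])
        also have "\<dots> = deriv (deriv (H \<theta>)) z - deriv (deriv (h \<theta>)) z"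
          using s31(3)[OF z] sub(4)
            holomorphic_on_imp_differentiable_at[OF holomorphic_deriv[OF Hhol[OF \<theta>] open_strip] open_strip]
            holomorphic_on_imp_differentiable_at[OF holomorphic_deriv[OF hhol[OF \<theta>] open_strip] open_strip]
          by (intro deriv_diff) auto
        finally have "deriv (deriv (H \<theta>)) z - deriv (deriv (h \<theta>)) z = deriv (deriv (u \<theta>)) z" ..
        moreover have "norm (deriv (deriv (u \<theta>)) z) \<le> k * M / d' / d'"
          using s31(2)[OF z] d dub[OF \<theta>] by (intro Cauchy_strip[OF dh]) (auto simp: r2_def)
        ultimately show ?thesis using rr(3) rrN1 by (simp add: power2_eq_square)
      qed
    next
      fix s t assume st: "s \<in> \<Theta>" "t \<in> \<Theta>"
      show "\<bar>(b t - \<alpha> t) - (b s - \<alpha> s)\<bar> \<le> N * M * \<bar>t - s\<bar>"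
      proof -
        have "(0::complex) \<in> strip r2" using r by (simp add: strip_def)
        from order_trans[OF lipb[OF st this] mult_right_mono[OF lN(1)]] show ?thesis by simp
      qed
      fix z assume z: "z \<in> strip r3"
      show "norm ((H t z - h t z) - (H s z - h s z)) \<le> N * M * \<bar>t - s\<bar>"
        using order_trans[OF lip[OF st s31(2)[OF z]] mult_right_mono[OF lN(1)]] by simp
      show "norm ((deriv (H t) z - deriv (h t) z) - (deriv (H s) z - deriv (h s) z)) \<le> N * M * \<bar>t - s\<bar>"
      proof -
        have uh2: "u \<theta> holomorphic_on strip r2" if "\<theta> \<in> \<Theta>" for \<theta>
          using uhol[OF that] sub by (auto intro: holomorphic_on_subset)
        have "norm (deriv (\<lambda>z. u t z - u s z) z) \<le> (l * ((k + S) * M) * \<bar>t - s\<bar>) / d'"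
        proof (rule Cauchy_strip[OF holomorphic_on_diff[OF uh2[OF st(2)] uh2[OF st(1)]]])
          show "norm (u t x - u s x) \<le> l * ((k + S) * M) * \<bar>t - s\<bar>" if "x \<in> strip r2" for x
            using lip[OF st that] by (simp add: u_def)
        qed (use d z in \<open>auto simp: r3_def\<close>)
        moreover have "deriv (\<lambda>z. u t z - u s z) z = deriv (u t) z - deriv (u s) z"
          using s31(3)[OF z] holomorphic_on_imp_differentiable_at[OF uhol open_strip] st
          by (intro deriv_diff) auto
        moreover have "(l * ((k + S) * M) * \<bar>t - s\<bar>) / d' \<le> N * M * \<bar>t - s\<bar>"
          using mult_right_mono[OF lN(2), of "\<bar>t - s\<bar>"] by simp
        ultimately show ?thesis using du[OF st(1) s31(3)[OF z]] du[OF st(2) s31(3)[OF z]] by simp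
      qed
    qed
  qed
qed

end

text \<open>If \<open>\<alpha>\<close> expands at rate \<open>l\<close>, then \<open>b\<close>
  expands at least at rate \<open>l - D\<close>. Subtracting \<open>2 * D\<close> instead leaves the
  spare \<open>D\<close> that makes the inequality strict; for \<open>l \<le> D\<close> the claimed
  lower bound is not positive.\<close>

lemma measure_conclusion:
  fixes \<alpha> b :: "real \<Rightarrow> real"
  assumes \<Theta>: "\<Theta> \<in> sets lebesgue"
    and L: "\<And>s t. s \<in> \<Theta> \<Longrightarrow> t \<in> \<Theta> \<Longrightarrow> \<bar>\<alpha> t - \<alpha> s\<bar> \<le> L * \<bar>t - s\<bar>"
    and D: "\<And>s t. s \<in> \<Theta> \<Longrightarrow> t \<in> \<Theta> \<Longrightarrow> \<bar>(b t - \<alpha> t) - (b s - \<alpha> s)\<bar> \<le> D * \<bar>t - s\<bar>" "0 \<le> D"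
  shows "b ` \<Theta> \<in> sets lebesgue"
    and "(enn2ereal (inf_lip \<Theta> \<alpha>) - ereal (2 * D)) * enn2ereal (emeasure lebesgue \<Theta>)
      \<le> enn2ereal (emeasure lebesgue (b ` \<Theta>))"
    and "0 < D \<Longrightarrow> 0 < emeasure lebesgue \<Theta> \<Longrightarrow> emeasure lebesgue \<Theta> < \<infinity> \<Longrightarrow>
      (enn2ereal (inf_lip \<Theta> \<alpha>) - ereal (2 * D)) * enn2ereal (emeasure lebesgue \<Theta>)
      < enn2ereal (emeasure lebesgue (b ` \<Theta>))"
proof -
  show bS: "b ` \<Theta> \<in> sets lebesgue"
  proof (rule lipschitz_image_sets_lebesgue[OF \<Theta>])
    fix s t assume st: "s \<in> \<Theta>" "t \<in> \<Theta>"
    have "\<bar>b t - b s\<bar> \<le> L * \<bar>t - s\<bar> + D * \<bar>t - s\<bar>" using L[OF st] D(1)[OF st] by linarith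
    then show "\<bar>b t - b s\<bar> \<le> (L + D) * \<bar>t - s\<bar>" by (simp add: algebra_simps)
  qed
  have pos: "(enn2ereal (inf_lip \<Theta> \<alpha>) - ereal (2 * D)) * enn2ereal (emeasure lebesgue \<Theta>)
      \<le> enn2ereal (emeasure lebesgue (b ` \<Theta>)) \<and>
    (0 < D \<and> emeasure lebesgue \<Theta> < \<infinity> \<longrightarrow>
      (enn2ereal (inf_lip \<Theta> \<alpha>) - ereal (2 * D)) * enn2ereal (emeasure lebesgue \<Theta>)
      < enn2ereal (emeasure lebesgue (b ` \<Theta>)))" if m: "0 < emeasure lebesgue \<Theta>"
  proof -
    obtain s0 where s0: "s0 \<in> \<Theta>" using m by (cases "\<Theta> = {}") auto
    \<comment> \<open>Two distinct points make \<open>inf_lip\<close> finite; as an infimum over the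
      empty set it would be infinite.\<close>
    have "\<not> \<Theta> \<subseteq> {s0}"
    proof
      assume "\<Theta> \<subseteq> {s0}"
      then have "emeasure lebesgue \<Theta> \<le> emeasure lebesgue {s0}" by (intro emeasure_mono) auto
      then show False using m by simp
    qed
    then obtain t0 where t0: "t0 \<in> \<Theta>" "t0 \<noteq> s0" by auto
    have "inf_lip \<Theta> \<alpha> \<le> ennreal (\<bar>\<alpha> t0 - \<alpha> s0\<bar> / \<bar>t0 - s0\<bar>)"
      unfolding inf_lip_def using s0 t0 by (intro INF_lower2[of "(s0, t0)"]) auto
    then obtain l where l: "inf_lip \<Theta> \<alpha> = ennreal l" "0 \<le> l"
      by (cases "inf_lip \<Theta> \<alpha>") (auto simp: top_unique)
    have ll: "l * \<bar>t - s\<bar> \<le> \<bar>\<alpha> t - \<alpha> s\<bar>" if st: "s \<in> \<Theta>" "t \<in> \<Theta>" for s t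
    proof (cases "s = t")
      case False
      have "ennreal l \<le> ennreal (\<bar>\<alpha> t - \<alpha> s\<bar> / \<bar>t - s\<bar>)"
        unfolding l(1)[symmetric] inf_lip_def using st False by (intro INF_lower2[of "(s, t)"]) auto
      then have "l \<le> \<bar>\<alpha> t - \<alpha> s\<bar> / \<bar>t - s\<bar>" by simp
      then show ?thesis using False by (simp add: pos_le_divide_eq)
    qed simp
    have sub: "enn2ereal (inf_lip \<Theta> \<alpha>) - ereal (2 * D) = ereal (l - 2 * D)"
      using l by simp
    have m0: "0 \<le> enn2ereal (emeasure lebesgue \<Theta>)" by simp
    have bl: "(l - D) * \<bar>t - s\<bar> \<le> \<bar>b t - b s\<bar>" if st: "s \<in> \<Theta>" "t \<in> \<Theta>" for s t
      using ll[OF st] D(1)[OF st] by (simp add: algebra_simps)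
    have fin: "enn2ereal (emeasure lebesgue \<Theta>) = ereal (measure lebesgue \<Theta>)" "0 < measure lebesgue \<Theta>"
      if "emeasure lebesgue \<Theta> < \<infinity>"
    proof -
      have e: "emeasure lebesgue \<Theta> = ennreal (measure lebesgue \<Theta>)"
        using that by (simp add: emeasure_eq_ennreal_measure)
      then show "enn2ereal (emeasure lebesgue \<Theta>) = ereal (measure lebesgue \<Theta>)" by simp
      show "0 < measure lebesgue \<Theta>" using m e by simp
    qed
    show ?thesis
    proof (cases "0 < l - D")
      case True
      have "ennreal (l - D) * emeasure lebesgue \<Theta> \<le> emeasure lebesgue (b ` \<Theta>)"
        by (rule emeasure_expansive_image[OF bS True bl])
      then have "enn2ereal (ennreal (l - D) * emeasure lebesgue \<Theta>) \<le> enn2ereal (emeasure lebesgue (b ` \<Theta>))"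
        by (simp add: less_eq_ennreal.rep_eq)
      then have le: "ereal (l - D) * enn2ereal (emeasure lebesgue \<Theta>) \<le> enn2ereal (emeasure lebesgue (b ` \<Theta>))"
        using True by (simp add: times_ennreal.rep_eq)
      have "ereal (l - 2 * D) * enn2ereal (emeasure lebesgue \<Theta>) \<le> ereal (l - D) * enn2ereal (emeasure lebesgue \<Theta>)"
        using D(2) by (intro ereal_mult_right_mono) auto
      moreover have "ereal (l - 2 * D) * enn2ereal (emeasure lebesgue \<Theta>) < ereal (l - D) * enn2ereal (emeasure lebesgue \<Theta>)"
        if "0 < D" "emeasure lebesgue \<Theta> < \<infinity>"
        using fin[OF that(2)] that(1) by (simp add: mult_strict_right_mono)
      ultimately show ?thesis unfolding sub using le by (meson order_trans less_le_trans)
    next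
      case False
      have "ereal (l - 2 * D) * enn2ereal (emeasure lebesgue \<Theta>) \<le> 0 * enn2ereal (emeasure lebesgue \<Theta>)"
        using False D(2) m0 by (intro ereal_mult_right_mono) auto
      then have "ereal (l - 2 * D) * enn2ereal (emeasure lebesgue \<Theta>) \<le> 0" by simp
      moreover have "ereal (l - 2 * D) * enn2ereal (emeasure lebesgue \<Theta>) < 0" if "0 < D" "emeasure lebesgue \<Theta> < \<infinity>"
        using fin[OF that(2)] that(1) False by (simp add: mult_neg_pos)
      moreover have "0 \<le> enn2ereal (emeasure lebesgue (b ` \<Theta>))" by simp
      ultimately show ?thesis unfolding sub by (meson order_trans less_le_trans)
    qed
  qed
  show "(enn2ereal (inf_lip \<Theta> \<alpha>) - ereal (2 * D)) * enn2ereal (emeasure lebesgue \<Theta>)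
      \<le> enn2ereal (emeasure lebesgue (b ` \<Theta>))"
  proof (cases "emeasure lebesgue \<Theta> = 0")
    case False
    then show ?thesis using pos by (simp add: zero_less_iff_neq_zero)
  qed (simp add: zero_ennreal.rep_eq)
  show "(enn2ereal (inf_lip \<Theta> \<alpha>) - ereal (2 * D)) * enn2ereal (emeasure lebesgue \<Theta>)
      < enn2ereal (emeasure lebesgue (b ` \<Theta>))"
    if "0 < D" "0 < emeasure lebesgue \<Theta>" "emeasure lebesgue \<Theta> < \<infinity>"
    using pos that by blast
qed

text \<open>Keeping only the first term of the Hurwitz series gives
  \<open>KR \<tau> \<le> 2 * const_R \<tau>\<close>, and \<open>2 \<le> 2 powr \<tau>\<close>. The
  factor \<open>2 powr \<tau>\<close> is affordable because the first step loses the width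
  \<open>2 * \<delta>\<close> and not \<open>\<delta>\<close>.\<close>

lemma KR_le_const_R:
  assumes "1 \<le> \<tau>"
  shows "KR \<tau> \<le> 2 powr \<tau> * const_R \<tau>" "0 < const_R \<tau>"
proof -
  define a where "a = (2::real) powr \<tau>"
  have a: "2 \<le> a" unfolding a_def using assms powr_mono[of 1 \<tau> 2] by simp
  have "summable (\<lambda>n. real (Suc n) powr (-2))"
    using summable_real_powr_iff[of "-2"] summable_Suc_iff[of "\<lambda>n. real n powr (-2)"] by simp
  then have sm: "summable (\<lambda>n. (real n + a) powr (-2))"
  proof (rule summable_comparison_test'[where N = 0])
    fix n
    show "norm ((real n + a) powr (-2)) \<le> real (Suc n) powr (-2)"
      using a by (simp add: powr_mono2')
  qed
  have "a powr (-2) = (\<Sum>n<1. (real n + a) powr (-2))" by simp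
  also have "\<dots> \<le> hurwitz_zeta 2 a"
    unfolding hurwitz_zeta_def using sm by (intro sum_le_suminf) auto
  finally have hz: "a powr (-2) \<le> hurwitz_zeta 2 a" .
  have G: "0 < Gamma (2 * \<tau> + 1)" using assms by (intro Gamma_real_pos) simp
  have sa: "sqrt (a powr (-2)) = 1 / a"
  proof -
    have "a powr (-2) = (1 / a)\<^sup>2" using a by (simp add: powr_minus power_divide divide_inverse power2_eq_square)
    then show ?thesis using a by (simp add: real_sqrt_divide)
  qed
  have "1 / a * sqrt (Gamma (2 * \<tau> + 1)) \<le> sqrt (hurwitz_zeta 2 a * Gamma (2 * \<tau> + 1))"
    unfolding sa[symmetric] real_sqrt_mult using hz G by (intro mult_right_mono) auto
  then have "1 / a * sqrt (Gamma (2 * \<tau> + 1)) / (2 * (2 * pi) powr \<tau>) \<le> const_R \<tau>"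
    unfolding const_R_def a_def[symmetric] by (intro divide_right_mono) auto
  moreover have "(4 * pi) powr \<tau> = a * (2 * pi) powr \<tau>"
  proof -
    have "4 * pi = 2 * (2 * pi)" by simp
    then show ?thesis unfolding a_def by (metis powr_mult zero_le_numeral mult_nonneg_nonneg pi_ge_zero)
  qed
  ultimately have R: "KR \<tau> / 2 \<le> const_R \<tau>"
    by (simp add: KR_def mult_ac)
  have "0 < KR \<tau>" using assms by (intro KR_pos) simp
  with R show R0: "0 < const_R \<tau>" by linarith
  have "KR \<tau> \<le> 2 * const_R \<tau>" using R by simp
  also have "\<dots> \<le> a * const_R \<tau>" using a R0 by (intro mult_right_mono) auto
  finally show "KR \<tau> \<le> 2 powr \<tau> * const_R \<tau>" by (simp add: a_def)
qed

text \<open>The term with \<open>j = 0\<close> equals 1, its exponent \<open>2 ^ 0 - 1\<close> being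
  0, and the others are nonnegative. Comparison with a geometric series in
  \<open>a powr (- l)\<close> gives convergence, also for \<open>\<kappa> = 1\<close>.\<close>

lemma Sigma_series_ge_1:
  assumes "1 < a" "0 \<le> \<kappa>" "\<kappa> \<le> 1" "0 < l"
  shows "1 \<le> Sigma_series a \<kappa> l"
proof -
  have q: "0 < a powr (- l)" "a powr (- l) < 1"
    using assms powr_less_mono[of "- l" 0 a] by auto
  have pw: "a powr (- l * real j) = (a powr (- l)) ^ j" for j
    using assms by (simp add: powr_realpow [symmetric] powr_powr)
  have sm: "summable (\<lambda>j::nat. \<kappa> ^ (2 ^ j - 1) * a powr (- l * real j))"
  proof (rule summable_comparison_test'[where N = 0])
    show "summable (\<lambda>j. (a powr (- l)) ^ j)" using q by (intro summable_geometric) auto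
    fix j :: nat
    have "\<kappa> ^ (2 ^ j - 1) * (a powr (- l)) ^ j \<le> 1 * (a powr (- l)) ^ j"
      using assms q by (intro mult_right_mono power_le_one) auto
    then show "norm (\<kappa> ^ (2 ^ j - 1) * a powr (- l * real j)) \<le> (a powr (- l)) ^ j"
      unfolding pw using assms q by simp
  qed
  have "(\<Sum>j<1. \<kappa> ^ (2 ^ j - 1) * a powr (- l * real j)) \<le> Sigma_series a \<kappa> l"
    unfolding Sigma_series_def using sm assms by (intro sum_le_suminf) auto
  then show ?thesis using assms by simp
qed

text \<open>The prescribed closeness constants are at least the first-step constants, as the series
  are at least 1; the power of \<open>const_a3\<close> turns \<open>\<rho> powr \<tau>\<close> into
  \<open>\<delta> powr \<tau>\<close>. \<open>const_kappa\<close> is linear in the error, so its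
  value at error 1 serves as a coefficient.\<close>

lemma frak_bounds:
  assumes p: "0 < \<rho>" "0 < \<gamma>" "1 \<le> \<tau>" "0 < \<delta>" "0 < \<rho>inf" "\<rho>inf < \<rho> - 2 * \<delta>"
    and c: "0 \<le> c 0 1" "0 \<le> c 2 0" "0 \<le> c 1 1" "0 \<le> c 0 2"
    and \<sigma>: "0 < \<sigma>1" "0 < \<sigma>2" "0 < \<sigma>b"
  shows "0 < const_C1 \<tau> \<sigma>1 \<sigma>2 \<sigma>b c"
    and "0 \<le> const_kappa \<rho> \<rho>inf \<delta> \<gamma> \<tau> \<sigma>1 \<sigma>2 \<sigma>b c 1"
    and "0 \<le> E \<Longrightarrow> const_kappa \<rho> \<rho>inf \<delta> \<gamma> \<tau> \<sigma>1 \<sigma>2 \<sigma>b c 1 * E \<le> 1 \<Longrightarrow>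
      \<sigma>1 * const_C1 \<tau> \<sigma>1 \<sigma>2 \<sigma>b c / (\<gamma> * \<delta> powr \<tau>)
        \<le> const_frakC2 \<rho> \<rho>inf \<delta> \<gamma> \<tau> \<sigma>1 \<sigma>2 \<sigma>b c E / (\<gamma> * \<rho> powr \<tau>)"
    and "0 \<le> E \<Longrightarrow> const_kappa \<rho> \<rho>inf \<delta> \<gamma> \<tau> \<sigma>1 \<sigma>2 \<sigma>b c 1 * E \<le> 1 \<Longrightarrow>
      \<sigma>b * \<sigma>2 \<le> const_frakC3 \<rho> \<rho>inf \<delta> \<gamma> \<tau> \<sigma>1 \<sigma>2 \<sigma>b c E"
proof -
  define C1 where "C1 = const_C1 \<tau> \<sigma>1 \<sigma>2 \<sigma>b c"
  have R: "0 < const_R \<tau>" by (rule KR_le_const_R(2)[OF p(3)])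
  have "0 < 1 + c 0 1 * \<sigma>b * \<sigma>2" using c \<sigma> by (simp add: add_pos_nonneg)
  then show C1: "0 < const_C1 \<tau> \<sigma>1 \<sigma>2 \<sigma>b c"
    unfolding const_C1_def using \<sigma> R by (intro mult_pos_pos) auto
  have "0 \<le> const_C3 \<gamma> \<tau> \<delta> \<sigma>1 \<sigma>2 \<sigma>b c"
    unfolding const_C3_def Let_def using C1 p c \<sigma> by (intro add_nonneg_nonneg mult_nonneg_nonneg) auto
  then show k0: "0 \<le> const_kappa \<rho> \<rho>inf \<delta> \<gamma> \<tau> \<sigma>1 \<sigma>2 \<sigma>b c 1"
    unfolding const_kappa_def by simp
  have a1: "1 < const_a1 \<rho> \<rho>inf \<delta>"
    unfolding const_a1_def using p by (simp add: pos_less_divide_eq)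
  have Sg: "1 \<le> Sigma_series (const_a1 \<rho> \<rho>inf \<delta>) (const_kappa \<rho> \<rho>inf \<delta> \<gamma> \<tau> \<sigma>1 \<sigma>2 \<sigma>b c E) l"
    if "0 \<le> E" "const_kappa \<rho> \<rho>inf \<delta> \<gamma> \<tau> \<sigma>1 \<sigma>2 \<sigma>b c 1 * E \<le> 1" "0 < l" for l
  proof -
    have "const_kappa \<rho> \<rho>inf \<delta> \<gamma> \<tau> \<sigma>1 \<sigma>2 \<sigma>b c E = const_kappa \<rho> \<rho>inf \<delta> \<gamma> \<tau> \<sigma>1 \<sigma>2 \<sigma>b c 1 * E"
      by (simp add: const_kappa_def)
    then show ?thesis using that k0 a1 by (intro Sigma_series_ge_1) auto
  qed
  show "\<sigma>1 * const_C1 \<tau> \<sigma>1 \<sigma>2 \<sigma>b c / (\<gamma> * \<delta> powr \<tau>)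
        \<le> const_frakC2 \<rho> \<rho>inf \<delta> \<gamma> \<tau> \<sigma>1 \<sigma>2 \<sigma>b c E / (\<gamma> * \<rho> powr \<tau>)"
    if E: "0 \<le> E" "const_kappa \<rho> \<rho>inf \<delta> \<gamma> \<tau> \<sigma>1 \<sigma>2 \<sigma>b c 1 * E \<le> 1"
  proof -
    let ?s = "Sigma_series (const_a1 \<rho> \<rho>inf \<delta>) (const_kappa \<rho> \<rho>inf \<delta> \<gamma> \<tau> \<sigma>1 \<sigma>2 \<sigma>b c E) \<tau>"
    have "1 \<le> ?s" using Sg[OF E] p by simp
    then have "\<sigma>1 * C1 / (\<gamma> * \<delta> powr \<tau>) * 1 \<le> \<sigma>1 * C1 / (\<gamma> * \<delta> powr \<tau>) * ?s"
      using C1 \<sigma> p by (intro mult_left_mono) (auto simp: C1_def)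
    also have "\<dots> = const_frakC2 \<rho> \<rho>inf \<delta> \<gamma> \<tau> \<sigma>1 \<sigma>2 \<sigma>b c E / (\<gamma> * \<rho> powr \<tau>)"
      using p by (simp add: const_frakC2_def const_a3_def C1_def powr_divide field_simps)
    finally show ?thesis by (simp add: C1_def)
  qed
  show "\<sigma>b * \<sigma>2 \<le> const_frakC3 \<rho> \<rho>inf \<delta> \<gamma> \<tau> \<sigma>1 \<sigma>2 \<sigma>b c E"
    if E: "0 \<le> E" "const_kappa \<rho> \<rho>inf \<delta> \<gamma> \<tau> \<sigma>1 \<sigma>2 \<sigma>b c 1 * E \<le> 1"
    unfolding const_frakC3_def using mult_left_mono[OF Sg[OF E, of "2 * \<tau>"], of "\<sigma>b * \<sigma>2"] p \<sigma> by simp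
qed

text \<open>Strict pointwise bounds do not survive a supremum; the intermediate \<open>B\<close>,
  supplied by the margin, does.\<close>

lemma fam_norm_less:
  assumes "\<And>\<theta> z. \<theta> \<in> \<Theta> \<Longrightarrow> z \<in> strip s \<Longrightarrow> norm (g \<theta> z) \<le> B" "0 \<le> B" "B < \<sigma>"
  shows "fam_norm \<Theta> s g < ennreal \<sigma>"
proof -
  have "fam_norm \<Theta> s g \<le> ennreal B" using assms by (simp add: fam_norm_le_iff)
  also have "\<dots> < ennreal \<sigma>" using assms by (simp add: ennreal_lessI)
  finally show ?thesis .
qed

lemma sup_norm_less:
  assumes "\<And>\<theta>. \<theta> \<in> \<Theta> \<Longrightarrow> norm (g \<theta>) \<le> B" "0 \<le> B" "B < \<sigma>"
  shows "sup_norm \<Theta> g < ennreal \<sigma>"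
proof -
  have "sup_norm \<Theta> g \<le> ennreal B" using assms by (simp add: sup_norm_le_iff)
  also have "\<dots> < ennreal \<sigma>" using assms by (simp add: ennreal_lessI)
  finally show ?thesis .
qed

lemma fam_Lip_less:
  assumes "\<And>s t z. s \<in> \<Theta> \<Longrightarrow> t \<in> \<Theta> \<Longrightarrow> z \<in> strip \<rho> \<Longrightarrow> norm (g t z - g s z) \<le> B * \<bar>t - s\<bar>" "0 \<le> B" "B < \<sigma>"
  shows "fam_Lip \<Theta> \<rho> g < ennreal \<sigma>"
proof -
  have "fam_Lip \<Theta> \<rho> g \<le> ennreal B" using assms by (simp add: fam_Lip_le_iff)
  also have "\<dots> < ennreal \<sigma>" using assms by (simp add: ennreal_lessI)
  finally show ?thesis .
qed

lemma sup_Lip_less: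
  assumes "\<And>s t. s \<in> \<Theta> \<Longrightarrow> t \<in> \<Theta> \<Longrightarrow> \<bar>g t - g s\<bar> \<le> B * \<bar>t - s\<bar>" "0 \<le> B" "B < \<sigma>"
  shows "sup_Lip \<Theta> g < ennreal \<sigma>"
proof -
  have "sup_Lip \<Theta> g \<le> ennreal B" using assms by (simp add: sup_Lip_le_iff)
  also have "\<dots> < ennreal \<sigma>" using assms by (simp add: ennreal_lessI)
  finally show ?thesis .
qed

text \<open>An interval around \<open>a\<close> that left \<open>A\<close> would meet the frontier,
  by connectedness.\<close>

lemma cball_subset_of_frontier:
  fixes A :: "real set"
  assumes "a \<in> A" "\<And>y. y \<in> frontier A \<Longrightarrow> m \<le> dist a y" "r < m" "0 < r"
  shows "cball a r \<subseteq> A"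
proof (rule ccontr)
  assume "\<not> cball a r \<subseteq> A"
  moreover have "a \<in> cball a r \<inter> A" using assms by simp
  ultimately have "cball a r \<inter> frontier A \<noteq> {}"
    by (intro connected_Int_frontier convex_connected convex_cball) blast+
  then show False using assms(2,3) by force
qed

lemma ennreal_mult_le_imp_le_divide:
  assumes "ennreal k * x \<le> ennreal M" "0 < k" "0 \<le> M"
  shows "x \<le> ennreal (M / k)"
proof (cases x)
  case (real r)
  then have "ennreal (k * r) \<le> ennreal M" using assms by (simp add: ennreal_mult)
  then have "k * r \<le> M" using assms by simp
  then show ?thesis using real assms by (simp add: field_simps)
next
  case top
  then show ?thesis using assms by (simp add: ennreal_mult_top top_unique)
qed

text \<open>The body repeats the premise of the theorem word for word, and
  \<open>kam_conclusion\<close> its conclusion, so that unfolding both matches the final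
  goal.\<close>

definition kam_hypotheses ::
  "real set \<Rightarrow> real \<Rightarrow> real \<Rightarrow> real \<Rightarrow> real \<Rightarrow> real \<Rightarrow> real \<Rightarrow> real \<Rightarrow> real \<Rightarrow> real \<Rightarrow> real \<Rightarrow> real \<Rightarrow> (nat \<Rightarrow> nat \<Rightarrow> real) \<Rightarrow>
   (real \<Rightarrow> complex \<Rightarrow> complex) \<Rightarrow> real set \<Rightarrow> (real \<Rightarrow> complex \<Rightarrow> complex) \<Rightarrow> (real \<Rightarrow> real) \<Rightarrow> bool" where
  "kam_hypotheses A \<rho>hat \<rho> \<gamma> \<tau> \<sigma>1 \<sigma>2 \<sigma>3 \<sigma>b \<beta>0 \<beta>1 \<beta>2 c f \<Theta> h \<alpha> \<longleftrightarrow>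
      open A \<and> C3_family A \<rho>hat f \<and>
      deriv_bounds A \<rho>hat f c \<and>
      \<Theta> \<subseteq> Diophantine \<gamma> \<tau> \<and>
      (\<forall>\<theta>\<in>\<Theta>. h \<theta> \<in> circle_maps \<rho> \<and> \<alpha> \<theta> \<in> A) \<and>
      conj_bounds \<Theta> \<rho> \<rho>hat \<sigma>1 \<sigma>2 \<sigma>3 h \<and>
      twist_bound \<Theta> \<sigma>b f h \<alpha> \<and>
      Lip_bounds \<Theta> \<rho> \<beta>0 \<beta>1 \<beta>2 h \<alpha>"

definition kam_conclusion ::
  "real set \<Rightarrow> real \<Rightarrow> real \<Rightarrow> real \<Rightarrow> real \<Rightarrow> real \<Rightarrow> real \<Rightarrow> real \<Rightarrow> real \<Rightarrow> real \<Rightarrow> real \<Rightarrow> real \<Rightarrow> real \<Rightarrow> real \<Rightarrow>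
   (nat \<Rightarrow> nat \<Rightarrow> real) \<Rightarrow> (real \<Rightarrow> complex \<Rightarrow> complex) \<Rightarrow> real set \<Rightarrow> (real \<Rightarrow> complex \<Rightarrow> complex) \<Rightarrow>
   (real \<Rightarrow> real) \<Rightarrow> real \<Rightarrow> bool" where
  "kam_conclusion A \<rho>hat \<rho> \<rho>inf \<delta> \<gamma> \<tau> \<sigma>1 \<sigma>2 \<sigma>3 \<sigma>b \<beta>0 \<beta>1 \<beta>2 c f \<Theta> h \<alpha> C2Lip \<longleftrightarrow>
    (let e = conj_error f h \<alpha>;
         E = fam_norm \<Theta> \<rho> e;
         M = err_size \<Theta> \<rho> \<delta> \<gamma> \<tau> e;
         B2 = ennreal (const_frakC2 \<rho> \<rho>inf \<delta> \<gamma> \<tau> \<sigma>1 \<sigma>2 \<sigma>b c (enn2real E)) * E / ennreal (\<gamma> * \<rho> powr \<tau>);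
         B3 = ennreal (const_frakC3 \<rho> \<rho>inf \<delta> \<gamma> \<tau> \<sigma>1 \<sigma>2 \<sigma>b c (enn2real E)) * E
     in
            (\<exists>(hinf :: real \<Rightarrow> complex \<Rightarrow> complex) (\<alpha>inf :: real \<Rightarrow> real).
              (\<forall>\<theta>\<in>\<Theta>. hinf \<theta> \<in> circle_maps \<rho>inf \<and> \<alpha>inf \<theta> \<in> A) \<and>
              (\<forall>\<theta>\<in>\<Theta>. \<forall>z\<in>cstrip \<rho>inf. f (\<alpha>inf \<theta>) (hinf \<theta> z) = hinf \<theta> (z + of_real \<theta>)) \<and>
              conj_bounds \<Theta> \<rho>inf \<rho>hat \<sigma>1 \<sigma>2 \<sigma>3 hinf \<and>
              twist_bound \<Theta> \<sigma>b f hinf \<alpha>inf \<and>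
              Lip_bounds \<Theta> \<rho>inf \<beta>0 \<beta>1 \<beta>2 hinf \<alpha>inf \<and>
              fam_norm \<Theta> \<rho>inf (\<lambda>\<theta> z. hinf \<theta> z - h \<theta> z) \<le> B2 \<and>
              sup_norm \<Theta> (\<lambda>\<theta>. \<alpha>inf \<theta> - \<alpha> \<theta>) \<le> B3 \<and>
              (E > 0 \<longrightarrow>
                fam_norm \<Theta> \<rho>inf (\<lambda>\<theta> z. hinf \<theta> z - h \<theta> z) < B2 \<and>
                sup_norm \<Theta> (\<lambda>\<theta>. \<alpha>inf \<theta> - \<alpha> \<theta>) < B3) \<and>
              (\<Theta> \<in> sets lebesgue \<longrightarrow>
                \<alpha>inf ` \<Theta> \<in> sets lebesgue \<and>
                enn2ereal (emeasure lebesgue (\<alpha>inf ` \<Theta>)) \<ge> measure_bound \<Theta> \<rho> \<gamma> \<tau> \<alpha> C2Lip M \<and>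
                (M > 0 \<and> 0 < emeasure lebesgue \<Theta> \<and> emeasure lebesgue \<Theta> < \<infinity> \<longrightarrow>
                  enn2ereal (emeasure lebesgue (\<alpha>inf ` \<Theta>)) > measure_bound \<Theta> \<rho> \<gamma> \<tau> \<alpha> C2Lip M))))"

section \<open>The theorem\<close>

lemma deriv_bounds_nonneg:
  assumes "deriv_bounds A \<rho>hat f c"
  shows "0 \<le> c 1 0" "0 \<le> c 0 1" "0 \<le> c 2 0" "0 \<le> c 1 1" "0 \<le> c 0 2"
proof -
  have "0 \<le> c i j" if "1 \<le> i + j" "i + j \<le> 3" for i j
    using assms that unfolding deriv_bounds_def by blast
  from this[of 1 0] this[of 0 1] this[of 2 0] this[of 1 1] this[of 0 2]
  show "0 \<le> c 1 0" "0 \<le> c 0 1" "0 \<le> c 2 0" "0 \<le> c 1 1" "0 \<le> c 0 2" by simp_all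
qed

text \<open>The point is the order of quantifiers: once the margin is fixed, \<open>\<mu>\<close>
  and \<open>K\<close> depend on the numerical data only and serve every family. A strict inequality
  with room \<open>m\<close> tolerates any change up to \<open>m / 2\<close>.\<close>

lemma kam_margin_conclusion:
  fixes \<rho>hat \<rho> \<rho>inf \<delta> \<gamma> \<tau> \<sigma>1 \<sigma>2 \<sigma>3 \<sigma>b \<beta>0 \<beta>1 \<beta>2 m :: real and c :: "nat \<Rightarrow> nat \<Rightarrow> real"
  assumes par: "0 < \<rho>hat" "0 < \<rho>" "0 < \<gamma>" "1 \<le> \<tau>" "0 < \<delta>" "0 < \<rho>inf" "\<rho>inf < \<rho> - 2 * \<delta>" and m: "0 < m"
  shows "\<exists>\<mu>>0. \<exists>K>0. \<forall>A f \<Theta> h \<alpha> M.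
    kam_hypotheses A \<rho>hat \<rho> \<gamma> \<tau> \<sigma>1 \<sigma>2 \<sigma>3 \<sigma>b \<beta>0 \<beta>1 \<beta>2 c f \<Theta> h \<alpha> \<and>
    has_margin A \<Theta> \<rho> \<rho>hat \<sigma>1 \<sigma>2 \<sigma>3 \<sigma>b \<beta>0 \<beta>1 \<beta>2 f h \<alpha> m \<and>
    err_size \<Theta> \<rho> \<delta> \<gamma> \<tau> (conj_error f h \<alpha>) = ennreal M \<and> 0 \<le> M \<and> M \<le> \<mu> \<longrightarrow>
    kam_conclusion A \<rho>hat \<rho> \<rho>inf \<delta> \<gamma> \<tau> \<sigma>1 \<sigma>2 \<sigma>3 \<sigma>b \<beta>0 \<beta>1 \<beta>2 c f \<Theta> h \<alpha> K"
\<comment> \<open>The signs of the numerical data are known only through some family that satisfies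
  the hypotheses; if there is none, any positive constants will do.\<close>
proof (cases "\<exists>A f \<Theta> h \<alpha>. kam_hypotheses A \<rho>hat \<rho> \<gamma> \<tau> \<sigma>1 \<sigma>2 \<sigma>3 \<sigma>b \<beta>0 \<beta>1 \<beta>2 c f \<Theta> h \<alpha> \<and>
    has_margin A \<Theta> \<rho> \<rho>hat \<sigma>1 \<sigma>2 \<sigma>3 \<sigma>b \<beta>0 \<beta>1 \<beta>2 f h \<alpha> m")
  case False
  then show ?thesis by (intro exI[of _ 1] conjI) auto
next
  case True
  then obtain A0 f0 \<Theta>0 h0 \<alpha>0 where
    set0: "kam_hypotheses A0 \<rho>hat \<rho> \<gamma> \<tau> \<sigma>1 \<sigma>2 \<sigma>3 \<sigma>b \<beta>0 \<beta>1 \<beta>2 c f0 \<Theta>0 h0 \<alpha>0" and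
    mar0: "has_margin A0 \<Theta>0 \<rho> \<rho>hat \<sigma>1 \<sigma>2 \<sigma>3 \<sigma>b \<beta>0 \<beta>1 \<beta>2 f0 h0 \<alpha>0 m" by blast
  have "deriv_bounds A0 \<rho>hat f0 c" using set0 by (simp add: kam_hypotheses_def)
  note c = deriv_bounds_nonneg[OF this]
  have mle: "m \<le> \<sigma>" if "x + ennreal m \<le> ennreal \<sigma>" for x \<sigma>
    using margin_realE[OF that m] by (metis add.commute add_le_cancel_right add_0 order_trans)
  have \<sigma>m: "m \<le> \<sigma>1" "m \<le> \<sigma>2" "m \<le> \<sigma>3" "m \<le> \<sigma>b" "m \<le> \<beta>0" "m \<le> \<beta>1" "m \<le> \<beta>2"
    using mar0 unfolding has_margin_def by (blast intro: mle)+
  then have \<sigma>: "0 < \<sigma>1" "0 < \<sigma>2" "0 < \<sigma>b" using m by linarith+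
  define g where "g = \<gamma> * \<delta> powr (\<tau> + 1)"
  have g: "0 < g" using par by (simp add: g_def)
  have \<tau>0: "0 \<le> \<tau>" using par by simp
  have KRp: "0 < KR \<tau>" by (rule KR_pos[OF \<tau>0])
  \<comment> \<open>The summand \<open>1 / m\<close> makes \<open>1 / S\<close> smaller than the
    margin, and \<open>1 / g\<close> converts the weighted Lipschitz part of \<open>err_size\<close>
    into the bound \<open>S * M\<close>.\<close>
  define S where "S = 1 + c 1 0 + c 0 1 + c 2 0 + c 1 1 + c 0 2 + \<sigma>1 + \<sigma>2 + \<sigma>b + \<beta>0 + \<beta>2 + 1 / m + KR \<tau> / \<gamma> + 1 / g"
  have pp: "0 < 1 / m" "0 < KR \<tau> / \<gamma>" "0 < 1 / g" using m KRp par g by auto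
  have S: "1 \<le> S" "c 1 0 \<le> S" "c 2 0 \<le> S" "c 0 1 \<le> S" "c 0 2 \<le> S" "c 1 1 \<le> S"
    "\<sigma>1 \<le> S" "\<sigma>2 \<le> S" "\<sigma>b \<le> S" "\<beta>0 \<le> S" "\<beta>2 \<le> S" "1 / m < S" "KR \<tau> / \<gamma> \<le> S" "1 / g \<le> S"
    unfolding S_def using c \<sigma>m m pp by linarith+
  have Sm: "1 / S < m" using S(1,12) m by (simp add: field_simps)
  define p where "p = nat \<lceil>\<tau>\<rceil>"
  have p: "\<tau> \<le> real p" unfolding p_def by linarith
  \<comment> \<open>Five parts of the spare width are consumed by \<open>core_solution\<close>; the
    sixth keeps the closed target strip inside the open strip on which the solution lives.\<close>
  define d' where "d' = (\<rho> - 2 * \<delta> - \<rho>inf) / 6"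
  have d': "0 < d'" "\<rho> - 2 * \<delta> - 5 * d' = \<rho>inf + d'" using par by (auto simp: d'_def field_simps)
  define N where "N = core_const S \<gamma> \<tau> p (2 * \<delta>) d'"
  have N: "1 \<le> N" unfolding N_def using core_const_props(2)[OF S(1) par(3) \<tau>0 _ d'(1), of "2 * \<delta>" p] par by simp
  define C1 where "C1 = const_C1 \<tau> \<sigma>1 \<sigma>2 \<sigma>b c"
  define kf where "kf = const_kappa \<rho> \<rho>inf \<delta> \<gamma> \<tau> \<sigma>1 \<sigma>2 \<sigma>b c 1"
  note fb = frak_bounds[OF par(2-7) c(2,3,4,5) \<sigma>, folded C1_def kf_def]
  define \<eta> where "\<eta> = C1 / (\<gamma> * \<delta> powr \<tau>)"
  have \<eta>: "0 < \<eta>" unfolding \<eta>_def using fb(1) par by simp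
  \<comment> \<open>In this order: solvability, preservation of the strict bounds, strict closeness
    of the conjugacies and of the parameters, and a value of \<open>const_kappa\<close> not
    exceeding 1.\<close>
  define \<mu> where "\<mu> = Min {1 / N, m / (2 * N), m * \<eta> / (2 * N), m * \<sigma>2 / (2 * N), 1 / (kf + 1)}"
  have \<mu>: "0 < \<mu>" unfolding \<mu>_def using N m \<eta> \<sigma> fb(2) by (auto simp: field_simps add_pos_nonneg add_nonneg_pos)
  have \<mu>le: "\<mu> \<le> 1 / N" "\<mu> \<le> m / (2 * N)" "\<mu> \<le> m * \<eta> / (2 * N)" "\<mu> \<le> m * \<sigma>2 / (2 * N)" "\<mu> \<le> 1 / (kf + 1)"
    unfolding \<mu>_def by (intro Min_le; simp)+
  have \<mu>N: "N * \<mu> \<le> 1" "N * \<mu> \<le> m / 2" "N * \<mu> < m * \<eta>" "N * \<mu> < m * \<sigma>2" "kf * \<mu> \<le> 1"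
  proof -
    show "N * \<mu> \<le> 1" "N * \<mu> \<le> m / 2" using \<mu>le(1,2) N by (simp_all add: field_simps)
    have "N * \<mu> \<le> m * \<eta> / 2" "N * \<mu> \<le> m * \<sigma>2 / 2" using \<mu>le(3,4) N by (simp_all add: field_simps)
    moreover have "0 < m * \<eta>" "0 < m * \<sigma>2" using m \<eta> \<sigma> by auto
    ultimately show "N * \<mu> < m * \<eta>" "N * \<mu> < m * \<sigma>2" by linarith+
    have "(kf + 1) * \<mu> \<le> 1" using \<mu>le(5) fb(2) by (simp add: field_simps)
    then show "kf * \<mu> \<le> 1" using \<mu> by (simp add: algebra_simps)
  qed
  \<comment> \<open>Chosen so that the subtracted term of \<open>measure_bound\<close> is
    \<open>2 * (N * M)\<close>, twice the Lipschitz constant of the change of the parameter.\<close>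
  define K where "K = 2 * N * (\<gamma> * \<rho> powr (\<tau> + 1))"
  have K: "0 < K" unfolding K_def using N par by simp
  have main: "kam_conclusion A \<rho>hat \<rho> \<rho>inf \<delta> \<gamma> \<tau> \<sigma>1 \<sigma>2 \<sigma>3 \<sigma>b \<beta>0 \<beta>1 \<beta>2 c f \<Theta> h \<alpha> K"
    if hyp: "kam_hypotheses A \<rho>hat \<rho> \<gamma> \<tau> \<sigma>1 \<sigma>2 \<sigma>3 \<sigma>b \<beta>0 \<beta>1 \<beta>2 c f \<Theta> h \<alpha>"
      and margin: "has_margin A \<Theta> \<rho> \<rho>hat \<sigma>1 \<sigma>2 \<sigma>3 \<sigma>b \<beta>0 \<beta>1 \<beta>2 f h \<alpha> m"
      and M: "err_size \<Theta> \<rho> \<delta> \<gamma> \<tau> (conj_error f h \<alpha>) = ennreal M" "0 \<le> M" "M \<le> \<mu>"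
    for A f \<Theta> h \<alpha> M
  proof -
    have su: "open A" "C3_family A \<rho>hat f" "deriv_bounds A \<rho>hat f c" "\<And>\<theta>. \<theta> \<in> \<Theta> \<Longrightarrow> \<theta> \<in> Diophantine \<gamma> \<tau>"
      "\<And>\<theta>. \<theta> \<in> \<Theta> \<Longrightarrow> h \<theta> \<in> circle_maps \<rho>" "\<And>\<theta>. \<theta> \<in> \<Theta> \<Longrightarrow> \<alpha> \<theta> \<in> A"
      and cb: "conj_bounds \<Theta> \<rho> \<rho>hat \<sigma>1 \<sigma>2 \<sigma>3 h" and tb: "twist_bound \<Theta> \<sigma>b f h \<alpha>"
      using hyp unfolding kam_hypotheses_def by auto
    have mg: "\<And>\<theta>. \<theta> \<in> \<Theta> \<Longrightarrow> m \<le> setdist (h \<theta> ` cstrip \<rho>) (strip_boundary \<rho>hat)"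
      "\<And>\<theta> y. \<theta> \<in> \<Theta> \<Longrightarrow> y \<in> frontier A \<Longrightarrow> m \<le> dist (\<alpha> \<theta>) y"
      and mgr: "fam_norm \<Theta> \<rho> (\<lambda>\<theta>. deriv (h \<theta>)) + ennreal m \<le> ennreal \<sigma>1"
      "fam_norm \<Theta> \<rho> (\<lambda>\<theta> z. 1 / deriv (h \<theta>) z) + ennreal m \<le> ennreal \<sigma>2"
      "fam_norm \<Theta> \<rho> (\<lambda>\<theta>. deriv (deriv (h \<theta>))) + ennreal m \<le> ennreal \<sigma>3"
      "sup_norm \<Theta> (\<lambda>\<theta>. 1 / average (twist f h \<alpha> \<theta>)) + ennreal m \<le> ennreal \<sigma>b"
      "fam_Lip \<Theta> \<rho> (\<lambda>\<theta> z. h \<theta> z - z) + ennreal m \<le> ennreal \<beta>0"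
      "fam_Lip \<Theta> \<rho> (\<lambda>\<theta>. deriv (h \<theta>)) + ennreal m \<le> ennreal \<beta>1"
      "sup_Lip \<Theta> \<alpha> + ennreal m \<le> ennreal \<beta>2"
      using margin unfolding has_margin_def by auto
    have le_m: "x \<le> ennreal (B - m)" if xB: "x + ennreal m \<le> ennreal B" for x B
    proof -
      obtain r where "x = ennreal r" "0 \<le> r" "r + m \<le> B" by (rule margin_realE[OF xB m])
      then show ?thesis by (auto intro!: ennreal_leI)
    qed
    have hd: "norm (deriv (h \<theta>) z) \<le> \<sigma>1 - m" and hi: "norm (1 / deriv (h \<theta>) z) \<le> \<sigma>2 - m"
      and hdd: "norm (deriv (deriv (h \<theta>)) z) \<le> \<sigma>3 - m"
      if "\<theta> \<in> \<Theta>" "z \<in> strip \<rho>" for \<theta> z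
      using le_m[OF mgr(1)] le_m[OF mgr(2)] le_m[OF mgr(3)] \<sigma>m that by (simp_all add: fam_norm_le_iff)
    have ab: "norm (1 / average (twist f h \<alpha> \<theta>)) \<le> \<sigma>b - m" if "\<theta> \<in> \<Theta>" for \<theta>
      using le_m[OF mgr(4)] \<sigma>m that by (simp add: sup_norm_le_iff)
    have hL: "norm (h t z - h s z) \<le> (\<beta>0 - m) * \<bar>t - s\<bar>"
      and hdL: "norm (deriv (h t) z - deriv (h s) z) \<le> (\<beta>1 - m) * \<bar>t - s\<bar>"
      and aL: "\<bar>\<alpha> t - \<alpha> s\<bar> \<le> (\<beta>2 - m) * \<bar>t - s\<bar>" if "s \<in> \<Theta>" "t \<in> \<Theta>" "z \<in> strip \<rho>" for s t z
      using le_m[OF mgr(5)] le_m[OF mgr(6)] le_m[OF mgr(7)] \<sigma>m that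
      by (simp_all add: fam_Lip_le_iff sup_Lip_le_iff)
    have zero: "0 \<in> strip \<rho>" using par by (simp add: strip_def)
    have tw: "twist f h \<alpha> \<theta> = (\<lambda>z. d_param 1 f (\<alpha> \<theta>) (h \<theta> z) / deriv (h \<theta>) (z + of_real \<theta>))" for f h \<alpha> \<theta>
      by (rule ext) (simp add: twist_def)
    have ce: "conj_error f h \<alpha> \<theta> = cerr f (h \<theta>) (\<alpha> \<theta>) \<theta>" for \<theta>
      by (rule ext) (simp add: conj_error_def cerr_def)
    have fnM: "fam_norm \<Theta> \<rho> (conj_error f h \<alpha>) \<le> ennreal M"
      and flM: "ennreal g * fam_Lip \<Theta> \<rho> (conj_error f h \<alpha>) \<le> ennreal M"
      using M(1) unfolding err_size_def g_def by (metis max.cobounded1, metis max.cobounded2)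
    obtain E where E: "fam_norm \<Theta> \<rho> (conj_error f h \<alpha>) = ennreal E" "0 \<le> E" "E \<le> M"
      using fnM M(2) by (cases "fam_norm \<Theta> \<rho> (conj_error f h \<alpha>)") (auto simp: top_unique)
    have eb: "norm (cerr f (h \<theta>) (\<alpha> \<theta>) \<theta> z) \<le> E" if "\<theta> \<in> \<Theta>" "z \<in> strip \<rho>" for \<theta> z
      using E that fam_norm_le_iff[OF E(2), of \<Theta> \<rho> "conj_error f h \<alpha>"] by (simp add: ce)
    have eL: "norm (cerr f (h t) (\<alpha> t) t z - cerr f (h s) (\<alpha> s) s z) \<le> S * M * \<bar>t - s\<bar>"
      if "s \<in> \<Theta>" "t \<in> \<Theta>" "z \<in> strip \<rho>" for s t z
    proof -
      have Mg: "0 \<le> M / g" using M(2) g by simp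
      have "fam_Lip \<Theta> \<rho> (conj_error f h \<alpha>) \<le> ennreal (M / g)"
        by (rule ennreal_mult_le_imp_le_divide[OF flM g M(2)])
      then have "norm (cerr f (h t) (\<alpha> t) t z - cerr f (h s) (\<alpha> s) s z) \<le> M / g * \<bar>t - s\<bar>"
        using that by (simp add: fam_Lip_le_iff[OF Mg] ce)
      also have "\<dots> \<le> S * M * \<bar>t - s\<bar>"
        using mult_right_mono[OF S(14) M(2)] by (intro mult_right_mono) auto
      finally show ?thesis .
    qed
    interpret F: kam_family A \<rho>hat S f "d_param 1 f" "d_param 2 f"
      by (rule kam_family_of_C3[OF su(1) par(1) su(2,3) S(1-6)])
    have cm: "perhol \<rho> (\<lambda>z. h \<theta> z - z)" "continuous_on (cstrip \<rho>) (h \<theta>)" "h \<theta> (of_real x) \<in> \<real>"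
      if "\<theta> \<in> \<Theta>" for \<theta> x using circle_mapsD[OF su(5)[OF that]] by auto
    have adm: "adm A \<rho>hat (d_param 1 f) S \<rho> (h \<theta>) (\<alpha> \<theta>) \<theta>" if \<theta>: "\<theta> \<in> \<Theta>" for \<theta>
    proof -
      have av: "average (\<lambda>z. h \<theta> z - z) = 0" and d0: "\<And>z. z \<in> strip \<rho> \<Longrightarrow> deriv (h \<theta>) z \<noteq> 0"
        using cb \<theta> unfolding conj_bounds_def by auto
      have t0: "average (twist f h \<alpha> \<theta>) \<noteq> 0" using tb \<theta> unfolding twist_bound_def by auto
      have "h \<theta> z \<in> strip (\<rho>hat - 1 / S)" if z: "z \<in> strip \<rho>" for z
      proof -
        have "z \<in> cstrip \<rho>" using z strip_subset_cstrip by blast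
        then have "\<bar>Im (h \<theta> z)\<bar> \<le> \<rho>hat - m"
          by (rule range_in_strip[OF cm(2)[OF \<theta>] cm(3)[OF \<theta>] mg(1)[OF \<theta>] m par(1)])
        then show ?thesis using Sm by (simp add: strip_def)
      qed
      moreover have "cball (\<alpha> \<theta>) (1 / S) \<subseteq> A"
        using S(1) by (intro cball_subset_of_frontier[OF su(6)[OF \<theta>] mg(2)[OF \<theta>] Sm]) auto
      moreover have "norm (deriv (h \<theta>) z) \<le> S" "norm (1 / deriv (h \<theta>) z) \<le> S" if "z \<in> strip \<rho>" for z
        using hd[OF \<theta> that] hi[OF \<theta> that] S m by linarith+
      moreover have "norm (1 / average (twist f h \<alpha> \<theta>)) \<le> S" using ab[OF \<theta>] S m by linarith
      ultimately show ?thesis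
        unfolding adm_def using cm(1,3)[OF \<theta>] av d0 t0 unfolding tw by blast
    qed
    have \<theta>L: "x * \<bar>t - s\<bar> \<le> S * \<bar>t - s\<bar>" if "x \<le> S" for x s t :: real
      using that by (intro mult_right_mono) auto
    have NM: "N * M \<le> N * \<mu>" using M N by (intro mult_left_mono) auto
    have NM1: "N * M \<le> 1" "N * M \<le> m / 2" "N * M < m * \<eta>" "N * M < m * \<sigma>2" using NM \<mu>N by linarith+
    have NM0: "0 \<le> N * M" using N M(2) by simp
    have Gb: "norm (d_param 1 f (\<alpha> \<theta>) (h \<theta> z)) \<le> c 0 1" if "\<theta> \<in> \<Theta>" "z \<in> strip \<rho>" for \<theta> z
    proof -
      have "fam_norm A \<rho>hat (d_mixed 0 1 f) \<le> ennreal (c 0 1)" using su(3) unfolding deriv_bounds_def by simp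
      then have "norm (d_mixed 0 1 f (\<alpha> \<theta>) (h \<theta> z)) \<le> c 0 1"
        using fam_norm_le_iff[OF c(2)] su(6)[OF that(1)] F.strip_P[OF F.adm_in[OF adm[OF that(1)] par(2) that(2)]] by blast
      then show ?thesis by (simp add: d_mixed_def)
    qed
    have d2: "0 < 2 * \<delta>" "0 < \<rho> - 2 * \<delta> - 5 * d'" using par d' by auto
    have hLS: "norm (h t z - h s z) \<le> S * \<bar>t - s\<bar>" if "s \<in> \<Theta>" "t \<in> \<Theta>" "z \<in> strip \<rho>" for s t z
      using hL[OF that] \<theta>L[of "\<beta>0 - m" t s] S m by linarith
    have aLS: "\<bar>\<alpha> t - \<alpha> s\<bar> \<le> S * \<bar>t - s\<bar>" if "s \<in> \<Theta>" "t \<in> \<Theta>" for s t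
      using aL[OF that zero] \<theta>L[of "\<beta>2 - m" t s] S m by linarith
    have x1S: "\<sigma>1 - m \<le> S" "\<sigma>2 - m \<le> S" "\<sigma>b - m \<le> S" using S m by linarith+
    \<comment> \<open>The first step receives the sharp bounds \<open>\<sigma>1 - m\<close>,
      \<open>\<sigma>2 - m\<close> and \<open>\<sigma>b - m\<close> and the full loss
      \<open>2 * \<delta>\<close>.\<close>
    obtain H b where
      H1: "\<And>\<theta>. \<theta> \<in> \<Theta> \<Longrightarrow> adm A \<rho>hat (d_param 1 f) (2 * S) (\<rho>inf + d') (H \<theta>) (b \<theta>) \<theta>" and
      H2: "\<And>\<theta> z. \<theta> \<in> \<Theta> \<Longrightarrow> z \<in> strip (\<rho>inf + d') \<Longrightarrow> f (b \<theta>) (H \<theta> z) = H \<theta> (z + of_real \<theta>)" and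
      H3: "\<And>\<theta> z. \<theta> \<in> \<Theta> \<Longrightarrow> z \<in> strip (\<rho>inf + d') \<Longrightarrow> norm (H \<theta> z - h \<theta> z)
       \<le> (\<sigma>1 - m) * (1 + (\<sigma>1 - m)) * KR \<tau> * (1 + c 0 1 * (\<sigma>b - m) * (\<sigma>2 - m)) * (\<sigma>2 - m) * E / (\<gamma> * (2 * \<delta>) powr \<tau>) + N * E\<^sup>2" and
      H4: "\<And>\<theta>. \<theta> \<in> \<Theta> \<Longrightarrow> \<bar>b \<theta> - \<alpha> \<theta>\<bar> \<le> (\<sigma>b - m) * (\<sigma>2 - m) * E + N * E\<^sup>2" and
      H5: "\<And>\<theta> z. \<theta> \<in> \<Theta> \<Longrightarrow> z \<in> strip (\<rho>inf + d') \<Longrightarrow> norm (deriv (H \<theta>) z - deriv (h \<theta>) z) \<le> N * M" and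
      H6: "\<And>\<theta> z. \<theta> \<in> \<Theta> \<Longrightarrow> z \<in> strip (\<rho>inf + d') \<Longrightarrow> norm (1 / deriv (H \<theta>) z - 1 / deriv (h \<theta>) z) \<le> N * M" and
      H7: "\<And>\<theta> z. \<theta> \<in> \<Theta> \<Longrightarrow> z \<in> strip (\<rho>inf + d') \<Longrightarrow> norm (deriv (deriv (H \<theta>)) z - deriv (deriv (h \<theta>)) z) \<le> N * M" and
      H8: "\<And>\<theta>. \<theta> \<in> \<Theta> \<Longrightarrow> norm (1 / average (\<lambda>z. d_param 1 f (b \<theta>) (H \<theta> z) / deriv (H \<theta>) (z + of_real \<theta>))
        - 1 / average (\<lambda>z. d_param 1 f (\<alpha> \<theta>) (h \<theta> z) / deriv (h \<theta>) (z + of_real \<theta>))) \<le> N * M" and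
      H9: "\<And>s t z. s \<in> \<Theta> \<Longrightarrow> t \<in> \<Theta> \<Longrightarrow> z \<in> strip (\<rho>inf + d') \<Longrightarrow>
         norm ((H t z - h t z) - (H s z - h s z)) \<le> N * M * \<bar>t - s\<bar>" and
      H10: "\<And>s t z. s \<in> \<Theta> \<Longrightarrow> t \<in> \<Theta> \<Longrightarrow> z \<in> strip (\<rho>inf + d') \<Longrightarrow>
         norm ((deriv (H t) z - deriv (h t) z) - (deriv (H s) z - deriv (h s) z)) \<le> N * M * \<bar>t - s\<bar>" and
      H11: "\<And>s t. s \<in> \<Theta> \<Longrightarrow> t \<in> \<Theta> \<Longrightarrow> \<bar>(b t - \<alpha> t) - (b s - \<alpha> s)\<bar> \<le> N * M * \<bar>t - s\<bar>"
      by (rule F.core_solution[OF adm par(2) su(4) par(3) \<tau>0 S(13) p eb eL E(2,3) hLS aLS d2(1) d'(1) d2(2)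
          hd x1S(1) hi x1S(2) Gb S(4) ab[unfolded tw] x1S(3) NM1(1)[unfolded N_def], unfolded d'(2), folded N_def])
        (assumption+ | rule that)+
    interpret T: kam_family A \<rho>hat "2 * S" f "d_param 1 f" "d_param 2 f"
      by (rule F.mono_S) (use S(1) in simp)
    have r0: "0 < \<rho>inf + d'" "\<rho>inf < \<rho>inf + d'" "\<rho>inf + d' \<le> \<rho>" using par d' by auto
    have sr: "z \<in> strip (\<rho>inf + d')" and s\<rho>: "z \<in> strip \<rho>" if "z \<in> strip \<rho>inf" for z
      using that strip_mono[of \<rho>inf "\<rho>inf + d'"] strip_mono[of "\<rho>inf + d'" \<rho>] r0 by auto
    have csr: "z \<in> strip (\<rho>inf + d')" if "z \<in> cstrip \<rho>inf" for z
      using that cstrip_subset_strip[OF r0(2)] by blast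
    have circ: "H \<theta> \<in> circle_maps \<rho>inf" if "\<theta> \<in> \<Theta>" for \<theta>
      by (rule circle_mapsI[OF T.adm_near[OF H1[OF that] r0(1)] T.adm_real[OF H1[OF that] r0(1)]
          T.adm_d0[OF H1[OF that] r0(1)] r0(1,2)])
    have bA: "b \<theta> \<in> A" if "\<theta> \<in> \<Theta>" for \<theta> by (rule T.adm_a[OF H1[OF that] r0(1)])
    have near: "norm (y - x) \<le> N * M \<Longrightarrow> norm x \<le> B - m \<Longrightarrow> norm y \<le> B - m + N * M" for x y :: complex and B
      using norm_triangle_ineq[of x "y - x"] by simp
    have conj: "conj_bounds \<Theta> \<rho>inf \<rho>hat \<sigma>1 \<sigma>2 \<sigma>3 H"
      unfolding conj_bounds_def
    proof (intro conjI ballI)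
      fix \<theta> assume \<theta>: "\<theta> \<in> \<Theta>"
      have "1 / (2 * S) \<le> setdist (H \<theta> ` cstrip \<rho>inf) (strip_boundary \<rho>hat)"
      proof (rule le_setdistI)
        have "0 \<in> cstrip \<rho>inf" using par by (simp add: cstrip_def)
        then show "H \<theta> ` cstrip \<rho>inf \<noteq> {}" by blast
        have "Complex 0 \<rho>hat \<in> strip_boundary \<rho>hat" using par by (simp add: strip_boundary_def)
        then show "strip_boundary \<rho>hat \<noteq> {}" by blast
        fix x y assume xy: "x \<in> H \<theta> ` cstrip \<rho>inf" "y \<in> strip_boundary \<rho>hat"
        then obtain z where z: "z \<in> cstrip \<rho>inf" "x = H \<theta> z" by blast
        have "x \<in> strip (\<rho>hat - 1 / (2 * S))"
          using T.adm_in[OF H1[OF \<theta>] r0(1) csr[OF z(1)]] z(2) by simp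
        then have "\<bar>Im x\<bar> < \<rho>hat - 1 / (2 * S)" by (simp add: strip_def)
        moreover have "\<bar>Im y\<bar> = \<rho>hat" using xy(2) by (simp add: strip_boundary_def)
        moreover have "\<bar>Im (y - x)\<bar> \<le> dist x y" using abs_Im_le_cmod[of "y - x"] by (simp add: dist_norm norm_minus_commute)
        ultimately show "1 / (2 * S) \<le> dist x y" by simp
      qed
      moreover have "0 < 1 / (2 * S)" using S(1) by simp
      ultimately show "0 < setdist (H \<theta> ` cstrip \<rho>inf) (strip_boundary \<rho>hat)" by linarith
      show "average (\<lambda>z. H \<theta> z - z) = 0" by (rule T.adm_avg[OF H1[OF \<theta>] r0(1)])
      show "deriv (H \<theta>) z \<noteq> 0" if "z \<in> strip \<rho>inf" for z
        by (rule T.adm_d0[OF H1[OF \<theta>] r0(1) sr[OF that]])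
    next
      show "fam_norm \<Theta> \<rho>inf (\<lambda>\<theta>. deriv (H \<theta>)) < ennreal \<sigma>1"
      proof (rule fam_norm_less[where B = "\<sigma>1 - m + N * M"])
        show "norm (deriv (H \<theta>) z) \<le> \<sigma>1 - m + N * M" if "\<theta> \<in> \<Theta>" "z \<in> strip \<rho>inf" for \<theta> z
          by (rule near[OF H5[OF that(1) sr[OF that(2)]] hd[OF that(1) s\<rho>[OF that(2)]]])
      qed (use NM1 NM0 \<sigma>m m in auto)
      show "fam_norm \<Theta> \<rho>inf (\<lambda>\<theta> z. 1 / deriv (H \<theta>) z) < ennreal \<sigma>2"
      proof (rule fam_norm_less[where B = "\<sigma>2 - m + N * M"])
        show "norm (1 / deriv (H \<theta>) z) \<le> \<sigma>2 - m + N * M" if "\<theta> \<in> \<Theta>" "z \<in> strip \<rho>inf" for \<theta> z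
          by (rule near[OF H6[OF that(1) sr[OF that(2)]] hi[OF that(1) s\<rho>[OF that(2)]]])
      qed (use NM1 NM0 \<sigma>m m in auto)
      show "fam_norm \<Theta> \<rho>inf (\<lambda>\<theta>. deriv (deriv (H \<theta>))) < ennreal \<sigma>3"
      proof (rule fam_norm_less[where B = "\<sigma>3 - m + N * M"])
        show "norm (deriv (deriv (H \<theta>)) z) \<le> \<sigma>3 - m + N * M" if "\<theta> \<in> \<Theta>" "z \<in> strip \<rho>inf" for \<theta> z
          by (rule near[OF H7[OF that(1) sr[OF that(2)]] hdd[OF that(1) s\<rho>[OF that(2)]]])
      qed (use NM1 NM0 \<sigma>m m in auto)
    qed
    have twist: "twist_bound \<Theta> \<sigma>b f H b"
      unfolding twist_bound_def
    proof (intro conjI ballI)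
      show "average (twist f H b \<theta>) \<noteq> 0" if "\<theta> \<in> \<Theta>" for \<theta>
        unfolding tw by (rule T.adm_b0[OF H1[OF that] r0(1)])
      show "sup_norm \<Theta> (\<lambda>\<theta>. 1 / average (twist f H b \<theta>)) < ennreal \<sigma>b"
      proof (rule sup_norm_less[where B = "\<sigma>b - m + N * M"])
        show "norm (1 / average (twist f H b \<theta>)) \<le> \<sigma>b - m + N * M" if "\<theta> \<in> \<Theta>" for \<theta>
          using near[OF H8[OF that] ab[OF that, unfolded tw]] unfolding tw .
      qed (use NM1 NM0 \<sigma>m m in auto)
    qed
    have lip: "Lip_bounds \<Theta> \<rho>inf \<beta>0 \<beta>1 \<beta>2 H b"
      unfolding Lip_bounds_def
    proof (intro conjI)
      show "fam_Lip \<Theta> \<rho>inf (\<lambda>\<theta> z. H \<theta> z - z) < ennreal \<beta>0"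
      proof (rule fam_Lip_less[where B = "\<beta>0 - m + N * M"])
        fix s t z assume *: "s \<in> \<Theta>" "t \<in> \<Theta>" "z \<in> strip \<rho>inf"
        have "norm ((h t z - h s z) + ((H t z - h t z) - (H s z - h s z))) \<le> (\<beta>0 - m) * \<bar>t - s\<bar> + N * M * \<bar>t - s\<bar>"
          by (rule norm_triangle_mono[OF hL[OF *(1,2) s\<rho>[OF *(3)]] H9[OF *(1,2) sr[OF *(3)]]])
        then show "norm ((H t z - z) - (H s z - z)) \<le> (\<beta>0 - m + N * M) * \<bar>t - s\<bar>"
          by (simp add: distrib_right)
      qed (use NM1 NM0 \<sigma>m m in auto)
      show "fam_Lip \<Theta> \<rho>inf (\<lambda>\<theta>. deriv (H \<theta>)) < ennreal \<beta>1"
      proof (rule fam_Lip_less[where B = "\<beta>1 - m + N * M"])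
        fix s t z assume *: "s \<in> \<Theta>" "t \<in> \<Theta>" "z \<in> strip \<rho>inf"
        have "norm ((deriv (h t) z - deriv (h s) z) + ((deriv (H t) z - deriv (h t) z) - (deriv (H s) z - deriv (h s) z)))
            \<le> (\<beta>1 - m) * \<bar>t - s\<bar> + N * M * \<bar>t - s\<bar>"
          by (rule norm_triangle_mono[OF hdL[OF *(1,2) s\<rho>[OF *(3)]] H10[OF *(1,2) sr[OF *(3)]]])
        then show "norm (deriv (H t) z - deriv (H s) z) \<le> (\<beta>1 - m + N * M) * \<bar>t - s\<bar>"
          by (simp add: distrib_right)
      qed (use NM1 NM0 \<sigma>m m in auto)
      show "sup_Lip \<Theta> b < ennreal \<beta>2"
      proof (rule sup_Lip_less[where B = "\<beta>2 - m + N * M"])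
        fix s t assume *: "s \<in> \<Theta>" "t \<in> \<Theta>"
        show "\<bar>b t - b s\<bar> \<le> (\<beta>2 - m + N * M) * \<bar>t - s\<bar>"
          using aL[OF * zero] H11[OF *] by (simp add: distrib_right)
      qed (use NM1 NM0 \<sigma>m m in auto)
    qed
    have kE: "kf * E \<le> 1"
    proof -
      have "kf * E \<le> kf * \<mu>" using E M fb(2) by (intro mult_left_mono) auto
      then show ?thesis using \<mu>N(5) by linarith
    qed
    define fC2 where "fC2 = const_frakC2 \<rho> \<rho>inf \<delta> \<gamma> \<tau> \<sigma>1 \<sigma>2 \<sigma>b c E"
    define fC3 where "fC3 = const_frakC3 \<rho> \<rho>inf \<delta> \<gamma> \<tau> \<sigma>1 \<sigma>2 \<sigma>b c E"
    have f2: "\<sigma>1 * \<eta> \<le> fC2 / (\<gamma> * \<rho> powr \<tau>)" and f3: "\<sigma>b * \<sigma>2 \<le> fC3"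
      using fb(3)[OF E(2) kE] fb(4)[OF E(2) kE] by (simp_all add: \<eta>_def fC2_def fC3_def)
    have g\<rho>: "0 < \<gamma> * \<rho> powr \<tau>" using par by simp
    have fC2: "0 \<le> fC2"
    proof -
      have "0 \<le> fC2 / (\<gamma> * \<rho> powr \<tau>)" using f2 \<sigma> \<eta> by (meson less_imp_le mult_pos_pos order_trans)
      then show ?thesis using g\<rho> by (simp add: zero_le_divide_iff)
    qed
    have fC3: "0 \<le> fC3" using f3 \<sigma> by (meson less_imp_le mult_pos_pos order_trans)
    have B2: "ennreal fC2 * ennreal E / ennreal (\<gamma> * \<rho> powr \<tau>) = ennreal (fC2 / (\<gamma> * \<rho> powr \<tau>) * E)"
      using fC2 E g\<rho> by (simp add: ennreal_mult [symmetric] divide_ennreal)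
    have B3: "ennreal fC3 * ennreal E = ennreal (fC3 * E)"
      using fC3 E by (simp add: ennreal_mult [symmetric])
    have NE: "N * E\<^sup>2 \<le> N * M * E"
      using mult_right_mono[OF mult_left_mono[OF E(3), of N] E(2)] N by (simp add: power2_eq_square mult_ac)
    have d2: "norm (H \<theta> z - h \<theta> z) \<le> ((\<sigma>1 - m) * \<eta> + N * M) * E" if "\<theta> \<in> \<Theta>" "z \<in> strip \<rho>inf" for \<theta> z
    proof -
      \<comment> \<open>The factor \<open>2 powr \<tau>\<close> cancels against
        \<open>(2 * \<delta>) powr \<tau>\<close>. Only the leading \<open>\<sigma>1 - m\<close> is
        kept sharp; the other factors are enlarged to those of \<open>const_C1\<close>.\<close>
      have "(\<sigma>1 - m) * (1 + (\<sigma>1 - m)) * KR \<tau> * (1 + c 0 1 * (\<sigma>b - m) * (\<sigma>2 - m)) * (\<sigma>2 - m) * E / (\<gamma> * (2 * \<delta>) powr \<tau>)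
         \<le> (\<sigma>1 - m) * (1 + \<sigma>1) * (2 powr \<tau> * const_R \<tau>) * (1 + c 0 1 * \<sigma>b * \<sigma>2) * \<sigma>2 * E / (\<gamma> * (2 * \<delta>) powr \<tau>)"
        using KR_le_const_R[OF par(4)] \<sigma> \<sigma>m m c E par KRp
        by (intro divide_right_mono mult_right_mono mult_mono add_mono order_refl) auto
      also have "\<dots> = (\<sigma>1 - m) * \<eta> * E"
        using par by (simp add: \<eta>_def C1_def const_C1_def powr_mult field_simps)
      finally show ?thesis using H3[OF that(1) sr[OF that(2)]] NE by (simp add: algebra_simps)
    qed
    have d3: "norm (b \<theta> - \<alpha> \<theta>) \<le> ((\<sigma>b - m) * \<sigma>2 + N * M) * E" if "\<theta> \<in> \<Theta>" for \<theta>
    proof -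
      have "(\<sigma>b - m) * (\<sigma>2 - m) * E \<le> (\<sigma>b - m) * \<sigma>2 * E"
        using \<sigma>m m E by (intro mult_right_mono mult_left_mono) auto
      then show ?thesis using H4[OF that] NE by (simp add: algebra_simps)
    qed
    \<comment> \<open>The second-order contribution \<open>N * M\<close> is paid for by the margin
      in the first-order one. This is where the strict closeness originates.\<close>
    have l2: "(\<sigma>1 - m) * \<eta> + N * M < \<sigma>1 * \<eta>" and l3: "(\<sigma>b - m) * \<sigma>2 + N * M < \<sigma>b * \<sigma>2"
      using NM1 by (simp_all add: algebra_simps)
    have nn: "0 \<le> ((\<sigma>1 - m) * \<eta> + N * M) * E" "0 \<le> ((\<sigma>b - m) * \<sigma>2 + N * M) * E"
      using \<sigma>m \<sigma> \<eta> NM0 E by (simp_all add: add_nonneg_nonneg)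
    have n2: "fam_norm \<Theta> \<rho>inf (\<lambda>\<theta> z. H \<theta> z - h \<theta> z) \<le> ennreal (((\<sigma>1 - m) * \<eta> + N * M) * E)"
      using d2 by (simp add: fam_norm_le_iff[OF nn(1)])
    have n3: "sup_norm \<Theta> (\<lambda>\<theta>. b \<theta> - \<alpha> \<theta>) \<le> ennreal (((\<sigma>b - m) * \<sigma>2 + N * M) * E)"
      using d3 by (simp add: sup_norm_le_iff[OF nn(2)])
    have m2: "((\<sigma>1 - m) * \<eta> + N * M) * E \<le> fC2 / (\<gamma> * \<rho> powr \<tau>) * E"
      and m3: "((\<sigma>b - m) * \<sigma>2 + N * M) * E \<le> fC3 * E"
      using l2 l3 f2 f3 E by (intro mult_right_mono; linarith)+
    have s2: "((\<sigma>1 - m) * \<eta> + N * M) * E < fC2 / (\<gamma> * \<rho> powr \<tau>) * E"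
      and s3: "((\<sigma>b - m) * \<sigma>2 + N * M) * E < fC3 * E" if "0 < E"
      using l2 l3 f2 f3 that by (intro mult_strict_right_mono; linarith)+
    have mb: "measure_bound \<Theta> \<rho> \<gamma> \<tau> \<alpha> K (ennreal M)
        = (enn2ereal (inf_lip \<Theta> \<alpha>) - ereal (2 * (N * M))) * enn2ereal (emeasure lebesgue \<Theta>)"
    proof -
      have "0 < \<gamma> * \<rho> powr (\<tau> + 1)" using par by simp
      then have "ennreal K * ennreal M / ennreal (\<gamma> * \<rho> powr (\<tau> + 1)) = ennreal (2 * (N * M))"
        using K M(2) par by (simp add: ennreal_mult [symmetric] divide_ennreal K_def)
      then show ?thesis unfolding measure_bound_def using NM0 by simp
    qed
    note mc = measure_conclusion[of \<Theta> \<alpha> "\<beta>2 - m" b "N * M", OF _ aL[OF _ _ zero] H11 NM0]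
    show ?thesis
      unfolding kam_conclusion_def Let_def M(1) E(1) enn2real_ennreal[OF E(2)] fC2_def[symmetric] fC3_def[symmetric] B2 B3 mb
    proof (intro exI[of _ H] exI[of _ b] conjI ballI impI)
      show "H \<theta> \<in> circle_maps \<rho>inf" "b \<theta> \<in> A" if "\<theta> \<in> \<Theta>" for \<theta> using circ bA that by auto
      show "f (b \<theta>) (H \<theta> z) = H \<theta> (z + of_real \<theta>)" if "\<theta> \<in> \<Theta>" "z \<in> cstrip \<rho>inf" for \<theta> z
        by (rule H2[OF that(1) csr[OF that(2)]])
      show "fam_norm \<Theta> \<rho>inf (\<lambda>\<theta> z. H \<theta> z - h \<theta> z) \<le> ennreal (fC2 / (\<gamma> * \<rho> powr \<tau>) * E)"
        by (rule order_trans[OF n2 ennreal_leI[OF m2]])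
      show "sup_norm \<Theta> (\<lambda>\<theta>. b \<theta> - \<alpha> \<theta>) \<le> ennreal (fC3 * E)"
        by (rule order_trans[OF n3 ennreal_leI[OF m3]])
      show "fam_norm \<Theta> \<rho>inf (\<lambda>\<theta> z. H \<theta> z - h \<theta> z) < ennreal (fC2 / (\<gamma> * \<rho> powr \<tau>) * E)" if "0 < ennreal E"
        using that nn by (intro le_less_trans[OF n2] ennreal_lessI s2 le_less_trans[OF nn(1) s2]) simp_all
      show "sup_norm \<Theta> (\<lambda>\<theta>. b \<theta> - \<alpha> \<theta>) < ennreal (fC3 * E)" if "0 < ennreal E"
        using that nn by (intro le_less_trans[OF n3] ennreal_lessI s3 le_less_trans[OF nn(2) s3]) simp_all
      assume \<Theta>: "\<Theta> \<in> sets lebesgue"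
      show "b ` \<Theta> \<in> sets lebesgue" by (rule mc(1)[OF \<Theta>])
      show "(enn2ereal (inf_lip \<Theta> \<alpha>) - ereal (2 * (N * M))) * enn2ereal (emeasure lebesgue \<Theta>)
          \<le> enn2ereal (emeasure lebesgue (b ` \<Theta>))" by (rule mc(2)[OF \<Theta>])
      assume pos: "0 < ennreal M \<and> 0 < emeasure lebesgue \<Theta> \<and> emeasure lebesgue \<Theta> < \<infinity>"
      then have "0 < N * M" using N by simp
      then show "(enn2ereal (inf_lip \<Theta> \<alpha>) - ereal (2 * (N * M))) * enn2ereal (emeasure lebesgue \<Theta>)
          < enn2ereal (emeasure lebesgue (b ` \<Theta>))" using pos by (intro mc(3)[OF \<Theta>]) auto
    qed (fact conj twist lip)+
  qed
  show ?thesis using \<mu> K main by blast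
qed

lemma circle_maps_antimono:
  assumes "s \<le> t"
  shows "circle_maps t \<subseteq> circle_maps s"
proof -
  have "strip s \<subseteq> strip t" "cstrip s \<subseteq> cstrip t" using assms by (auto simp: strip_def cstrip_def)
  then have "Per t \<subseteq> Per s"
    unfolding Per_def by (auto intro: holomorphic_on_subset continuous_on_subset)
  then show ?thesis unfolding circle_maps_def by blast
qed

lemma strip_norm_mono: "s \<le> t \<Longrightarrow> strip_norm s g \<le> strip_norm t g"
  unfolding strip_norm_def by (intro SUP_subset_mono strip_mono) auto

lemma fam_norm_mono: "s \<le> t \<Longrightarrow> fam_norm \<Theta> s g \<le> fam_norm \<Theta> t g"
  unfolding fam_norm_def by (intro SUP_mono') (rule strip_norm_mono)

lemma fam_Lip_mono: "s \<le> t \<Longrightarrow> fam_Lip \<Theta> s g \<le> fam_Lip \<Theta> t g"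
  unfolding fam_Lip_def
  by (intro SUP_mono') (auto intro!: divide_right_mono_ennreal strip_norm_mono)

text \<open>A family with vanishing error is its own limit, restricted to the smaller strip; the
  constant \<open>K\<close> is arbitrary because it is multiplied by 0. This settles families that
  satisfy the strict inequalities without a uniform margin.\<close>

lemma kam_conclusion_exact:
  assumes hyp: "kam_hypotheses A \<rho>hat \<rho> \<gamma> \<tau> \<sigma>1 \<sigma>2 \<sigma>3 \<sigma>b \<beta>0 \<beta>1 \<beta>2 c f \<Theta> h \<alpha>"
    and M: "err_size \<Theta> \<rho> \<delta> \<gamma> \<tau> (conj_error f h \<alpha>) = 0"
    and par: "0 < \<delta>" "0 < \<rho>inf" "\<rho>inf < \<rho> - 2 * \<delta>"
  shows "kam_conclusion A \<rho>hat \<rho> \<rho>inf \<delta> \<gamma> \<tau> \<sigma>1 \<sigma>2 \<sigma>3 \<sigma>b \<beta>0 \<beta>1 \<beta>2 c f \<Theta> h \<alpha> K"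
proof -
  have \<rho>: "\<rho>inf \<le> \<rho>" "\<rho>inf < \<rho>" using par by auto
  have hc: "\<And>\<theta>. \<theta> \<in> \<Theta> \<Longrightarrow> h \<theta> \<in> circle_maps \<rho>" "\<And>\<theta>. \<theta> \<in> \<Theta> \<Longrightarrow> \<alpha> \<theta> \<in> A"
    and cb: "conj_bounds \<Theta> \<rho> \<rho>hat \<sigma>1 \<sigma>2 \<sigma>3 h" and tb: "twist_bound \<Theta> \<sigma>b f h \<alpha>"
    and lb: "Lip_bounds \<Theta> \<rho> \<beta>0 \<beta>1 \<beta>2 h \<alpha>"
    using hyp unfolding kam_hypotheses_def by auto
  have E: "fam_norm \<Theta> \<rho> (conj_error f h \<alpha>) = 0"
    using M unfolding err_size_def by (metis le_zero_eq max.cobounded1)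
  then have "conj_error f h \<alpha> \<theta> z = 0" if "\<theta> \<in> \<Theta>" "z \<in> strip \<rho>" for \<theta> z
    using fam_norm_le_iff[of 0 \<Theta> \<rho> "conj_error f h \<alpha>"] that by simp
  then have exact: "f (\<alpha> \<theta>) (h \<theta> z) = h \<theta> (z + of_real \<theta>)" if "\<theta> \<in> \<Theta>" "z \<in> cstrip \<rho>inf" for \<theta> z
    using that cstrip_subset_strip[OF \<rho>(2)] by (auto simp: conj_error_def)
  have cs: "cstrip \<rho>inf \<subseteq> cstrip \<rho>" "cstrip \<rho>inf \<noteq> {}" "strip \<rho>inf \<subseteq> strip \<rho>"
    using \<rho> par by (auto simp: cstrip_def strip_def intro!: exI[of _ 0])
  have conj: "conj_bounds \<Theta> \<rho>inf \<rho>hat \<sigma>1 \<sigma>2 \<sigma>3 h"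
    unfolding conj_bounds_def
  proof (intro conjI ballI)
    fix \<theta> assume \<theta>: "\<theta> \<in> \<Theta>"
    have "setdist (h \<theta> ` cstrip \<rho>) (strip_boundary \<rho>hat) \<le> setdist (h \<theta> ` cstrip \<rho>inf) (strip_boundary \<rho>hat)"
      using cs by (intro setdist_subset_left) auto
    then show "0 < setdist (h \<theta> ` cstrip \<rho>inf) (strip_boundary \<rho>hat)"
      using cb \<theta> unfolding conj_bounds_def by (meson less_le_trans)
    show "average (\<lambda>z. h \<theta> z - z) = 0" using cb \<theta> unfolding conj_bounds_def by auto
    show "deriv (h \<theta>) z \<noteq> 0" if "z \<in> strip \<rho>inf" for z
      using cb \<theta> that cs(3) unfolding conj_bounds_def by auto
  qed (use cb fam_norm_mono[OF \<rho>(1)] in \<open>(auto simp: conj_bounds_def intro: le_less_trans)[3]\<close>)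
  have lip: "Lip_bounds \<Theta> \<rho>inf \<beta>0 \<beta>1 \<beta>2 h \<alpha>"
    using lb fam_Lip_mono[OF \<rho>(1)] unfolding Lip_bounds_def by (meson le_less_trans)
  have z: "fam_norm \<Theta> \<rho>inf (\<lambda>\<theta> z. h \<theta> z - h \<theta> z) \<le> 0" "sup_norm \<Theta> (\<lambda>\<theta>. \<alpha> \<theta> - \<alpha> \<theta>) \<le> 0"
    using fam_norm_le_iff[of 0 \<Theta> \<rho>inf "\<lambda>\<theta> z. h \<theta> z - h \<theta> z"] sup_norm_le_iff[of 0 \<Theta> "\<lambda>\<theta>. \<alpha> \<theta> - \<alpha> \<theta>"]
    by simp_all
  have "sup_Lip \<Theta> \<alpha> < ennreal \<beta>2" using lb unfolding Lip_bounds_def by auto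
  then obtain L where L: "sup_Lip \<Theta> \<alpha> = ennreal L" "0 \<le> L" by (cases "sup_Lip \<Theta> \<alpha>") auto
  then have aL: "\<bar>\<alpha> t - \<alpha> s\<bar> \<le> L * \<bar>t - s\<bar>" if "s \<in> \<Theta>" "t \<in> \<Theta>" for s t
    using sup_Lip_le_iff[of L \<Theta> \<alpha>] that by simp
  note mc = measure_conclusion[of \<Theta> \<alpha> L \<alpha> 0, OF _ aL]
  have mb: "measure_bound \<Theta> \<rho> \<gamma> \<tau> \<alpha> K 0 = enn2ereal (inf_lip \<Theta> \<alpha>) * enn2ereal (emeasure lebesgue \<Theta>)"
    unfolding measure_bound_def by (simp add: zero_ennreal.rep_eq)
  show ?thesis
    unfolding kam_conclusion_def Let_def M E
  proof (intro exI[of _ h] exI[of _ \<alpha>] conjI ballI impI)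
    show "h \<theta> \<in> circle_maps \<rho>inf" "\<alpha> \<theta> \<in> A" if "\<theta> \<in> \<Theta>" for \<theta>
      using hc that circle_maps_antimono[OF \<rho>(1)] by auto
    show "f (\<alpha> \<theta>) (h \<theta> z) = h \<theta> (z + of_real \<theta>)" if "\<theta> \<in> \<Theta>" "z \<in> cstrip \<rho>inf" for \<theta> z
      by (rule exact[OF that])
    assume \<Theta>: "\<Theta> \<in> sets lebesgue"
    show "\<alpha> ` \<Theta> \<in> sets lebesgue" using mc(1)[OF \<Theta>] by simp
    show "measure_bound \<Theta> \<rho> \<gamma> \<tau> \<alpha> K 0 \<le> enn2ereal (emeasure lebesgue (\<alpha> ` \<Theta>))"
      using mc(2)[OF \<Theta>] unfolding mb by simp
  qed (use conj tb lip z in \<open>auto intro: order_trans\<close>)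
qed

lemma has_margin_antimono:
  assumes "has_margin A \<Theta> \<rho> \<rho>hat \<sigma>1 \<sigma>2 \<sigma>3 \<sigma>b \<beta>0 \<beta>1 \<beta>2 f h \<alpha> m" "m' \<le> m"
  shows "has_margin A \<Theta> \<rho> \<rho>hat \<sigma>1 \<sigma>2 \<sigma>3 \<sigma>b \<beta>0 \<beta>1 \<beta>2 f h \<alpha> m'"
proof -
  have le: "x + ennreal m' \<le> y" if "x + ennreal m \<le> y" for x y
    using that assms(2) by (meson add_left_mono ennreal_leI order_trans)
  show ?thesis
    using assms unfolding has_margin_def by (auto intro: le order_trans[OF assms(2)])
qed

text \<open>Since \<open>K1\<close> and \<open>K2\<close> must bound the constants for every margin
  of a family at once, margins are reduced to the values \<open>1 / (n + 1)\<close>, and each family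
  that has a margin is treated with the constants of its least admissible \<open>n\<close>.\<close>

theorem theorem4p1:
  fixes \<rho>hat \<rho> \<rho>inf \<delta> \<gamma> \<tau> \<sigma>1 \<sigma>2 \<sigma>3 \<sigma>b \<beta>0 \<beta>1 \<beta>2 :: real
    and c :: "nat \<Rightarrow> nat \<Rightarrow> real"
  assumes "\<rho>hat > 0" "\<rho> > 0" "\<gamma> > 0" "\<tau> \<ge> 1"
    and "0 < \<delta>" "\<delta> < \<rho> / 2" "0 < \<rho>inf" "\<rho>inf < \<rho> - 2 * \<delta>"
  shows "\<exists>K1 K2 :: real \<Rightarrow> real.
    \<forall>(A :: real set) (f :: real \<Rightarrow> complex \<Rightarrow> complex) (\<Theta> :: real set)
      (h :: real \<Rightarrow> complex \<Rightarrow> complex) (\<alpha> :: real \<Rightarrow> real).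
      open A \<and> C3_family A \<rho>hat f \<and>
      deriv_bounds A \<rho>hat f c \<and>
      \<Theta> \<subseteq> Diophantine \<gamma> \<tau> \<and>
      (\<forall>\<theta>\<in>\<Theta>. h \<theta> \<in> circle_maps \<rho> \<and> \<alpha> \<theta> \<in> A) \<and>
      conj_bounds \<Theta> \<rho> \<rho>hat \<sigma>1 \<sigma>2 \<sigma>3 h \<and>
      twist_bound \<Theta> \<sigma>b f h \<alpha> \<and>
      Lip_bounds \<Theta> \<rho> \<beta>0 \<beta>1 \<beta>2 h \<alpha> \<longrightarrow>
      (let e = conj_error f h \<alpha>;
           E = fam_norm \<Theta> \<rho> e;
           M = err_size \<Theta> \<rho> \<delta> \<gamma> \<tau> e;
           B2 = ennreal (const_frakC2 \<rho> \<rho>inf \<delta> \<gamma> \<tau> \<sigma>1 \<sigma>2 \<sigma>b c (enn2real E)) * E / ennreal (\<gamma> * \<rho> powr \<tau>);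
           B3 = ennreal (const_frakC3 \<rho> \<rho>inf \<delta> \<gamma> \<tau> \<sigma>1 \<sigma>2 \<sigma>b c (enn2real E)) * E
       in
        \<exists>C1Lip C2Lip :: real. C1Lip > 0 \<and> C2Lip > 0 \<and>
          (\<forall>m>0. has_margin A \<Theta> \<rho> \<rho>hat \<sigma>1 \<sigma>2 \<sigma>3 \<sigma>b \<beta>0 \<beta>1 \<beta>2 f h \<alpha> m \<longrightarrow>
                 C1Lip \<le> K1 m \<and> C2Lip \<le> K2 m) \<and>
          (ennreal C1Lip * M / ennreal (\<gamma>\<^sup>2 * \<rho> powr (2 * \<tau> + 2)) < 1 \<longrightarrow>
            (\<exists>(hinf :: real \<Rightarrow> complex \<Rightarrow> complex) (\<alpha>inf :: real \<Rightarrow> real).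
              (\<forall>\<theta>\<in>\<Theta>. hinf \<theta> \<in> circle_maps \<rho>inf \<and> \<alpha>inf \<theta> \<in> A) \<and>
              (\<forall>\<theta>\<in>\<Theta>. \<forall>z\<in>cstrip \<rho>inf. f (\<alpha>inf \<theta>) (hinf \<theta> z) = hinf \<theta> (z + of_real \<theta>)) \<and>
              conj_bounds \<Theta> \<rho>inf \<rho>hat \<sigma>1 \<sigma>2 \<sigma>3 hinf \<and>
              twist_bound \<Theta> \<sigma>b f hinf \<alpha>inf \<and>
              Lip_bounds \<Theta> \<rho>inf \<beta>0 \<beta>1 \<beta>2 hinf \<alpha>inf \<and>
              fam_norm \<Theta> \<rho>inf (\<lambda>\<theta> z. hinf \<theta> z - h \<theta> z) \<le> B2 \<and>
              sup_norm \<Theta> (\<lambda>\<theta>. \<alpha>inf \<theta> - \<alpha> \<theta>) \<le> B3 \<and>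
              (E > 0 \<longrightarrow>
                fam_norm \<Theta> \<rho>inf (\<lambda>\<theta> z. hinf \<theta> z - h \<theta> z) < B2 \<and>
                sup_norm \<Theta> (\<lambda>\<theta>. \<alpha>inf \<theta> - \<alpha> \<theta>) < B3) \<and>
              (\<Theta> \<in> sets lebesgue \<longrightarrow>
                \<alpha>inf ` \<Theta> \<in> sets lebesgue \<and>
                enn2ereal (emeasure lebesgue (\<alpha>inf ` \<Theta>)) \<ge> measure_bound \<Theta> \<rho> \<gamma> \<tau> \<alpha> C2Lip M \<and>
                (M > 0 \<and> 0 < emeasure lebesgue \<Theta> \<and> emeasure lebesgue \<Theta> < \<infinity> \<longrightarrow>
                  enn2ereal (emeasure lebesgue (\<alpha>inf ` \<Theta>)) > measure_bound \<Theta> \<rho> \<gamma> \<tau> \<alpha> C2Lip M)))))"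
proof -
  have "\<forall>n. \<exists>\<mu>>0. \<exists>K>0. \<forall>A f \<Theta> h \<alpha> M.
    kam_hypotheses A \<rho>hat \<rho> \<gamma> \<tau> \<sigma>1 \<sigma>2 \<sigma>3 \<sigma>b \<beta>0 \<beta>1 \<beta>2 c f \<Theta> h \<alpha> \<and>
    has_margin A \<Theta> \<rho> \<rho>hat \<sigma>1 \<sigma>2 \<sigma>3 \<sigma>b \<beta>0 \<beta>1 \<beta>2 f h \<alpha> (1 / real (Suc n)) \<and>
    err_size \<Theta> \<rho> \<delta> \<gamma> \<tau> (conj_error f h \<alpha>) = ennreal M \<and> 0 \<le> M \<and> M \<le> \<mu> \<longrightarrow>
    kam_conclusion A \<rho>hat \<rho> \<rho>inf \<delta> \<gamma> \<tau> \<sigma>1 \<sigma>2 \<sigma>3 \<sigma>b \<beta>0 \<beta>1 \<beta>2 c f \<Theta> h \<alpha> K"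
    using assms by (intro allI kam_margin_conclusion) auto
  then obtain \<mu> K where
    \<mu>: "\<And>n. 0 < \<mu> n" and K: "\<And>n. 0 < K n" and
    concl: "\<And>n A f \<Theta> h \<alpha> M. kam_hypotheses A \<rho>hat \<rho> \<gamma> \<tau> \<sigma>1 \<sigma>2 \<sigma>3 \<sigma>b \<beta>0 \<beta>1 \<beta>2 c f \<Theta> h \<alpha> \<Longrightarrow>
      has_margin A \<Theta> \<rho> \<rho>hat \<sigma>1 \<sigma>2 \<sigma>3 \<sigma>b \<beta>0 \<beta>1 \<beta>2 f h \<alpha> (1 / real (Suc n)) \<Longrightarrow>
      err_size \<Theta> \<rho> \<delta> \<gamma> \<tau> (conj_error f h \<alpha>) = ennreal M \<Longrightarrow> 0 \<le> M \<Longrightarrow> M \<le> \<mu> n \<Longrightarrow>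
      kam_conclusion A \<rho>hat \<rho> \<rho>inf \<delta> \<gamma> \<tau> \<sigma>1 \<sigma>2 \<sigma>3 \<sigma>b \<beta>0 \<beta>1 \<beta>2 c f \<Theta> h \<alpha> (K n)"
    by metis
  define D where "D = \<gamma>\<^sup>2 * \<rho> powr (2 * \<tau> + 2)"
  have D: "0 < D" using assms by (simp add: D_def)
  \<comment> \<open>Nothing is known about monotonicity of the constants in \<open>n\<close>; the
    sum dominates all those that can occur for a family with margin \<open>m\<close>.\<close>
  define K1 where "K1 m = (\<Sum>i\<le>nat \<lceil>1 / m\<rceil>. D / \<mu> i)" for m :: real
  define K2 where "K2 m = (\<Sum>i\<le>nat \<lceil>1 / m\<rceil>. K i)" for m :: real
  have "\<exists>C1Lip C2Lip. C1Lip > 0 \<and> C2Lip > 0 \<and>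
      (\<forall>m>0. has_margin A \<Theta> \<rho> \<rho>hat \<sigma>1 \<sigma>2 \<sigma>3 \<sigma>b \<beta>0 \<beta>1 \<beta>2 f h \<alpha> m \<longrightarrow> C1Lip \<le> K1 m \<and> C2Lip \<le> K2 m) \<and>
      (ennreal C1Lip * err_size \<Theta> \<rho> \<delta> \<gamma> \<tau> (conj_error f h \<alpha>) / ennreal D < 1 \<longrightarrow>
        kam_conclusion A \<rho>hat \<rho> \<rho>inf \<delta> \<gamma> \<tau> \<sigma>1 \<sigma>2 \<sigma>3 \<sigma>b \<beta>0 \<beta>1 \<beta>2 c f \<Theta> h \<alpha> C2Lip)"
    if hyp: "kam_hypotheses A \<rho>hat \<rho> \<gamma> \<tau> \<sigma>1 \<sigma>2 \<sigma>3 \<sigma>b \<beta>0 \<beta>1 \<beta>2 c f \<Theta> h \<alpha>" for A f \<Theta> h \<alpha>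
  proof -
    let ?V = "\<lambda>m. has_margin A \<Theta> \<rho> \<rho>hat \<sigma>1 \<sigma>2 \<sigma>3 \<sigma>b \<beta>0 \<beta>1 \<beta>2 f h \<alpha> m"
    define M where "M = err_size \<Theta> \<rho> \<delta> \<gamma> \<tau> (conj_error f h \<alpha>)"
    have premD: "\<exists>r. M = ennreal r \<and> 0 \<le> r \<and> C * r < D" if "0 < C" "ennreal C * M / ennreal D < 1" for C
    proof (cases M)
      case (real r)
      then have "C * r < D" using that D
        by (simp add: ennreal_mult [symmetric] divide_ennreal ennreal_less_one_iff pos_divide_less_eq)
      then show ?thesis using real by blast
    next
      case top
      then show ?thesis using that by (simp add: ennreal_mult_top ennreal_top_divide)
    qed
    have zero: "kam_conclusion A \<rho>hat \<rho> \<rho>inf \<delta> \<gamma> \<tau> \<sigma>1 \<sigma>2 \<sigma>3 \<sigma>b \<beta>0 \<beta>1 \<beta>2 c f \<Theta> h \<alpha> 1" if "M = 0"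
      using kam_conclusion_exact[OF hyp _ assms(5,7,8)] that by (simp add: M_def)
    show ?thesis
    proof (cases "\<exists>m>0. ?V m")
      case True
      have small: "?V (1 / real (Suc (nat \<lceil>1 / m\<rceil>)))" if "0 < m" "?V m" for m
      proof (rule has_margin_antimono[OF that(2)])
        define k where "k = Suc (nat \<lceil>1 / m\<rceil>)"
        have "1 / m \<le> real k" "0 < real k" unfolding k_def by linarith+
        then have "1 / real k \<le> m" using that(1) by (simp add: field_simps)
        then show "1 / real (Suc (nat \<lceil>1 / m\<rceil>)) \<le> m" by (simp add: k_def)
      qed
      \<comment> \<open>The least index depends on the family alone and lies below
        \<open>nat \<lceil>1 / m\<rceil>\<close> for every margin \<open>m\<close> of it, so its
        constants are among the summands of \<open>K1 m\<close> and \<open>K2 m\<close>.\<close>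
      define n where "n = (LEAST n. ?V (1 / real (Suc n)))"
      have n: "?V (1 / real (Suc n))" using True small unfolding n_def by (metis (mono_tags, lifting) LeastI)
      have nle: "n \<le> nat \<lceil>1 / m\<rceil>" if "0 < m" "?V m" for m
        unfolding n_def by (rule Least_le) (rule small[OF that])
      have "D / \<mu> n \<le> K1 m \<and> K n \<le> K2 m" if "0 < m" "?V m" for m
        unfolding K1_def K2_def using nle[OF that] \<mu> K D
        by (auto intro!: member_le_sum simp: less_imp_le)
      moreover have "kam_conclusion A \<rho>hat \<rho> \<rho>inf \<delta> \<gamma> \<tau> \<sigma>1 \<sigma>2 \<sigma>3 \<sigma>b \<beta>0 \<beta>1 \<beta>2 c f \<Theta> h \<alpha> (K n)"
        if small: "ennreal (D / \<mu> n) * M / ennreal D < 1"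
      proof -
        obtain r where r: "M = ennreal r" "0 \<le> r" "D / \<mu> n * r < D"
          using premD[OF _ small] D \<mu> by (auto simp: divide_pos_pos)
        then have "r \<le> \<mu> n" using D \<mu>[of n] by (simp add: field_simps)
        then show ?thesis using concl[OF hyp n] r by (simp add: M_def)
      qed
      ultimately show ?thesis using D \<mu>[of n] K[of n]
        unfolding M_def by (intro exI[of _ "D / \<mu> n"] exI[of _ "K n"]) auto
    next
      case False
      \<comment> \<open>Without a margin the constants are not subject to any bound, so \<open>C\<close> may depend on the error:
        the smallness condition then only holds for exact conjugacies.\<close>
      define C where "C = (if M = 0 \<or> M = \<infinity> then 1 else D / enn2real M)"
      have C: "0 < C" using D by (auto simp: C_def enn2real_positive_iff top.not_eq_extremum zero_less_iff_neq_zero)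
      \<comment> \<open>For finite nonzero \<open>M\<close> the quotient is exactly 1, and for
        infinite \<open>M\<close> it is infinite.\<close>
      have "M = 0" if small: "ennreal C * M / ennreal D < 1"
      proof (rule ccontr)
        assume M0: "M \<noteq> 0"
        obtain r where r: "M = ennreal r" "0 \<le> r" "C * r < D" using premD[OF C small] by blast
        then show False using M0 by (auto simp: C_def)
      qed
      then show ?thesis using False C zero unfolding M_def[symmetric]
        by (intro exI[of _ C] exI[of _ 1]) auto
    qed
  qed
  note main = this
  show ?thesis
    unfolding Let_def D_def[symmetric]
    by (intro exI[of _ K1] exI[of _ K2] allI impI main[unfolded kam_hypotheses_def kam_conclusion_def Let_def])
qed

end
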